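(* Let $(X_n)_{n\ge 1}$ be independent identically distributed real random variables, let $a_n\in\mathbb{R}$ and $b_n>0$ ($n\ge 1$) be non-random numbers, and put $$Z_n=\frac{X_1+\dots+X_n}{b_n}-a_n .$$ Assume that $Z_n$ converges weakly in distribution to a random variable $Z$ which has a (non-degenerate) non-extremal stable law. Then $D(Z_n\|Z)\to 0$ as $n\to\infty$ if and only if $D(Z_n\|Z)<+\infty$ for some $n$.
   Context: Relative entropy: for random variables $X,Z$ with distributions $\mu,\nu$ on $\mathbb{R}$, $D(X\|Z)=D(\mu\|\nu)=\int \log\frac{d\mu}{d\nu}\,d\mu\in[0,+\infty]$ if $\mu$ is absolutely continuous with respect to $\nu$, and $D(X\|Z)=+\infty$ otherwise. Stable laws: a non-degenerate stable law is either a normal law (with positive variance; index $\alpha=2$), or, for parameters $0<\alpha<2$, $-1\le\beta\le 1$, $a\in\mathbb{R}$, $c>0$, the law with characteristic function $$f(t)=\mathbf{E}\,e^{itZ}=\exp\big\{iat-c|t|^\alpha\big(1+i\beta\,\mathrm{sign}(t)\,\omega(t,\alpha)\big)\big\},$$ where $\omega(t,\alpha)=\tan(\pi\alpha/2)$ if $\alpha\ne 1$ and $\omega(t,1)=\frac{2}{\pi}\log|t|$. A stable law is called non-extremal if it is normal, or if $0<\alpha<2$ and $-1<\beta<1$. *)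

theory Defs
  imports "HOL-Probability.Probability"
begin

text \<open>
  \<open>relative_entropy \<mu> \<nu>\<close> is \<open>D(\<mu>\<parallel>\<nu>)\<close>, with natural logarithm and values in \<open>ereal\<close>.  The library's
  \<^const>\<open>KL_divergence\<close> is real-valued (and \<open>0\<close> when the integrand is not integrable), so the integral
  is taken here in the extended sense, as positive part minus negative part (\<^const>\<open>ennreal\<close> truncates
  negative reals to \<open>0\<close>).  The negative part is finite for probability measures.
  As in the library, the reference measure comes first in \<^const>\<open>absolutely_continuous\<close>,
  \<^const>\<open>RN_deriv\<close> and \<^const>\<open>entropy_density\<close>:
  \<open>entropy_density (exp 1) \<nu> \<mu>\<close> is \<open>log (d\<mu>/d\<nu>)\<close>.
\<close>

definition relative_entropy :: "real measure \<Rightarrow> real measure \<Rightarrow> ereal" where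
  "relative_entropy \<mu> \<nu> =
     (if absolutely_continuous \<nu> \<mu>
      then enn2ereal (\<integral>\<^sup>+ x. ennreal (entropy_density (exp 1) \<nu> \<mu> x) \<partial>\<mu>)
           - enn2ereal (\<integral>\<^sup>+ x. ennreal (- entropy_density (exp 1) \<nu> \<mu> x) \<partial>\<mu>)
      else \<infinity>)"

lemma relative_entropy_eq_KL_divergence:
  assumes "absolutely_continuous \<nu> \<mu>" and "integrable \<mu> (entropy_density (exp 1) \<nu> \<mu>)"
  shows "relative_entropy \<mu> \<nu> = ereal (KL_divergence (exp 1) \<nu> \<mu>)"
proof -
  let ?f = "entropy_density (exp 1) \<nu> \<mu>"
  obtain p q where p: "0 \<le> p" "(\<integral>\<^sup>+ x. ennreal (?f x) \<partial>\<mu>) = ennreal p"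
    and q: "0 \<le> q" "(\<integral>\<^sup>+ x. ennreal (- ?f x) \<partial>\<mu>) = ennreal q"
    using assms(2) unfolding real_integrable_def
    by (metis ennreal_cases infinity_ennreal_def)
  show ?thesis
    using assms p q
    by (simp add: relative_entropy_def KL_divergence_def real_lebesgue_integral_def enn2ereal_ennreal)
qed

definition normal_law :: "real measure \<Rightarrow> bool" where
  "normal_law \<nu> \<longleftrightarrow> (\<exists>m \<sigma>. \<sigma> > 0 \<and> \<nu> = density lborel (\<lambda>x. ennreal (normal_density m \<sigma> x)))"

definition stable_omega :: "real \<Rightarrow> real \<Rightarrow> real" where
  "stable_omega t \<alpha> = (if \<alpha> \<noteq> 1 then tan (pi * \<alpha> / 2) else 2 / pi * ln \<bar>t\<bar>)"

definition stable_char :: "real \<Rightarrow> real \<Rightarrow> real \<Rightarrow> real \<Rightarrow> real \<Rightarrow> complex" where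
  "stable_char \<alpha> \<beta> a c t =
     exp (\<i> * of_real (a * t)
          - of_real (c * \<bar>t\<bar> powr \<alpha>) * (1 + \<i> * of_real (\<beta> * sgn t * stable_omega t \<alpha>)))"

definition nonnormal_stable_law ::
    "real \<Rightarrow> real \<Rightarrow> real \<Rightarrow> real \<Rightarrow> real measure \<Rightarrow> bool" where
  "nonnormal_stable_law \<alpha> \<beta> a c \<nu> \<longleftrightarrow>
     0 < \<alpha> \<and> \<alpha> < 2 \<and> -1 \<le> \<beta> \<and> \<beta> \<le> 1 \<and> c > 0 \<and>
     real_distribution \<nu> \<and> (\<forall>t. char \<nu> t = stable_char \<alpha> \<beta> a c t)"

definition non_extremal_stable_law :: "real measure \<Rightarrow> bool" where
  "non_extremal_stable_law \<nu> \<longleftrightarrow>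
     normal_law \<nu> \<or> (\<exists>\<alpha> \<beta> a c. nonnormal_stable_law \<alpha> \<beta> a c \<nu> \<and> -1 < \<beta> \<and> \<beta> < 1)"

end

theory Submission
  imports Defs "HOL-Complex_Analysis.Complex_Analysis" "HOL-Real_Asymp.Real_Asymp"
begin

text \<open>
  Write \<open>D(\<mu>\<parallel>\<nu>) = \<integral> k(d\<mu>/d\<nu>) d\<nu>\<close> with \<open>k(r) = r log r - r + 1 \<ge> 0\<close> and split the density of \<open>Z\<^sub>n\<close>
  as \<open>u\<^sub>n + v\<^sub>n\<close>, where \<open>u\<^sub>n\<close> is bounded and tends pointwise to the density \<open>\<psi>\<close> of \<open>Z\<close>, while \<open>v\<^sub>n\<close> and
  \<open>v\<^sub>n log\<^sup>+ v\<^sub>n\<close> tend to \<open>0\<close> in \<open>L\<^sup>1\<close>.  Then \<open>D \<rightarrow> 0\<close> as soon as \<open>- log \<psi>(Z\<^sub>n)\<close> is uniformly integrable.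

  The splitting comes from the finite entropy of \<open>Z\<^sub>n\<close> at one index \<open>n\<^sub>0\<close>: the sum of a block of \<open>2 n\<^sub>0\<close> terms has
  a component that is a convolution of two bounded densities, hence has an integrable characteristic
  function, and a remainder of mass less than one.  Only the event that all of about \<open>n / (4 n\<^sub>0)\<close> blocks
  follow the remainder is put into \<open>v\<^sub>n\<close>; its mass is exponentially small, whereas the characteristic
  functions of \<open>u\<^sub>n\<close> converge in \<open>L\<^sup>1\<close>.

  In the stable case non-extremality gives the polynomial lower bound \<open>\<psi>(x) \<ge> C (1 + \<bar>x\<bar>) powr -(\<alpha> + 2)\<close>, so a
  bounded fractional moment of \<open>Z\<^sub>n\<close> suffices.  In the normal case \<open>- log \<psi>\<close> is quadratic; finite relative
  entropy yields a finite variance, and the second moments of the symmetrized \<open>Z\<^sub>n\<close> converge.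
\<close>

section \<open>Characteristic functions and Fourier inversion\<close>

text \<open>Finite entropy at one index need not make the density of any \<open>Zn n\<close>
  bounded, so Fourier inversion cannot be applied to the full density; this is why a part has to be
  split off. Blocks use up only about half of the \<open>n\<close> factors of the characteristic
  function, because the other half must supply its decay where the difference of block powers is
  merely bounded. Regular variation of the norming constants is not assumed. It is replaced by two
  weaker facts, that consecutive constants have ratio tending to one and that \<open>- ln\<close> of
  the modulus of the characteristic function grows by at least \<open>2 powr (\<alpha> / 2)\<close>
  under doubling. The price is an exponent \<alpha>/2 in place of \<alpha>, which is harmless for
  integrability and for some positive moment. The lower bound for stable densities loses one power
  against the true decay \<open>- (\<alpha> + 1)\<close>, which is also harmless since only its
  logarithm is used. In the normal case a bounded second moment would not suffice, since
  \<open>- log \<psi>\<close> is itself quadratic; the second moments must converge to the right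
  limit. Symmetrization makes the centring constants disappear from this question.\<close>

lemma cmod_iexp_diff_le: "cmod (iexp a - iexp b) \<le> \<bar>a - b\<bar>"
proof -
  have "iexp a - iexp b = iexp b * (iexp (a - b) - 1)"
    by (simp add: right_diff_distrib exp_diff)
  moreover have "cmod (iexp (a - b) - 1) \<le> \<bar>a - b\<bar>"
    using iexp_approx1[of "a - b" 0] by simp
  ultimately show ?thesis by (simp add: norm_mult)
qed

lemma cmod_iexp_diff_le_2: "cmod (iexp a - iexp b) \<le> 2"
  using norm_triangle_ineq4[of "iexp a" "iexp b"] by simp

text \<open>By Skorohod representation the laws are realised by variables converging pointwise. The
  difference of the characteristic functions is then at most the mean of
  \<open>min 2 (T * \<bar>Ys n - Y\<bar>)\<close>, a bound free of \<open>t\<close> that vanishes by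
  dominated convergence.\<close>

lemma weak_conv_char_uniform:
  assumes "\<And>n. real_distribution (M n)" "real_distribution M'" "weak_conv_m M M'" "e > 0"
  shows "\<forall>\<^sub>F n in sequentially. \<forall>t. \<bar>t\<bar> \<le> T \<longrightarrow> cmod (char (M n) t - char M' t) < e"
proof -
  from Skorohod[OF assms(1-3)] obtain \<Omega> :: "real measure" and Ys Y where
    \<Omega>: "prob_space \<Omega>" and Ys[measurable]: "\<And>n. Ys n \<in> borel_measurable \<Omega>"
    and dYs: "\<And>n. distr \<Omega> borel (Ys n) = M n" and Y: "Y \<in> measurable \<Omega> lborel"
    and dY: "distr \<Omega> borel Y = M'" and lim: "\<And>x. x \<in> space \<Omega> \<Longrightarrow> (\<lambda>n. Ys n x) \<longlonglongrightarrow> Y x"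
    by blast
  have Yb[measurable]: "Y \<in> borel_measurable \<Omega>" using Y by simp
  interpret \<Omega>: prob_space \<Omega> by fact
  \<comment> \<open>For negative \<open>T\<close> the claim is vacuous; the cap keeps the dominating
    function nonnegative.\<close>
  let ?T = "max T 0"
  let ?g = "\<lambda>n x. min 2 (?T * \<bar>Ys n x - Y x\<bar>)"
  have int: "integrable \<Omega> (?g n)" for n
    by (rule \<Omega>.integrable_const_bound[of _ 2]) (auto simp: min_def)
  have "(\<lambda>n. \<integral>x. ?g n x \<partial>\<Omega>) \<longlonglongrightarrow> (\<integral>x. 0 \<partial>\<Omega>)"
  proof (rule integral_dominated_convergence[where w="\<lambda>_. 2"])
    show "AE x in \<Omega>. (\<lambda>n. ?g n x) \<longlonglongrightarrow> 0"
    proof (rule AE_I2)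
      fix x assume "x \<in> space \<Omega>"
      then have "(\<lambda>n. min 2 (?T * \<bar>Ys n x - Y x\<bar>)) \<longlonglongrightarrow> min 2 (?T * \<bar>Y x - Y x\<bar>)"
        by (intro tendsto_intros lim)
      then show "(\<lambda>n. ?g n x) \<longlonglongrightarrow> 0" by simp
    qed
  qed (auto simp: min_def)
  then have "\<forall>\<^sub>F n in sequentially. (\<integral>x. ?g n x \<partial>\<Omega>) < e"
    using \<open>e > 0\<close> by (simp add: order_tendstoD(2))
  then show ?thesis
  proof eventually_elim
    case (elim n)
    show ?case
    proof safe
      fix t assume t: "\<bar>t\<bar> \<le> T"
      have i: "integrable \<Omega> (\<lambda>x. iexp (t * Ys n x))" "integrable \<Omega> (\<lambda>x. iexp (t * Y x))"
        by (rule \<Omega>.integrable_const_bound[of _ 1]; simp)+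
      have "char (M n) t - char M' t = (\<integral>x. iexp (t * Ys n x) - iexp (t * Y x) \<partial>\<Omega>)"
        unfolding char_def dYs[symmetric] dY[symmetric] by (simp add: integral_distr Bochner_Integration.integral_diff[OF i, simplified])
      also have "cmod \<dots> \<le> (\<integral>x. ?g n x \<partial>\<Omega>)"
      proof (rule Bochner_Integration.integral_norm_bound_integral)
        fix x
        have "cmod (iexp (t * Ys n x) - iexp (t * Y x)) \<le> \<bar>t * Ys n x - t * Y x\<bar>"
          by (rule cmod_iexp_diff_le)
        also have "\<dots> = \<bar>t\<bar> * \<bar>Ys n x - Y x\<bar>" by (simp add: abs_mult[symmetric] algebra_simps)
        also have "\<dots> \<le> ?T * \<bar>Ys n x - Y x\<bar>" using t by (intro mult_right_mono) auto
        finally show "cmod (iexp (t * Ys n x) - iexp (t * Y x)) \<le> ?g n x"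
          using cmod_iexp_diff_le_2[of "t * Ys n x" "t * Y x"] by simp
      qed (use i int in auto)
      finally show "cmod (char (M n) t - char M' t) < e" using elim by simp
    qed
  qed
qed

text \<open>Truncated densities and remainders are only sub-probabilities, so characteristic
  functions are needed for finite measures and not just for
  \<open>real_distribution\<close>.\<close>

locale finite_borel_measure = finite_measure M for M :: "real measure" +
  assumes sets_M [simp, measurable_cong]: "sets M = sets borel"
begin

lemma integrable_iexp_mult: "integrable M (\<lambda>x. iexp (t * x))"
  by (intro integrable_const_bound[of _ 1]) auto

lemma cmod_char_le: "cmod (char M t) \<le> measure M (space M)"
proof -
  have "cmod (char M t) \<le> (\<integral>x. norm (iexp (t * x)) \<partial>M)"
    unfolding char_def by (rule integral_norm_bound)
  then show ?thesis by simp
qed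

end

lemma char_convolution:
  assumes "finite_measure M" "finite_measure N" and [simp, measurable_cong]: "sets M = sets borel" "sets N = sets borel"
  shows "char (M \<star> N) t = char M t * char N t"
proof -
  interpret M: finite_measure M by fact
  interpret N: finite_measure N by fact
  interpret pair_sigma_finite M N ..
  interpret P: finite_measure "M \<Otimes>\<^sub>M N" by (rule finite_measure_pair_measure) fact+
  have "char (M \<star> N) t = (\<integral>z. iexp (t * (fst z + snd z)) \<partial>(M \<Otimes>\<^sub>M N))"
    unfolding char_def convolution_def by (subst integral_distr) (auto simp: split_beta')
  also have "\<dots> = (\<integral>x. \<integral>y. iexp (t * x) * iexp (t * y) \<partial>N \<partial>M)"
  proof (subst integral_fst'[symmetric])
    show "integrable (M \<Otimes>\<^sub>M N) (\<lambda>z. iexp (t * (fst z + snd z)))"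
      by (rule P.integrable_const_bound[of _ 1]) auto
  qed (simp add: distrib_left exp_add)
  also have "\<dots> = char M t * char N t"
    by (simp add: char_def)
  finally show ?thesis .
qed

context finite_borel_measure begin

lemma continuous_char:
  shows "isCont (char M) t"
  unfolding continuous_at_sequentially
proof safe
  fix X assume X: "X \<longlonglongrightarrow> t"
  show "(char M \<circ> X) \<longlonglongrightarrow> char M t"
    unfolding comp_def char_def
    by (rule integral_dominated_convergence[where w="\<lambda>_. 1"]) (auto intro!: tendsto_intros X)
qed

lemma char_borel_measurable:
  shows "char M \<in> borel_measurable borel"
  by (auto intro!: borel_measurable_continuous_onI continuous_at_imp_continuous_on continuous_char)

text \<open>The modulus of continuity does not depend on the base point.\<close>
lemma char_uniformly_continuous:
  assumes "e > 0"
  obtains d where "d > 0" "\<And>t h. \<bar>h\<bar> \<le> d \<Longrightarrow> cmod (char M (t + h) - char M t) < e"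
proof -
  let ?w = "\<lambda>h. (\<integral>x. min 2 (\<bar>h\<bar> * \<bar>x\<bar>) \<partial>M)"
  have "(\<lambda>n. ?w (1 / real (Suc n))) \<longlonglongrightarrow> (\<integral>x. 0 \<partial>M)"
  proof (rule integral_dominated_convergence[where w="\<lambda>_. 2"])
    show "AE x in M. (\<lambda>n. min 2 (\<bar>1 / real (Suc n)\<bar> * \<bar>x\<bar>)) \<longlonglongrightarrow> 0"
    proof (rule AE_I2)
      fix x :: real
      have "(\<lambda>n. min 2 (\<bar>1 / real (Suc n)\<bar> * \<bar>x\<bar>)) \<longlonglongrightarrow> min 2 (\<bar>0\<bar> * \<bar>x\<bar>)"
        by (intro tendsto_intros LIMSEQ_Suc[OF lim_1_over_n])
      then show "(\<lambda>n. min 2 (\<bar>1 / real (Suc n)\<bar> * \<bar>x\<bar>)) \<longlonglongrightarrow> 0" by simp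
    qed
  qed (auto simp: min_def)
  then have "\<forall>\<^sub>F n in sequentially. ?w (1 / real (Suc n)) < e"
    using \<open>e > 0\<close> by (simp add: order_tendstoD(2))
  then obtain n where n: "?w (1 / real (Suc n)) < e" by (auto simp: eventually_sequentially)
  show ?thesis
  proof (rule that[of "1 / real (Suc n)"])
    fix t h :: real assume h: "\<bar>h\<bar> \<le> 1 / real (Suc n)"
    have "char M (t + h) - char M t = (\<integral>x. iexp ((t + h) * x) - iexp (t * x) \<partial>M)"
      unfolding char_def by (intro Bochner_Integration.integral_diff[symmetric] integrable_iexp_mult)
    also have "cmod \<dots> \<le> ?w (1 / real (Suc n))"
    proof (rule Bochner_Integration.integral_norm_bound_integral)
      show "integrable M (\<lambda>x. iexp ((t + h) * x) - iexp (t * x))"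
        by (intro Bochner_Integration.integrable_diff integrable_iexp_mult)
      show "integrable M (\<lambda>x. min 2 (\<bar>1 / real (Suc n)\<bar> * \<bar>x\<bar>))"
        by (rule integrable_const_bound[of _ 2]) (auto simp: min_def)
      fix x
      have "cmod (iexp ((t + h) * x) - iexp (t * x)) \<le> \<bar>(t + h) * x - t * x\<bar>"
        by (rule cmod_iexp_diff_le)
      also have "\<dots> = \<bar>h\<bar> * \<bar>x\<bar>" by (simp add: abs_mult[symmetric] algebra_simps)
      also have "\<dots> \<le> \<bar>1 / real (Suc n)\<bar> * \<bar>x\<bar>" using h by (intro mult_right_mono) auto
      finally show "cmod (iexp ((t + h) * x) - iexp (t * x)) \<le> min 2 (\<bar>1 / real (Suc n)\<bar> * \<bar>x\<bar>)"
        using cmod_iexp_diff_le_2[of "(t + h) * x" "t * x"] by simp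
    qed
    finally show "cmod (char M (t + h) - char M t) < e" using n by simp
  qed simp
qed

text \<open>A Riemann-Lebesgue statement obtained from square integrability: a value above
  \<open>e\<close> at \<open>t\<close> persists above \<open>e / 2\<close> on an interval of fixed
  length \<open>d\<close> by uniform continuity, and so contributes at least
  \<open>d * (e/2)^2\<close> to a tail of the integral of \<open>G\<close>.\<close>

lemma char_vanishes_at_infinity:
  assumes G: "integrable lborel G" and "e > 0"
    and GM: "\<And>t. cmod (char M t) ^ 2 \<le> G t"
  obtains T where "\<And>t. \<bar>t\<bar> \<ge> T \<Longrightarrow> cmod (char M t) \<le> e"
proof -
  have [measurable]: "G \<in> borel_measurable borel" using G by simp
  have G0: "0 \<le> G t" for t using GM[of t] by (rule order_trans[rotated]) simp
  obtain d where d: "d > 0" "\<And>t h. \<bar>h\<bar> \<le> d \<Longrightarrow> cmod (char M (t + h) - char M t) < e / 2"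
    using char_uniformly_continuous[of "e/2"] \<open>e > 0\<close> by auto
  have "(\<lambda>n::nat. \<integral>x. indicator {x. \<bar>x\<bar> > real n} x * G x \<partial>lborel) \<longlonglongrightarrow> (\<integral>x. 0 \<partial>(lborel :: real measure))"
  proof (rule integral_dominated_convergence[where w=G and f="\<lambda>_. 0" and s="\<lambda>n x. indicator {x. \<bar>x\<bar> > real n} x * G x"])
    show "AE x in lborel. (\<lambda>n::nat. indicator {x. \<bar>x\<bar> > real n} x * G x) \<longlonglongrightarrow> 0"
    proof (rule AE_I2)
      fix x :: real
      have "\<forall>\<^sub>F n in sequentially. indicator {x. \<bar>x\<bar> > real n} x * G x = 0"
        using eventually_ge_at_top[of "nat \<lceil>\<bar>x\<bar>\<rceil>"]
        by eventually_elim (auto simp: indicator_def)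
      then show "(\<lambda>n::nat. indicator {x. \<bar>x\<bar> > real n} x * G x) \<longlonglongrightarrow> 0"
        by (rule tendsto_eventually)
    qed
    show "AE x in lborel. norm (indicator {x. \<bar>x\<bar> > real n} x * G x) \<le> G x" for n :: nat
      by (auto simp: indicator_def G0)
  qed (use G in auto)
  then have "\<forall>\<^sub>F n::nat in sequentially. (\<integral>x. indicator {x. \<bar>x\<bar> > real n} x * G x \<partial>lborel) < d * (e/2)^2"
    using d \<open>e > 0\<close> by (simp add: order_tendstoD(2))
  then obtain n :: nat where n: "(\<integral>x. indicator {x. \<bar>x\<bar> > real n} x * G x \<partial>lborel) < d * (e/2)^2"
    by (auto simp: eventually_sequentially)
  show ?thesis
  \<comment> \<open>The threshold leaves room for the whole interval from \<open>t\<close> to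
    \<open>t + d\<close> to stay outside \<open>[-n, n]\<close> even when \<open>t\<close> is
    negative.\<close>
  proof (rule that[of "real n + d + 1"], rule ccontr)
    fix t assume t: "real n + d + 1 \<le> \<bar>t\<bar>" and c: "\<not> cmod (char M t) \<le> e"
    have low: "cmod (char M y) \<ge> e / 2" if "y \<in> {t..t+d}" for y
      using d(2)[of "y - t" t] that c norm_triangle_ineq2[of "char M t" "char M y"]
      by (auto simp: norm_minus_commute)
    have "d * (e/2)^2 = (\<integral>x. indicator {t..t+d} x * (e/2)^2 \<partial>lborel)" using d by simp
    also have "\<dots> \<le> (\<integral>x. indicator {x. \<bar>x\<bar> > real n} x * G x \<partial>lborel)"
    proof (rule integral_mono)
      show "integrable lborel (\<lambda>x. indicator {x. \<bar>x\<bar> > real n} x * G x)"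
        by (rule Bochner_Integration.integrable_bound[OF G]) (auto simp: indicator_def G0)
      fix x
      show "indicator {t..t+d} x * (e/2)^2 \<le> indicator {x. \<bar>x\<bar> > real n} x * G x"
      proof (cases "x \<in> {t..t+d}")
        case True
        then have "(e/2)^2 \<le> cmod (char M x) ^ 2" using low[OF True] \<open>e > 0\<close> by (intro power_mono) auto
        moreover have "\<bar>x\<bar> > real n" using True t d by auto
        ultimately show ?thesis using True GM[of x] by (auto intro: order_trans)
      qed (auto simp: G0)
    qed (use d in auto)
    finally show False using n by simp
  qed
qed

end

text \<open>The inverse Fourier transform. The real part only fixes the type: for
  conjugate-symmetric \<open>\<phi>\<close>, in particular for characteristic functions, the
  integral is real.\<close>

definition char_inverse :: "(real \<Rightarrow> complex) \<Rightarrow> real \<Rightarrow> real" where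
  "char_inverse \<phi> x = Re (\<integral>t. iexp (- (t * x)) * \<phi> t \<partial>lborel) / (2 * pi)"

lemma integrable_iexp_mult_lborel:
  assumes "integrable lborel \<phi>"
  shows "integrable lborel (\<lambda>t. iexp (- (t * x)) * \<phi> t)"
proof -
  have [measurable]: "\<phi> \<in> borel_measurable borel" using assms by simp
  show ?thesis by (rule Bochner_Integration.integrable_bound[OF assms]) (auto simp: norm_mult)
qed

lemma continuous_char_inverse:
  assumes "integrable lborel \<phi>"
  shows "isCont (char_inverse \<phi>) x"
  unfolding continuous_at_sequentially
proof safe
  have [measurable]: "\<phi> \<in> borel_measurable borel" using assms by simp
  fix X assume X: "X \<longlonglongrightarrow> x"
  have "(\<lambda>n. \<integral>t. iexp (- (t * X n)) * \<phi> t \<partial>lborel) \<longlonglongrightarrow> (\<integral>t. iexp (- (t * x)) * \<phi> t \<partial>lborel)"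
    by (rule integral_dominated_convergence[where w="\<lambda>t. norm (\<phi> t)"])
      (auto intro!: tendsto_intros X simp: norm_mult assms)
  then show "(char_inverse \<phi> \<circ> X) \<longlonglongrightarrow> char_inverse \<phi> x"
    unfolding comp_def char_inverse_def by (intro tendsto_intros) auto
qed

lemma char_inverse_borel_measurable:
  assumes "integrable lborel \<phi>"
  shows "char_inverse \<phi> \<in> borel_measurable borel"
  by (auto intro!: borel_measurable_continuous_onI continuous_at_imp_continuous_on continuous_char_inverse assms)

text \<open>Convergence of characteristic functions in mean thus becomes uniform convergence of
  densities. The factor \<open>1 / (2 * pi)\<close> is at most one and is dropped.\<close>

lemma char_inverse_diff_le:
  assumes "integrable lborel \<phi>" "integrable lborel \<phi>'"
  shows "\<bar>char_inverse \<phi> x - char_inverse \<phi>' x\<bar> \<le> (\<integral>t. cmod (\<phi> t - \<phi>' t) \<partial>lborel)"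
proof -
  note i = integrable_iexp_mult_lborel[OF assms(1), of x] integrable_iexp_mult_lborel[OF assms(2), of x]
  have "char_inverse \<phi> x - char_inverse \<phi>' x =
     Re (\<integral>t. iexp (- (t * x)) * \<phi> t - iexp (- (t * x)) * \<phi>' t \<partial>lborel) / (2 * pi)"
    unfolding char_inverse_def Bochner_Integration.integral_diff[OF i] by (simp add: diff_divide_distrib)
  also have "\<bar>\<dots>\<bar> \<le> cmod (\<integral>t. iexp (- (t * x)) * \<phi> t - iexp (- (t * x)) * \<phi>' t \<partial>lborel) / (2 * pi)"
    using abs_Re_le_cmod by (auto intro!: divide_right_mono)
  also have "\<dots> \<le> cmod (\<integral>t. iexp (- (t * x)) * \<phi> t - iexp (- (t * x)) * \<phi>' t \<partial>lborel)"
    using pi_gt3 by (auto simp: divide_le_eq mult_le_cancel_left1)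
  also have "\<dots> \<le> (\<integral>t. cmod (\<phi> t - \<phi>' t) \<partial>lborel)"
  proof (rule Bochner_Integration.integral_norm_bound_integral)
    show "integrable lborel (\<lambda>t. iexp (- (t * x)) * \<phi> t - iexp (- (t * x)) * \<phi>' t)"
      by (intro Bochner_Integration.integrable_diff i)
    show "integrable lborel (\<lambda>t. cmod (\<phi> t - \<phi>' t))"
      by (intro integrable_norm Bochner_Integration.integrable_diff assms)
    show "cmod (iexp (- (t * x)) * \<phi> t - iexp (- (t * x)) * \<phi>' t) \<le> cmod (\<phi> t - \<phi>' t)" for t
      by (simp add: right_diff_distrib[symmetric] norm_mult del: of_real_mult of_real_minus)
  qed
  finally show ?thesis .
qed

lemma char_inverse_le:
  assumes "integrable lborel \<phi>"
  shows "\<bar>char_inverse \<phi> x\<bar> \<le> (\<integral>t. cmod (\<phi> t) \<partial>lborel)"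
  using char_inverse_diff_le[OF assms, of "\<lambda>_. 0" x] by (simp add: char_inverse_def)

section \<open>Levy inversion for integrable characteristic functions\<close>

lemma iexp_interval_integral:
  fixes a b t :: real
  assumes "a \<le> b" "t \<noteq> 0"
  shows "(iexp (- (t * a)) - iexp (- (t * b))) / (\<i> * t) = (CLINT x:{a..b}|lborel. iexp (- (t * x)))"
proof -
  have "(CLBINT x=a..b. iexp (- (t * x))) = iexp (- (t * b)) * (\<i> / t) - iexp (- (t * a)) * (\<i> / t)"
  proof (rule interval_integral_FTC_finite)
    show "continuous_on {min a b..max a b} (\<lambda>x. iexp (- (t * x)))" by (intro continuous_intros)
    fix x
    have "((\<lambda>z. exp (- (\<i> * (t * z))) * (\<i> / t)) has_field_derivative exp (- (\<i> * (t * of_real x)))) (at (of_real x))"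
      using \<open>t \<noteq> 0\<close> by (auto intro!: derivative_eq_intros)
    from has_vector_derivative_real_field[OF this]
    show "((\<lambda>x. iexp (- (t * x)) * (\<i> / t)) has_vector_derivative iexp (- (t * x))) (at x within {min a b..max a b})"
      by simp
  qed
  moreover have "(z - w) / (\<i> * t) = w * (\<i> / t) - z * (\<i> / t)" for z w :: complex
    using \<open>t \<noteq> 0\<close> by (simp add: field_simps)
  ultimately show ?thesis
    using assms by (simp add: interval_integral_Icc)
qed

lemma integrable_indicator_Icc: "integrable lborel (\<lambda>x::real. indicator {a..b} x * (c :: real))"
  by (intro integrable_mult_left integrable_real_indicator) (auto simp: emeasure_lborel_Icc_eq)

context real_distribution begin

text \<open>Levy's formula is a limit of integrals over \<open>[-n, n]\<close>. Integrability of the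
  characteristic function removes the limit by dominated convergence, and Fubini moves the interval
  integral hidden in the kernel to the outside.\<close>

lemma measure_Ioc_eq_char_inverse:
  assumes \<phi>: "integrable lborel (char M)" and ab: "a \<le> b"
    and atoms: "measure M {a} = 0" "measure M {b} = 0"
  shows "measure M {a<..b} = (\<integral>x. indicator {a..b} x * char_inverse (char M) x \<partial>lborel)"
proof -
  define F where "F = (\<lambda>t::real. (iexp (- (t * a)) - iexp (- (t * b))) / (\<i> * t))"
  have [measurable]: "F \<in> borel_measurable borel" unfolding F_def by measurable
  have [measurable]: "char M \<in> borel_measurable borel" using \<phi> by simp
  have F_bound: "cmod (F t) \<le> b - a" for t
    using Levy_Inversion_aux2[of "-b" "-a" t] ab by (cases "t = 0") (auto simp: F_def)
  have "cmod (complex_of_real b - complex_of_real a) = b - a"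
    using ab by (metis abs_of_nonneg diff_ge_0_iff_ge norm_of_real of_real_diff)
  note cb = this
  have Fint: "integrable lborel (\<lambda>t. F t * char M t)"
    by (rule Bochner_Integration.integrable_bound[OF integrable_mult_right[OF \<phi>, of "of_real (b - a)"]])
      (use F_bound in \<open>auto simp: norm_mult cb intro!: mult_right_mono\<close>)
  have ind: "(CLBINT t=-real n..real n. F t * char M t)
      = (\<integral>t. indicator {-real n..real n} t *\<^sub>R (F t * char M t) \<partial>lborel)" for n :: nat
    by (subst interval_integral_Icc) (auto simp: set_lebesgue_integral_def)
  have "(\<lambda>n::nat. \<integral>t. indicator {-real n..real n} t *\<^sub>R (F t * char M t) \<partial>lborel)
     \<longlonglongrightarrow> (\<integral>t. F t * char M t \<partial>lborel)"
  proof (rule integral_dominated_convergence[where w="\<lambda>t. cmod (F t * char M t)"])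
    show "AE t in lborel. (\<lambda>n::nat. indicator {-real n..real n} t *\<^sub>R (F t * char M t)) \<longlonglongrightarrow> F t * char M t"
    proof (rule AE_I2)
      fix t :: real
      have "\<forall>\<^sub>F n::nat in sequentially. indicator {-real n..real n} t *\<^sub>R (F t * char M t) = F t * char M t"
        using eventually_ge_at_top[of "nat \<lceil>\<bar>t\<bar>\<rceil>"] by eventually_elim (auto simp: indicator_def)
      then show "(\<lambda>n::nat. indicator {-real n..real n} t *\<^sub>R (F t * char M t)) \<longlonglongrightarrow> F t * char M t"
        by (rule tendsto_eventually)
    qed
  qed (use Fint in \<open>auto simp: indicator_def\<close>)
  from tendsto_mult[OF tendsto_const[of "complex_of_real (1 / (2 * pi))"] this]
  have "(\<lambda>n::nat. 1 / (2 * pi) * (CLBINT t=-real n..real n. F t * char M t))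
     \<longlonglongrightarrow> 1 / (2 * pi) * (\<integral>t. F t * char M t \<partial>lborel)"
    unfolding ind by simp
  moreover have "(\<lambda>n::nat. 1 / (2 * pi) * (CLBINT t=-real n..real n. F t * char M t)) \<longlonglongrightarrow> measure M {a<..b}"
    using Levy_Inversion[OF ab atoms] unfolding F_def by simp
  ultimately have 1: "of_real (measure M {a<..b}) = 1 / (2 * pi) * (\<integral>t. F t * char M t \<partial>lborel)"
    using LIMSEQ_unique by blast
  have pint: "integrable (lborel \<Otimes>\<^sub>M lborel) (\<lambda>(x, t). indicator {a..b} x *\<^sub>R (iexp (- (t * x)) * char M t))"
  proof (rule Bochner_Integration.integrable_bound)
    show "integrable (lborel \<Otimes>\<^sub>M lborel) (\<lambda>(x, t). indicator {a..b} x * cmod (char M t))"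
      using \<phi> integrable_indicator_Icc[of a b 1] by (intro lborel_pair.Fubini_integrable) (auto simp: abs_mult)
  qed (auto simp: norm_mult)
  have "(\<integral>t. F t * char M t \<partial>lborel) = (\<integral>t. \<integral>x. indicator {a..b} x *\<^sub>R (iexp (- (t * x)) * char M t) \<partial>lborel \<partial>lborel)"
  proof (rule integral_cong_AE)
    \<comment> \<open>At \<open>t = 0\<close> the quotient \<open>F\<close> is zero by the
      convention for division, so the kernel equals the interval integral only away from that
      point.\<close>
    have "AE t in lborel. t \<noteq> (0::real)" by (rule AE_lborel_singleton)
    then show "AE t in lborel. F t * char M t = (\<integral>x. indicator {a..b} x *\<^sub>R (iexp (- (t * x)) * char M t) \<partial>lborel)"
    proof eventually_elim
      case (elim t)
      have "F t * char M t = (\<integral>x. indicator {a..b} x *\<^sub>R iexp (- (t * x)) \<partial>lborel) * char M t"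
        using iexp_interval_integral[OF ab elim] by (simp add: F_def set_lebesgue_integral_def)
      also have "\<dots> = (\<integral>x. indicator {a..b} x *\<^sub>R iexp (- (t * x)) * char M t \<partial>lborel)"
        by (rule integral_mult_left_zero[symmetric])
      finally show ?case by simp
    qed
  qed auto
  also have "\<dots> = (\<integral>x. \<integral>t. indicator {a..b} x *\<^sub>R (iexp (- (t * x)) * char M t) \<partial>lborel \<partial>lborel)"
    using lborel_pair.Fubini_integral[OF pint] by simp
  finally have 2: "(\<integral>t. F t * char M t \<partial>lborel) = (\<integral>x. \<integral>t. indicator {a..b} x *\<^sub>R (iexp (- (t * x)) * char M t) \<partial>lborel \<partial>lborel)" .
  have ri: "integrable lborel (\<lambda>x. \<integral>t. indicator {a..b} x *\<^sub>R (iexp (- (t * x)) * char M t) \<partial>lborel)"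
    using lborel_pair.integrable_fst'[OF pint] by simp
  have "measure M {a<..b} = Re (\<integral>x. \<integral>t. indicator {a..b} x *\<^sub>R (iexp (- (t * x)) * char M t) \<partial>lborel \<partial>lborel) / (2 * pi)"
  proof -
    have "complex_of_real (measure M {a<..b}) = (1 / (2 * pi)) *\<^sub>R
        (\<integral>x. \<integral>t. indicator {a..b} x *\<^sub>R (iexp (- (t * x)) * char M t) \<partial>lborel \<partial>lborel)"
      unfolding 1 2 scaleR_conv_of_real by (simp only: of_real_divide of_real_1)
    from arg_cong[OF this, of Re] show ?thesis by simp
  qed
  also have "\<dots> = (\<integral>x. Re (\<integral>t. indicator {a..b} x *\<^sub>R (iexp (- (t * x)) * char M t) \<partial>lborel) / (2 * pi) \<partial>lborel)"
    using integral_Re[OF ri] by simp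
  also have "\<dots> = (\<integral>x. indicator {a..b} x * char_inverse (char M) x \<partial>lborel)"
    by (intro Bochner_Integration.integral_cong) (auto simp: char_inverse_def)
  finally show ?thesis .
qed

lemma integrable_char_inverse_Icc:
  assumes \<phi>: "integrable lborel (char M)"
  shows "integrable lborel (\<lambda>x. indicator {a..b} x * char_inverse (char M) x)"
  using borel_integrable_atLeastAtMost'[of a b "char_inverse (char M)"]
    continuous_at_imp_continuous_on[of "{a..b}" "char_inverse (char M)"] continuous_char_inverse[OF \<phi>]
  by (auto simp: set_integrable_def)

text \<open>There are only countably many atoms, so \<open>x\<close> can be enclosed between
  arbitrarily close points without mass; the inversion formula bounds the mass between them by their
  distance times the L1 norm of the characteristic function.\<close>

lemma measure_singleton_eq_0:
  assumes \<phi>: "integrable lborel (char M)"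
  shows "measure M {x} = 0"
proof -
  let ?K = "\<integral>t. cmod (char M t) \<partial>lborel"
  have nonatom: "\<exists>c\<in>{u<..<v}. measure M {c} = 0" if "u < v" for u v :: real
  proof (rule ccontr)
    assume "\<not> ?thesis"
    then have "{u<..<v} \<subseteq> {c. measure M {c} \<noteq> 0}" by auto
    then have "countable {u<..<v}" using countable_support countable_subset by blast
    then show False using \<open>u < v\<close> uncountable_open_interval by blast
  qed
  have "measure M {x} \<le> e" if "e > 0" for e
  proof -
    have K: "?K \<ge> 0" by simp
    define d where "d = e / (2 * (?K + 1))"
    have "d > 0" using \<open>e > 0\<close> K by (simp add: d_def add_nonneg_pos)
    obtain a where a: "a \<in> {x-d<..<x}" "measure M {a} = 0" using nonatom[of "x-d" x] \<open>d > 0\<close> by auto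
    obtain b where b: "b \<in> {x<..<x+d}" "measure M {b} = 0" using nonatom[of x "x+d"] \<open>d > 0\<close> by auto
    have "measure M {x} \<le> measure M {a<..b}"
      using a b by (intro finite_measure_mono) auto
    also have "\<dots> = (\<integral>x. indicator {a..b} x * char_inverse (char M) x \<partial>lborel)"
      using a b by (intro measure_Ioc_eq_char_inverse \<phi>) auto
    also have "\<dots> \<le> (\<integral>x. indicator {a..b} x * ?K \<partial>lborel)"
    proof (rule integral_mono)
      show "integrable lborel (\<lambda>x. indicator {a..b} x * char_inverse (char M) x)"
        by (rule integrable_char_inverse_Icc[OF \<phi>])
      show "integrable lborel (\<lambda>x. indicator {a..b} x * ?K)" by (rule integrable_indicator_Icc)
      show "indicator {a..b} x * char_inverse (char M) x \<le> indicator {a..b} x * ?K" for x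
        using char_inverse_le[OF \<phi>, of x] by (auto simp: indicator_def abs_le_iff)
    qed
    also have "\<dots> = (b - a) * ?K" using a b by simp
    also have "\<dots> \<le> (2 * d) * (?K + 1)" using a b K by (intro mult_mono) auto
    also have "\<dots> = e"
    proof -
      have "?K + 1 \<noteq> 0" using K by linarith
      then show ?thesis unfolding d_def by (simp only: times_divide_eq_right times_divide_eq_left) (simp add: field_simps)
    qed
    finally show ?thesis .
  qed
  then show ?thesis using measure_nonneg[of M "{x}"] by (metis antisym field_le_epsilon add_0)
qed

text \<open>Continuity gives this at every point and not just almost everywhere: a negative value
  would make the mass of a short interval to its right negative.\<close>

lemma char_inverse_nonneg:
  assumes \<phi>: "integrable lborel (char M)"
  shows "char_inverse (char M) x \<ge> 0"
proof (rule ccontr)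
  let ?\<psi> = "char_inverse (char M)"
  assume "\<not> ?\<psi> x \<ge> 0"
  then have neg: "?\<psi> x < 0" by simp
  then obtain d where d: "d > 0" "\<And>y. dist y x < d \<Longrightarrow> dist (?\<psi> y) (?\<psi> x) < - ?\<psi> x / 2"
    using continuous_char_inverse[OF \<phi>, of x] unfolding continuous_at_eps_delta
    by (metis divide_pos_pos neg_0_less_iff_less zero_less_numeral)
  have low: "?\<psi> y \<le> ?\<psi> x / 2" if "y \<in> {x..x+d/2}" for y
    using d(2)[of y] that d(1) by (auto simp: dist_real_def abs_if split: if_splits)
  have "0 \<le> measure M {x<..x+d/2}" by simp
  also have "\<dots> = (\<integral>y. indicator {x..x+d/2} y * ?\<psi> y \<partial>lborel)"
    using d by (intro measure_Ioc_eq_char_inverse measure_singleton_eq_0 \<phi>) auto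
  also have "\<dots> \<le> (\<integral>y. indicator {x..x+d/2} y * (?\<psi> x / 2) \<partial>lborel)"
    by (intro integral_mono integrable_char_inverse_Icc integrable_indicator_Icc \<phi>)
      (use low in \<open>auto simp: indicator_def\<close>)
  also have "\<dots> = d / 2 * (?\<psi> x / 2)" using d by simp
  also have "\<dots> < 0" using d neg by (simp add: mult_less_0_iff)
  finally show False by simp
qed

theorem density_char_inverse:
  assumes \<phi>: "integrable lborel (char M)"
  shows "M = density lborel (\<lambda>x. ennreal (char_inverse (char M) x))"
proof -
  let ?\<psi> = "char_inverse (char M)"
  have [measurable]: "?\<psi> \<in> borel_measurable borel" by (rule char_inverse_borel_measurable[OF \<phi>])
  let ?N = "density lborel (\<lambda>x. ennreal (?\<psi> x))"
  have Ioc: "emeasure M {a<..b} = emeasure ?N {a<..b}" if "a \<le> b" for a b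
  proof -
    have "emeasure M {a<..b} = ennreal (\<integral>x. indicator {a..b} x * ?\<psi> x \<partial>lborel)"
      using that by (simp add: emeasure_eq_measure measure_Ioc_eq_char_inverse measure_singleton_eq_0 \<phi>)
    also have "\<dots> = (\<integral>\<^sup>+x. ennreal (indicator {a..b} x * ?\<psi> x) \<partial>lborel)"
      by (rule nn_integral_eq_integral[symmetric, OF integrable_char_inverse_Icc[OF \<phi>]])
        (auto simp: char_inverse_nonneg[OF \<phi>])
    also have "\<dots> = (\<integral>\<^sup>+x. ennreal (?\<psi> x) * indicator {a<..b} x \<partial>lborel)"
    proof (rule nn_integral_cong_AE)
      have "AE x in lborel. x \<noteq> a" by (rule AE_lborel_singleton)
      then show "AE x in lborel. ennreal (indicator {a..b} x * ?\<psi> x) = ennreal (?\<psi> x) * indicator {a<..b} x"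
        by eventually_elim (auto simp: indicator_def)
    qed
    finally show ?thesis by (simp add: emeasure_density)
  qed
  have Ioi: "emeasure M {x<..} = emeasure ?N {x<..}" for x
  proof -
    have U: "(\<Union>n::nat. {x<..x + real n}) = {x<..}"
    proof safe
      fix y assume "x < y"
      then show "y \<in> (\<Union>n::nat. {x<..x + real n})"
        using real_arch_simple[of "y - x"] by (auto simp: algebra_simps)
    qed auto
    have inc: "incseq (\<lambda>n::nat. {x<..x + real n})" by (auto simp: incseq_def)
    have up: "emeasure L {x<..} = (SUP n. emeasure L {x<..x + real n})" if L: "sets L = sets borel" for L :: "real measure"
    proof -
      have "range (\<lambda>n::nat. {x<..x + real n}) \<subseteq> sets L" by (auto simp: L)
      from SUP_emeasure_incseq[OF this inc] show ?thesis by (simp only: U)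
    qed
    have "emeasure M {x<..} = (SUP n. emeasure M {x<..x + real n})" by (rule up) simp
    also have "\<dots> = (SUP n. emeasure ?N {x<..x + real n})" by (simp add: Ioc)
    also have "\<dots> = emeasure ?N {x<..}" by (rule up[symmetric]) simp
    finally show ?thesis .
  qed
  show ?thesis
    by (rule measure_eqI_lessThan) (auto simp: Ioi[symmetric] emeasure_eq_measure)
qed

end

context finite_borel_measure begin

text \<open>Division by the total mass reduces the claim to probability measures; both sides scale
  linearly.\<close>

theorem density_char_inverse_finite:
  assumes \<phi>: "integrable lborel (char M)" and nz: "measure M UNIV \<noteq> 0"
  shows "M = density lborel (\<lambda>x. ennreal (char_inverse (char M) x))"
proof -
  define c where "c = measure M UNIV"
  have c: "c > 0" using nz measure_nonneg[of M UNIV] unfolding c_def by linarith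
  have sp: "space M = UNIV" using sets_eq_imp_space_eq[OF sets_M] by simp
  define L where "L = density M (\<lambda>_. ennreal (1 / c))"
  have [simp, measurable_cong]: "sets L = sets borel" by (simp add: L_def)
  have spL: "space L = UNIV" unfolding L_def space_density by (rule sp)
  interpret L: real_distribution L
  proof (intro real_distribution.intro prob_spaceI real_distribution_axioms.intro)
    have "emeasure L UNIV = ennreal (1 / c) * emeasure M UNIV"
      unfolding L_def by (subst emeasure_density) (auto simp: sp)
    also have "\<dots> = ennreal (1 / c) * ennreal c" unfolding c_def emeasure_eq_measure ..
    also have "\<dots> = 1" using c by (subst ennreal_mult''[symmetric]) auto
    finally show "emeasure L (space L) = 1" unfolding spL .
  qed simp
  have dens_L: "M = density L (\<lambda>_. ennreal c)"
    unfolding L_def using c by (subst density_density_eq) (auto simp: ennreal_mult[symmetric] density_1)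
  have chL: "char L t = char M t / c" for t
    unfolding char_def L_def using c by (subst integral_density) (auto simp: scaleR_conv_of_real field_simps)
  have iL: "integrable lborel (char L)"
    unfolding chL[abs_def] by (intro integrable_divide_zero \<phi>) 
  have [measurable]: "char_inverse (char L) \<in> borel_measurable borel"
    by (rule char_inverse_borel_measurable[OF iL])
  have "M = density (density lborel (\<lambda>x. ennreal (char_inverse (char L) x))) (\<lambda>_. ennreal c)"
    using L.density_char_inverse[OF iL] dens_L by simp
  also have "\<dots> = density lborel (\<lambda>x. ennreal (char_inverse (char L) x) * ennreal c)"
    by (rule density_density_eq) auto
  also have "\<dots> = density lborel (\<lambda>x. ennreal (char_inverse (char M) x))"
  proof (rule density_cong)
    have "char_inverse (char L) x * c = char_inverse (char M) x" for x
    proof -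
      have "(\<integral>t. iexp (- (t * x)) * char L t \<partial>lborel) = (\<integral>t. iexp (- (t * x)) * char M t \<partial>lborel) / c"
        unfolding chL by simp
      then show ?thesis using c by (simp add: char_inverse_def)
    qed
    then show "AE x in lborel. ennreal (char_inverse (char L) x) * ennreal c = ennreal (char_inverse (char M) x)"
      using c by (simp add: ennreal_mult''[symmetric] L.char_inverse_nonneg[OF iL])
    show "(\<lambda>x. ennreal (char_inverse (char M) x)) \<in> borel_measurable lborel"
      using char_inverse_borel_measurable[OF \<phi>] by simp
  qed simp
  finally show ?thesis .
qed

end

section \<open>Parseval's identity and square integrability\<close>

lemma parseval:
  assumes "finite_borel_measure M" "finite_borel_measure N"
  shows "(\<integral>t. char M t \<partial>N) = (\<integral>x. char N x \<partial>M)"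
proof -
  interpret M: finite_borel_measure M by fact
  interpret N: finite_borel_measure N by fact
  interpret pair_sigma_finite M N ..
  interpret P: finite_measure "M \<Otimes>\<^sub>M N" by (rule finite_measure_pair_measure) (rule M.finite_measure_axioms N.finite_measure_axioms)+
  have "integrable (M \<Otimes>\<^sub>M N) (\<lambda>(x, t). iexp (t * x))"
    by (rule P.integrable_const_bound[of _ 1]) auto
  from Fubini_integral[OF this] show ?thesis
    by (simp add: char_def mult.commute)
qed

lemma char_normal:
  assumes "s > 0"
  shows "char (density lborel (\<lambda>x. ennreal (normal_density m s x))) t = iexp (t * m) * of_real (exp (- (s\<^sup>2 * t\<^sup>2) / 2))"
proof -
  have "char (density lborel (\<lambda>x. ennreal (normal_density m s x))) t
      = (\<integral>x. normal_density m s x *\<^sub>R iexp (t * x) \<partial>lborel)"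
    unfolding char_def by (subst integral_density) (auto simp: normal_density_nonneg)
  also have "\<dots> = s *\<^sub>R (\<integral>x. normal_density m s (m + s * x) *\<^sub>R iexp (t * (m + s * x)) \<partial>lborel)"
    using assms by (subst lborel_integral_real_affine[where c=s and t=m]) auto
  also have "\<dots> = (\<integral>x. s *\<^sub>R (normal_density m s (m + s * x) *\<^sub>R iexp (t * (m + s * x))) \<partial>lborel)"
    by (rule integral_scaleR_right[symmetric])
  also have "\<dots> = (\<integral>x. iexp (t * m) * (std_normal_density x *\<^sub>R iexp ((s * t) * x)) \<partial>lborel)"
  proof (rule Bochner_Integration.integral_cong)
    fix x
    have "s * normal_density m s (m + s * x) = std_normal_density x"
      using assms by (simp add: normal_density_def power_mult_distrib real_sqrt_mult)
    moreover have "iexp (t * (m + s * x)) = iexp (t * m) * iexp ((s * t) * x)"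
      by (simp add: algebra_simps exp_add)
    ultimately show "s *\<^sub>R (normal_density m s (m + s * x) *\<^sub>R iexp (t * (m + s * x))) =
        iexp (t * m) * (std_normal_density x *\<^sub>R iexp ((s * t) * x))"
      by (simp only: scaleR_scaleR) simp
  qed simp
  also have "\<dots> = iexp (t * m) * (\<integral>x. std_normal_density x *\<^sub>R iexp ((s * t) * x) \<partial>lborel)"
    by (rule integral_mult_right_zero)
  also have "(\<integral>x. std_normal_density x *\<^sub>R iexp ((s * t) * x) \<partial>lborel) = char std_normal_distribution (s * t)"
    unfolding char_def by (subst integral_density) auto
  finally show ?thesis by (simp add: char_std_normal_distribution power_mult_distrib)
qed

lemma finite_borel_density:
  assumes "integrable lborel h" "\<And>x. 0 \<le> h x"
  shows "finite_borel_measure (density lborel (\<lambda>x. ennreal (h x)))"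
proof (intro finite_borel_measure.intro finite_measureI finite_borel_measure_axioms.intro)
  show "emeasure (density lborel (\<lambda>x. ennreal (h x))) (space (density lborel (\<lambda>x. ennreal (h x)))) \<noteq> \<infinity>"
    using assms by (simp add: emeasure_density nn_integral_eq_integral)
qed simp

text \<open>One half of Plancherel's theorem for bounded densities. The squared modulus is the
  characteristic function of \<open>H\<close> convolved with its reflection. Parseval against a
  centred normal law of standard deviation \<open>s\<close> bounds its Gaussian average by a
  constant divided by \<open>s\<close>; the normalisation of the normal density restores the factor
  \<open>s\<close>, and Fatou lets \<open>s\<close> grow.\<close>

lemma char_density_sq_integrable:
  fixes h :: "real \<Rightarrow> real"
  assumes h: "integrable lborel h" and h0: "\<And>x. 0 \<le> h x" and hK: "\<And>x. h x \<le> K"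
  shows "integrable lborel (\<lambda>t. (cmod (char (density lborel (\<lambda>x. ennreal (h x))) t))\<^sup>2)"
proof -
  have [measurable]: "h \<in> borel_measurable borel" using h by simp
  have K: "0 \<le> K" using h0[of 0] hK[of 0] by linarith
  let ?h' = "\<lambda>x. h (- x)"
  have h': "integrable lborel ?h'" using lborel_integrable_real_affine[OF h, of "-1" 0] by simp
  define H where "H = density lborel (\<lambda>x. ennreal (h x))"
  define H' where "H' = density lborel (\<lambda>x. ennreal (?h' x))"
  interpret H: finite_borel_measure H unfolding H_def by (rule finite_borel_density[OF h h0])
  interpret H': finite_borel_measure H' unfolding H'_def using h' h0 by (rule finite_borel_density)
  define W where "W = (H \<star> H')"
  interpret W: finite_borel_measure W
  proof (intro finite_borel_measure.intro finite_borel_measure_axioms.intro)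
    show "finite_measure W" unfolding W_def by (rule convolution_finite) (auto intro: H.finite_measure_axioms H'.finite_measure_axioms)
  qed (simp add: W_def)
  have "char H' t = cnj (char H t)" for t
  proof -
    have "char H' t = (\<integral>x. h (- x) *\<^sub>R iexp (t * x) \<partial>lborel)"
      unfolding char_def H'_def by (subst integral_density) (auto simp: h0)
    also have "\<dots> = (\<integral>x. h x *\<^sub>R iexp (- (t * x)) \<partial>lborel)"
      by (subst lborel_integral_real_affine[where c="-1" and t=0]) auto
    also have "\<dots> = (\<integral>x. cnj (h x *\<^sub>R iexp (t * x)) \<partial>lborel)"
      by (simp add: exp_cnj)
    also have "\<dots> = cnj (\<integral>x. h x *\<^sub>R iexp (t * x) \<partial>lborel)" by (rule integral_bounded_linear'[OF bounded_linear_cnj bounded_linear_cnj]) simp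
    also have "(\<integral>x. h x *\<^sub>R iexp (t * x) \<partial>lborel) = char H t"
      unfolding char_def H_def by (subst integral_density) (auto simp: h0)
    finally show ?thesis .
  qed
  then have chW: "char W t = of_real ((cmod (char H t))\<^sup>2)" for t
    unfolding W_def by (subst char_convolution) (auto intro: H.finite_measure_axioms H'.finite_measure_axioms simp: complex_mult_cnj cmod_power2)
  have [measurable]: "char H \<in> borel_measurable borel" by (rule H.char_borel_measurable)
  \<comment> \<open>The product of the two Gaussian constants \<open>sqrt (2 * pi) * s\<close> and
    \<open>sqrt (2 * pi) / s\<close>, times the bound and the mass of \<open>h\<close>.\<close>
  let ?B = "2 * pi * K * (\<integral>x. h x \<partial>lborel)"
  have bound: "(\<integral>\<^sup>+t. ennreal (exp (- t\<^sup>2 / (2 * s\<^sup>2)) * (cmod (char H t))\<^sup>2) \<partial>lborel) \<le> ennreal ?B" if s: "s > 0" for s :: real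
  proof -
    define N where "N = density lborel (\<lambda>x. ennreal (normal_density 0 s x))"
    interpret N: finite_borel_measure N unfolding N_def
      using s by (intro finite_borel_density integrable_normal_density normal_density_nonneg)
    have gauss: "(\<integral>\<^sup>+y. ennreal (exp (- (s\<^sup>2 * (x + y)\<^sup>2) / 2)) \<partial>lborel) = ennreal (sqrt (2 * pi) / s)" for x
    proof -
      have "(\<integral>\<^sup>+y. ennreal (exp (- (s\<^sup>2 * (x + y)\<^sup>2) / 2)) \<partial>lborel)
          = (\<integral>\<^sup>+y. ennreal (sqrt (2 * pi) / s) * ennreal (normal_density (-x) (1 / s) y) \<partial>lborel)"
        using s by (intro nn_integral_cong, subst ennreal_mult[symmetric])
          (auto simp: normal_density_def real_sqrt_mult real_sqrt_divide field_simps power2_eq_square)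
      also have "\<dots> = ennreal (sqrt (2 * pi) / s) * (\<integral>\<^sup>+y. ennreal (normal_density (-x) (1 / s) y) \<partial>lborel)"
        by (rule nn_integral_cmult) auto
      also have "(\<integral>\<^sup>+y. ennreal (normal_density (-x) (1 / s) y) \<partial>lborel) = 1"
        using s prob_space.emeasure_space_1[OF prob_space_normal_density[of "1/s" "-x"]] by (simp add: emeasure_density)
      finally show ?thesis by simp
    qed
    have "complex_of_real (\<integral>t. (cmod (char H t))\<^sup>2 \<partial>N) = (\<integral>t. char W t \<partial>N)"
      unfolding chW by (rule integral_complex_of_real[symmetric])
    then have re: "(\<integral>t. (cmod (char H t))\<^sup>2 \<partial>N) = Re (\<integral>x. char N x \<partial>W)"
      using parseval[OF W.finite_borel_measure_axioms N.finite_borel_measure_axioms]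
      by (metis Re_complex_of_real)
    have "(\<integral>\<^sup>+t. ennreal ((cmod (char H t))\<^sup>2) \<partial>N) = ennreal (\<integral>t. (cmod (char H t))\<^sup>2 \<partial>N)"
      by (rule nn_integral_eq_integral[OF N.integrable_const_bound[of _ "(measure H (space H))\<^sup>2"]])
         (use H.cmod_char_le in \<open>auto intro!: power_mono\<close>)
    also note re
    also have "(\<integral>x. char N x \<partial>W) = of_real (\<integral>x. exp (- (s\<^sup>2 * x\<^sup>2) / 2) \<partial>W)"
      unfolding N_def char_normal[OF s] by simp
    also have "ennreal (Re (complex_of_real (\<integral>x. exp (- (s\<^sup>2 * x\<^sup>2) / 2) \<partial>W))) = (\<integral>\<^sup>+x. ennreal (exp (- (s\<^sup>2 * x\<^sup>2) / 2)) \<partial>W)"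
      by (simp, subst nn_integral_eq_integral[OF W.integrable_const_bound[of _ 1]]) auto
    also have "\<dots> = (\<integral>\<^sup>+x. \<integral>\<^sup>+y. ennreal (exp (- (s\<^sup>2 * (x + y)\<^sup>2) / 2)) \<partial>H' \<partial>H)"
      unfolding W_def by (rule nn_integral_convolution) (auto intro: H.finite_measure_axioms H'.finite_measure_axioms)
    also have "\<dots> \<le> (\<integral>\<^sup>+x. ennreal (K * (sqrt (2 * pi) / s)) \<partial>H)"
    proof (rule nn_integral_mono)
      fix x
      have "(\<integral>\<^sup>+y. ennreal (exp (- (s\<^sup>2 * (x + y)\<^sup>2) / 2)) \<partial>H') = (\<integral>\<^sup>+y. ennreal (h (- y)) * ennreal (exp (- (s\<^sup>2 * (x + y)\<^sup>2) / 2)) \<partial>lborel)"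
        unfolding H'_def by (rule nn_integral_density) auto
      also have "\<dots> \<le> (\<integral>\<^sup>+y. ennreal K * ennreal (exp (- (s\<^sup>2 * (x + y)\<^sup>2) / 2)) \<partial>lborel)"
        by (intro nn_integral_mono mult_right_mono) (auto simp: hK ennreal_leI)
      also have "\<dots> = ennreal K * ennreal (sqrt (2 * pi) / s)"
        unfolding gauss[of x, symmetric] by (rule nn_integral_cmult) auto
      finally show "(\<integral>\<^sup>+y. ennreal (exp (- (s\<^sup>2 * (x + y)\<^sup>2) / 2)) \<partial>H') \<le> ennreal (K * (sqrt (2 * pi) / s))"
        using K s by (subst ennreal_mult) auto
    qed
    also have "\<dots> = ennreal (K * (sqrt (2 * pi) / s)) * ennreal (\<integral>x. h x \<partial>lborel)"
      unfolding H_def by (simp add: emeasure_density nn_integral_eq_integral h h0)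
    also have "(\<integral>\<^sup>+t. ennreal ((cmod (char H t))\<^sup>2) \<partial>N) = (\<integral>\<^sup>+t. ennreal (normal_density 0 s t) * ennreal ((cmod (char H t))\<^sup>2) \<partial>lborel)"
      unfolding N_def by (rule nn_integral_density) auto
    finally have A: "(\<integral>\<^sup>+t. ennreal (normal_density 0 s t) * ennreal ((cmod (char H t))\<^sup>2) \<partial>lborel)
       \<le> ennreal (K * (sqrt (2 * pi) / s)) * ennreal (\<integral>x. h x \<partial>lborel)" .
    have "(\<integral>\<^sup>+t. ennreal (exp (- t\<^sup>2 / (2 * s\<^sup>2)) * (cmod (char H t))\<^sup>2) \<partial>lborel)
       = (\<integral>\<^sup>+t. ennreal (sqrt (2 * pi) * s) * (ennreal (normal_density 0 s t) * ennreal ((cmod (char H t))\<^sup>2)) \<partial>lborel)"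
      using s by (intro nn_integral_cong) (simp add: ennreal_mult[symmetric] normal_density_nonneg normal_density_def real_sqrt_mult)
    also have "\<dots> = ennreal (sqrt (2 * pi) * s) * (\<integral>\<^sup>+t. ennreal (normal_density 0 s t) * ennreal ((cmod (char H t))\<^sup>2) \<partial>lborel)"
      by (rule nn_integral_cmult) auto
    also have "\<dots> \<le> ennreal (sqrt (2 * pi) * s) * (ennreal (K * (sqrt (2 * pi) / s)) * ennreal (\<integral>x. h x \<partial>lborel))"
      by (intro mult_left_mono A) auto
    also have "\<dots> = ennreal ?B"
      using s K h0 by (simp add: ennreal_mult[symmetric] field_simps)
    finally show ?thesis .
  qed
  \<comment> \<open>Fatou along \<open>s = Suc n\<close>: the Gaussian weights tend to one while
    \<open>?B\<close> does not depend on \<open>s\<close>.\<close>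
  have "(\<integral>\<^sup>+t. ennreal ((cmod (char H t))\<^sup>2) \<partial>lborel)
     = (\<integral>\<^sup>+t. liminf (\<lambda>n. ennreal (exp (- t\<^sup>2 / (2 * (real (Suc n))\<^sup>2)) * (cmod (char H t))\<^sup>2)) \<partial>lborel)"
  proof (rule nn_integral_cong)
    fix t :: real
    have "(\<lambda>n. exp (- (t\<^sup>2 / 2) * (1 / real (Suc n))\<^sup>2) * (cmod (char H t))\<^sup>2) \<longlonglongrightarrow> exp (- (t\<^sup>2/2) * 0\<^sup>2) * (cmod (char H t))\<^sup>2"
      by (intro tendsto_intros LIMSEQ_Suc[OF lim_1_over_n])
    then have "(\<lambda>n. exp (- t\<^sup>2 / (2 * (real (Suc n))\<^sup>2)) * (cmod (char H t))\<^sup>2) \<longlonglongrightarrow> (cmod (char H t))\<^sup>2"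
      by (simp add: power_divide)
    from lim_imp_Liminf[OF _ tendsto_ennrealI[OF this]]
    show "ennreal ((cmod (char H t))\<^sup>2) = liminf (\<lambda>n. ennreal (exp (- t\<^sup>2 / (2 * (real (Suc n))\<^sup>2)) * (cmod (char H t))\<^sup>2))"
      by simp
  qed
  also have "\<dots> \<le> liminf (\<lambda>n. \<integral>\<^sup>+t. ennreal (exp (- t\<^sup>2 / (2 * (real (Suc n))\<^sup>2)) * (cmod (char H t))\<^sup>2) \<partial>lborel)"
    by (rule nn_integral_liminf) auto
  also have "\<dots> \<le> liminf (\<lambda>n. ennreal ?B)"
    by (intro Liminf_mono always_eventually allI bound) auto
  also have "\<dots> < \<infinity>" by (simp add: Liminf_const)
  finally show ?thesis
    unfolding H_def[symmetric] by (intro integrableI_bounded) auto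
qed

section \<open>Symmetrization and fractional moments\<close>

lemma (in finite_borel_measure) finite_borel_distr:
  assumes [measurable]: "f \<in> borel_measurable borel"
  shows "finite_borel_measure (distr M borel f)"
  by (intro finite_borel_measure.intro finite_measure_distr finite_borel_measure_axioms.intro) auto

lemma (in finite_borel_measure) char_distr_uminus: "char (distr M borel uminus) t = cnj (char M t)"
proof -
  have "char (distr M borel uminus) t = (\<integral>x. cnj (iexp (t * x)) \<partial>M)"
    unfolding char_def by (subst integral_distr) (auto simp: exp_cnj)
  also have "\<dots> = cnj (char M t)" unfolding char_def
    by (rule integral_bounded_linear'[OF bounded_linear_cnj bounded_linear_cnj]) simp
  finally show ?thesis .
qed

lemma finite_borel_convolution:
  assumes "finite_borel_measure M" "finite_borel_measure N"
  shows "finite_borel_measure (M \<star> N)"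
proof (intro finite_borel_measure.intro finite_borel_measure_axioms.intro)
  interpret M: finite_borel_measure M by fact
  interpret N: finite_borel_measure N by fact
  show "finite_measure (M \<star> N)" by (rule convolution_finite) (auto intro: M.finite_measure_axioms N.finite_measure_axioms)
qed simp

lemma char_convolution':
  assumes "finite_borel_measure M" "finite_borel_measure N"
  shows "char (M \<star> N) t = char M t * char N t"
proof -
  interpret M: finite_borel_measure M by fact
  interpret N: finite_borel_measure N by fact
  show ?thesis by (rule char_convolution) (auto intro: M.finite_measure_axioms N.finite_measure_axioms)
qed

sublocale real_distribution \<subseteq> finite_borel_measure
  by unfold_locales simp

lemma real_distribution_convolution:
  assumes "real_distribution M" "real_distribution N"
  shows "real_distribution (M \<star> N)"
proof -
  interpret M: real_distribution M by fact
  interpret N: real_distribution N by fact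
  have "prob_space (M \<Otimes>\<^sub>M N)" by (rule prob_space_pair) (rule M.prob_space_axioms N.prob_space_axioms)+
  then show ?thesis unfolding convolution_def
    by (intro real_distribution.intro prob_space.prob_space_distr real_distribution_axioms.intro) auto
qed

context real_distribution begin

text \<open>The law of the difference of two independent copies. Its characteristic function is real
  and nonnegative, and a shift of \<open>M\<close> does not change it, so the centring constants
  drop out.\<close>

definition "symm = (M \<star> distr M borel uminus)"

lemma real_distribution_uminus: "real_distribution (distr M borel uminus)"
  by (intro real_distribution.intro prob_space_distr real_distribution_axioms.intro) auto

lemma real_distribution_symm: "real_distribution symm"
  unfolding symm_def by (rule real_distribution_convolution) (rule real_distribution_axioms real_distribution_uminus)+

lemma char_symm: "char symm t = of_real ((cmod (char M t))\<^sup>2)"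
  unfolding symm_def
  by (subst char_convolution')
    (auto simp: char_distr_uminus complex_mult_cnj cmod_power2
      intro: finite_borel_measure_axioms finite_borel_distr)

lemma one_minus_norm_char_sq: "1 - (cmod (char M t))\<^sup>2 = (\<integral>x. 1 - cos (t * x) \<partial>symm)"
  and integrable_cos_symm: "integrable symm (\<lambda>x. cos (t * x))"
proof -
  interpret W: real_distribution symm by (rule real_distribution_symm)
  show i: "integrable symm (\<lambda>x. cos (t * x))" by (rule W.integrable_const_bound[of _ 1]) auto
  have "(cmod (char M t))\<^sup>2 = Re (char symm t)" by (simp add: char_symm)
  also have "\<dots> = (\<integral>x. Re (iexp (t * x)) \<partial>symm)"
    unfolding char_def by (rule integral_Re[symmetric]) (rule W.integrable_iexp_mult)
  also have "\<dots> = (\<integral>x. cos (t * x) \<partial>symm)" by (simp add: Re_exp)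
  finally show "1 - (cmod (char M t))\<^sup>2 = (\<integral>x. 1 - cos (t * x) \<partial>symm)"
    using i W.prob_space by simp
qed

text \<open>The pointwise inequality \<open>1 - cos (2 * y) \<le> 4 * (1 - cos y)\<close> amounts to
  \<open>0 \<le> (1 - cos y)^2\<close>; it is integrated against the symmetrized law.\<close>

lemma norm_char_doubling: "1 - (cmod (char M (2 * t)))\<^sup>2 \<le> 4 * (1 - (cmod (char M t))\<^sup>2)"
proof -
  interpret W: real_distribution symm by (rule real_distribution_symm)
  have "1 - (cmod (char M (2 * t)))\<^sup>2 \<le> (\<integral>x. 4 * (1 - cos (t * x)) \<partial>symm)"
    unfolding one_minus_norm_char_sq
  proof (rule integral_mono)
    fix x
    have "cos (2 * t * x) = 2 * (cos (t * x))\<^sup>2 - 1"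
      using cos_double_cos[of "t * x"] by (simp add: mult.assoc)
    moreover have "0 \<le> (1 - cos (t * x))\<^sup>2" by simp
    ultimately show "1 - cos (2 * t * x) \<le> 4 * (1 - cos (t * x))" by (simp add: power2_diff)
  qed (auto intro!: Bochner_Integration.integrable_diff integrable_mult_right integrable_cos_symm)
  also have "\<dots> = 4 * (\<integral>x. 1 - cos (t * x) \<partial>symm)" by (rule integral_mult_right_zero)
  finally show ?thesis by (simp add: one_minus_norm_char_sq)
qed

lemma nn_integral_symm:
  assumes [measurable]: "f \<in> borel_measurable borel"
  shows "(\<integral>\<^sup>+x. f x \<partial>symm) = (\<integral>\<^sup>+x. \<integral>\<^sup>+y. f (x - y) \<partial>M \<partial>M)"
  unfolding symm_def
  by (subst nn_integral_convolution)
    (auto simp: nn_integral_distr intro: finite_measure_axioms finite_measure_distr)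

text \<open>The mean of \<open>1 - cos (t * x)\<close> is integrated against
  \<open>t powr (- 1 - \<rho>/2)\<close> over \<open>t\<close> in (0, 1]. The hypothesis makes the
  result finite, since half of the exponent \<rho> is left over at zero. For fixed \<open>x\<close>
  with modulus at least one, the window \<open>t * \<bar>x\<bar>\<close> in [1/2, 1] alone yields a
  multiple of \<open>\<bar>x\<bar> powr (\<rho>/2)\<close>.\<close>

lemma fractional_moment_bound:
  assumes \<rho>: "\<rho> > 0" and C: "C \<ge> 0"
    and le: "\<And>t. 0 < t \<Longrightarrow> t \<le> 1 \<Longrightarrow> 1 - (cmod (char M t))\<^sup>2 \<le> C * t powr \<rho>"
  shows "(\<integral>\<^sup>+x. ennreal (\<bar>x\<bar> powr (\<rho>/2)) * indicator {x. \<bar>x\<bar> \<ge> 1} x \<partial>symm) \<le> ennreal (4 * C / (\<rho> * (1 - cos (1/2))))"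
proof -
  interpret W: real_distribution symm by (rule real_distribution_symm)
  interpret pair_sigma_finite symm "lborel :: real measure" ..
  have cos12: "cos (1/2 :: real) < 1"
    using cos_monotone_0_pi[of 0 "1/2"] pi_gt3 by simp
  \<comment> \<open>The minimum of \<open>1 - cos\<close> over [1/2, 1], the range of
    \<open>t * \<bar>x\<bar>\<close> in the window used below.\<close>
  define \<kappa> where "\<kappa> = 1 - cos (1/2 :: real)"
  have \<kappa>: "\<kappa> > 0" using cos12 by (simp add: \<kappa>_def)
  let ?k = "\<lambda>t x::real. indicator {0<..1} t * ((1 - cos (t * x)) * t powr (- 1 - \<rho>/2))"
  have low: "ennreal (\<kappa> / 2) * (ennreal (\<bar>x\<bar> powr (\<rho>/2)) * indicator {x. \<bar>x\<bar> \<ge> 1} x) \<le> (\<integral>\<^sup>+t. ennreal (?k t x) \<partial>lborel)" for x :: real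
  proof (cases "\<bar>x\<bar> \<ge> 1")
    case True
    have "ennreal (\<kappa> / 2 * \<bar>x\<bar> powr (\<rho>/2)) = (\<integral>\<^sup>+t. ennreal (\<kappa> * \<bar>x\<bar> powr (1 + \<rho>/2)) * indicator {1/(2*\<bar>x\<bar>)..1/\<bar>x\<bar>} t \<partial>lborel)"
    proof -
      have "(\<integral>\<^sup>+t. ennreal (\<kappa> * \<bar>x\<bar> powr (1 + \<rho>/2)) * indicator {1/(2*\<bar>x\<bar>)..1/\<bar>x\<bar>} t \<partial>lborel)
         = ennreal (\<kappa> * \<bar>x\<bar> powr (1 + \<rho>/2)) * ennreal (1/\<bar>x\<bar> - 1/(2*\<bar>x\<bar>))"
        using True by (subst nn_integral_cmult_indicator) (auto simp: field_simps)
      also have "\<dots> = ennreal (\<kappa> * \<bar>x\<bar> powr (1 + \<rho>/2) * (1/\<bar>x\<bar> - 1/(2*\<bar>x\<bar>)))"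
        using \<kappa> by (subst ennreal_mult') auto
      also have "\<kappa> * \<bar>x\<bar> powr (1 + \<rho>/2) * (1/\<bar>x\<bar> - 1/(2*\<bar>x\<bar>)) = \<kappa> / 2 * \<bar>x\<bar> powr (\<rho>/2)"
      proof -
        have "\<bar>x\<bar> powr (1 + \<rho>/2) = \<bar>x\<bar> * \<bar>x\<bar> powr (\<rho>/2)" using True by (simp add: powr_add)
        then show ?thesis using True by (simp add: field_simps)
      qed
      finally show ?thesis by simp
    qed
    also have "\<dots> \<le> (\<integral>\<^sup>+t. ennreal (?k t x) \<partial>lborel)"
    proof (rule nn_integral_mono)
      fix t
      show "ennreal (\<kappa> * \<bar>x\<bar> powr (1 + \<rho>/2)) * indicator {1/(2*\<bar>x\<bar>)..1/\<bar>x\<bar>} t \<le> ennreal (?k t x)"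
      proof (cases "t \<in> {1/(2*\<bar>x\<bar>)..1/\<bar>x\<bar>}")
        case t: True
        have tx: "t > 0" "1/2 \<le> t * \<bar>x\<bar>" "t * \<bar>x\<bar> \<le> 1"
        proof -
          have "0 < 1/(2*\<bar>x\<bar>)" using True by simp
          also have "1/(2*\<bar>x\<bar>) \<le> t" using t by simp
          finally show "t > 0" .
        qed (use t True in \<open>auto simp: field_simps\<close>)
        then have t1: "t \<le> 1" using True by (smt (verit) mult_le_cancel_left1)
        have "cos (t * x) = cos (t * \<bar>x\<bar>)" by (cases "x \<ge> 0") auto
        also have "\<dots> \<le> cos (1/2)" using tx pi_gt3 by (intro cos_monotone_0_pi_le) auto
        finally have a: "\<kappa> \<le> 1 - cos (t * x)" by (simp add: \<kappa>_def)
        have "\<bar>x\<bar> powr (1 + \<rho>/2) \<le> (1 / t) powr (1 + \<rho>/2)"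
          using tx \<rho> by (intro powr_mono2) (auto simp: field_simps)
        also have "\<dots> = 1 / t powr (1 + \<rho>/2)" using tx by (simp add: powr_divide)
        also have "\<dots> = t powr (- (1 + \<rho>/2))" by (rule powr_minus_divide[symmetric])
        also have "- (1 + \<rho>/2) = - 1 - \<rho>/2" by simp
        finally have pw: "\<bar>x\<bar> powr (1 + \<rho>/2) \<le> t powr (- 1 - \<rho>/2)" .
        have "\<kappa> * \<bar>x\<bar> powr (1 + \<rho>/2) \<le> (1 - cos (t * x)) * t powr (- 1 - \<rho>/2)"
          using a \<kappa> by (intro mult_mono pw) auto
        then show ?thesis using t tx t1 by (simp add: ennreal_leI)
      qed simp
    qed
    finally have fin: "ennreal (\<kappa> / 2 * \<bar>x\<bar> powr (\<rho>/2)) \<le> (\<integral>\<^sup>+t. ennreal (?k t x) \<partial>lborel)" .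
    have "ennreal (\<kappa> / 2) * (ennreal (\<bar>x\<bar> powr (\<rho>/2)) * indicator {x. \<bar>x\<bar> \<ge> 1} x) = ennreal (\<kappa> / 2) * ennreal (\<bar>x\<bar> powr (\<rho>/2))"
      using True by simp
    also have "\<dots> = ennreal (\<kappa> / 2 * \<bar>x\<bar> powr (\<rho>/2))" using \<kappa> by (intro ennreal_mult[symmetric]) auto
    finally show ?thesis using fin by (simp only:)
  qed simp
  have "ennreal (\<kappa> / 2) * (\<integral>\<^sup>+x. ennreal (\<bar>x\<bar> powr (\<rho>/2)) * indicator {x. \<bar>x\<bar> \<ge> 1} x \<partial>symm)
     = (\<integral>\<^sup>+x. ennreal (\<kappa> / 2) * (ennreal (\<bar>x\<bar> powr (\<rho>/2)) * indicator {x. \<bar>x\<bar> \<ge> 1} x) \<partial>symm)"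
    by (rule nn_integral_cmult[symmetric]) auto
  also have "\<dots> \<le> (\<integral>\<^sup>+x. \<integral>\<^sup>+t. ennreal (?k t x) \<partial>lborel \<partial>symm)"
    by (intro nn_integral_mono low)
  also have "\<dots> = (\<integral>\<^sup>+t. \<integral>\<^sup>+x. ennreal (?k t x) \<partial>symm \<partial>lborel)"
    by (rule Fubini'[symmetric]) auto
  also have "\<dots> \<le> (\<integral>\<^sup>+t. ennreal (indicator {0..1} t * (C * t powr (\<rho>/2 - 1))) \<partial>lborel)"
  proof (rule nn_integral_mono)
    fix t :: real
    show "(\<integral>\<^sup>+x. ennreal (?k t x) \<partial>symm) \<le> ennreal (indicator {0..1} t * (C * t powr (\<rho>/2 - 1)))"
    proof (cases "t \<in> {0<..1}")
      case True
      have "(\<integral>\<^sup>+x. ennreal (?k t x) \<partial>symm) = ennreal (\<integral>x. ?k t x \<partial>symm)"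
        using True by (intro nn_integral_eq_integral) (auto intro!: integrable_cos_symm)
      also have "(\<integral>x. ?k t x \<partial>symm) = (1 - (cmod (char M t))\<^sup>2) * t powr (- 1 - \<rho>/2)"
        using True by (simp add: one_minus_norm_char_sq)
      also have "\<dots> \<le> (C * t powr \<rho>) * t powr (- 1 - \<rho>/2)"
        using le[of t] True by (intro mult_right_mono) auto
      also have "\<dots> = C * t powr (\<rho>/2 - 1)" using True by (simp add: powr_add[symmetric])
      finally show ?thesis using True by (simp add: ennreal_leI)
    qed (auto simp: indicator_def)
  qed
  also have "\<dots> = ennreal (C * (1 / (\<rho>/2)))"
  proof -
    have "((\<lambda>t. t powr (\<rho>/2 - 1)) has_integral (1 powr (\<rho>/2 - 1 + 1) / (\<rho>/2 - 1 + 1))) {0..1}"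
      using \<rho> by (intro has_integral_powr_from_0) auto
    from has_integral_mult_right[OF this, of C]
    have "((\<lambda>t. C * t powr (\<rho>/2 - 1)) has_integral (C * (1 / (\<rho>/2)))) {0..1}" by simp
    then have "((\<lambda>t. if t \<in> {0..1} then C * t powr (\<rho>/2 - 1) else 0) has_integral (C * (1 / (\<rho>/2)))) UNIV"
      by (simp only: has_integral_restrict_UNIV)
    also have "(\<lambda>t. if t \<in> {0..1} then C * t powr (\<rho>/2 - 1) else 0) = (\<lambda>t. indicator {0..1} t * (C * t powr (\<rho>/2 - 1)))"
      by (auto simp: indicator_def)
    finally show ?thesis by (intro nn_integral_has_integral_lborel) (use C in auto)
  qed
  finally have "ennreal (\<kappa> / 2) * (\<integral>\<^sup>+x. ennreal (\<bar>x\<bar> powr (\<rho>/2)) * indicator {x. \<bar>x\<bar> \<ge> 1} x \<partial>symm) \<le> ennreal (C * (1 / (\<rho>/2)))" .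
  then have "ennreal (2 / \<kappa>) * (ennreal (\<kappa> / 2) * (\<integral>\<^sup>+x. ennreal (\<bar>x\<bar> powr (\<rho>/2)) * indicator {x. \<bar>x\<bar> \<ge> 1} x \<partial>symm))
     \<le> ennreal (2 / \<kappa>) * ennreal (C * (1 / (\<rho>/2)))"
    by (rule mult_left_mono) simp
  also have "ennreal (2 / \<kappa>) * (ennreal (\<kappa> / 2) * (\<integral>\<^sup>+x. ennreal (\<bar>x\<bar> powr (\<rho>/2)) * indicator {x. \<bar>x\<bar> \<ge> 1} x \<partial>symm))
     = (\<integral>\<^sup>+x. ennreal (\<bar>x\<bar> powr (\<rho>/2)) * indicator {x. \<bar>x\<bar> \<ge> 1} x \<partial>symm)"
    using \<kappa> by (simp add: mult.assoc[symmetric] ennreal_mult'[symmetric])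
  also have "ennreal (2 / \<kappa>) * ennreal (C * (1 / (\<rho>/2))) = ennreal (4 * C / (\<rho> * \<kappa>))"
    using \<kappa> C \<rho> by (subst ennreal_mult'[symmetric]) (auto simp: field_simps)
  finally show ?thesis by (simp add: \<kappa>_def)
qed

text \<open>With probability at least one half the subtracted copy \<open>y\<close> lies in
  \<open>[-K, K]\<close>. There \<open>\<bar>x - y\<bar>\<close> is at least both
  \<open>\<bar>x\<bar> / 2\<close> and \<open>R\<close>, which accounts for the threshold and for
  the factor \<open>2 * 2 powr \<gamma>\<close>.\<close>

lemma desymmetrize:
  assumes K: "K \<ge> 0" "measure M {-K..K} \<ge> 1/2" and \<gamma>: "\<gamma> > 0" and R: "R > 0"
  shows "(\<integral>\<^sup>+x. ennreal (\<bar>x\<bar> powr \<gamma>) * indicator {x. \<bar>x\<bar> \<ge> 2 * K + 2 * R} x \<partial>M)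
    \<le> ennreal (2 * 2 powr \<gamma>) * (\<integral>\<^sup>+x. ennreal (\<bar>x\<bar> powr \<gamma>) * indicator {x. \<bar>x\<bar> \<ge> R} x \<partial>symm)"
proof -
  have "(\<integral>\<^sup>+x. ennreal (\<bar>x\<bar> powr \<gamma>) * indicator {x. \<bar>x\<bar> \<ge> 2 * K + 2 * R} x \<partial>M)
    \<le> (\<integral>\<^sup>+x. ennreal (2 * 2 powr \<gamma>) * (\<integral>\<^sup>+y. ennreal (\<bar>x - y\<bar> powr \<gamma>) * indicator {x. \<bar>x\<bar> \<ge> R} (x - y) \<partial>M) \<partial>M)"
  proof (rule nn_integral_mono)
    fix x :: real
    show "ennreal (\<bar>x\<bar> powr \<gamma>) * indicator {x. \<bar>x\<bar> \<ge> 2 * K + 2 * R} x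
       \<le> ennreal (2 * 2 powr \<gamma>) * (\<integral>\<^sup>+y. ennreal (\<bar>x - y\<bar> powr \<gamma>) * indicator {x. \<bar>x\<bar> \<ge> R} (x - y) \<partial>M)"
    proof (cases "\<bar>x\<bar> \<ge> 2 * K + 2 * R")
      case True
      have "(\<bar>x\<bar>/2) powr \<gamma> * (1/2) \<le> (\<bar>x\<bar>/2) powr \<gamma> * measure M {-K..K}"
        by (rule mult_left_mono[OF K(2)]) simp
      then have "ennreal ((\<bar>x\<bar>/2) powr \<gamma> * (1/2)) \<le> ennreal ((\<bar>x\<bar>/2) powr \<gamma> * measure M {-K..K})"
        by (rule ennreal_leI)
      also have "\<dots> = ennreal ((\<bar>x\<bar>/2) powr \<gamma>) * emeasure M {-K..K}"
        unfolding emeasure_eq_measure by (rule ennreal_mult) auto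
      also have "\<dots> = (\<integral>\<^sup>+y. ennreal ((\<bar>x\<bar>/2) powr \<gamma>) * indicator {-K..K} y \<partial>M)"
        by (rule nn_integral_cmult_indicator[symmetric]) simp
      also have "\<dots> \<le> (\<integral>\<^sup>+y. ennreal (\<bar>x - y\<bar> powr \<gamma>) * indicator {x. \<bar>x\<bar> \<ge> R} (x - y) \<partial>M)"
      proof (rule nn_integral_mono)
        fix y
        show "ennreal ((\<bar>x\<bar>/2) powr \<gamma>) * indicator {-K..K} y \<le> ennreal (\<bar>x - y\<bar> powr \<gamma>) * indicator {x. \<bar>x\<bar> \<ge> R} (x - y)"
        proof (cases "y \<in> {-K..K}")
          case y: True
          have "\<bar>y\<bar> \<le> K" "\<bar>x\<bar> - \<bar>y\<bar> \<le> \<bar>x - y\<bar>" using y by (auto simp: abs_le_iff)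
          then have "\<bar>x\<bar>/2 \<le> \<bar>x - y\<bar>" "R \<le> \<bar>x - y\<bar>" using True K(1) R by linarith+
          then show ?thesis using y \<gamma> by (auto intro!: ennreal_leI powr_mono2)
        qed simp
      qed
      finally have "ennreal (2 * 2 powr \<gamma>) * ennreal ((\<bar>x\<bar>/2) powr \<gamma> * (1/2)) \<le>
         ennreal (2 * 2 powr \<gamma>) * (\<integral>\<^sup>+y. ennreal (\<bar>x - y\<bar> powr \<gamma>) * indicator {x. \<bar>x\<bar> \<ge> R} (x - y) \<partial>M)"
        by (rule mult_left_mono) simp
      also have "ennreal (2 * 2 powr \<gamma>) * ennreal ((\<bar>x\<bar>/2) powr \<gamma> * (1/2)) = ennreal (\<bar>x\<bar> powr \<gamma>)"
        using True K R by (subst ennreal_mult'[symmetric]) (auto simp: powr_divide)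
      finally show ?thesis using True by simp
    qed simp
  qed
  also have "\<dots> = ennreal (2 * 2 powr \<gamma>) * (\<integral>\<^sup>+x. \<integral>\<^sup>+y. ennreal (\<bar>x - y\<bar> powr \<gamma>) * indicator {x. \<bar>x\<bar> \<ge> R} (x - y) \<partial>M \<partial>M)"
    by (rule nn_integral_cmult) auto
  also have "(\<integral>\<^sup>+x. \<integral>\<^sup>+y. ennreal (\<bar>x - y\<bar> powr \<gamma>) * indicator {x. \<bar>x\<bar> \<ge> R} (x - y) \<partial>M \<partial>M)
    = (\<integral>\<^sup>+x. ennreal (\<bar>x\<bar> powr \<gamma>) * indicator {x. \<bar>x\<bar> \<ge> R} x \<partial>symm)"
    by (rule nn_integral_symm[symmetric]) auto
  finally show ?thesis .
qed

end

lemma weak_conv_tight: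
  assumes "\<And>n. real_distribution (P n)" "real_distribution Q" "weak_conv_m P Q"
  obtains K where "K \<ge> 0" "\<forall>\<^sub>F n in sequentially. measure (P n) {-K..K} \<ge> 1/2"
proof -
  interpret P: real_distribution "P n" for n by fact
  interpret Q: real_distribution Q by fact
  have "(\<lambda>n. measure Q {- real n..real n}) \<longlonglongrightarrow> measure Q (\<Union>n. {- real n..real n})"
    by (rule Q.finite_Lim_measure_incseq) (auto simp: incseq_def)
  also have "(\<Union>n. {- real n..real n}) = UNIV"
  proof safe
    fix x :: real
    obtain n where "\<bar>x\<bar> \<le> real n" using real_arch_simple by blast
    then show "x \<in> (\<Union>n. {- real n..real n})" by (auto simp: abs_le_iff intro!: exI[of _ n])
  qed auto
  also have "measure Q UNIV = 1" using Q.prob_space by simp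
  finally have "\<forall>\<^sub>F n in sequentially. measure Q {- real n..real n} > 1/2"
    by (rule order_tendstoD) simp
  then obtain k :: nat where k: "measure Q {- real k..real k} > 1/2" by (auto simp: eventually_sequentially)
  \<comment> \<open>A continuous trapezoid between the indicators of \<open>[-k, k]\<close> and
    \<open>[-k-1, k+1]\<close>; weak convergence applies to it without any question of boundary
    mass.\<close>
  define f where "f x = max 0 (min 1 (real k + 1 - \<bar>x\<bar>))" for x :: real
  have f: "isCont f x" for x unfolding f_def by (intro continuous_intros)
  have [measurable]: "f \<in> borel_measurable borel"
    by (intro borel_measurable_continuous_onI continuous_at_imp_continuous_on ballI f)
  have fb: "0 \<le> f x" "f x \<le> 1" for x by (auto simp: f_def)
  have "(\<lambda>n. \<integral>x. f x \<partial>(P n)) \<longlonglongrightarrow> (\<integral>x. f x \<partial>Q)"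
    by (rule weak_conv_imp_integral_bdd_continuous_conv[OF assms, of f 1]) (use f fb in auto)
  moreover have "(\<integral>x. f x \<partial>Q) > 1/2"
  proof -
    have "measure Q {- real k..real k} = (\<integral>x. indicator {- real k..real k} x \<partial>Q)" by simp
    also have "\<dots> \<le> (\<integral>x. f x \<partial>Q)"
    proof (rule integral_mono)
      show "integrable Q f" by (rule Q.integrable_const_bound[where B=1]) (use fb in auto)
      show "integrable Q (indicator {- real k..real k} :: real \<Rightarrow> real)"
        by (rule Q.integrable_const_bound[where B=1]) auto
      show "indicator {- real k..real k} x \<le> f x" for x
        by (auto simp: f_def indicator_def)
    qed
    finally show ?thesis using k by simp
  qed
  ultimately have "\<forall>\<^sub>F n in sequentially. (\<integral>x. f x \<partial>(P n)) > 1/2" by (rule order_tendstoD)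
  then have "\<forall>\<^sub>F n in sequentially. measure (P n) {- (real k + 1)..real k + 1} \<ge> 1/2"
  proof eventually_elim
    case (elim n)
    have "(\<integral>x. f x \<partial>(P n)) \<le> (\<integral>x. indicator {- (real k + 1)..real k + 1} x \<partial>(P n))"
    proof (rule integral_mono)
      show "integrable (P n) f" by (rule P.integrable_const_bound[where B=1]) (use fb in auto)
      show "integrable (P n) (indicator {- (real k + 1)..real k + 1} :: real \<Rightarrow> real)"
        by (rule P.integrable_const_bound[where B=1]) auto
      show "f x \<le> indicator {- (real k + 1)..real k + 1} x" for x
        by (auto simp: f_def indicator_def)
    qed
    also have "\<dots> = measure (P n) {- (real k + 1)..real k + 1}" by simp
    finally have "(\<integral>x. f x \<partial>(P n)) \<le> measure (P n) {- (real k + 1)..real k + 1}" .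
    then show ?case using elim by simp
  qed
  then show ?thesis by (rule that[rotated]) simp
qed

section \<open>Scaling of the characteristic function\<close>

text \<open>\<open>g\<close> stands for the modulus of the characteristic function of one summand.
  Only moduli are recorded, so the constants \<open>a n\<close> and the skewness of the limit are
  invisible here.\<close>

locale stable_scaling =
  fixes g :: "real \<Rightarrow> real" and b :: "nat \<Rightarrow> real" and c \<alpha> :: real
  assumes c: "c > 0" and \<alpha>: "\<alpha> > 0"
    and g_nonneg: "\<And>s. 0 \<le> g s" and g_le_1: "\<And>s. g s \<le> 1"
    and b_pos: "\<And>n. n \<ge> 1 \<Longrightarrow> b n > 0"
    and unif: "\<And>T e. e > 0 \<Longrightarrow> \<forall>\<^sub>F n in sequentially. \<forall>t. \<bar>t\<bar> \<le> T \<longrightarrow> \<bar>g (t / b n) ^ n - exp (- c * \<bar>t\<bar> powr \<alpha>)\<bar> < e"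
begin

text \<open>If \<open>b n < Z\<close> infinitely often, then \<open>t = s * b n\<close> stays
  bounded along these \<open>n\<close>, so \<open>g s ^ n\<close> stays away from zero and
  \<open>g s\<close> must be 1. This for all \<open>s\<close> contradicts the limit
  \<open>exp (- c)\<close> at \<open>t = 1\<close>.\<close>

lemma b_at_top: "filterlim b at_top sequentially"
proof (rule ccontr)
  assume "\<not> ?thesis"
  then obtain Z where "\<not> (\<forall>\<^sub>F n in sequentially. Z \<le> b n)"
    unfolding filterlim_at_top by blast
  then have Z: "\<exists>\<^sub>F n in sequentially. b n < Z"
    by (simp add: not_eventually not_le)
  have g1: "g s = 1" for s
  proof (rule ccontr)
    assume "g s \<noteq> 1"
    then have s: "g s < 1" using g_le_1[of s] by simp
    define T where "T = \<bar>s\<bar> * Z"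
    define q where "q = exp (- c * \<bar>T\<bar> powr \<alpha>)"
    have "q > 0" by (simp add: q_def)
    have "(\<lambda>n. g s ^ n) \<longlonglongrightarrow> 0" using s g_nonneg[of s] by (intro LIMSEQ_power_zero) auto
    then have "\<forall>\<^sub>F n in sequentially. g s ^ n < q / 2" using \<open>q > 0\<close> by (intro order_tendstoD) auto
    moreover have "\<forall>\<^sub>F n in sequentially. \<forall>t. \<bar>t\<bar> \<le> T \<longrightarrow> \<bar>g (t / b n) ^ n - exp (- c * \<bar>t\<bar> powr \<alpha>)\<bar> < q / 2"
      using \<open>q > 0\<close> by (intro unif) auto
    ultimately have "\<forall>\<^sub>F n in sequentially. \<not> b n < Z"
      using eventually_ge_at_top[of 1]
    proof eventually_elim
      case (elim n)
      show ?case
      proof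
        assume bZ: "b n < Z"
        have bn: "b n > 0" using b_pos elim by simp
        let ?t = "s * b n"
        have t: "\<bar>?t\<bar> \<le> T" using bn bZ unfolding T_def by (auto simp: abs_mult intro!: mult_left_mono)
        then have "\<bar>?t\<bar> powr \<alpha> \<le> \<bar>T\<bar> powr \<alpha>" using \<alpha> by (intro powr_mono2) auto
        then have "q \<le> exp (- c * \<bar>?t\<bar> powr \<alpha>)" unfolding q_def using c by auto
        moreover have "\<bar>g (?t / b n) ^ n - exp (- c * \<bar>?t\<bar> powr \<alpha>)\<bar> < q / 2" using elim t by blast
        ultimately have "g s ^ n > q / 2" using bn by (simp add: abs_if split: if_splits)
        then show False using elim by simp
      qed
    qed
    then show False using Z by (simp add: frequently_def)
  qed
  have "\<forall>\<^sub>F n in sequentially. \<forall>t. \<bar>t\<bar> \<le> 1 \<longrightarrow> \<bar>g (t / b n) ^ n - exp (- c * \<bar>t\<bar> powr \<alpha>)\<bar> < 1 - exp (- c)"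
    using c by (intro unif) auto
  then have "\<forall>\<^sub>F n in sequentially. False"
  proof eventually_elim
    case (elim n)
    from spec[OF elim, of 1] show ?case using g1 by simp
  qed
  then show False by simp
qed

lemma tendsto_g_power: "(\<lambda>n. g (1 / b n) ^ n) \<longlonglongrightarrow> exp (- c)"
proof (rule LIMSEQ_I)
  fix e :: real assume "e > 0"
  from unif[OF this, of 1] obtain N where N: "\<forall>n\<ge>N. \<forall>t. \<bar>t\<bar> \<le> 1 \<longrightarrow> \<bar>g (t / b n) ^ n - exp (- c * \<bar>t\<bar> powr \<alpha>)\<bar> < e"
    by (auto simp: eventually_sequentially)
  show "\<exists>N. \<forall>n\<ge>N. norm (g (1 / b n) ^ n - exp (- c)) < e"
  proof (intro exI[of _ N] allI impI)
    fix n assume "n \<ge> N"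
    then have "\<forall>t. \<bar>t\<bar> \<le> 1 \<longrightarrow> \<bar>g (t / b n) ^ n - exp (- c * \<bar>t\<bar> powr \<alpha>)\<bar> < e" using N by blast
    from spec[OF this, of 1] show "norm (g (1 / b n) ^ n - exp (- c)) < e" by simp
  qed
qed

lemma tendsto_g_1: "(\<lambda>n. g (1 / b n)) \<longlonglongrightarrow> 1"
proof (rule tendsto_sandwich)
  have "\<forall>\<^sub>F n in sequentially. g (1 / b n) ^ n > exp (- c) / 2"
    using tendsto_g_power by (rule order_tendstoD) simp
  then show "\<forall>\<^sub>F n in sequentially. (exp (- c) / 2) powr (1 / real n) \<le> g (1 / b n)"
    using eventually_ge_at_top[of 1]
  proof eventually_elim
    case (elim n)
    have "(exp (- c) / 2) powr (1 / real n) \<le> (g (1 / b n) ^ n) powr (1 / real n)"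
      using elim by (intro powr_mono2) auto
    also have "\<dots> = g (1 / b n)"
      using elim g_nonneg[of "1 / b n"] by (cases "g (1 / b n) = 0") (auto simp: powr_realpow[symmetric] powr_powr power_0_left)
    finally show ?case .
  qed
  have "(\<lambda>n. (exp (- c) / 2) powr (1 / real n)) \<longlonglongrightarrow> (exp (- c) / 2) powr 0"
    by (intro tendsto_intros lim_1_over_n) auto
  then show "(\<lambda>n. (exp (- c) / 2) powr (1 / real n)) \<longlonglongrightarrow> 1" by simp
qed (auto simp: g_le_1)

text \<open>On (0, 1] the strictly decreasing function \<open>exp (- c * y powr \<alpha>)\<close>
  has its minimum \<open>exp (- c)\<close> at \<open>y = 1\<close> only, so nearly minimal values
  force \<open>y\<close> close to 1.\<close>

lemma tendsto_1_if_exp_le: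
  assumes y: "\<And>n. n \<ge> 1 \<Longrightarrow> 0 < y n" "\<And>n. y n \<le> 1"
    and le: "\<And>e. e > 0 \<Longrightarrow> \<forall>\<^sub>F n in sequentially. exp (- c * y n powr \<alpha>) < exp (- c) + e"
  shows "y \<longlonglongrightarrow> 1"
proof (rule LIMSEQ_I)
  fix d :: real assume "d > 0"
  define d' where "d' = min d (1/2)"
  have d': "0 < d'" "d' < 1" using \<open>d > 0\<close> by (auto simp: d'_def)
  define e where "e = exp (- c * (1 - d') powr \<alpha>) - exp (- c)"
  have "(1 - d') powr \<alpha> < 1" using powr_less_mono2[of \<alpha> "1 - d'" 1] d' \<alpha> by simp
  then have "e > 0" unfolding e_def using c by simp
  from le[OF this] obtain N where N: "\<forall>n\<ge>N. exp (- c * y n powr \<alpha>) < exp (- c) + e"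
    by (auto simp: eventually_sequentially)
  show "\<exists>N. \<forall>n\<ge>N. norm (y n - 1) < d"
  proof (intro exI[of _ "max N 1"] allI impI)
    fix n assume n: "n \<ge> max N 1"
    have "y n > 1 - d'"
    proof (rule ccontr)
      assume "\<not> y n > 1 - d'"
      then have "y n powr \<alpha> \<le> (1 - d') powr \<alpha>" using y(1)[of n] n \<alpha> by (intro powr_mono2) auto
      then have "exp (- c * (1 - d') powr \<alpha>) \<le> exp (- c * y n powr \<alpha>)" using c by simp
      then show False using N n unfolding e_def by (auto dest!: spec[of _ n])
    qed
    then show "norm (y n - 1) < d" using y(2)[of n] by (auto simp: d'_def)
  qed
qed

text \<open>With \<open>t = b n / b (Suc n)\<close> the value \<open>g (t / b n)\<close> is
  \<open>g (1 / b (Suc n))\<close>, whose powers are known to tend to \<open>exp (- c)\<close>. The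
  ratio and its inverse are treated separately and capped at 1, which keeps \<open>t\<close> in the
  compact range where convergence is uniform.\<close>

lemma ratio_tendsto_1: "(\<lambda>n. b (Suc n) / b n) \<longlonglongrightarrow> 1"
proof -
  define r where "r n = b n / b (Suc n)" for n
  have rpos: "r n > 0" if "n \<ge> 1" for n using b_pos that by (simp add: r_def)
  have x: "(\<lambda>n. g (1 / b (Suc n))) \<longlonglongrightarrow> 1" by (rule LIMSEQ_Suc[OF tendsto_g_1])
  \<comment> \<open>The exponent \<open>n\<close> in place of \<open>Suc n\<close> costs one factor,
    which tends to 1; \<open>p2\<close> is the reverse shift.\<close>
  have p1: "(\<lambda>n. g (1 / b (Suc n)) ^ n) \<longlonglongrightarrow> exp (- c)"
  proof -
    have "(\<lambda>n. g (1 / b (Suc n)) ^ Suc n / g (1 / b (Suc n))) \<longlonglongrightarrow> exp (- c) / 1"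
      by (rule tendsto_divide[OF LIMSEQ_Suc[OF tendsto_g_power] x]) simp
    moreover have "\<forall>\<^sub>F n in sequentially. g (1 / b (Suc n)) ^ Suc n / g (1 / b (Suc n)) = g (1 / b (Suc n)) ^ n"
      using order_tendstoD(1)[OF x, of 0] by (auto elim: eventually_mono)
    ultimately have "(\<lambda>n. g (1 / b (Suc n)) ^ n) \<longlonglongrightarrow> exp (- c) / 1"
      by (rule Lim_transform_eventually)
    then show ?thesis by simp
  qed
  have p2: "(\<lambda>n. g (1 / b n) ^ Suc n) \<longlonglongrightarrow> exp (- c)"
    using tendsto_mult[OF tendsto_g_1 tendsto_g_power] by simp
  have y: "(\<lambda>n. min (r n) 1) \<longlonglongrightarrow> 1"
  proof (rule tendsto_1_if_exp_le)
    fix e :: real assume e: "e > 0"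
    have "\<forall>\<^sub>F n in sequentially. \<forall>t. \<bar>t\<bar> \<le> 1 \<longrightarrow> \<bar>g (t / b n) ^ n - exp (- c * \<bar>t\<bar> powr \<alpha>)\<bar> < e / 2"
      using e by (intro unif) auto
    moreover have "\<forall>\<^sub>F n in sequentially. g (1 / b (Suc n)) ^ n < exp (- c) + e / 2"
      using p1 by (rule order_tendstoD) (use e in auto)
    ultimately show "\<forall>\<^sub>F n in sequentially. exp (- c * min (r n) 1 powr \<alpha>) < exp (- c) + e"
      using eventually_ge_at_top[of 1]
    proof eventually_elim
      case (elim n)
      show ?case
      proof (cases "r n \<le> 1")
        case True
        have "r n / b n = 1 / b (Suc n)" using b_pos[of n] elim by (simp add: r_def)
        moreover have "\<bar>g (r n / b n) ^ n - exp (- c * \<bar>r n\<bar> powr \<alpha>)\<bar> < e / 2"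
          using elim(1)[rule_format, of "r n"] elim(3) True rpos[of n] by simp
        ultimately show ?thesis using elim True rpos[of n] by (auto simp: abs_if split: if_splits)
      qed (use e in auto)
    qed
  qed (use rpos in auto)
  have z: "(\<lambda>n. min (1 / r n) 1) \<longlonglongrightarrow> 1"
  proof (rule tendsto_1_if_exp_le)
    fix e :: real assume e: "e > 0"
    have "\<forall>\<^sub>F n in sequentially. \<forall>t. \<bar>t\<bar> \<le> 1 \<longrightarrow> \<bar>g (t / b n) ^ n - exp (- c * \<bar>t\<bar> powr \<alpha>)\<bar> < e / 2"
      using e by (intro unif) auto
    then have "\<forall>\<^sub>F n in sequentially. \<forall>t. \<bar>t\<bar> \<le> 1 \<longrightarrow> \<bar>g (t / b (Suc n)) ^ Suc n - exp (- c * \<bar>t\<bar> powr \<alpha>)\<bar> < e / 2"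
      by (subst (asm) eventually_sequentially_Suc[symmetric])
    moreover have "\<forall>\<^sub>F n in sequentially. g (1 / b n) ^ Suc n < exp (- c) + e / 2"
      using p2 by (rule order_tendstoD) (use e in auto)
    ultimately show "\<forall>\<^sub>F n in sequentially. exp (- c * min (1 / r n) 1 powr \<alpha>) < exp (- c) + e"
      using eventually_ge_at_top[of 1]
    proof eventually_elim
      case (elim n)
      show ?case
      proof (cases "1 / r n \<le> 1")
        case True
        have "(1 / r n) / b (Suc n) = 1 / b n" using b_pos[of "Suc n"] elim by (simp add: r_def)
        moreover have "\<bar>g ((1 / r n) / b (Suc n)) ^ Suc n - exp (- c * \<bar>1 / r n\<bar> powr \<alpha>)\<bar> < e / 2"
          using elim(1) True rpos[of n] elim(3) by (metis abs_of_pos zero_less_divide_1_iff)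
        ultimately show ?thesis using elim True rpos[of n] by (auto simp: abs_if min_def split: if_splits)
      qed (use e in auto)
    qed
  qed (use rpos in auto)
  have "(\<lambda>n. min (1 / r n) 1 / min (r n) 1) \<longlonglongrightarrow> 1 / 1" by (rule tendsto_divide[OF z y]) simp
  moreover have "\<forall>\<^sub>F n in sequentially. min (1 / r n) 1 / min (r n) 1 = b (Suc n) / b n"
    using eventually_ge_at_top[of 1]
  proof eventually_elim
    case (elim n)
    then have "b n > 0" "b (Suc n) > 0" by (auto intro: b_pos)
    then show ?case
      by (cases "b n" "b (Suc n)" rule: linorder_cases) (simp_all add: min_def r_def)
  qed
  ultimately have "(\<lambda>n. b (Suc n) / b n) \<longlonglongrightarrow> 1 / 1" by (rule Lim_transform_eventually)
  then show ?thesis by simp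
qed

text \<open>The ratio test, as \<open>b (Suc n) / b n\<close> tends to 1. Changes of variable
  produce powers of \<open>b n\<close>, and every geometric factor must absorb them.\<close>

lemma subexponential:
  assumes x: "0 \<le> x" "x < 1"
  shows "(\<lambda>n. real n * b n * x ^ n) \<longlonglongrightarrow> 0"
proof -
  have "(\<lambda>n. (1 + 1 / real n) * (b (Suc n) / b n) * x) \<longlonglongrightarrow> (1 + 0) * 1 * x"
    by (intro tendsto_intros lim_1_over_n ratio_tendsto_1)
  then have "\<forall>\<^sub>F n in sequentially. (1 + 1 / real n) * (b (Suc n) / b n) * x < (1 + x) / 2"
    by (rule order_tendstoD) (use x in auto)
  then obtain N where N: "\<And>n. n \<ge> N \<Longrightarrow> (1 + 1 / real n) * (b (Suc n) / b n) * x < (1 + x) / 2"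
    by (auto simp: eventually_sequentially)
  have "summable (\<lambda>n. real n * b n * x ^ n)"
  proof (rule summable_ratio_test[of "(1 + x) / 2" "max N 1"])
    fix n assume n: "n \<ge> max N 1"
    then have bn: "b n > 0" "b (Suc n) > 0" by (auto intro!: b_pos)
    have "real (Suc n) * b (Suc n) * x ^ Suc n = ((1 + 1 / real n) * (b (Suc n) / b n) * x) * (real n * b n * x ^ n)"
      using n bn by (simp add: field_simps)
    also have "\<dots> \<le> (1 + x) / 2 * (real n * b n * x ^ n)"
      using N[of n] n bn x by (intro mult_right_mono) auto
    finally show "norm (real (Suc n) * b (Suc n) * x ^ Suc n) \<le> (1 + x) / 2 * norm (real n * b n * x ^ n)"
      using bn x by (simp add: abs_mult)
  qed (use x in auto)
  then show ?thesis by (rule summable_LIMSEQ_zero)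
qed

text \<open>Since \<open>ln 0 = 0\<close>, a vanishing \<open>g s\<close> would give
  \<open>u s = 0\<close> and not infinity; the statements about \<open>u\<close> below therefore
  also assert positivity of \<open>g\<close>.\<close>

definition "u s = - ln (g s)"

lemma u_uniform:
  assumes e: "e > 0"
  shows "\<forall>\<^sub>F n in sequentially. \<forall>t. 0 \<le> t \<and> t \<le> T \<longrightarrow> g (t / b n) > 0 \<and> \<bar>real n * u (t / b n) - c * t powr \<alpha>\<bar> < e"
proof -
  define q where "q = exp (- c * \<bar>T\<bar> powr \<alpha>)"
  have q: "q > 0" "q \<le> 1" using c by (auto simp: q_def)
  \<comment> \<open>\<open>q\<close> is the smallest value of the limit on \<open>[0, T]\<close>.
    The first entry keeps the powers of \<open>g\<close> above \<open>q / 2\<close>; given this, the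
    second one makes the logarithms differ by less than \<open>e\<close>.\<close>
  define e' where "e' = min (q / 2) (e * q / 2)"
  have e': "e' > 0" using q e by (auto simp: e'_def)
  show ?thesis
    using unif[OF e', of T] eventually_ge_at_top[of 1]
  proof eventually_elim
    case (elim n)
    show ?case
    proof (intro allI impI)
      fix t assume t: "0 \<le> t \<and> t \<le> T"
      define x where "x = g (t / b n) ^ n"
      define y where "y = exp (- c * t powr \<alpha>)"
      have xy: "\<bar>x - y\<bar> < e'" using elim(1)[rule_format, of t] t by (simp add: x_def y_def)
      have "t powr \<alpha> \<le> \<bar>T\<bar> powr \<alpha>" using t \<alpha> by (intro powr_mono2) auto
      then have y: "y \<ge> q" using c by (simp add: q_def y_def)
      have "\<bar>x - y\<bar> < q / 2" using xy by (simp add: e'_def)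
      then have x: "x > q / 2" using y by linarith
      then have x0: "x > 0" using q by linarith
      then have g0: "g (t / b n) > 0" using g_nonneg[of "t / b n"] elim by (cases "g (t / b n) = 0") (auto simp: x_def power_0_left)
      have lnx: "ln x = - real n * u (t / b n)" using g0 by (simp add: x_def u_def ln_realpow)
      have lny: "ln y = - c * t powr \<alpha>" by (simp add: y_def)
      have d: "ln v - ln w < e" if "v > q / 2" "w > q / 2" "\<bar>v - w\<bar> < e'" for v w
      proof -
        have vw: "v > 0" "w > 0" using that q by linarith+
        have "ln v - ln w = ln (v / w)" using vw by (simp add: ln_div)
        also have "\<dots> \<le> v / w - 1" using vw by (intro ln_le_minus_one) auto
        also have "\<dots> = (v - w) / w" using vw by (simp add: field_simps)
        also have "\<dots> < e"
        proof -
          have "\<bar>v - w\<bar> < e * q / 2" using that by (simp add: e'_def)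
          then have "v - w < e * q / 2" by linarith
          also have "\<dots> \<le> e * w" using that e by simp
          finally show ?thesis using vw by (simp add: divide_less_eq)
        qed
        finally show ?thesis .
      qed
      have "\<bar>ln x - ln y\<bar> < e" using d[of x y] d[of y x] x y xy q by (auto simp: abs_if split: if_splits)
      then show "0 < g (t / b n) \<and> \<bar>real n * u (t / b n) - c * t powr \<alpha>\<bar> < e"
        using g0 unfolding lnx lny by (auto simp: abs_if split: if_splits)
    qed
  qed
qed

text \<open>A substitute for the regular variation of \<open>u\<close> at the origin: every small \<open>s\<close> is some \<open>t / b n\<close> with \<open>t\<close> in
  a fixed compact interval, because consecutive \<open>b n\<close> have ratio close to one.\<close>
lemma doubling: "\<exists>d>0. \<forall>s. 0 < s \<and> s \<le> d \<longrightarrow> g s > 0 \<and> g (2 * s) > 0 \<and> u (2 * s) \<ge> 2 powr (\<alpha> / 2) * u s"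
proof -
  \<comment> \<open>The solution of
    \<open>2 powr (\<alpha>/2) * (c + k) = c * 2 powr \<alpha> - k\<close>: the error that degrades
    the limiting factor \<open>2 powr \<alpha>\<close> exactly to
    \<open>2 powr (\<alpha>/2)\<close>. The range of \<open>t\<close> below goes up to 4 to cover
    both \<open>t\<close> and \<open>2 * t\<close>.\<close>
  define k where "k = c * (2 powr \<alpha> - 2 powr (\<alpha>/2)) / (1 + 2 powr (\<alpha>/2))"
  have pw: "2 powr (\<alpha>/2) < 2 powr \<alpha>" using \<alpha> by simp
  have den: "1 + 2 powr (\<alpha>/2) > 0" by (simp add: add_pos_pos)
  have k: "k > 0" unfolding k_def using pw den c by (intro divide_pos_pos mult_pos_pos) auto
  have "\<forall>\<^sub>F n in sequentially. b (Suc n) / b n < 2"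
    using ratio_tendsto_1 by (rule order_tendstoD) simp
  then have "\<forall>\<^sub>F n in sequentially. b (Suc n) / b n < 2 \<and> n \<ge> 1 \<and>
     (\<forall>t. 0 \<le> t \<and> t \<le> 4 \<longrightarrow> g (t / b n) > 0 \<and> \<bar>real n * u (t / b n) - c * t powr \<alpha>\<bar> < k)"
    using u_uniform[OF k, of 4] eventually_ge_at_top[of 1] by eventually_elim auto
  then obtain N where N: "\<And>n. n \<ge> N \<Longrightarrow> b (Suc n) / b n < 2 \<and> n \<ge> 1 \<and>
     (\<forall>t. 0 \<le> t \<and> t \<le> 4 \<longrightarrow> g (t / b n) > 0 \<and> \<bar>real n * u (t / b n) - c * t powr \<alpha>\<bar> < k)"
    by (auto simp: eventually_sequentially)
  have bN: "b N > 0" using N[of N] b_pos by auto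
  show ?thesis
  proof (intro exI[of _ "1 / (2 * b N)"] conjI allI impI)
    show "1 / (2 * b N) > 0" using bN by simp
    fix s assume s: "0 < s \<and> s \<le> 1 / (2 * b N)"
    \<comment> \<open>The least such \<open>n\<close> satisfies \<open>1 \<le> b n * s < 2\<close>,
      because its predecessor fails the second condition and consecutive norming constants differ by
      a factor below 2. The bound on \<open>s\<close> excludes \<open>n = N\<close>, so the
      predecessor still lies beyond \<open>N\<close>.\<close>
    let ?P = "\<lambda>n. n \<ge> N \<and> b n * s \<ge> 1"
    have "\<forall>\<^sub>F n in sequentially. b n \<ge> 1 / s" using b_at_top by (auto simp: filterlim_at_top)
    then obtain m where m: "\<And>n. n \<ge> m \<Longrightarrow> b n \<ge> 1 / s" by (auto simp: eventually_sequentially)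
    have "?P (max m N)" using m[of "max m N"] s by (auto simp: field_simps)
    then have L: "?P (LEAST n. ?P n)" by (rule LeastI)
    define n where "n = (LEAST n. ?P n)"
    have n: "n \<ge> N" "b n * s \<ge> 1" using L by (auto simp: n_def)
    have "b N * s < 1" using s bN by (auto simp: field_simps)
    then have "n \<noteq> N" using n by auto
    then have nN: "n - 1 \<ge> N" "Suc (n - 1) = n" using n by auto
    have "\<not> ?P (n - 1)" using not_less_Least[of "n - 1" ?P] nN unfolding n_def[symmetric] by auto
    then have less: "b (n - 1) * s < 1" using nN by auto
    have bn1: "b (n - 1) > 0" using N[of "n-1"] nN b_pos by auto
    have "b n < 2 * b (n - 1)" using N[of "n - 1"] nN bn1 by (auto simp: field_simps)
    then have "b n * s < (2 * b (n - 1)) * s" using s by (intro mult_strict_right_mono) auto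
    also have "\<dots> = 2 * (b (n - 1) * s)" by simp
    also have "\<dots> < 2 * 1" using less by (intro mult_strict_left_mono) auto
    finally have "b n * s < 2" by simp
    define t where "t = b n * s"
    have t: "1 \<le> t" "t < 2" using n \<open>b n * s < 2\<close> by (auto simp: t_def)
    have bn: "b n > 0" using N[of n] n b_pos by auto
    have st: "s = t / b n" "2 * s = (2 * t) / b n" using bn by (auto simp: t_def)
    have n0: "real n > 0" using N[of n] n by auto
    have A: "g s > 0" "\<bar>real n * u s - c * t powr \<alpha>\<bar> < k" using N[of n] n t unfolding st(1) by auto
    have B: "g (2 * s) > 0" "\<bar>real n * u (2 * s) - c * (2 * t) powr \<alpha>\<bar> < k" using N[of n] n t unfolding st(2) by auto
    have "k * (1 + 2 powr (\<alpha>/2)) = c * (2 powr \<alpha> - 2 powr (\<alpha>/2))" using den by (simp add: k_def)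
    also have "\<dots> \<le> c * (2 powr \<alpha> - 2 powr (\<alpha>/2)) * t powr \<alpha>"
      using mult_left_mono[of 1 "t powr \<alpha>" "c * (2 powr \<alpha> - 2 powr (\<alpha>/2))"] c pw t \<alpha>
      by (simp add: ge_one_powr_ge_zero)
    finally have "2 powr (\<alpha>/2) * (c * t powr \<alpha> + k) \<le> c * (2 powr \<alpha> * t powr \<alpha>) - k" by (simp add: algebra_simps)
    also have "2 powr \<alpha> * t powr \<alpha> = (2 * t) powr \<alpha>" using t by (simp add: powr_mult)
    finally have "2 powr (\<alpha>/2) * (c * t powr \<alpha> + k) \<le> real n * u (2 * s)" using B by linarith
    moreover have "2 powr (\<alpha>/2) * (real n * u s) \<le> 2 powr (\<alpha>/2) * (c * t powr \<alpha> + k)"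
      using A by (intro mult_left_mono) auto
    ultimately have "real n * (2 powr (\<alpha>/2) * u s) \<le> real n * u (2 * s)" by (simp add: algebra_simps)
    then show "g s > 0" "g (2 * s) > 0" "u (2 * s) \<ge> 2 powr (\<alpha> / 2) * u s" using A B n0 by auto
  qed
qed

text \<open>Every \<open>t \<ge> 1\<close> is \<open>2 ^ j * s\<close> with \<open>s\<close> in
  [1, 2]. There \<open>n * u\<close> is at least \<open>c / 2\<close>, and each of the
  \<open>j\<close> doublings multiplies it by at least \<open>2 powr (\<alpha> / 2)\<close>, as long
  as the argument stays below \<open>d\<close>.\<close>

lemma small_scale_lower: "\<exists>d>0. \<exists>k>0. \<forall>\<^sub>F n in sequentially. \<forall>t. 1 \<le> t \<and> t \<le> d * b n \<longrightarrow> g (t / b n) ^ n \<le> exp (- k * t powr (\<alpha> / 2))"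
proof -
  obtain d where d: "d > 0" and dbl: "\<And>s. 0 < s \<Longrightarrow> s \<le> d \<Longrightarrow> g s > 0 \<and> g (2 * s) > 0 \<and> u (2 * s) \<ge> 2 powr (\<alpha> / 2) * u s"
    using doubling by blast
  \<comment> \<open>The second factor is the loss from replacing \<open>t\<close> by the power of
    two below it.\<close>
  define k where "k = (c / 2) * (1 / 2) powr (\<alpha> / 2)"
  have k: "k > 0" using c by (simp add: k_def)
  have "\<forall>\<^sub>F n in sequentially. \<forall>t. 1 \<le> t \<and> t \<le> d * b n \<longrightarrow> g (t / b n) ^ n \<le> exp (- k * t powr (\<alpha> / 2))"
    using u_uniform[OF half_gt_zero[OF c], of 2] eventually_ge_at_top[of 1]
  proof eventually_elim
    case (elim n)
    have bn: "b n > 0" using elim b_pos by simp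
    have base: "g (s / b n) > 0 \<and> real n * u (s / b n) \<ge> c / 2" if "1 \<le> s" "s \<le> 2" for s
    proof -
      have "c * 1 \<le> c * s powr \<alpha>" using that c \<alpha> by (intro mult_left_mono) (auto intro!: ge_one_powr_ge_zero)
      moreover have "0 < g (s / b n) \<and> \<bar>real n * u (s / b n) - c * s powr \<alpha>\<bar> < c / 2"
        using elim(1) that by auto
      ultimately show ?thesis by linarith
    qed
    have iter: "g (2 ^ j * s / b n) > 0 \<and> real n * u (2 ^ j * s / b n) \<ge> (2 powr (\<alpha> / 2)) ^ j * (c / 2)"
      if s: "1 \<le> s" "s \<le> 2" and "2 ^ j * s \<le> d * b n" for s j
      using that(3)
    proof (induction j)
      case 0
      then show ?case using base[OF s] by simp
    next
      case (Suc j)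
      have le: "2 ^ j * s \<le> 2 ^ Suc j * s" using s by simp
      then have le': "2 ^ j * s \<le> d * b n" using Suc.prems by linarith
      from Suc.IH[OF le'] have IH: "real n * u (2 ^ j * s / b n) \<ge> (2 powr (\<alpha> / 2)) ^ j * (c / 2)" by simp
      have D: "g (2 * (2 ^ j * s / b n)) > 0 \<and> u (2 * (2 ^ j * s / b n)) \<ge> 2 powr (\<alpha> / 2) * u (2 ^ j * s / b n)"
        using dbl[of "2 ^ j * s / b n"] le' bn s by (simp add: divide_le_eq)
      have "(2 powr (\<alpha> / 2)) ^ Suc j * (c / 2) = 2 powr (\<alpha> / 2) * ((2 powr (\<alpha> / 2)) ^ j * (c / 2))" by simp
      also have "\<dots> \<le> 2 powr (\<alpha> / 2) * (real n * u (2 ^ j * s / b n))" by (intro mult_left_mono IH) auto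
      also have "\<dots> = real n * (2 powr (\<alpha> / 2) * u (2 ^ j * s / b n))" by simp
      also have "\<dots> \<le> real n * u (2 * (2 ^ j * s / b n))" using D by (intro mult_left_mono) auto
      finally show ?case using D by (simp add: mult.assoc)
    qed
    show ?case
    proof (intro allI impI)
      fix t assume t: "1 \<le> t \<and> t \<le> d * b n"
      define j where "j = nat \<lfloor>log 2 t\<rfloor>"
      have lg: "0 \<le> log 2 t" using t by simp
      have j: "real j \<le> log 2 t" "log 2 t < real j + 1" using lg unfolding j_def by linarith+
      have j1: "2 ^ j \<le> t"
      proof -
        have "2 powr real j \<le> 2 powr log 2 t" using j by simp
        then show ?thesis using t by (simp add: powr_realpow)
      qed
      have j2: "t \<le> 2 * 2 ^ j"
      proof -
        have "2 powr log 2 t \<le> 2 powr (real j + 1)" using j by simp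
        then show ?thesis using t by (simp add: powr_realpow powr_add)
      qed
      define s where "s = t / 2 ^ j"
      have s: "1 \<le> s" "s \<le> 2" "2 ^ j * s = t" using j1 j2 by (auto simp: s_def field_simps)
      have it: "g (t / b n) > 0" "real n * u (t / b n) \<ge> (2 powr (\<alpha> / 2)) ^ j * (c / 2)"
        using iter[of s j] s t by auto
      have "k * t powr (\<alpha> / 2) = (c / 2) * (t / 2) powr (\<alpha> / 2)"
        using t by (simp add: k_def powr_divide)
      also have "\<dots> \<le> (c / 2) * (2 ^ j) powr (\<alpha> / 2)"
        using t j2 c \<alpha> by (intro mult_left_mono powr_mono2) auto
      also have "(2 ^ j) powr (\<alpha> / 2) = (2 powr (\<alpha> / 2)) ^ j"
        by (simp add: powr_realpow[symmetric] powr_powr mult.commute)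
      finally have "k * t powr (\<alpha> / 2) \<le> real n * u (t / b n)" using it by (simp add: mult.commute)
      moreover have "g (t / b n) ^ n = exp (- (real n * u (t / b n)))"
        using it by (simp add: u_def exp_of_nat_mult)
      ultimately show "g (t / b n) ^ n \<le> exp (- k * t powr (\<alpha> / 2))" by simp
    qed
  qed
  then show ?thesis using d k by blast
qed

text \<open>The doubling inequality is run downwards from \<open>s\<close> in (0, 1], each halving
  dividing \<open>n * u\<close> by at least \<open>2 powr (\<alpha> / 2)\<close>; then
  \<open>1 - exp (- 2 * y) \<le> 2 * y\<close>.\<close>

lemma small_scale_upper: "\<exists>C\<ge>0. \<forall>\<^sub>F n in sequentially. \<forall>t. 0 < t \<and> t \<le> 1 \<longrightarrow> 1 - (g (t / b n) ^ n)\<^sup>2 \<le> C * t powr (\<alpha> / 2)"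
proof -
  obtain d where d: "d > 0" and dbl: "\<And>s. 0 < s \<Longrightarrow> s \<le> d \<Longrightarrow> g s > 0 \<and> g (2 * s) > 0 \<and> u (2 * s) \<ge> 2 powr (\<alpha> / 2) * u s"
    using doubling by blast
  \<comment> \<open>\<open>c + 1\<close> bounds \<open>n * u\<close> on [0, 1]; the power of two is
    the loss in rounding \<open>1 / t\<close> down to a power of two.\<close>
  define C where "C = 2 * ((c + 1) * 2 powr (\<alpha> / 2))"
  have bd: "\<forall>\<^sub>F n in sequentially. b n \<ge> 1 / d" using b_at_top by (auto simp: filterlim_at_top)
  have "\<forall>\<^sub>F n in sequentially. \<forall>t. 0 < t \<and> t \<le> 1 \<longrightarrow> 1 - (g (t / b n) ^ n)\<^sup>2 \<le> C * t powr (\<alpha> / 2)"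
    using u_uniform[OF zero_less_one, of 1] eventually_ge_at_top[of 1] bd
  proof eventually_elim
    case (elim n)
    have bn: "b n > 0" using elim b_pos by simp
    have sd: "s / b n \<le> d" if "s \<le> 1" for s
    proof -
      have "s \<le> d * b n" using elim(3) that d by (simp add: divide_le_eq mult.commute)
      then show ?thesis using bn by (simp add: divide_le_eq)
    qed
    have base: "real n * u (s / b n) \<le> c + 1" if "0 \<le> s" "s \<le> 1" for s
    proof -
      have "c * s powr \<alpha> \<le> c * 1" using that c \<alpha> by (intro mult_left_mono powr_le1) auto
      moreover have "\<bar>real n * u (s / b n) - c * s powr \<alpha>\<bar> < 1" using elim(1) that by auto
      ultimately show ?thesis by linarith
    qed
    have iter: "real n * u (s / 2 ^ j / b n) * (2 powr (\<alpha> / 2)) ^ j \<le> c + 1" if s: "0 < s" "s \<le> 1" for s j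
    proof (induction j)
      case 0
      then show ?case using base[of s] s by simp
    next
      case (Suc j)
      have "s \<le> 2 ^ Suc j" by (rule order_trans[OF s(2) one_le_power]) simp
      then have "s / 2 ^ Suc j \<le> 1" using s by (simp add: divide_le_eq del: power_Suc)
      then have "u (2 * (s / 2 ^ Suc j / b n)) \<ge> 2 powr (\<alpha> / 2) * u (s / 2 ^ Suc j / b n)"
        using dbl[of "s / 2 ^ Suc j / b n"] sd[of "s / 2 ^ Suc j"] s bn by simp
      moreover have "2 * (s / 2 ^ Suc j / b n) = s / 2 ^ j / b n" by simp
      ultimately have D: "u (s / 2 ^ j / b n) \<ge> 2 powr (\<alpha> / 2) * u (s / 2 ^ Suc j / b n)" by simp
      have "real n * u (s / 2 ^ Suc j / b n) * (2 powr (\<alpha> / 2)) ^ Suc j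
         = (real n * (2 powr (\<alpha> / 2)) ^ j) * (2 powr (\<alpha> / 2) * u (s / 2 ^ Suc j / b n))" by simp
      also have "\<dots> \<le> (real n * (2 powr (\<alpha> / 2)) ^ j) * u (s / 2 ^ j / b n)"
        by (intro mult_left_mono D) auto
      also have "\<dots> \<le> c + 1" using Suc.IH by (simp add: algebra_simps)
      finally show ?case .
    qed
    show ?case
    proof (intro allI impI)
      fix t :: real assume t: "0 < t \<and> t \<le> 1"
      define j where "j = nat \<lfloor>log 2 (1 / t)\<rfloor>"
      have lg: "0 \<le> log 2 (1 / t)" using t by simp
      have j: "real j \<le> log 2 (1 / t)" "log 2 (1 / t) < real j + 1" using lg unfolding j_def by linarith+
      have j1: "2 ^ j \<le> 1 / t"
      proof -
        have "2 powr real j \<le> 2 powr log 2 (1 / t)" using j by simp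
        then show ?thesis using t by (simp add: powr_realpow del: log_divide)
      qed
      have j2: "1 / t \<le> 2 * 2 ^ j"
      proof -
        have "2 powr log 2 (1 / t) \<le> 2 powr (real j + 1)" using j by simp
        then show ?thesis using t by (simp add: powr_realpow powr_add)
      qed
      define s where "s = t * 2 ^ j"
      have s: "0 < s" "s \<le> 1" "s / 2 ^ j = t" using j1 t by (auto simp: s_def field_simps)
      have it: "real n * u (t / b n) * (2 powr (\<alpha> / 2)) ^ j \<le> c + 1"
        using iter[of s j] s by simp
      have gt: "g (t / b n) > 0" using dbl[of "t / b n"] sd[of t] t bn by auto
      have "1 \<le> (2 * t * 2 ^ j) powr (\<alpha> / 2)"
        using j2 t \<alpha> by (intro ge_one_powr_ge_zero) (auto simp: field_simps)
      also have "\<dots> = 2 powr (\<alpha> / 2) * t powr (\<alpha> / 2) * (2 powr (\<alpha> / 2)) ^ j"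
        using t by (simp add: powr_mult powr_realpow[symmetric] powr_powr mult.commute)
      finally have one: "1 \<le> 2 powr (\<alpha> / 2) * t powr (\<alpha> / 2) * (2 powr (\<alpha> / 2)) ^ j" .
      have u0: "u (t / b n) \<ge> 0" using gt g_le_1[of "t / b n"] by (simp add: u_def ln_le_zero_iff)
      have "real n * u (t / b n) \<le> real n * u (t / b n) * (2 powr (\<alpha> / 2) * t powr (\<alpha> / 2) * (2 powr (\<alpha> / 2)) ^ j)"
        using mult_left_mono[OF one, of "real n * u (t / b n)"] u0 by simp
      also have "\<dots> = (real n * u (t / b n) * (2 powr (\<alpha> / 2)) ^ j) * (2 powr (\<alpha> / 2) * t powr (\<alpha> / 2))" by simp
      also have "\<dots> \<le> (c + 1) * (2 powr (\<alpha> / 2) * t powr (\<alpha> / 2))" by (intro mult_right_mono it) auto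
      finally have nu: "real n * u (t / b n) \<le> (c + 1) * 2 powr (\<alpha> / 2) * t powr (\<alpha> / 2)" by simp
      have "(g (t / b n) ^ n)\<^sup>2 = exp (- 2 * (real n * u (t / b n)))"
      proof -
        have "g (t / b n) ^ n = exp (- (real n * u (t / b n)))"
          using gt by (simp add: u_def exp_of_nat_mult)
        then show ?thesis by (simp add: power2_eq_square exp_add[symmetric])
      qed
      moreover have "1 + - 2 * (real n * u (t / b n)) \<le> exp (- 2 * (real n * u (t / b n)))" by (rule exp_ge_add_one_self)
      ultimately show "1 - (g (t / b n) ^ n)\<^sup>2 \<le> C * t powr (\<alpha> / 2)"
        using nu unfolding C_def by simp
    qed
  qed
  moreover have "C \<ge> 0" using c by (simp add: C_def)
  ultimately show ?thesis by blast
qed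

end

text \<open>If \<open>1 - (g s)^2\<close> were tiny for some \<open>s\<close> of modulus at least
  \<open>d\<close>, then \<open>k\<close> doublings, each costing a factor 4, would keep it small at
  \<open>2 ^ k * s\<close>, which lies beyond \<open>T\<close> where \<open>g\<close> is at most
  \<eta>.\<close>

lemma uniformly_below_one:
  fixes g :: "real \<Rightarrow> real"
  assumes g: "\<And>s. 0 \<le> g s" and dbl: "\<And>s. 1 - (g (2 * s))\<^sup>2 \<le> 4 * (1 - (g s)\<^sup>2)"
    and far: "\<And>s. \<bar>s\<bar> \<ge> T \<Longrightarrow> g s \<le> \<eta>" and \<eta>: "\<eta> < 1" and d: "d > 0"
  shows "\<exists>\<eta>'<1. 0 \<le> \<eta>' \<and> (\<forall>s. \<bar>s\<bar> \<ge> d \<longrightarrow> g s \<le> \<eta>')"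
proof -
  have iter: "1 - (g (2 ^ k * s))\<^sup>2 \<le> 4 ^ k * (1 - (g s)\<^sup>2)" for k s
  proof (induction k)
    case (Suc k)
    have "1 - (g (2 ^ Suc k * s))\<^sup>2 \<le> 4 * (1 - (g (2 ^ k * s))\<^sup>2)"
      using dbl[of "2 ^ k * s"] by (simp add: mult.assoc)
    then show ?case using Suc by simp
  qed simp
  obtain k :: nat where k: "T / d < 2 ^ k" using real_arch_pow[of 2 "T / d"] by auto
  define z where "z = 1 - (1 - (max \<eta> 0)\<^sup>2) / 4 ^ k"
  have m: "(max \<eta> 0)\<^sup>2 < 1" using \<eta> by (simp add: power_less_one_iff abs_square_less_1)
  have z1: "z < 1" using m by (simp add: z_def)
  have z0: "0 \<le> z"
  proof -
    have "(1 - (max \<eta> 0)\<^sup>2) \<le> 4 ^ k" by (rule order_trans[of _ 1]) auto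
    then show ?thesis by (simp add: z_def)
  qed
  have "g s \<le> sqrt z" if s: "\<bar>s\<bar> \<ge> d" for s
  proof (rule real_le_rsqrt)
    have "T \<le> 2 ^ k * d" using k d by (simp add: divide_less_eq)
    also have "\<dots> \<le> 2 ^ k * \<bar>s\<bar>" using s by (intro mult_left_mono) auto
    also have "\<dots> = \<bar>2 ^ k * s\<bar>" by (simp add: abs_mult)
    finally have "g (2 ^ k * s) \<le> max \<eta> 0" using far by fastforce
    then have "(g (2 ^ k * s))\<^sup>2 \<le> (max \<eta> 0)\<^sup>2" using g by (intro power_mono) auto
    then have "1 - (max \<eta> 0)\<^sup>2 \<le> 4 ^ k * (1 - (g s)\<^sup>2)" using iter[of k s] by linarith
    then have "(1 - (max \<eta> 0)\<^sup>2) / 4 ^ k \<le> 1 - (g s)\<^sup>2" by (simp add: divide_le_eq mult.commute)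
    then show "(g s)\<^sup>2 \<le> z" by (simp add: z_def)
  qed
  moreover have "sqrt z < 1" using z1 by (simp add: real_sqrt_lt_1_iff)
  ultimately show ?thesis using z0 by (intro exI[of _ "sqrt z"]) auto
qed

section \<open>Convergence in relative entropy\<close>

definition kl :: "real \<Rightarrow> real" where "kl r = r * ln r - r + 1"

lemma kl_borel_measurable [measurable]: "kl \<in> borel_measurable borel"
  unfolding kl_def[abs_def] by measurable

lemma kl_nonneg: "r \<ge> 0 \<Longrightarrow> 0 \<le> kl r"
proof (cases "r = 0")
  case False
  assume "r \<ge> 0"
  with False have r: "r > 0" by simp
  have "ln (1 / r) \<le> 1 / r - 1" using r by (intro ln_le_minus_one) auto
  then have "- ln r \<le> 1 / r - 1" using r by (simp add: ln_div)
  then have "r * (- ln r) \<le> r * (1 / r - 1)" using r by (intro mult_left_mono) auto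
  then show ?thesis using r by (simp add: kl_def algebra_simps)
qed (simp add: kl_def)

text \<open>Convexity: the derivative of \<open>kl\<close> is \<open>ln\<close>, so the increment is
  at most \<open>h\<close> times the derivative at the right end point.\<close>

lemma kl_add_le:
  assumes "r \<ge> 0" "h \<ge> 0"
  shows "kl (r + h) \<le> kl r + h * max 0 (ln (r + h))"
proof (cases "r = 0")
  case True
  then show ?thesis using assms by (auto simp: kl_def max_def intro: order_trans[OF mult_nonneg_nonpos])
next
  case False
  with assms have r: "r > 0" by simp
  have "ln ((r + h) / r) \<le> (r + h) / r - 1" using r assms by (intro ln_le_minus_one) auto
  then have "r * ln ((r + h) / r) \<le> r * ((r + h) / r - 1)" using r by (intro mult_left_mono) auto
  moreover have "ln ((r + h) / r) = ln (r + h) - ln r" using r assms by (simp add: ln_div)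
  moreover have "r * ((r + h) / r - 1) = h" using r by (simp add: field_simps)
  ultimately have "r * (ln (r + h) - ln r) \<le> h" by simp
  then have "r * ln (r + h) - r * ln r \<le> h" by (simp only: right_diff_distrib)
  moreover have "h * ln (r + h) \<le> h * max 0 (ln (r + h))" using assms by (intro mult_left_mono) auto
  ultimately show ?thesis by (simp add: kl_def algebra_simps)
qed

text \<open>The added term \<open>1 - r\<close> has integral zero under \<open>Q\<close>. The gain
  is a nonnegative integrand, so that only one extended integral is left and Fatou or domination
  arguments apply.\<close>

lemma relative_entropy_eq_kl:
  assumes "real_distribution P" "real_distribution Q"
    and [measurable]: "r \<in> borel_measurable borel" and r0: "\<And>x. 0 \<le> r x"
    and PQ: "P = density Q (\<lambda>x. ennreal (r x))"
  shows "relative_entropy P Q = enn2ereal (\<integral>\<^sup>+x. ennreal (kl (r x)) \<partial>Q)"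
proof -
  interpret P: real_distribution P by fact
  interpret Q: real_distribution Q by fact
  have ac: "absolutely_continuous Q P" unfolding PQ by (rule absolutely_continuousI_density) simp
  have "AE x in Q. ennreal (r x) = RN_deriv Q P x"
    by (rule Q.RN_deriv_unique) (auto simp: PQ)
  then have ed: "AE x in Q. entropy_density (exp 1) Q P x = ln (r x)"
  proof eventually_elim
    case (elim x)
    have "enn2real (RN_deriv Q P x) = r x" using elim r0[of x] by (metis enn2real_ennreal)
    then show ?case by (simp add: entropy_density_def log_def)
  qed
  define A where "A = (\<integral>\<^sup>+x. ennreal (r x * max 0 (ln (r x))) \<partial>Q)"
  define B where "B = (\<integral>\<^sup>+x. ennreal (r x * max 0 (- ln (r x))) \<partial>Q)"
  define K where "K = (\<integral>\<^sup>+x. ennreal (kl (r x)) \<partial>Q)"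
  have gen: "(\<integral>\<^sup>+x. ennreal (s * entropy_density (exp 1) Q P x) \<partial>P) = (\<integral>\<^sup>+x. ennreal (r x * max 0 (s * ln (r x))) \<partial>Q)" for s :: real
  proof -
    have "(\<integral>\<^sup>+x. ennreal (s * entropy_density (exp 1) Q P x) \<partial>P) = (\<integral>\<^sup>+x. ennreal (r x) * ennreal (s * entropy_density (exp 1) Q P x) \<partial>Q)"
      by (subst PQ, rule nn_integral_density) auto
    also have "\<dots> = (\<integral>\<^sup>+x. ennreal (r x * max 0 (s * ln (r x))) \<partial>Q)"
    proof (rule nn_integral_cong_AE)
      show "AE x in Q. ennreal (r x) * ennreal (s * entropy_density (exp 1) Q P x) = ennreal (r x * max 0 (s * ln (r x)))"
        using ed by eventually_elim (auto simp: ennreal_mult r0 max_def ennreal_neg)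
    qed
    finally show ?thesis .
  qed
  have re: "relative_entropy P Q = enn2ereal A - enn2ereal B"
    using gen[of 1] gen[of "-1"] ac by (simp add: relative_entropy_def A_def B_def)
  have r1: "(\<integral>\<^sup>+x. ennreal (r x) \<partial>Q) = 1"
    using P.emeasure_space_1 unfolding PQ by (simp add: emeasure_density)
  have B1: "B \<le> 1"
  proof -
    have "B \<le> (\<integral>\<^sup>+x. 1 \<partial>Q)" unfolding B_def
    proof (rule nn_integral_mono)
      fix x
      have "r x * max 0 (- ln (r x)) \<le> 1"
      proof (cases "r x > 0 \<and> r x < 1")
        case True
        have "ln (1 / r x) \<le> 1 / r x - 1" using True by (intro ln_le_minus_one) auto
        then have "r x * (- ln (r x)) \<le> r x * (1 / r x - 1)" using True by (intro mult_left_mono) (auto simp: ln_div)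
        then show ?thesis using True by (simp add: max_def algebra_simps)
      next
        case False
        then consider "r x = 0" | "r x \<ge> 1" using r0[of x] by linarith
        then show ?thesis by cases (auto simp: max_def)
      qed
      then show "ennreal (r x * max 0 (- ln (r x))) \<le> 1" by (simp add: ennreal_le_1)
    qed
    then show ?thesis using Q.emeasure_space_1 by simp
  qed
  \<comment> \<open>The negative part is moved to the other side, so the comparison in
    \<open>ennreal\<close> needs additions only; \<open>B \<le> 1\<close> then allows it to be
    subtracted.\<close>
  have "K + B + 1 = (\<integral>\<^sup>+x. ennreal (kl (r x)) + ennreal (r x * max 0 (- ln (r x))) + ennreal (r x) \<partial>Q)"
    unfolding K_def B_def r1[symmetric] by (subst nn_integral_add; (subst nn_integral_add)?) auto
  also have "\<dots> = (\<integral>\<^sup>+x. ennreal (r x * max 0 (ln (r x))) + 1 \<partial>Q)"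
  proof (rule nn_integral_cong)
    fix x
    have "kl (r x) + r x * max 0 (- ln (r x)) + r x = r x * max 0 (ln (r x)) + 1"
      by (auto simp: kl_def max_def algebra_simps)
    moreover have "0 \<le> r x * max 0 (- ln (r x))" "0 \<le> r x * max 0 (ln (r x))" using r0 by auto
    ultimately show "ennreal (kl (r x)) + ennreal (r x * max 0 (- ln (r x))) + ennreal (r x) = ennreal (r x * max 0 (ln (r x))) + 1"
      using r0[of x] kl_nonneg[OF r0[of x]] by (simp flip: ennreal_plus ennreal_1)
  qed
  also have "\<dots> = A + 1"
    unfolding A_def using Q.emeasure_space_1 by (subst nn_integral_add) auto
  finally have "A = K + B" by simp
  moreover have "B \<noteq> \<infinity>" using B1 by (auto simp: top_unique)
  ultimately show ?thesis unfolding re K_def[symmetric]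
    by (cases B; cases K) (auto simp: plus_ennreal.rep_eq ennreal_plus[symmetric] simp del: ennreal_plus)
qed

lemma relative_entropy_finiteE:
  assumes PQ: "real_distribution P" "real_distribution Q" and fin: "relative_entropy P Q < \<infinity>"
  obtains r where "r \<in> borel_measurable borel" "\<And>x. 0 \<le> r x" "P = density Q (\<lambda>x. ennreal (r x))"
    "(\<integral>\<^sup>+x. ennreal (r x * max 0 (ln (r x))) \<partial>Q) < \<infinity>"
proof -
  interpret P: real_distribution P by fact
  interpret Q: real_distribution Q by fact
  have ac: "absolutely_continuous Q P" using fin by (auto simp: relative_entropy_def split: if_splits)
  define r where "r x = enn2real (RN_deriv Q P x)" for x
  have [measurable]: "r \<in> borel_measurable borel" unfolding r_def[abs_def] by simp
  have r0: "0 \<le> r x" for x by (simp add: r_def)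
  have "AE x in Q. RN_deriv Q P x \<noteq> \<infinity>"
    by (rule Q.RN_deriv_finite[OF _ ac]) (auto intro: P.sigma_finite_measure)
  then have "density Q (\<lambda>x. ennreal (r x)) = density Q (RN_deriv Q P)"
    by (intro density_cong) (auto simp: r_def less_top)
  also have "\<dots> = P" using Q.density_RN_deriv[OF ac] by simp
  finally have Pr: "P = density Q (\<lambda>x. ennreal (r x))" by simp
  have "enn2ereal (\<integral>\<^sup>+x. ennreal (kl (r x)) \<partial>Q) < \<infinity>"
    using relative_entropy_eq_kl[OF PQ _ r0 Pr] fin by simp
  then have K: "(\<integral>\<^sup>+x. ennreal (kl (r x)) \<partial>Q) < \<infinity>"
    by (metis enn2ereal_eq_top_iff infinity_ereal_def less_irrefl top.not_eq_extremum top_ereal_def infinity_ennreal_def)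
  have "(\<integral>\<^sup>+x. ennreal (r x * max 0 (ln (r x))) \<partial>Q) \<le> (\<integral>\<^sup>+x. ennreal (kl (r x)) + ennreal (r x) \<partial>Q)"
  proof (rule nn_integral_mono)
    fix x
    have "r x * max 0 (ln (r x)) \<le> kl (r x) + r x"
      using r0[of x] kl_nonneg[OF r0[of x]] by (auto simp: kl_def max_def)
    then show "ennreal (r x * max 0 (ln (r x))) \<le> ennreal (kl (r x)) + ennreal (r x)"
      using r0[of x] kl_nonneg[OF r0[of x]] by (simp flip: ennreal_plus add: ennreal_leI)
  qed
  also have "\<dots> = (\<integral>\<^sup>+x. ennreal (kl (r x)) \<partial>Q) + (\<integral>\<^sup>+x. ennreal (r x) \<partial>Q)" by (rule nn_integral_add) auto
  also have "(\<integral>\<^sup>+x. ennreal (r x) \<partial>Q) = 1"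
    using P.emeasure_space_1 unfolding Pr by (simp add: emeasure_density)
  finally have "(\<integral>\<^sup>+x. ennreal (r x * max 0 (ln (r x))) \<partial>Q) < \<infinity>" using K
    by (auto simp: less_top[symmetric] top_unique)
  then show ?thesis by (intro that[OF _ r0 Pr]) auto
qed

text \<open>The perturbation \<open>v\<close> costs at most \<open>v\<close> times the positive part
  of the logarithm of the total ratio. This is estimated through
  \<open>u + v \<le> 2 * C * max 1 v\<close> and \<open>- ln \<psi> \<le> V\<close>, which separates
  the three sources of the error.\<close>

lemma kl_ratio_add_le:
  assumes u: "0 \<le> u" "u \<le> C" and v: "0 \<le> v" and C: "1 \<le> C" and V: "0 \<le> V" and \<psi>: "\<psi> \<ge> exp (- V)"
  shows "\<psi> * kl ((u + v) / \<psi>) \<le> \<psi> * kl (u / \<psi>) + v * (ln 2 + ln C) + v * max 0 (ln v) + v * V"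
proof -
  have \<psi>0: "\<psi> > 0" using \<psi> exp_gt_zero[of "-V"] by linarith
  have "kl ((u + v) / \<psi>) \<le> kl (u / \<psi>) + v / \<psi> * max 0 (ln (u / \<psi> + v / \<psi>))"
    using kl_add_le[of "u / \<psi>" "v / \<psi>"] u v \<psi>0 by (simp add: add_divide_distrib)
  then have "\<psi> * kl ((u + v) / \<psi>) \<le> \<psi> * (kl (u / \<psi>) + v / \<psi> * max 0 (ln (u / \<psi> + v / \<psi>)))"
    using \<psi>0 by (intro mult_left_mono) auto
  also have "\<dots> = \<psi> * kl (u / \<psi>) + v * max 0 (ln ((u + v) / \<psi>))" using \<psi>0 by (simp add: algebra_simps add_divide_distrib)
  also have "v * max 0 (ln ((u + v) / \<psi>)) \<le> v * (ln 2 + ln C + max 0 (ln v) + V)"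
  proof (rule mult_left_mono[OF _ v])
    have nn: "0 \<le> ln 2 + ln C + max 0 (ln v) + V" using C V by (intro add_nonneg_nonneg) auto
    have "ln ((u + v) / \<psi>) \<le> ln 2 + ln C + max 0 (ln v) + V" if "u + v > 0"
    proof -
      have "u + v \<le> 2 * C * max 1 v"
      proof -
        have "u \<le> C * max 1 v" 
        proof -
          have "C * 1 \<le> C * max 1 v" using C by (intro mult_left_mono) auto
          then show ?thesis using u by linarith
        qed
        moreover have "v \<le> C * max 1 v" using C v mult_mono[of 1 C v "max 1 v"] by auto
        ultimately show ?thesis by linarith
      qed
      then have "ln (u + v) \<le> ln (2 * C * max 1 v)" using that by simp
      also have "\<dots> = ln 2 + ln C + ln (max 1 v)" using C by (simp add: ln_mult)
      also have "ln (max 1 v) = max 0 (ln v)" using v by (cases "v = 0") (auto simp: max_def)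
      finally have "ln (u + v) \<le> ln 2 + ln C + max 0 (ln v)" .
      moreover have "- V \<le> ln \<psi>" using \<psi> \<psi>0 by (simp add: ln_ge_iff)
      moreover have "ln ((u + v) / \<psi>) = ln (u + v) - ln \<psi>" using that \<psi>0 by (simp add: ln_div)
      ultimately show ?thesis by linarith
    qed
    then show "max 0 (ln ((u + v) / \<psi>)) \<le> ln 2 + ln C + max 0 (ln v) + V"
      using nn u v by (cases "u + v = 0") auto
  qed
  finally show ?thesis by (simp add: algebra_simps)
qed

text \<open>Used twice: as a dominating function where \<open>V\<close> is bounded, and as the
  estimate of the bounded part \<open>u\<close> on the tails.\<close>

lemma kl_ratio_le:
  assumes u: "0 \<le> u" "u \<le> C" and C: "1 \<le> C" and V: "0 \<le> V" and \<psi>: "\<psi> \<ge> exp (- V)"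
  shows "\<psi> * kl (u / \<psi>) \<le> u * (ln C + V) + \<psi>"
proof -
  have \<psi>0: "\<psi> > 0" using \<psi> exp_gt_zero[of "-V"] by linarith
  have "u * ln (u / \<psi>) \<le> u * (ln C + V)"
  proof (cases "u = 0")
    case False
    then have "u > 0" using u by simp
    moreover have "- V \<le> ln \<psi>" using \<psi> \<psi>0 by (simp add: ln_ge_iff)
    moreover have "ln u \<le> ln C" using u \<open>u > 0\<close> by simp
    ultimately show ?thesis using \<psi>0 by (intro mult_left_mono) (auto simp: ln_div)
  qed simp
  moreover have "\<psi> * kl (u / \<psi>) = u * ln (u / \<psi>) - u + \<psi>" using \<psi>0 by (simp add: kl_def algebra_simps)
  ultimately show ?thesis using u by linarith
qed

lemma kl_ratio_tendsto_0:
  assumes "u \<longlonglongrightarrow> \<psi>" "\<psi> > 0"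
  shows "(\<lambda>n. \<psi> * kl (u n / \<psi>)) \<longlonglongrightarrow> 0"
proof -
  have "(\<lambda>n. u n / \<psi>) \<longlonglongrightarrow> \<psi> / \<psi>" using assms by (intro tendsto_intros) auto
  then have "(\<lambda>n. u n / \<psi>) \<longlonglongrightarrow> 1" using assms by simp
  then have "(\<lambda>n. \<psi> * (u n / \<psi> * ln (u n / \<psi>) - u n / \<psi> + 1)) \<longlonglongrightarrow> \<psi> * (1 * ln 1 - 1 + 1)"
    by (intro tendsto_intros) auto
  then show ?thesis by (simp add: kl_def)
qed

section \<open>From a splitting of densities to convergence of relative entropy\<close>

lemma ennreal_tendsto_0_iff:
  fixes f :: "nat \<Rightarrow> ennreal"
  shows "f \<longlonglongrightarrow> 0 \<longleftrightarrow> (\<forall>e>0. \<forall>\<^sub>F n in sequentially. f n \<le> ennreal e)"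
proof
  assume f: "f \<longlonglongrightarrow> 0"
  show "\<forall>e>0. \<forall>\<^sub>F n in sequentially. f n \<le> ennreal e"
  proof (intro allI impI)
    fix e :: real assume "e > 0"
    then have "\<forall>\<^sub>F n in sequentially. f n < ennreal e" using f by (intro order_tendstoD) auto
    then show "\<forall>\<^sub>F n in sequentially. f n \<le> ennreal e" by eventually_elim auto
  qed
next
  assume e: "\<forall>e>0. \<forall>\<^sub>F n in sequentially. f n \<le> ennreal e"
  show "f \<longlonglongrightarrow> 0"
  proof (rule order_tendstoI)
    fix a :: ennreal assume "0 < a"
    then obtain b where "0 < b" "b < a" using dense by blast
    then obtain r where r: "b = ennreal r" "r > 0" by (cases b) auto
    then have "\<forall>\<^sub>F n in sequentially. f n \<le> ennreal r" using e by auto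
    then show "\<forall>\<^sub>F n in sequentially. f n < a" by (rule eventually_mono) (use \<open>b < a\<close> r in auto)
  qed auto
qed

text \<open>On a bounded interval \<open>V\<close> is bounded, so the part from \<open>u\<close>
  vanishes by dominated convergence and the part from \<open>v\<close> by its two integral
  hypotheses. Outside, the integrand is at most a multiple of the density of \<open>P n\<close>
  weighted by \<open>1 + V\<close>, plus \<psi>, plus terms in \<open>v\<close> that vanish on the
  whole line.\<close>

theorem relative_entropy_tendsto_0:
  fixes P :: "nat \<Rightarrow> real measure" and Q :: "real measure"
    and u v :: "nat \<Rightarrow> real \<Rightarrow> real" and \<psi> V :: "real \<Rightarrow> real"
  assumes P: "\<And>n. real_distribution (P n)" and Q: "real_distribution Q"
    and [measurable]: "\<psi> \<in> borel_measurable borel" "V \<in> borel_measurable borel"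
      "\<And>n. u n \<in> borel_measurable borel" "\<And>n. v n \<in> borel_measurable borel"
    and Q\<psi>: "Q = density lborel (\<lambda>x. ennreal (\<psi> x))"
    and Puv: "\<And>n. n \<ge> N \<Longrightarrow> P n = density lborel (\<lambda>x. ennreal (u n x + v n x))"
    and u0: "\<And>n x. 0 \<le> u n x" and v0: "\<And>n x. 0 \<le> v n x" and V0: "\<And>x. 0 \<le> V x" and \<psi>0: "\<And>x. 0 \<le> \<psi> x"
    and \<psi>V: "AE x in lborel. \<psi> x \<ge> exp (- V x)"
    and Vloc: "\<And>T. \<exists>K. \<forall>x. \<bar>x\<bar> \<le> T \<longrightarrow> V x \<le> K"
    and uC: "\<And>n. n \<ge> N \<Longrightarrow> AE x in lborel. u n x \<le> C"
    and ulim: "AE x in lborel. (\<lambda>n. u n x) \<longlonglongrightarrow> \<psi> x"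
    and vlim: "(\<lambda>n. \<integral>\<^sup>+x. ennreal (v n x) \<partial>lborel) \<longlonglongrightarrow> 0"
    and vlog: "(\<lambda>n. \<integral>\<^sup>+x. ennreal (v n x * max 0 (ln (v n x))) \<partial>lborel) \<longlonglongrightarrow> 0"
    and UI: "\<And>e. e > 0 \<Longrightarrow> \<exists>T. \<forall>\<^sub>F n in sequentially. (\<integral>\<^sup>+x. ennreal (1 + V x) * indicator {x. \<bar>x\<bar> > T} x \<partial>P n) \<le> ennreal e"
  shows "(\<lambda>n. relative_entropy (P n) Q) \<longlonglongrightarrow> 0"
proof -
  interpret P: real_distribution "P n" for n by fact
  interpret Q: real_distribution Q by fact
  define C' where "C' = max C 1"
  have C': "1 \<le> C'" "C \<le> C'" by (auto simp: C'_def)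
  have lnC: "0 \<le> ln C'" using C' by simp
  define r where "r n x = (u n x + v n x) / \<psi> x" for n x
  have r0: "0 \<le> r n x" for n x unfolding r_def using u0 v0 \<psi>0 by (intro divide_nonneg_nonneg add_nonneg_nonneg)
  have [measurable]: "r n \<in> borel_measurable borel" for n unfolding r_def[abs_def] by measurable
  have \<psi>pos: "AE x in lborel. \<psi> x > 0" using \<psi>V by eventually_elim (auto intro: less_le_trans[OF exp_gt_zero])
  have Pr: "P n = density Q (\<lambda>x. ennreal (r n x))" if "n \<ge> N" for n
  proof -
    have "density Q (\<lambda>x. ennreal (r n x)) = density lborel (\<lambda>x. ennreal (\<psi> x) * ennreal (r n x))"
      unfolding Q\<psi> by (rule density_density_eq) auto
    also have "\<dots> = density lborel (\<lambda>x. ennreal (u n x + v n x))"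
    proof (rule density_cong)
      show "AE x in lborel. ennreal (\<psi> x) * ennreal (r n x) = ennreal (u n x + v n x)"
        using \<psi>pos by eventually_elim (auto simp: ennreal_mult''[symmetric] r0, simp add: r_def)
    qed auto
    finally show ?thesis using Puv[OF that] by simp
  qed
  define I where "I n = (\<integral>\<^sup>+x. ennreal (\<psi> x * kl (r n x)) \<partial>lborel)" for n
  have re: "relative_entropy (P n) Q = enn2ereal (I n)" if "n \<ge> N" for n
  proof -
    have "relative_entropy (P n) Q = enn2ereal (\<integral>\<^sup>+x. ennreal (kl (r n x)) \<partial>Q)"
      by (rule relative_entropy_eq_kl[OF P Q _ r0 Pr[OF that]]) simp
    also have "(\<integral>\<^sup>+x. ennreal (kl (r n x)) \<partial>Q) = (\<integral>\<^sup>+x. ennreal (\<psi> x) * ennreal (kl (r n x)) \<partial>lborel)"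
      unfolding Q\<psi> by (rule nn_integral_density) auto
    also have "\<dots> = I n" unfolding I_def
      by (intro nn_integral_cong) (simp add: ennreal_mult \<psi>0 kl_nonneg r0)
    finally show ?thesis .
  qed
  have Ilim: "I \<longlonglongrightarrow> 0"
    unfolding ennreal_tendsto_0_iff
  proof (intro allI impI)
    fix e :: real assume e: "e > 0"
    \<comment> \<open>The final bound is the sum of at most \<open>d\<close> four times and of
      \<open>(ln C' + 2) * d\<close>, hence below \<open>e\<close>.\<close>
    define d where "d = e / (ln C' + 8)"
    have d: "d > 0" using e lnC by (simp add: d_def)
    obtain T1 where T1: "\<forall>\<^sub>F n in sequentially. (\<integral>\<^sup>+x. ennreal (1 + V x) * indicator {x. \<bar>x\<bar> > T1} x \<partial>P n) \<le> ennreal d"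
      using UI[OF d] by blast
    \<comment> \<open>The summand \<psi> in \<open>kl_ratio_le\<close> leaves the tail mass of
      \<open>Q\<close> outside the interval; it is controlled by enlarging \<open>T\<close>.\<close>
    have "(\<lambda>k. measure Q {x. \<bar>x\<bar> > real k}) \<longlonglongrightarrow> measure Q (\<Inter>k. {x. \<bar>x\<bar> > real k})"
      by (rule Q.finite_Lim_measure_decseq) (auto simp: decseq_def)
    also have "(\<Inter>k. {x. \<bar>x\<bar> > real k}) = ({} :: real set)"
    proof safe
      fix x :: real assume x: "x \<in> (\<Inter>k. {x. \<bar>x\<bar> > real k})"
      obtain k where "\<bar>x\<bar> < real k" using reals_Archimedean2 by blast
      moreover have "\<bar>x\<bar> > real k" using x by blast
      ultimately show "x \<in> {}" by linarith
    qed
    finally have "\<forall>\<^sub>F k in sequentially. measure Q {x. \<bar>x\<bar> > real k} < d"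
      using d by (intro order_tendstoD) auto
    then obtain k where k: "measure Q {x. \<bar>x\<bar> > real k} < d" by (auto simp: eventually_sequentially)
    define T where "T = max T1 (real k)"
    obtain K0 where K0: "\<And>x. \<bar>x\<bar> \<le> T \<Longrightarrow> V x \<le> K0" using Vloc[of T] by blast
    define K where "K = max K0 0"
    have K: "V x \<le> K" "0 \<le> K" if "\<bar>x\<bar> \<le> T" for x using K0[OF that] by (auto simp: K_def)
    have K00: "0 \<le> K" by (simp add: K_def)
    let ?A = "{x. \<bar>x\<bar> > T} :: real set" and ?B = "{-T..T}"
    define D where "D n = (\<integral>\<^sup>+x. ennreal (\<psi> x * kl (u n x / \<psi> x)) * indicator ?B x \<partial>lborel)" for n
    have Dlim: "(\<lambda>n. D (n + N)) \<longlonglongrightarrow> (\<integral>\<^sup>+x. 0 \<partial>(lborel :: real measure))"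
      unfolding D_def
    proof (rule nn_integral_dominated_convergence[where w="\<lambda>x. ennreal (C' * (ln C' + K) + \<psi> x) * indicator ?B x"])
      fix n
      have "AE x in lborel. u (n + N) x \<le> C" by (rule uC) simp
      then show "AE x in lborel. ennreal (\<psi> x * kl (u (n + N) x / \<psi> x)) * indicator ?B x \<le> ennreal (C' * (ln C' + K) + \<psi> x) * indicator ?B x"
        using \<psi>V
      proof eventually_elim
        case (elim x)
        show ?case
        proof (cases "\<bar>x\<bar> \<le> T")
          case True
          have "\<psi> x * kl (u (n + N) x / \<psi> x) \<le> u (n + N) x * (ln C' + V x) + \<psi> x"
            using elim u0 C' V0 by (intro kl_ratio_le) auto
          also have "\<dots> \<le> C' * (ln C' + K) + \<psi> x"
            using elim C' K[OF True] V0[of x] lnC u0 by (intro add_right_mono mult_mono) auto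
          finally show ?thesis by (intro mult_right_mono ennreal_leI) auto
        qed (auto simp: indicator_def abs_le_iff)
      qed
    next
      have "(\<integral>\<^sup>+x. ennreal (C' * (ln C' + K) + \<psi> x) * indicator ?B x \<partial>lborel)
          \<le> (\<integral>\<^sup>+x. ennreal (C' * (ln C' + K)) * indicator ?B x + ennreal (\<psi> x) \<partial>lborel)"
        using C' lnC K00 \<psi>0 by (intro nn_integral_mono) (auto simp: indicator_def ennreal_plus)
      also have "\<dots> = ennreal (C' * (ln C' + K)) * emeasure lborel ?B + (\<integral>\<^sup>+x. ennreal (\<psi> x) \<partial>lborel)"
        by (subst nn_integral_add) (auto simp: nn_integral_cmult_indicator)
      also have "(\<integral>\<^sup>+x. ennreal (\<psi> x) \<partial>lborel) = 1"
        using Q.emeasure_space_1 unfolding Q\<psi> by (simp add: emeasure_density)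
      finally show "(\<integral>\<^sup>+x. ennreal (C' * (ln C' + K) + \<psi> x) * indicator ?B x \<partial>lborel) < \<infinity>"
        by (rule le_less_trans) (auto simp: ennreal_mult_less_top emeasure_lborel_Icc_eq)
    next
      show "AE x in lborel. (\<lambda>n. ennreal (\<psi> x * kl (u (n + N) x / \<psi> x)) * indicator ?B x) \<longlonglongrightarrow> 0"
        using ulim \<psi>pos
      proof eventually_elim
        case (elim x)
        have "(\<lambda>n. ennreal (\<psi> x * kl (u (n + N) x / \<psi> x))) \<longlonglongrightarrow> ennreal 0"
          using kl_ratio_tendsto_0[OF elim] by (intro tendsto_ennrealI LIMSEQ_ignore_initial_segment)
        then show ?case by (auto simp: indicator_def)
      qed
    qed auto
    then have "(\<lambda>n. D (n + N)) \<longlonglongrightarrow> 0" by simp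
    then have "D \<longlonglongrightarrow> 0" by (rule LIMSEQ_offset)
    then have Dev: "\<forall>\<^sub>F n in sequentially. D n \<le> ennreal d" using d unfolding ennreal_tendsto_0_iff by blast
    define M where "M = ln 2 + ln C' + K"
    have M: "M \<ge> 0" using lnC K00 by (simp add: M_def)
    have vev: "\<forall>\<^sub>F n in sequentially. (\<integral>\<^sup>+x. ennreal (v n x) \<partial>lborel) \<le> ennreal (d / (M + 1))"
      using vlim d M unfolding ennreal_tendsto_0_iff by simp
    have lev: "\<forall>\<^sub>F n in sequentially. (\<integral>\<^sup>+x. ennreal (v n x * max 0 (ln (v n x))) \<partial>lborel) \<le> ennreal d"
      using vlog d unfolding ennreal_tendsto_0_iff by blast
    show "\<forall>\<^sub>F n in sequentially. I n \<le> ennreal e"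
      using Dev vev lev T1 eventually_ge_at_top[of N]
    proof eventually_elim
      case (elim n)
      let ?v = "\<integral>\<^sup>+x. ennreal (v n x) \<partial>lborel"
      let ?l = "\<integral>\<^sup>+x. ennreal (v n x * max 0 (ln (v n x))) \<partial>lborel"
      let ?U = "\<integral>\<^sup>+x. ennreal (1 + V x) * indicator ?A x \<partial>P n"
      let ?q = "\<integral>\<^sup>+x. ennreal (\<psi> x) * indicator ?A x \<partial>lborel"
      have Ueq: "?U = (\<integral>\<^sup>+x. ennreal (u n x + v n x) * (ennreal (1 + V x) * indicator ?A x) \<partial>lborel)"
        by (subst Puv[OF elim(5)], rule nn_integral_density) auto
      have "I n \<le> (\<integral>\<^sup>+x. ((((ennreal (\<psi> x * kl (u n x / \<psi> x)) * indicator ?B x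
          + ennreal (ln C' + 2) * (ennreal (u n x + v n x) * (ennreal (1 + V x) * indicator ?A x)))
          + ennreal (\<psi> x) * indicator ?A x) + ennreal M * ennreal (v n x)) + ennreal (v n x * max 0 (ln (v n x)))) \<partial>lborel)"
        unfolding I_def
      proof (rule nn_integral_mono_AE)
        have "AE x in lborel. u n x \<le> C" by (rule uC) fact
        then show "AE x in lborel. ennreal (\<psi> x * kl (r n x)) \<le> ((((ennreal (\<psi> x * kl (u n x / \<psi> x)) * indicator ?B x
          + ennreal (ln C' + 2) * (ennreal (u n x + v n x) * (ennreal (1 + V x) * indicator ?A x)))
          + ennreal (\<psi> x) * indicator ?A x) + ennreal M * ennreal (v n x)) + ennreal (v n x * max 0 (ln (v n x))))"
          using \<psi>V
        proof eventually_elim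
          case (elim x)
          let ?lv = "v n x * max 0 (ln (v n x))" and ?ku = "\<psi> x * kl (u n x / \<psi> x)"
          have lv0: "0 \<le> ?lv" using v0 by simp
          have ku0: "0 \<le> ?ku" using \<psi>0 u0 by (intro mult_nonneg_nonneg kl_nonneg divide_nonneg_nonneg) auto
          have main: "\<psi> x * kl (r n x) \<le> ?ku + v n x * (ln 2 + ln C') + ?lv + v n x * V x"
            unfolding r_def using elim u0 v0 V0 C' by (intro kl_ratio_add_le) auto
          show ?case
          proof (cases "\<bar>x\<bar> \<le> T")
            case True
            have "v n x * V x \<le> v n x * K" using K[OF True] v0 by (intro mult_left_mono) auto
            then have "\<psi> x * kl (r n x) \<le> ?ku + M * v n x + ?lv" using main by (simp add: M_def algebra_simps)
            then have "ennreal (\<psi> x * kl (r n x)) \<le> ennreal (?ku + M * v n x + ?lv)" by (rule ennreal_leI)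
            also have "\<dots> = ennreal ?ku + ennreal M * ennreal (v n x) + ennreal ?lv"
              using lv0 ku0 M v0[of n x] by (simp add: ennreal_plus ennreal_mult)
            finally show ?thesis using True by (auto simp: indicator_def abs_le_iff)
          next
            case False
            have "?ku \<le> u n x * (ln C' + V x) + \<psi> x" using elim u0 C' V0 by (intro kl_ratio_le) auto
            moreover have "v n x * (ln 2 + ln C') \<le> M * v n x" using v0[of n x] K00 by (simp add: M_def algebra_simps)
            moreover have "u n x * (ln C' + V x) + v n x * V x \<le> (ln C' + 2) * ((u n x + v n x) * (1 + V x))"
            proof -
              have "u n x * (ln C' + V x) \<le> u n x * ((ln C' + 2) * (1 + V x))"
                using lnC V0[of x] u0 by (intro mult_left_mono) (auto simp: algebra_simps)
              moreover have "v n x * V x \<le> v n x * ((ln C' + 2) * (1 + V x))"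
                using lnC V0[of x] v0 by (intro mult_left_mono) (auto simp: algebra_simps intro: add_nonneg_nonneg)
              ultimately show ?thesis by (simp add: algebra_simps)
            qed
            ultimately have "\<psi> x * kl (r n x) \<le> (ln C' + 2) * ((u n x + v n x) * (1 + V x)) + \<psi> x + M * v n x + ?lv"
              using main by linarith
            then have "ennreal (\<psi> x * kl (r n x)) \<le> ennreal ((ln C' + 2) * ((u n x + v n x) * (1 + V x)) + \<psi> x + M * v n x + ?lv)"
              by (rule ennreal_leI)
            also have "\<dots> = ennreal (ln C' + 2) * (ennreal (u n x + v n x) * ennreal (1 + V x)) + ennreal (\<psi> x) + ennreal M * ennreal (v n x) + ennreal ?lv"
            proof -
              have n1: "0 \<le> (u n x + v n x) * (1 + V x)" using u0[of n x] v0[of n x] V0[of x] by simp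
              have n2: "0 \<le> (ln C' + 2) * ((u n x + v n x) * (1 + V x))" using n1 lnC by simp
              have n3: "0 \<le> M * v n x" using M v0 by simp
              show ?thesis using n1 n2 n3 lv0 \<psi>0[of x] lnC M u0[of n x] v0[of n x] V0[of x]
                by (simp add: ennreal_plus ennreal_mult del: distrib_left distrib_right)
            qed
            finally show ?thesis using False by (auto simp: indicator_def abs_le_iff)
          qed
        qed
      qed
      also have "\<dots> = D n + ennreal (ln C' + 2) * ?U + ?q + ennreal M * ?v + ?l"
        unfolding Ueq D_def by (simp add: nn_integral_add nn_integral_cmult)
      also have "\<dots> \<le> ennreal d + ennreal (ln C' + 2) * ennreal d + ennreal d + ennreal M * ennreal (d / (M + 1)) + ennreal d"
      proof (intro add_mono mult_left_mono elim)
        have "?U \<le> (\<integral>\<^sup>+x. ennreal (1 + V x) * indicator {x. \<bar>x\<bar> > T1} x \<partial>P n)"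
          by (intro nn_integral_mono mult_left_mono) (auto simp: T_def indicator_def)
        then show "?U \<le> ennreal d" using elim(4) by (rule order_trans)
        have "?q = emeasure Q ?A" unfolding Q\<psi> by (simp add: emeasure_density)
        also have "\<dots> \<le> emeasure Q {x. \<bar>x\<bar> > real k}" by (intro emeasure_mono) (auto simp: T_def)
        also have "\<dots> \<le> ennreal d" using k by (simp add: Q.emeasure_eq_measure ennreal_leI)
        finally show "?q \<le> ennreal d" .
      qed auto
      also have "\<dots> = ennreal (d + (ln C' + 2) * d + d + M * (d / (M + 1)) + d)"
      proof -
        define p where "p = (ln C' + 2) * d"
        define q where "q = M * (d / (M + 1))"
        have pq: "0 \<le> p" "0 \<le> q" using d lnC M by (auto simp: p_def q_def)
        have "ennreal (ln C' + 2) * ennreal d = ennreal p"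
          unfolding p_def using lnC d by (intro ennreal_mult[symmetric]) auto
        moreover have "ennreal M * ennreal (d / (M + 1)) = ennreal q"
          unfolding q_def using M d by (intro ennreal_mult[symmetric]) auto
        ultimately show ?thesis
          unfolding p_def[symmetric] q_def[symmetric] using pq d
          by (simp add: ennreal_plus[symmetric] del: ennreal_plus)
      qed
      also have "\<dots> \<le> ennreal e"
      proof (rule ennreal_leI)
        have "M * (d / (M + 1)) \<le> d" using M d by (simp add: field_simps)
        then have "d + (ln C' + 2) * d + d + M * (d / (M + 1)) + d \<le> (ln C' + 8) * d" using d by (simp add: algebra_simps)
        also have "\<dots> = e" using lnC by (simp add: d_def)
        finally show "d + (ln C' + 2) * d + d + M * (d / (M + 1)) + d \<le> e" .
      qed
      finally show ?case .
    qed
  qed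
  have "(\<lambda>n. enn2ereal (I n)) \<longlonglongrightarrow> enn2ereal 0"
    by (rule tendsto_enn2erealI) (rule Ilim)
  moreover have "\<forall>\<^sub>F n in sequentially. enn2ereal (I n) = relative_entropy (P n) Q"
    using eventually_ge_at_top[of N] by eventually_elim (simp add: re)
  ultimately have "(\<lambda>n. relative_entropy (P n) Q) \<longlonglongrightarrow> enn2ereal 0" by (rule Lim_transform_eventually)
  then show ?thesis by (simp add: zero_ennreal.rep_eq)
qed

section \<open>Rotation of the contour\<close>

lemma integrable_inverse_1_plus_sq: "integrable lborel (\<lambda>t::real. 1 / (1 + t\<^sup>2))"
  using integrable_inverse_1_plus_square by (simp add: set_integrable_def inverse_eq_divide)

text \<open>Comparison with \<open>1 / (1 + t^2)\<close>: \<open>exp y\<close> exceeds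
  \<open>(y / m) ^ m\<close>, and \<open>m\<close> is taken with
  \<open>m * a \<ge> 2\<close>.\<close>

lemma integrable_exp_powr:
  assumes a: "a > 0" and k: "k > 0"
  shows "integrable lborel (\<lambda>t::real. exp (- k * \<bar>t\<bar> powr a))"
proof -
  define m where "m = nat \<lceil>2 / a\<rceil> + 1"
  have m: "real m \<ge> 2 / a" "m > 0" unfolding m_def by linarith+
  then have ma: "real m * a \<ge> 2" using a by (simp add: divide_le_eq)
  define K where "K = max 2 (2 * (real m / k) ^ m)"
  have bound: "exp (- k * \<bar>t\<bar> powr a) \<le> K * (1 / (1 + t\<^sup>2))" for t :: real
  proof (cases "\<bar>t\<bar> \<le> 1")
    case True
    then have "t\<^sup>2 \<le> 1" by (simp add: abs_square_le_1)
    then have "1 \<le> 2 * (1 / (1 + t\<^sup>2))" by (simp add: le_divide_eq add_pos_nonneg)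
    also have "\<dots> \<le> K * (1 / (1 + t\<^sup>2))" by (intro mult_right_mono) (auto simp: K_def)
    finally have "1 \<le> K * (1 / (1 + t\<^sup>2))" .
    moreover have "exp (- k * \<bar>t\<bar> powr a) \<le> 1" using k by simp
    ultimately show ?thesis by linarith
  next
    case False
    then have t: "\<bar>t\<bar> > 1" by simp
    define y where "y = k * \<bar>t\<bar> powr a"
    have y: "y \<ge> 0" using k by (simp add: y_def)
    have "(y / real m) ^ m \<le> (1 + y / real m) ^ m" using y by (intro power_mono) auto
    also have "\<dots> \<le> exp y" using m y by (intro exp_ge_one_plus_x_over_n_power_n) auto
    finally have 1: "(y / real m) ^ m \<le> exp y" .
    have "t\<^sup>2 = \<bar>t\<bar> powr 2" using t by (simp add: powr_realpow[of "\<bar>t\<bar>" 2, simplified])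
    also have "\<dots> \<le> \<bar>t\<bar> powr (real m * a)" using t ma by (intro powr_mono) auto
    also have "\<dots> = (\<bar>t\<bar> powr a) ^ m" using t by (simp add: powr_realpow[symmetric] powr_powr mult.commute)
    finally have "(k / real m) ^ m * t\<^sup>2 \<le> (k / real m) ^ m * (\<bar>t\<bar> powr a) ^ m" using k by (intro mult_left_mono) auto
    also have "\<dots> = (y / real m) ^ m" by (simp add: y_def power_mult_distrib power_divide)
    finally have 2: "(k / real m) ^ m * t\<^sup>2 \<le> exp y" using 1 by linarith
    have km: "(k / real m) ^ m > 0" using k m by simp
    have t2: "t\<^sup>2 > 0" using t by auto
    have "exp (- y) = 1 / exp y" by (simp add: exp_minus inverse_eq_divide)
    also have "\<dots> \<le> 1 / ((k / real m) ^ m * t\<^sup>2)" using 2 km t2 by (intro divide_left_mono mult_pos_pos) auto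
    also have "\<dots> = (real m / k) ^ m * (1 / t\<^sup>2)" using k m by (simp add: power_divide field_simps)
    also have "1 / t\<^sup>2 \<le> 2 * (1 / (1 + t\<^sup>2))"
    proof -
      have "1 \<le> t\<^sup>2" using t by (metis abs_square_le_1 less_imp_le linorder_not_less linear)
      then show ?thesis using t2 by (simp add: divide_le_eq le_divide_eq field_simps)
    qed
    then have "(real m / k) ^ m * (1 / t\<^sup>2) \<le> (real m / k) ^ m * (2 * (1 / (1 + t\<^sup>2)))"
      using k by (intro mult_left_mono) auto
    also have "\<dots> = (2 * (real m / k) ^ m) * (1 / (1 + t\<^sup>2))" by simp
    also have "\<dots> \<le> K * (1 / (1 + t\<^sup>2))" by (intro mult_right_mono) (auto simp: K_def)
    finally show ?thesis by (simp add: y_def)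
  qed
  show ?thesis
    by (rule Bochner_Integration.integrable_bound[OF integrable_mult_right[OF integrable_inverse_1_plus_sq, of K]])
      (use bound in \<open>auto simp: K_def\<close>)
qed

lemma continuous_AE_zero:
  fixes f :: "real \<Rightarrow> real"
  assumes f: "\<And>x. isCont f x" and ae: "AE x in lborel. f x = 0"
  shows "f y = 0"
proof (rule ccontr)
  assume y: "f y \<noteq> 0"
  let ?S = "{x. f x \<noteq> 0}"
  have o: "open ?S"
  proof -
    have "?S = f -` (- {0})" by auto
    then show ?thesis using continuous_open_vimage[of "- {0}" f] f by auto
  qed
  then have "?S \<in> sets lborel" by simp
  with ae have "?S \<in> null_sets lborel" by (subst (asm) AE_iff_null) auto
  then have "negligible ?S"
    unfolding negligible_iff_null_sets by (rule null_sets_completionI)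
  then show False using open_not_negligible[OF o] y by auto
qed

text \<open>The characteristic function of the Erlang density \<open>x^2 * exp (- x) / 2\<close> on
  the half-line. The exponent 3 is dictated by a later product with a stable exponent of growth
  below \<open>\<bar>t\<bar>^2\<close>, which must remain integrable.\<close>

definition erlang_char :: "real \<Rightarrow> complex" where "erlang_char t = 1 / (1 - \<i> * of_real t) ^ 3"

lemma norm_one_minus_ix: "cmod (1 - \<i> * of_real t) = sqrt (1 + t\<^sup>2)"
  by (simp add: cmod_def)

lemma char_erlang: "char (density lborel (\<lambda>x. ennreal (erlang_density 2 1 x))) t = erlang_char t"
proof -
  define w where "w = 1 - \<i> * complex_of_real t"
  have nw: "cmod w \<ge> 1" unfolding w_def norm_one_minus_ix by simp
  then have w0: "w \<noteq> 0" by auto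
  define f where "f = (\<lambda>x::real. (x\<^sup>2 / 2) *\<^sub>R exp (- (w * of_real x)))"
  \<comment> \<open>The antiderivative of \<open>z^2 / 2 * exp (- (w * z))\<close> found by two
    integrations by parts; \<open>- G 0\<close> is the claimed value.\<close>
  define G where "G = (\<lambda>z::complex. - (z\<^sup>2 / (2 * w) + z / w\<^sup>2 + 1 / w ^ 3) * exp (- (w * z)))"
  let ?e = "\<lambda>x. erlang_density 2 1 x *\<^sub>R iexp (t * x)"
  have eq: "indicator {0..r} x *\<^sub>R f x = indicator {0..r} x *\<^sub>R ?e x" for r x :: real
    by (auto simp: indicator_def f_def erlang_density_def w_def algebra_simps exp_diff exp_add exp_minus
        exp_of_real[symmetric] scaleR_conv_of_real field_simps eval_nat_numeral)
  interpret H: prob_space "density lborel (\<lambda>x. ennreal (erlang_density 2 1 x))"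
    using prob_space_erlang_density[of 1 2] by simp
  have ei: "integrable lborel (erlang_density 2 1)"
  proof (rule integrableI_bounded)
    have "(\<integral>\<^sup>+x. ennreal (norm (erlang_density 2 1 x)) \<partial>lborel) = 1"
      using H.emeasure_space_1 by (simp add: emeasure_density)
    then show "(\<integral>\<^sup>+x. ennreal (norm (erlang_density 2 1 x)) \<partial>lborel) < \<infinity>" by simp
  qed simp
  have "(\<lambda>n::nat. \<integral>x. indicator {0..real n} x *\<^sub>R ?e x \<partial>lborel) \<longlonglongrightarrow> (\<integral>x. ?e x \<partial>lborel)"
  proof (rule integral_dominated_convergence[where w="\<lambda>x. erlang_density 2 1 x"])
    show "AE x in lborel. (\<lambda>n::nat. indicator {0..real n} x *\<^sub>R ?e x) \<longlonglongrightarrow> ?e x"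
    proof (rule AE_I2)
      fix x :: real
      have "\<forall>\<^sub>F n::nat in sequentially. indicator {0..real n} x *\<^sub>R ?e x = ?e x"
        using eventually_ge_at_top[of "nat \<lceil>\<bar>x\<bar>\<rceil>"] by eventually_elim (auto simp: indicator_def erlang_density_def)
      then show "(\<lambda>n::nat. indicator {0..real n} x *\<^sub>R ?e x) \<longlonglongrightarrow> ?e x" by (rule tendsto_eventually)
    qed
  qed (use ei in \<open>auto simp: indicator_def\<close>)
  moreover have "(\<integral>x. indicator {0..real n} x *\<^sub>R ?e x \<partial>lborel) = G (real n) - G 0" for n :: nat
  proof -
    have "(\<integral>x. indicator {0..real n} x *\<^sub>R f x \<partial>lborel) = G (of_real (real n)) - G (of_real 0)"
    proof (rule integral_FTC_atLeastAtMost)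
      show "continuous_on {0..real n} f" unfolding f_def by (intro continuous_intros) auto
      fix x :: real
      have "(G has_field_derivative (of_real x)\<^sup>2 / 2 * exp (- (w * of_real x))) (at (of_real x))"
        unfolding G_def by (rule derivative_eq_intros refl | (use w0 in force))+
          (use w0 in \<open>simp add: field_simps eval_nat_numeral\<close>)
      from has_vector_derivative_real_field[OF this, of "{0..real n}"]
      show "((\<lambda>x. G (of_real x)) has_vector_derivative f x) (at x within {0..real n})"
        by (simp add: f_def scaleR_conv_of_real)
    qed simp
    then show ?thesis unfolding eq by simp
  qed
  moreover have "(\<lambda>n. G (real n) - G 0) \<longlonglongrightarrow> 0 - G 0"
  proof (intro tendsto_diff tendsto_const, rule Lim_null_comparison)
    show "(\<lambda>n. ((real n)\<^sup>2 + real n + 1) * exp (- real n)) \<longlonglongrightarrow> 0" by real_asymp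
    show "\<forall>\<^sub>F n in sequentially. norm (G (of_real (real n))) \<le> ((real n)\<^sup>2 + real n + 1) * exp (- real n)"
    proof (intro always_eventually allI)
      fix n :: nat
      have "cmod (complex_of_real (real n) ^ 2 / (2 * w) + complex_of_real (real n) / w\<^sup>2 + 1 / w ^ 3)
         \<le> cmod (complex_of_real (real n) ^ 2 / (2 * w)) + cmod (complex_of_real (real n) / w\<^sup>2) + cmod (1 / w ^ 3)"
        by (intro norm_triangle_le add_mono norm_triangle_ineq order_refl)
      also have "\<dots> \<le> (real n)\<^sup>2 + real n + 1"
      proof (intro add_mono)
        show "cmod (complex_of_real (real n) ^ 2 / (2 * w)) \<le> (real n)\<^sup>2"
          using nw by (simp add: norm_divide norm_mult norm_power divide_le_eq mult_le_cancel_left1)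
        show "cmod (complex_of_real (real n) / w\<^sup>2) \<le> real n"
          using nw one_le_power[OF nw, of 2] by (simp add: norm_divide norm_power divide_le_eq mult_le_cancel_left1)
        show "cmod (1 / w ^ 3) \<le> 1" using one_le_power[OF nw, of 3] by (simp add: norm_divide norm_power divide_le_eq)
      qed
      finally have A: "cmod (complex_of_real (real n) ^ 2 / (2 * w) + complex_of_real (real n) / w\<^sup>2 + 1 / w ^ 3) \<le> (real n)\<^sup>2 + real n + 1" .
      have "cmod (exp (- (w * complex_of_real (real n)))) = exp (- real n)"
        by (simp add: w_def)
      then show "norm (G (of_real (real n))) \<le> ((real n)\<^sup>2 + real n + 1) * exp (- real n)"
        unfolding G_def norm_mult norm_minus_cancel using A by (intro mult_mono) auto
    qed
  qed
  ultimately have "(\<lambda>n::nat. G (real n) - G 0) \<longlonglongrightarrow> (\<integral>x. ?e x \<partial>lborel)" "(\<lambda>n. G (real n) - G 0) \<longlonglongrightarrow> 0 - G 0"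
    by simp_all
  then have "(\<integral>x. ?e x \<partial>lborel) = 0 - G 0" by (rule LIMSEQ_unique)
  moreover have "char (density lborel (\<lambda>x. ennreal (erlang_density 2 1 x))) t = (\<integral>x. ?e x \<partial>lborel)"
    unfolding char_def by (subst integral_density) auto
  ultimately show ?thesis by (simp add: G_def erlang_char_def w_def)
qed

lemma integrable_erlang_char: "integrable lborel erlang_char"
proof (rule Bochner_Integration.integrable_bound[OF integrable_inverse_1_plus_sq])
  have "1 - \<i> * complex_of_real t \<noteq> 0" for t by (auto simp: complex_eq_iff)
  then show "erlang_char \<in> borel_measurable lborel"
    unfolding erlang_char_def[abs_def] by measurable
  show "AE t in lborel. norm (erlang_char t) \<le> norm (1 / (1 + t\<^sup>2))"
  proof (rule AE_I2)
    fix t :: real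
    have s: "sqrt (1 + t\<^sup>2) \<ge> 1" by simp
    have "1 + t\<^sup>2 = (sqrt (1 + t\<^sup>2))\<^sup>2" by (simp add: add_nonneg_nonneg)
    also have "\<dots> \<le> (sqrt (1 + t\<^sup>2)) ^ 3" using s by (intro power_increasing) auto
    finally have "1 / (sqrt (1 + t\<^sup>2)) ^ 3 \<le> 1 / (1 + t\<^sup>2)" by (intro divide_left_mono mult_pos_pos) (auto simp: add_pos_nonneg)
    then show "norm (erlang_char t) \<le> norm (1 / (1 + t\<^sup>2))"
      unfolding erlang_char_def norm_divide norm_power norm_one_minus_ix by simp
  qed
qed

text \<open>Inversion yields equality almost everywhere, and both sides are continuous. The value at
  single points, in particular zero on the negative axis, is what matters later.\<close>

lemma char_inverse_erlang: "char_inverse erlang_char y = (if y < 0 then 0 else y\<^sup>2 / 2 * exp (- y))"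
proof -
  interpret H: real_distribution "density lborel (\<lambda>x. ennreal (erlang_density 2 1 x))"
    using prob_space_erlang_density[of 1 2] by (intro real_distribution.intro real_distribution_axioms.intro) auto
  have ce: "char (density lborel (\<lambda>x. ennreal (erlang_density 2 1 x))) = erlang_char" by (rule ext, rule char_erlang)
  have i: "integrable lborel (char (density lborel (\<lambda>x. ennreal (erlang_density 2 1 x))))"
    unfolding ce by (rule integrable_erlang_char)
  have n: "char_inverse erlang_char x \<ge> 0" for x using H.char_inverse_nonneg[OF i] unfolding ce .
  have m[measurable]: "char_inverse erlang_char \<in> borel_measurable borel"
    by (rule char_inverse_borel_measurable[OF integrable_erlang_char])
  have "density lborel (\<lambda>x. ennreal (erlang_density 2 1 x)) = density lborel (\<lambda>x. ennreal (char_inverse erlang_char x))"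
    using H.density_char_inverse[OF i] unfolding ce .
  then have "AE x in lborel. ennreal (erlang_density 2 1 x) = ennreal (char_inverse erlang_char x)"
    by (subst (asm) sigma_finite_measure.density_unique_iff[OF sigma_finite_lborel]) auto
  then have ae: "AE x in lborel. char_inverse erlang_char x - (if x < 0 then 0 else x\<^sup>2 / 2 * exp (- x)) = 0"
    by eventually_elim (auto simp: n erlang_density_def eval_nat_numeral)
  have "char_inverse erlang_char y - (if y < 0 then 0 else y\<^sup>2 / 2 * exp (- y)) = 0"
  proof (rule continuous_AE_zero[OF _ ae])
    fix x :: real
    have eq: "(if x < 0 then 0 else x\<^sup>2 / 2 * exp (- x)) = (max 0 x)\<^sup>2 / 2 * exp (- x)" for x :: real
      by (auto simp: max_def)
    show "isCont (\<lambda>x. char_inverse erlang_char x - (if x < 0 then 0 else x\<^sup>2 / 2 * exp (- x))) x"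
      unfolding eq by (intro continuous_intros continuous_char_inverse integrable_erlang_char) auto
  qed
  then show ?thesis by simp
qed

section \<open>Cauchy's theorem in the lower right quadrant\<close>

lemma tendsto_set_integral_atLeast:
  fixes f :: "real \<Rightarrow> complex"
  assumes f: "set_integrable lborel {0..} f"
  shows "(\<lambda>n::nat. CLINT t:{0..real n}|lborel. f t) \<longlonglongrightarrow> (CLINT t:{0..}|lborel. f t)"
  unfolding set_lebesgue_integral_def
proof (rule integral_dominated_convergence[where w="\<lambda>t. norm (indicator {0..} t *\<^sub>R f t)"])
  show "AE t in lborel. (\<lambda>n::nat. indicator {0..real n} t *\<^sub>R f t) \<longlonglongrightarrow> indicator {0..} t *\<^sub>R f t"
  proof (rule AE_I2)
    fix t :: real
    have "\<forall>\<^sub>F n::nat in sequentially. indicator {0..real n} t *\<^sub>R f t = indicator {0..} t *\<^sub>R f t"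
      using eventually_ge_at_top[of "nat \<lceil>\<bar>t\<bar>\<rceil>"] by eventually_elim (auto simp: indicator_def)
    then show "(\<lambda>n::nat. indicator {0..real n} t *\<^sub>R f t) \<longlonglongrightarrow> indicator {0..} t *\<^sub>R f t" by (rule tendsto_eventually)
  qed
  show "(\<lambda>t. indicator {0..} t *\<^sub>R f t) \<in> borel_measurable lborel" using f unfolding set_integrable_def by simp
  show "(\<lambda>t. indicator {0..real n} t *\<^sub>R f t) \<in> borel_measurable lborel" for n :: nat
    using set_integrable_subset[OF f, of "{0..real n}"] unfolding set_integrable_def by auto
  show "integrable lborel (\<lambda>t. norm (indicator {0..} t *\<^sub>R f t))"
    using f unfolding set_integrable_def by (rule integrable_norm)
qed (auto simp: indicator_def)

text \<open>Cauchy's theorem on the triangle with vertices 0, \<open>n\<close> and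
  \<open>- \<i> * n\<close>; the hypotenuse replaces the usual arc, and decay of order
  \<open>p > 1\<close> kills it. Holomorphy is required only inside because the stable exponent is
  merely continuous at the corner 0.\<close>

theorem quadrant_rotation:
  fixes F :: "complex \<Rightarrow> complex"
  assumes cont: "continuous_on {z. 0 \<le> Re z \<and> Im z \<le> 0} F"
    and holo: "\<And>z. 0 < Re z \<Longrightarrow> Im z < 0 \<Longrightarrow> F field_differentiable at z"
    and p: "p > 1" and K: "K \<ge> 0"
    and decay: "\<And>z. 0 \<le> Re z \<Longrightarrow> Im z \<le> 0 \<Longrightarrow> 1 \<le> cmod z \<Longrightarrow> cmod (F z) \<le> K * cmod z powr (- p)"
    and int1: "set_integrable lborel {0..} (\<lambda>t. F (of_real t))"
    and int2: "set_integrable lborel {0..} (\<lambda>t. F (Complex 0 (- t)))"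
  shows "(CLINT t:{0..}|lborel. F (of_real t)) = - \<i> * (CLINT t:{0..}|lborel. F (Complex 0 (- t)))"
proof -
  let ?S = "{z. 0 \<le> Re z \<and> Im z \<le> 0}"
  define I1 where "I1 n = (CLINT t:{0..real n}|lborel. F (of_real t))" for n :: nat
  define I3 where "I3 n = (CLINT t:{0..real n}|lborel. F (Complex 0 (- t)))" for n :: nat
  have conv: "convex ?S"
  proof -
    have "?S = {z. 0 \<le> Re z} \<inter> {z. Im z \<le> 0}" by auto
    then show ?thesis by (simp add: convex_Int convex_halfspace_Re_ge convex_halfspace_Im_le)
  qed
  have c1: "continuous_on {0..r} (\<lambda>t. F (of_real t))" for r :: real
    by (rule continuous_on_compose2[OF cont]) (auto intro!: continuous_intros)
  have c3: "continuous_on {0..r} (\<lambda>t. F (Complex 0 (- t)))" for r :: real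
    by (rule continuous_on_compose2[OF cont]) (auto intro!: continuous_intros simp: Complex_eq)
  have bound: "cmod (I1 n + \<i> * I3 n) \<le> K * 2 powr (p / 2) * 2 * real n powr (1 - p)" if n: "n \<ge> 2" for n :: nat
  proof -
    let ?R = "complex_of_real (real n)" and ?C = "Complex 0 (- real n)"
    have sub: "convex hull {0, ?R, ?C} \<subseteq> ?S" by (rule hull_minimal) (use conv in auto)
    have int_sub: "interior (convex hull {0, ?R, ?C}) \<subseteq> {z. 0 < Re z \<and> Im z < 0}"
    proof -
      have "interior (convex hull {0, ?R, ?C}) \<subseteq> interior ({z. 0 \<le> Re z} \<inter> {z. Im z \<le> 0})"
        using sub by (intro interior_mono) auto
      moreover have "interior {z. 0 \<le> Re z} = {z. 0 < Re z}"
        using interior_halfspace_ge[of "1 :: complex" 0] by (simp add: inner_complex_def)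
      moreover have "interior {z. Im z \<le> 0} = {z. Im z < 0}"
        using interior_halfspace_le[of \<i> 0] by (simp add: inner_complex_def)
      ultimately show ?thesis by (auto simp: interior_Int)
    qed
    have tri: "(F has_contour_integral 0) (linepath 0 ?R +++ linepath ?R ?C +++ linepath ?C 0)"
    proof (rule Cauchy_theorem_triangle_cofinite[where S="{}"])
      show "continuous_on (convex hull {0, ?R, ?C}) F" by (rule continuous_on_subset[OF cont sub])
      fix z assume "z \<in> interior (convex hull {0, ?R, ?C}) - {}"
      then show "F field_differentiable at z" using int_sub by (intro holo) auto
    qed simp
    have "(F has_contour_integral I1 n) (linepath 0 ?R)"
    proof -
      have "set_integrable lborel {0..real n} (\<lambda>t. F (of_real t))"
        by (rule borel_integrable_atLeastAtMost'[OF c1])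
      note si = set_borel_integral_eq_integral[OF this]
      have "((\<lambda>t. F (of_real t)) has_integral I1 n) {0..real n}"
        unfolding I1_def si(2) by (rule integrable_integral[OF si(1)])
      then show ?thesis using n by (subst has_contour_integral_linepath_Reals_iff) auto
    qed
    moreover have "(F has_contour_integral \<i> * I3 n) (linepath ?C 0)"
    proof -
      have "set_integrable lborel {0..real n} (\<lambda>t. F (Complex 0 (- t)))"
        by (rule borel_integrable_atLeastAtMost'[OF c3])
      note si = set_borel_integral_eq_integral[OF this]
      have "((\<lambda>t. F (Complex 0 (- t))) has_integral I3 n) {0..real n}"
        unfolding I3_def si(2) by (rule integrable_integral[OF si(1)])
      then have "((\<lambda>t. F (Complex 0 t)) has_integral I3 n) {- real n..0}"
        by (subst (asm) has_integral_reflect_real[symmetric]) simp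
      then show ?thesis using n by (subst has_contour_integral_linepath_same_Re_iff[where c=0 and a="- real n" and b=0]) auto
    qed
    moreover obtain I2 where I2: "(F has_contour_integral I2) (linepath ?R ?C)"
    proof -
      have "F contour_integrable_on (linepath ?R ?C)"
        by (rule contour_integrable_continuous_linepath, rule continuous_on_subset[OF cont])
          (rule order_trans[OF _ sub], simp add: closed_segment_subset_convex_hull hull_inc)
      then show ?thesis using that contour_integrable_on_def by blast
    qed
    ultimately have "(F has_contour_integral (I1 n + (I2 + \<i> * I3 n))) (linepath 0 ?R +++ linepath ?R ?C +++ linepath ?C 0)"
      by (intro has_contour_integral_join) auto
    with tri have "I1 n + (I2 + \<i> * I3 n) = 0" using contour_integral_unique by metis
    then have "I1 n + \<i> * I3 n = - I2" by (simp add: algebra_simps eq_neg_iff_add_eq_0)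
    then have "cmod (I1 n + \<i> * I3 n) = cmod I2" by simp
    also have "cmod I2 \<le> (K * (real n / sqrt 2) powr (- p)) * cmod (?C - ?R)"
    proof (rule has_contour_integral_bound_linepath[OF I2])
      show "0 \<le> K * (real n / sqrt 2) powr (- p)" using K by simp
      fix z assume "z \<in> closed_segment ?R ?C"
      then obtain s where s: "0 \<le> s" "s \<le> 1" and z: "z = (1 - s) *\<^sub>R ?R + s *\<^sub>R ?C" unfolding in_segment by blast
      have re: "Re z = (1 - s) * real n" "Im z = - (s * real n)" unfolding z by auto
      \<comment> \<open>The hypotenuse keeps distance at least \<open>n / sqrt 2\<close> from the
        origin.\<close>
      have "(1 - s)\<^sup>2 + s\<^sup>2 \<ge> 1 / 2"
      proof -
        have "0 \<le> (1 - 2 * s)\<^sup>2" by simp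
        then show ?thesis by (simp add: power2_eq_square algebra_simps)
      qed
      then have "(real n)\<^sup>2 * (1/2) \<le> (real n)\<^sup>2 * ((1 - s)\<^sup>2 + s\<^sup>2)" by (intro mult_left_mono) auto
      also have "\<dots> = (cmod z)\<^sup>2" by (simp only: cmod_power2 re power_mult_distrib power2_minus distrib_left) (simp add: mult.commute)
      finally have "(real n / sqrt 2)\<^sup>2 \<le> (cmod z)\<^sup>2" by (simp add: power_divide)
      then have nz: "real n / sqrt 2 \<le> cmod z" by (rule power2_le_imp_le) simp
      have "2 * 1 \<le> real n * real n" using n by (intro mult_mono) auto
      then have "sqrt 2 \<le> real n" by (intro real_le_lsqrt) (auto simp: power2_eq_square)
      then have n1: "1 \<le> real n / sqrt 2" by (simp add: le_divide_eq)
      have "cmod (F z) \<le> K * cmod z powr (- p)"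
        using s n order_trans[OF n1 nz] by (intro decay) (auto simp: re)
      also have "\<dots> \<le> K * (real n / sqrt 2) powr (- p)"
        using nz less_le_trans[OF zero_less_one n1] p K by (intro mult_left_mono powr_mono2') auto
      finally show "cmod (F z) \<le> K * (real n / sqrt 2) powr (- p)" .
    qed
    also have "cmod (?C - ?R) \<le> 2 * real n"
      using norm_triangle_ineq4[of ?C ?R] by (simp add: complex_norm)
    then have "(K * (real n / sqrt 2) powr (- p)) * cmod (?C - ?R) \<le> (K * (real n / sqrt 2) powr (- p)) * (2 * real n)"
      using K by (intro mult_left_mono) auto
    also have "(real n / sqrt 2) powr (- p) = real n powr (- p) * 2 powr (p / 2)"
      using n by (simp add: powr_divide powr_minus powr_half_sqrt[symmetric] powr_powr field_simps)
    also have "(K * (real n powr (- p) * 2 powr (p / 2))) * (2 * real n) = K * 2 powr (p / 2) * 2 * real n powr (1 - p)"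
      using n by (simp add: powr_diff powr_minus field_simps)
    finally show ?thesis .
  qed
  have "(\<lambda>n. I1 n + \<i> * I3 n) \<longlonglongrightarrow> 0"
  proof (rule Lim_null_comparison)
    show "\<forall>\<^sub>F n in sequentially. norm (I1 n + \<i> * I3 n) \<le> K * 2 powr (p / 2) * 2 * real n powr (1 - p)"
      using eventually_ge_at_top[of 2] by eventually_elim (rule bound)
    have "(\<lambda>n. real n powr (1 - p)) \<longlonglongrightarrow> 0"
      using p by (intro tendsto_neg_powr filterlim_real_sequentially) auto
    then show "(\<lambda>n. K * 2 powr (p / 2) * 2 * real n powr (1 - p)) \<longlonglongrightarrow> 0" by (rule tendsto_mult_right_zero)
  qed
  moreover have "(\<lambda>n. I1 n + \<i> * I3 n) \<longlonglongrightarrow> (CLINT t:{0..}|lborel. F (of_real t)) + \<i> * (CLINT t:{0..}|lborel. F (Complex 0 (- t)))"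
    unfolding I1_def I3_def by (intro tendsto_intros tendsto_set_integral_atLeast int1 int2)
  ultimately have "(CLINT t:{0..}|lborel. F (of_real t)) + \<i> * (CLINT t:{0..}|lborel. F (Complex 0 (- t))) = 0"
    using LIMSEQ_unique by blast
  then show ?thesis by (simp add: eq_neg_iff_add_eq_0)
qed

section \<open>Convolution powers and entropy\<close>

text \<open>The positive part of the logarithm on \<open>ennreal\<close>. Densities of convolutions
  arise as nonnegative integrals that may be infinite on a null set, and this form spares a
  finiteness argument at each point.\<close>

definition lnp :: "ennreal \<Rightarrow> ennreal" where
  "lnp x = (if x = \<infinity> then \<infinity> else ennreal (max 0 (ln (enn2real x))))"

lemma lnp_measurable [measurable]: "lnp \<in> borel_measurable borel"
  unfolding lnp_def[abs_def] by measurable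

lemma lnp_ennreal: "0 \<le> r \<Longrightarrow> lnp (ennreal r) = ennreal (max 0 (ln r))"
  by (simp add: lnp_def)

lemma lnp_0 [simp]: "lnp 0 = 0"
  by (simp add: lnp_def)

lemma lnp_mono: "x \<le> y \<Longrightarrow> lnp x \<le> lnp y"
proof (cases x; cases y)
  fix r s assume xy: "x \<le> y" and x: "x = ennreal r" "0 \<le> r" and y: "y = ennreal s" "0 \<le> s"
  show "lnp x \<le> lnp y"
  proof (cases "r = 0")
    case False
    then show ?thesis using xy x y by (auto simp: lnp_ennreal intro!: ennreal_leI)
  qed (use x y in \<open>simp add: lnp_ennreal\<close>)
qed (auto simp: lnp_def top_unique)

text \<open>Young's inequality for the pair of entropy and exponential:
  \<open>ln (s / r) \<le> s / r - 1\<close> multiplied by \<open>r\<close>. It lets an entropy bound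
  on \<open>a\<close> control the integral of \<open>a\<close> against the logarithm of any
  integrable \<open>b\<close>.\<close>

lemma young_lnp: "a * lnp b \<le> a * lnp a + b"
proof (cases a; cases b)
  fix r s assume a: "a = ennreal r" "0 \<le> r" and b: "b = ennreal s" "0 \<le> s"
  have "r * max 0 (ln s) \<le> r * max 0 (ln r) + s"
  proof (cases "r = 0 \<or> s \<le> 1")
    case True
    have "max 0 (ln s) = 0" if "s \<le> 1" using that b by (cases "s = 0") auto
    then show ?thesis using True a b by auto
  next
    case False
    then have rs: "r > 0" "s > 1" using a by auto
    have "ln (s / r) \<le> s / r - 1" using rs by (intro ln_le_minus_one) auto
    then have "r * ln (s / r) \<le> r * (s / r - 1)" using rs by (intro mult_left_mono) auto
    also have "\<dots> \<le> s" using rs by (simp add: field_simps)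
    finally have "r * (ln s - ln r) \<le> s" using rs by (simp add: ln_div)
    moreover have "r * ln r \<le> r * max 0 (ln r)" using rs by (intro mult_left_mono) auto
    moreover have "r * (ln s - ln r) = r * ln s - r * ln r" by (rule right_diff_distrib)
    ultimately have "r * ln s \<le> r * max 0 (ln r) + s" by linarith
    then show ?thesis using rs by simp
  qed
  then have "ennreal (r * max 0 (ln s)) \<le> ennreal (r * max 0 (ln r) + s)" by (rule ennreal_leI)
  also have "\<dots> = ennreal (r * max 0 (ln r)) + ennreal s" using a b by (intro ennreal_plus) auto
  also have "ennreal (r * max 0 (ln s)) = a * lnp b"
    unfolding a(1) b(1) lnp_ennreal[OF b(2)] using a by (intro ennreal_mult) auto
  also have "ennreal (r * max 0 (ln r)) = a * lnp a"
    unfolding a(1) lnp_ennreal[OF a(2)] using a by (intro ennreal_mult) auto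
  finally show ?thesis unfolding b(1) .
next
  assume "a = \<top>" then show ?thesis by (simp add: lnp_def)
qed (auto simp: lnp_def)

definition conv_density :: "(real \<Rightarrow> ennreal) \<Rightarrow> real measure \<Rightarrow> real \<Rightarrow> ennreal" where
  "conv_density g \<tau> x = (\<integral>\<^sup>+y. g (x - y) \<partial>\<tau>)"

lemma conv_density_measurable [measurable]:
  assumes "finite_borel_measure \<tau>" and [measurable]: "g \<in> borel_measurable borel"
  shows "conv_density g \<tau> \<in> borel_measurable borel"
proof -
  interpret finite_borel_measure \<tau> by fact
  show ?thesis unfolding conv_density_def[abs_def] by measurable
qed

lemma nn_integral_lborel_translate:
  fixes f :: "real \<Rightarrow> ennreal"
  assumes [measurable]: "f \<in> borel_measurable borel"
  shows "(\<integral>\<^sup>+x. f (x - y) \<partial>lborel) = (\<integral>\<^sup>+x. f x \<partial>lborel)"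
  using nn_integral_real_affine[of "\<lambda>x. f (x - y)" 1 y] by simp

lemma convolution_density_measure:
  assumes \<tau>: "finite_borel_measure \<tau>" and [measurable]: "g \<in> borel_measurable borel"
    and fin: "finite_measure (density lborel g)"
  shows "(density lborel g \<star> \<tau>) = density lborel (conv_density g \<tau>)"
proof (rule measure_eqI)
  interpret \<tau>: finite_borel_measure \<tau> by fact
  interpret pair_sigma_finite "lborel :: real measure" \<tau> ..
  note conv_density_measurable[OF \<tau>, of g, measurable]
  fix A assume "A \<in> sets (density lborel g \<star> \<tau>)"
  then have [measurable]: "A \<in> sets borel" by simp
  have "emeasure (density lborel g \<star> \<tau>) A = (\<integral>\<^sup>+x. indicator A x \<partial>(density lborel g \<star> \<tau>))" by simp
  also have "\<dots> = (\<integral>\<^sup>+x. \<integral>\<^sup>+y. indicator A (x + y) \<partial>\<tau> \<partial>density lborel g)"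
    by (rule nn_integral_convolution) (auto intro: fin \<tau>.finite_measure_axioms)
  also have "\<dots> = (\<integral>\<^sup>+x. g x * (\<integral>\<^sup>+y. indicator A (x + y) \<partial>\<tau>) \<partial>lborel)"
    by (rule nn_integral_density) auto
  also have "\<dots> = (\<integral>\<^sup>+x. \<integral>\<^sup>+y. g x * indicator A (x + y) \<partial>\<tau> \<partial>lborel)"
    by (intro nn_integral_cong nn_integral_cmult[symmetric]) auto
  also have "\<dots> = (\<integral>\<^sup>+y. \<integral>\<^sup>+x. g x * indicator A (x + y) \<partial>lborel \<partial>\<tau>)"
    by (rule Fubini'[symmetric]) auto
  also have "\<dots> = (\<integral>\<^sup>+y. \<integral>\<^sup>+x. g (x - y) * indicator A x \<partial>lborel \<partial>\<tau>)"
  proof (rule nn_integral_cong)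
    fix y
    show "(\<integral>\<^sup>+x. g x * indicator A (x + y) \<partial>lborel) = (\<integral>\<^sup>+x. g (x - y) * indicator A x \<partial>lborel)"
      using nn_integral_lborel_translate[of "\<lambda>x. g x * indicator A (x + y)" y] by simp
  qed
  also have "\<dots> = (\<integral>\<^sup>+x. \<integral>\<^sup>+y. g (x - y) * indicator A x \<partial>\<tau> \<partial>lborel)"
    by (rule Fubini') auto
  also have "\<dots> = (\<integral>\<^sup>+x. conv_density g \<tau> x * indicator A x \<partial>lborel)"
    unfolding conv_density_def by (intro nn_integral_cong nn_integral_multc) auto
  also have "\<dots> = emeasure (density lborel (conv_density g \<tau>)) A"
    by (simp add: emeasure_density)
  finally show "emeasure (density lborel g \<star> \<tau>) A = emeasure (density lborel (conv_density g \<tau>)) A" .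
qed simp

lemma nn_integral_conv_density:
  assumes \<tau>: "finite_borel_measure \<tau>" and [measurable]: "g \<in> borel_measurable borel"
  shows "(\<integral>\<^sup>+x. conv_density g \<tau> x \<partial>lborel) = (\<integral>\<^sup>+x. g x \<partial>lborel) * emeasure \<tau> UNIV"
proof -
  interpret \<tau>: finite_borel_measure \<tau> by fact
  interpret pair_sigma_finite "lborel :: real measure" \<tau> ..
  have sp: "space \<tau> = UNIV" using sets_eq_imp_space_eq[OF \<tau>.sets_M] by simp
  have "(\<integral>\<^sup>+x. conv_density g \<tau> x \<partial>lborel) = (\<integral>\<^sup>+y. \<integral>\<^sup>+x. g (x - y) \<partial>lborel \<partial>\<tau>)"
    unfolding conv_density_def by (rule Fubini'[symmetric]) auto
  then show ?thesis by (simp add: nn_integral_lborel_translate sp)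
qed

text \<open>Young's inequality is applied to \<open>g (x - y)\<close> and the convolution density at
  \<open>x\<close>, and then integrated. The total mass of \<tau> appears as a factor, so a measure
  of exponentially small mass also yields exponentially small entropy.\<close>

lemma conv_density_entropy:
  assumes \<tau>: "finite_borel_measure \<tau>" and [measurable]: "g \<in> borel_measurable borel"
  shows "(\<integral>\<^sup>+x. conv_density g \<tau> x * lnp (conv_density g \<tau> x) \<partial>lborel)
    \<le> emeasure \<tau> UNIV * ((\<integral>\<^sup>+x. g x * lnp (g x) \<partial>lborel) + (\<integral>\<^sup>+x. conv_density g \<tau> x \<partial>lborel))"
proof -
  interpret \<tau>: finite_borel_measure \<tau> by fact
  interpret pair_sigma_finite "lborel :: real measure" \<tau> ..
  have sp: "space \<tau> = UNIV" using sets_eq_imp_space_eq[OF \<tau>.sets_M] by simp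
  let ?v = "conv_density g \<tau>"
  have [measurable]: "?v \<in> borel_measurable borel" by (rule conv_density_measurable[OF \<tau>]) simp
  have "(\<integral>\<^sup>+x. ?v x * lnp (?v x) \<partial>lborel) = (\<integral>\<^sup>+x. \<integral>\<^sup>+y. g (x - y) * lnp (?v x) \<partial>\<tau> \<partial>lborel)"
    unfolding conv_density_def[of g \<tau>] by (intro nn_integral_cong nn_integral_multc[symmetric]) auto
  also have "\<dots> \<le> (\<integral>\<^sup>+x. \<integral>\<^sup>+y. g (x - y) * lnp (g (x - y)) + ?v x \<partial>\<tau> \<partial>lborel)"
    by (intro nn_integral_mono young_lnp)
  also have "\<dots> = (\<integral>\<^sup>+x. (\<integral>\<^sup>+y. g (x - y) * lnp (g (x - y)) \<partial>\<tau>) + ?v x * emeasure \<tau> UNIV \<partial>lborel)"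
    by (intro nn_integral_cong, subst nn_integral_add) (auto simp: sp)
  also have "\<dots> = (\<integral>\<^sup>+x. \<integral>\<^sup>+y. g (x - y) * lnp (g (x - y)) \<partial>\<tau> \<partial>lborel) + (\<integral>\<^sup>+x. ?v x \<partial>lborel) * emeasure \<tau> UNIV"
    by (subst nn_integral_add) (auto simp: nn_integral_multc)
  also have "(\<integral>\<^sup>+x. \<integral>\<^sup>+y. g (x - y) * lnp (g (x - y)) \<partial>\<tau> \<partial>lborel) = (\<integral>\<^sup>+x. g x * lnp (g x) \<partial>lborel) * emeasure \<tau> UNIV"
    using nn_integral_conv_density[OF \<tau>, of "\<lambda>x. g x * lnp (g x)"] by (simp add: conv_density_def)
  finally show ?thesis by (simp add: algebra_simps)
qed

section \<open>Order and total mass of convolution powers\<close>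

lemma measure_le_iff:
  assumes "sets M = sets N"
  shows "M \<le> N \<longleftrightarrow> (\<forall>A. emeasure M A \<le> emeasure N A)"
  unfolding le_measure[OF assms] by (metis assms emeasure_notin_sets zero_le)

lemma convolution_mono:
  fixes M M' N N' :: "real measure"
  assumes "finite_borel_measure M" "finite_borel_measure M'" "finite_borel_measure N" "finite_borel_measure N'"
    and le: "M \<le> M'" "N \<le> N'"
  shows "(M \<star> N) \<le> (M' \<star> N')"
proof -
  interpret M: finite_borel_measure M by fact
  interpret M': finite_borel_measure M' by fact
  interpret N: finite_borel_measure N by fact
  interpret N': finite_borel_measure N' by fact
  have "emeasure (M \<star> N) A \<le> emeasure (M' \<star> N') A" for A
  proof (cases "A \<in> sets borel")
    case True
    note [measurable] = True
    have "emeasure (M \<star> N) A = (\<integral>\<^sup>+x. \<integral>\<^sup>+y. indicator A (x + y) \<partial>N \<partial>M)"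
      by (rule convolution_emeasure') (auto intro: M.finite_measure_axioms N.finite_measure_axioms)
    also have "\<dots> \<le> (\<integral>\<^sup>+x. \<integral>\<^sup>+y. indicator A (x + y) \<partial>N' \<partial>M')"
      by (rule order_trans[OF nn_integral_mono[OF nn_integral_mono_measure] nn_integral_mono_measure]) (use le in auto)
    also have "\<dots> = emeasure (M' \<star> N') A"
      by (rule convolution_emeasure'[symmetric]) (auto intro: M'.finite_measure_axioms N'.finite_measure_axioms)
    finally show ?thesis .
  qed (simp add: emeasure_notin_sets)
  then show ?thesis by (subst measure_le_iff) auto
qed

lemma emeasure_convolution_UNIV:
  assumes "finite_borel_measure M" "finite_borel_measure N"
  shows "emeasure (M \<star> N) UNIV = emeasure M UNIV * emeasure N UNIV"
proof -
  interpret M: finite_borel_measure M by fact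
  interpret N: finite_borel_measure N by fact
  have sp: "space M = UNIV" "space N = UNIV"
    using sets_eq_imp_space_eq[OF M.sets_M] sets_eq_imp_space_eq[OF N.sets_M] by auto
  have "emeasure (M \<star> N) UNIV = (\<integral>\<^sup>+x. \<integral>\<^sup>+y. indicator UNIV (x + y) \<partial>N \<partial>M)"
    by (rule convolution_emeasure') (auto intro: M.finite_measure_axioms N.finite_measure_axioms)
  then show ?thesis by (simp add: sp mult.commute)
qed

text \<open>The seed \<open>T\<close> carries the summands outside the blocks; with the unit mass at
  0 as seed this is the plain convolution power.\<close>

primrec conv_pow :: "real measure \<Rightarrow> nat \<Rightarrow> real measure \<Rightarrow> real measure" where
  "conv_pow M 0 T = T"
| "conv_pow M (Suc n) T = (M \<star> conv_pow M n T)"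

lemma finite_borel_conv_pow:
  "finite_borel_measure M \<Longrightarrow> finite_borel_measure T \<Longrightarrow> finite_borel_measure (conv_pow M n T)"
  by (induction n) (auto intro: finite_borel_convolution)

lemma real_distribution_conv_pow:
  "real_distribution M \<Longrightarrow> real_distribution T \<Longrightarrow> real_distribution (conv_pow M n T)"
  by (induction n) (auto intro: real_distribution_convolution)

lemma char_conv_pow:
  assumes "finite_borel_measure M" "finite_borel_measure T"
  shows "char (conv_pow M n T) t = char M t ^ n * char T t"
  using assms by (induction n) (auto simp: char_convolution' finite_borel_conv_pow mult.assoc)

lemma emeasure_conv_pow:
  assumes "finite_borel_measure M" "finite_borel_measure T"
  shows "emeasure (conv_pow M n T) UNIV = emeasure M UNIV ^ n * emeasure T UNIV"
  using assms by (induction n) (auto simp: emeasure_convolution_UNIV finite_borel_conv_pow mult.assoc)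

lemma conv_pow_mono:
  assumes "finite_borel_measure M" "finite_borel_measure M'" "finite_borel_measure T" "M \<le> M'"
  shows "conv_pow M n T \<le> conv_pow M' n T"
  using assms by (induction n) (auto intro!: convolution_mono finite_borel_conv_pow)

lemma real_distribution_return: "real_distribution (return borel (0::real))"
  by (intro real_distribution.intro prob_space_return real_distribution_axioms.intro) auto

lemma char_return_0: "char (return borel 0) t = 1"
  unfolding char_def by (subst integral_return) auto

section \<open>Affine change of variables\<close>

lemma (in finite_borel_measure) char_affine:
  "char (distr M borel (\<lambda>x. x / b - a)) t = iexp (- (t * a)) * char M (t / b)"
proof -
  have "char (distr M borel (\<lambda>x. x / b - a)) t = (\<integral>x. iexp (t * (x / b - a)) \<partial>M)"
    unfolding char_def by (subst integral_distr) auto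
  also have "\<dots> = (\<integral>x. iexp (- (t * a)) * iexp (t / b * x) \<partial>M)"
    by (intro Bochner_Integration.integral_cong refl) (simp add: exp_add[symmetric] algebra_simps)
  also have "\<dots> = iexp (- (t * a)) * char M (t / b)" unfolding char_def by (rule integral_mult_right_zero)
  finally show ?thesis .
qed

lemma distr_density_affine:
  fixes g :: "real \<Rightarrow> ennreal"
  assumes [measurable]: "g \<in> borel_measurable borel" and b: "b > 0"
  shows "distr (density lborel g) borel (\<lambda>x. x / b - a) = density lborel (\<lambda>x. ennreal b * g (b * (x + a)))"
proof (rule measure_eqI)
  fix A assume "A \<in> sets (distr (density lborel g) borel (\<lambda>x. x / b - a))"
  then have [measurable]: "A \<in> sets borel" by simp
  have "emeasure (distr (density lborel g) borel (\<lambda>x. x / b - a)) A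
      = (\<integral>\<^sup>+x. indicator A x \<partial>distr (density lborel g) borel (\<lambda>x. x / b - a))" by simp
  also have "\<dots> = (\<integral>\<^sup>+x. g x * indicator A (x / b - a) \<partial>lborel)"
    by (subst nn_integral_distr) (auto simp: nn_integral_density)
  also have "\<dots> = ennreal b * (\<integral>\<^sup>+x. g (b * a + b * x) * indicator A ((b * a + b * x) / b - a) \<partial>lborel)"
    using b by (subst nn_integral_real_affine[where c=b and t="b * a"]) auto
  also have "\<dots> = (\<integral>\<^sup>+x. ennreal b * (g (b * a + b * x) * indicator A ((b * a + b * x) / b - a)) \<partial>lborel)"
    by (rule nn_integral_cmult[symmetric]) auto
  also have "\<dots> = (\<integral>\<^sup>+x. ennreal b * g (b * (x + a)) * indicator A x \<partial>lborel)"
    using b by (intro nn_integral_cong) (auto simp: algebra_simps add_divide_distrib)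
  also have "\<dots> = emeasure (density lborel (\<lambda>x. ennreal b * g (b * (x + a)))) A"
    by (simp add: emeasure_density)
  finally show "emeasure (distr (density lborel g) borel (\<lambda>x. x / b - a)) A = emeasure (density lborel (\<lambda>x. ennreal b * g (b * (x + a)))) A" .
qed simp

lemma nn_integral_affine_density:
  fixes g k :: "real \<Rightarrow> ennreal"
  assumes [measurable]: "g \<in> borel_measurable borel" and b: "b > 0"
  shows "(\<integral>\<^sup>+x. ennreal b * g (b * (x + a)) \<partial>lborel) = (\<integral>\<^sup>+x. g x \<partial>lborel)"
proof -
  have "(\<integral>\<^sup>+x. g x \<partial>lborel) = ennreal b * (\<integral>\<^sup>+x. g (b * a + b * x) \<partial>lborel)"
    using b by (subst nn_integral_real_affine[where c=b and t="b * a"]) auto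
  also have "\<dots> = (\<integral>\<^sup>+x. ennreal b * g (b * a + b * x) \<partial>lborel)"
    by (rule nn_integral_cmult[symmetric]) auto
  finally show ?thesis by (simp add: algebra_simps)
qed

lemma lnp_mult_le: "lnp (ennreal b * x) \<le> ennreal (max 0 (ln b)) + lnp x" if "b > 0"
proof (cases x)
  case (real r)
  show ?thesis
  proof (cases "r = 0")
    case False
    then have r: "r > 0" using real by simp
    have xr: "x = ennreal r" using real by simp
    have "ennreal b * x = ennreal (b * r)" unfolding xr using that r by (intro ennreal_mult[symmetric]) auto
    then have "lnp (ennreal b * x) = ennreal (max 0 (ln (b * r)))" using that r by (simp only: lnp_ennreal mult_nonneg_nonneg less_imp_le)
    also have "\<dots> \<le> ennreal (max 0 (ln b) + max 0 (ln r))" using r that by (intro ennreal_leI) (auto simp: ln_mult)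
    also have "\<dots> = ennreal (max 0 (ln b)) + ennreal (max 0 (ln r))" by (rule ennreal_plus) auto
    also have "ennreal (max 0 (ln r)) = lnp x" unfolding xr using r by (simp only: lnp_ennreal less_imp_le)
    finally show ?thesis .
  qed (use real in \<open>simp add: lnp_def\<close>)
qed (simp add: lnp_def)

text \<open>Rescaling a density by \<open>b\<close> shifts its logarithm by \<open>ln b\<close>, at
  the cost of \<open>ln b\<close> times the mass. This is the only way the norming constants enter
  the entropy of the remainder.\<close>

lemma affine_density_entropy:
  fixes g :: "real \<Rightarrow> ennreal"
  assumes [measurable]: "g \<in> borel_measurable borel" and b: "b > 0"
  shows "(\<integral>\<^sup>+x. ennreal b * g (b * (x + a)) * lnp (ennreal b * g (b * (x + a))) \<partial>lborel)
    \<le> ennreal (max 0 (ln b)) * (\<integral>\<^sup>+x. g x \<partial>lborel) + (\<integral>\<^sup>+x. g x * lnp (g x) \<partial>lborel)"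
proof -
  have "(\<integral>\<^sup>+x. ennreal b * g (b * (x + a)) * lnp (ennreal b * g (b * (x + a))) \<partial>lborel)
    \<le> (\<integral>\<^sup>+x. ennreal b * (g (b * (x + a)) * (ennreal (max 0 (ln b)) + lnp (g (b * (x + a))))) \<partial>lborel)"
    unfolding mult.assoc by (intro nn_integral_mono mult_left_mono lnp_mult_le b) auto
  also have "\<dots> = (\<integral>\<^sup>+x. g x * (ennreal (max 0 (ln b)) + lnp (g x)) \<partial>lborel)"
    using nn_integral_affine_density[of "\<lambda>x. g x * (ennreal (max 0 (ln b)) + lnp (g x))" b a] b by simp
  also have "\<dots> = (\<integral>\<^sup>+x. ennreal (max 0 (ln b)) * g x + g x * lnp (g x) \<partial>lborel)"
    by (intro nn_integral_cong) (simp add: algebra_simps)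
  also have "\<dots> = ennreal (max 0 (ln b)) * (\<integral>\<^sup>+x. g x \<partial>lborel) + (\<integral>\<^sup>+x. g x * lnp (g x) \<partial>lborel)"
    by (subst nn_integral_add) (auto simp: nn_integral_cmult)
  finally show ?thesis .
qed

section \<open>The stable exponent\<close>

text \<open>The holomorphic continuation, by principal branches, of \<open>stable_log_char\<close>
  from the positive half-line to the plane cut along the negative one.\<close>

definition stable_exponent :: "real \<Rightarrow> real \<Rightarrow> complex \<Rightarrow> complex" where
  "stable_exponent \<alpha> \<beta> z = (if \<alpha> \<noteq> 1 then z powr of_real \<alpha> * (1 + \<i> * of_real (\<beta> * tan (pi * \<alpha> / 2)))
     else z * (1 + \<i> * of_real (\<beta> * 2 / pi) * Ln z))"

text \<open>Minus the logarithm of the characteristic function for location 0 and scale constant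
  1.\<close>

definition stable_log_char :: "real \<Rightarrow> real \<Rightarrow> real \<Rightarrow> complex" where
  "stable_log_char \<alpha> \<beta> t = of_real (\<bar>t\<bar> powr \<alpha>) * (1 + \<i> * of_real (\<beta> * sgn t * stable_omega t \<alpha>))"

lemma stable_log_char_pos:
  assumes "t \<ge> 0"
  shows "stable_log_char \<alpha> \<beta> t = stable_exponent \<alpha> \<beta> (of_real t)"
proof (cases "t = 0")
  case True
  then show ?thesis by (simp add: stable_log_char_def stable_exponent_def)
next
  case False
  then show ?thesis using assms
    by (auto simp: stable_log_char_def stable_exponent_def stable_omega_def powr_of_real Ln_of_real algebra_simps)
qed

lemma stable_log_char_uminus: "stable_log_char \<alpha> \<beta> (- t) = cnj (stable_log_char \<alpha> \<beta> t)"
  by (simp add: stable_log_char_def stable_omega_def sgn_minus)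

lemma Re_stable_log_char: "Re (stable_log_char \<alpha> \<beta> t) = \<bar>t\<bar> powr \<alpha>"
  by (simp add: stable_log_char_def)

lemma cmod_Ln_le:
  assumes "z \<noteq> 0"
  shows "cmod (Ln z) \<le> \<bar>ln (cmod z)\<bar> + pi"
proof -
  have "cmod (Ln z) \<le> \<bar>Re (Ln z)\<bar> + \<bar>Im (Ln z)\<bar>" by (rule cmod_le)
  moreover have "\<bar>Im (Ln z)\<bar> \<le> pi" using Im_Ln_le_pi[OF assms] mpi_less_Im_Ln[OF assms] by linarith
  ultimately show ?thesis using assms by simp
qed

lemma ln_le_2_sqrt:
  fixes x :: real
  assumes x: "x \<ge> 1"
  shows "ln x \<le> 2 * x powr (1/2)"
proof -
  have "ln (x powr (1/2)) \<le> x powr (1/2) - 1" using x by (intro ln_le_minus_one) auto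
  then show ?thesis using x by (simp add: ln_powr)
qed

text \<open>For \<open>\<alpha> \<noteq> 1\<close> both exponents are \<alpha>. For
  \<open>\<alpha> = 1\<close> the logarithm is absorbed into a half power, which gives 3/2 at
  infinity and 1/2 at zero. What counts later is \<open>q < 2\<close> and
  \<open>r > 0\<close>.\<close>

lemma stable_exponent_bounds:
  assumes \<alpha>: "0 < \<alpha>" "\<alpha> < 2"
  shows "\<exists>K q r. K \<ge> 0 \<and> 0 < q \<and> q < 2 \<and> r > 0
    \<and> (\<forall>z. 1 \<le> cmod z \<longrightarrow> cmod (stable_exponent \<alpha> \<beta> z) \<le> K * cmod z powr q)
    \<and> (\<forall>z. cmod z \<le> 1 \<longrightarrow> cmod (stable_exponent \<alpha> \<beta> z) \<le> K * cmod z powr r)"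
proof (cases "\<alpha> = 1")
  case False
  let ?K = "cmod (1 + \<i> * of_real (\<beta> * tan (pi * \<alpha> / 2)))"
  have "cmod (stable_exponent \<alpha> \<beta> z) \<le> ?K * cmod z powr \<alpha>" for z
    using False by (simp add: stable_exponent_def norm_mult norm_powr_real_powr' mult.commute)
  then show ?thesis using \<alpha> by (intro exI[of _ ?K] exI[of _ \<alpha>]) auto
next
  case True
  define B where "B = \<bar>\<beta> * 2 / pi\<bar>"
  have B: "B \<ge> 0" by (simp add: B_def)
  define K where "K = 1 + B * (2 + pi)"
  have K: "K \<ge> 0" using B by (simp add: K_def)
  have gen: "cmod (stable_exponent \<alpha> \<beta> z) \<le> cmod z * (1 + B * (\<bar>ln (cmod z)\<bar> + pi))" if "z \<noteq> 0" for z
  proof -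
    have "cmod (1 + \<i> * of_real (\<beta> * 2 / pi) * Ln z) \<le> 1 + cmod (\<i> * of_real (\<beta> * 2 / pi) * Ln z)"
      by (rule order_trans[OF norm_triangle_ineq]) simp
    also have "cmod (\<i> * of_real (\<beta> * 2 / pi) * Ln z) = B * cmod (Ln z)"
      unfolding norm_mult norm_of_real B_def by simp
    also have "\<dots> \<le> B * (\<bar>ln (cmod z)\<bar> + pi)" by (intro mult_left_mono cmod_Ln_le that B)
    finally show ?thesis unfolding stable_exponent_def using True by (simp add: norm_mult mult_left_mono)
  qed
  have big: "cmod (stable_exponent \<alpha> \<beta> z) \<le> K * cmod z powr (3/2)" if z: "1 \<le> cmod z" for z
  proof -
    have z0: "z \<noteq> 0" using z by auto
    have s: "1 \<le> cmod z powr (1/2)" using z by (intro ge_one_powr_ge_zero) auto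
    have "\<bar>ln (cmod z)\<bar> + pi \<le> (2 + pi) * cmod z powr (1/2)"
    proof -
      have "\<bar>ln (cmod z)\<bar> \<le> 2 * cmod z powr (1/2)" using z ln_le_2_sqrt[OF z] by simp
      moreover have "pi \<le> pi * cmod z powr (1/2)" using mult_left_mono[OF s, of pi] by simp
      ultimately show ?thesis unfolding distrib_right by linarith
    qed
    then have "B * (\<bar>ln (cmod z)\<bar> + pi) \<le> B * ((2 + pi) * cmod z powr (1/2))" using B by (intro mult_left_mono)
    then have "1 + B * (\<bar>ln (cmod z)\<bar> + pi) \<le> K * cmod z powr (1/2)"
      using s by (simp add: K_def algebra_simps)
    then have "cmod z * (1 + B * (\<bar>ln (cmod z)\<bar> + pi)) \<le> cmod z * (K * cmod z powr (1/2))"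
      by (intro mult_left_mono) auto
    also have "\<dots> = K * (cmod z powr 1 * cmod z powr (1/2))" using z by simp
    also have "cmod z powr 1 * cmod z powr (1/2) = cmod z powr (3/2)" by (simp only: powr_add[symmetric]) simp
    finally show ?thesis using gen[OF z0] by linarith
  qed
  have small: "cmod (stable_exponent \<alpha> \<beta> z) \<le> K * cmod z powr (1/2)" if z: "cmod z \<le> 1" for z
  proof (cases "z = 0")
    case True
    then show ?thesis using \<open>\<alpha> = 1\<close> by (simp add: stable_exponent_def)
  next
    case False
    then have z0: "cmod z > 0" by simp
    define x where "x = cmod z"
    have x: "0 < x" "x \<le> 1" using z z0 by (auto simp: x_def)
    have le1: "x \<le> x powr (1/2)" using powr_mono'[of "1/2" 1 x] x by simp
    have "\<bar>ln x\<bar> = ln (1 / x)" using x by (simp add: ln_div abs_if ln_less_zero_iff not_less)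
    also have "\<dots> \<le> 2 * (1 / x) powr (1/2)" using x by (intro ln_le_2_sqrt) (simp add: le_divide_eq)
    finally have "x * \<bar>ln x\<bar> \<le> x * (2 * (1 / x) powr (1/2))" using x by (intro mult_left_mono) auto
    also have "\<dots> = 2 * (x powr 1 * x powr (- (1/2)))" using x by (simp add: powr_divide powr_minus field_simps)
    also have "x powr 1 * x powr (- (1/2)) = x powr (1/2)" by (simp only: powr_add[symmetric]) simp
    finally have l: "x * \<bar>ln x\<bar> \<le> 2 * x powr (1/2)" .
    have "x * (1 + B * (\<bar>ln x\<bar> + pi)) = x + B * (x * \<bar>ln x\<bar> + pi * x)" by (simp add: algebra_simps)
    also have "\<dots> \<le> x powr (1/2) + B * (2 * x powr (1/2) + pi * x powr (1/2))"
      using le1 l B by (intro add_mono mult_left_mono) auto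
    also have "\<dots> = K * x powr (1/2)" by (simp add: K_def algebra_simps)
    finally show ?thesis using gen[OF False] unfolding x_def by linarith
  qed
  show ?thesis using K big small by (intro exI[of _ K] exI[of _ "3/2"] exI[of _ "1/2"]) auto
qed

lemma stable_exponent_0 [simp]: "stable_exponent \<alpha> \<beta> 0 = 0"
  by (simp add: stable_exponent_def)

text \<open>The origin is the end point of the branch cut; there continuity comes from the power
  bound near zero and not from the branches.\<close>

lemma continuous_stable_exponent:
  assumes \<alpha>: "0 < \<alpha>" "\<alpha> < 2" and z: "z \<notin> \<real>\<^sub>\<le>\<^sub>0 \<or> z = 0"
  shows "isCont (stable_exponent \<alpha> \<beta>) z"
proof (cases "z = 0")
  case False
  then have nz: "z \<notin> \<real>\<^sub>\<le>\<^sub>0" using z by auto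
  show ?thesis
  proof (cases "\<alpha> = 1")
    case True
    then show ?thesis using nz unfolding stable_exponent_def[abs_def] by (auto intro!: continuous_intros)
  next
    case False
    then show ?thesis using nz unfolding stable_exponent_def[abs_def]
      by (auto intro!: continuous_intros continuous_at_imp_continuous_on simp: isCont_powr_complex)
  qed
next
  case True
  from stable_exponent_bounds[OF \<alpha>, of \<beta>] obtain K r where r: "r > 0" and K: "K \<ge> 0"
    and b: "\<And>z. cmod z \<le> 1 \<Longrightarrow> cmod (stable_exponent \<alpha> \<beta> z) \<le> K * cmod z powr r" by blast
  have "(stable_exponent \<alpha> \<beta> \<longlongrightarrow> 0) (at 0)"
  proof (rule Lim_null_comparison)
    show "\<forall>\<^sub>F z in at 0. norm (stable_exponent \<alpha> \<beta> z) \<le> K * cmod z powr r"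
      by (rule eventually_at_ball'[of 1 0, THEN eventually_mono]) (auto intro!: b)
    have "((\<lambda>z. K * cmod z powr r) \<longlongrightarrow> K * cmod 0 powr r) (at 0)"
      using r by (intro tendsto_intros tendsto_powr2) (auto intro: always_eventually)
    then show "((\<lambda>z. K * cmod z powr r) \<longlongrightarrow> 0) (at 0)" by simp
  qed
  then show ?thesis unfolding True isCont_def by simp
qed

lemma stable_exponent_differentiable:
  assumes "z \<notin> \<real>\<^sub>\<le>\<^sub>0"
  shows "stable_exponent \<alpha> \<beta> field_differentiable at z"
proof (cases "\<alpha> = 1")
  case True
  have "(\<lambda>z. z * (1 + \<i> * of_real (\<beta> * 2 / pi) * Ln z)) field_differentiable at z"
    using assms by (intro derivative_intros) (auto intro!: field_differentiable_at_Ln field_differentiable_mult field_differentiable_add)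
  then show ?thesis using True unfolding stable_exponent_def[abs_def] by simp
next
  case False
  have "((\<lambda>z. z powr of_real \<alpha>) has_field_derivative of_real \<alpha> * z powr (of_real \<alpha> - 1)) (at z)"
    using assms by (rule has_field_derivative_powr)
  then have "(\<lambda>z. z powr of_real \<alpha>) field_differentiable at z" unfolding field_differentiable_def by blast
  then have "(\<lambda>z. z powr of_real \<alpha> * (1 + \<i> * of_real (\<beta> * tan (pi * \<alpha> / 2)))) field_differentiable at z"
    by (intro field_differentiable_mult) auto
  then show ?thesis using False unfolding stable_exponent_def[abs_def] by simp
qed

text \<open>This is where non-extremality enters: on the negative imaginary half-axis the exponent is
  rotated by \<open>exp (- \<i> \<pi> \<alpha> / 2)\<close>, and its component along \<open>\<i>\<close> has a strict sign exactly if
  \<open>\<bar>\<beta>\<bar> < 1\<close>.\<close>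
lemma stable_exponent_rotated_neg:
  assumes \<alpha>: "0 < \<alpha>" "\<alpha> < 2" and \<beta>: "-1 < \<beta>" "\<beta> < 1" and u: "u > 0"
  shows "Re (- \<i> * stable_exponent \<alpha> \<beta> (Complex 0 (- u))) < 0"
proof -
  have z: "Complex 0 (- u) = of_real u * (- \<i>)" by (simp add: complex_eq_iff)
  have "Ln (of_real u * (- \<i>)) = of_real (ln u) + Ln (- \<i>)"
    using Ln_times_of_real[of u "- \<i>"] u by (simp add: Ln_of_real)
  then have Ln: "Ln (Complex 0 (- u)) = of_real (ln u) - \<i> * of_real (pi / 2)"
    unfolding z by simp
  show ?thesis
  proof (cases "\<alpha> = 1")
    case True
    have "- \<i> * stable_exponent \<alpha> \<beta> (Complex 0 (- u)) = - (of_real u * (1 + \<i> * of_real (\<beta> * 2 / pi) * (of_real (ln u) - \<i> * of_real (pi / 2))))"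
      unfolding stable_exponent_def Ln using True by (simp add: complex_eq_iff)
    then have "Re (- \<i> * stable_exponent \<alpha> \<beta> (Complex 0 (- u))) = - (u * (1 + \<beta>))" by simp
    then show ?thesis using u \<beta> by simp
  next
    case False
    define \<theta> where "\<theta> = pi * \<alpha> / 2"
    have \<theta>: "0 < \<theta>" "\<theta> < pi" using \<alpha> by (auto simp: \<theta>_def)
    have s: "sin \<theta> > 0" using \<theta> by (intro sin_gt_zero) auto
    have c: "cos \<theta> \<noteq> 0"
    proof
      assume "cos \<theta> = 0"
      then have "\<theta> = pi / 2" using cos_inj_pi[of \<theta> "pi/2"] \<theta> by simp
      then show False using False by (simp add: \<theta>_def)
    qed
    have "Complex 0 (- u) powr of_real \<alpha> = exp (of_real \<alpha> * (of_real (ln u) - \<i> * of_real (pi / 2)))"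
      unfolding powr_def Ln using u by (simp add: complex_eq_iff)
    also have "of_real \<alpha> * (of_real (ln u) - \<i> * of_real (pi / 2)) = of_real (\<alpha> * ln u) + \<i> * of_real (- \<theta>)"
      by (simp add: \<theta>_def algebra_simps)
    also have "exp \<dots> = of_real (u powr \<alpha>) * (of_real (cos \<theta>) - \<i> * of_real (sin \<theta>))"
    proof -
      have "exp (\<alpha> * ln u) = u powr \<alpha>" using u by (simp add: powr_def)
      then show ?thesis by (simp add: complex_eq_iff Re_exp Im_exp)
    qed
    finally have p: "Complex 0 (- u) powr of_real \<alpha> = of_real (u powr \<alpha>) * (of_real (cos \<theta>) - \<i> * of_real (sin \<theta>))" .
    have "Re (- \<i> * stable_exponent \<alpha> \<beta> (Complex 0 (- u))) = u powr \<alpha> * (- sin \<theta> + \<beta> * tan \<theta> * cos \<theta>)"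
      unfolding stable_exponent_def p using False by (simp add: \<theta>_def algebra_simps)
    also have "\<beta> * tan \<theta> * cos \<theta> = \<beta> * sin \<theta>" using c by (simp add: tan_def)
    also have "u powr \<alpha> * (- sin \<theta> + \<beta> * sin \<theta>) = - (u powr \<alpha> * sin \<theta> * (1 - \<beta>))" by (simp add: algebra_simps)
    finally show ?thesis using u s \<beta> by simp
  qed
qed

section \<open>The line integral and its rotation\<close>

lemma integrable_powr_tail:
  assumes p: "p > 1"
  shows "integrable lborel (\<lambda>t::real. indicator {-1..1} t + indicator {t. \<bar>t\<bar> \<ge> 1} t * \<bar>t\<bar> powr (- p))"
proof -
  have h: "integrable lborel (\<lambda>t::real. indicator {1..} t * t powr (- p))"
  proof -
    have "((\<lambda>t. t powr (- p)) has_integral - (1 powr (- p + 1)) / (- p + 1)) {1::real..}"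
      using p by (intro has_integral_powr_to_inf) auto
    then have "((\<lambda>t. if t \<in> {1..} then t powr (- p) else 0) has_integral - (1 powr (- p + 1)) / (- p + 1)) UNIV"
      by (simp only: has_integral_restrict_UNIV)
    also have "(\<lambda>t. if t \<in> {1..} then t powr (- p) else 0) = (\<lambda>t. indicator {1..} t * t powr (- p))"
      by (auto simp: indicator_def)
    finally have "(\<integral>\<^sup>+t. ennreal (indicator {1..} t * t powr (- p)) \<partial>lborel) = ennreal (- (1 powr (- p + 1)) / (- p + 1))"
      by (intro nn_integral_has_integral_lborel) auto
    then show ?thesis by (intro integrableI_nonneg) (auto simp: less_top[symmetric])
  qed
  have h': "integrable lborel (\<lambda>t::real. indicator {1..} (- t) * (- t) powr (- p))"
    using lborel_integrable_real_affine[OF h, of "-1" 0] by simp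
  have "integrable lborel (\<lambda>t::real. indicator {-1..1} t + (indicator {1..} t * t powr (- p) + indicator {1..} (- t) * (- t) powr (- p)))"
    using integrable_indicator_Icc[of "-1" 1 1] h h' by (intro Bochner_Integration.integrable_add) auto
  also have "(\<lambda>t::real. indicator {-1..1} t + (indicator {1..} t * t powr (- p) + indicator {1..} (- t) * (- t) powr (- p)))
     = (\<lambda>t::real. indicator {-1..1} t + indicator {t. \<bar>t\<bar> \<ge> 1} t * \<bar>t\<bar> powr (- p))"
    by (auto simp: indicator_def fun_eq_iff abs_if)
  finally show ?thesis .
qed

text \<open>On the real line this is the conjugate of the characteristic function of the Erlang
  density moved to the right by one. The formula continues it holomorphically to the closed lower
  half-plane; the pole is at \<open>\<i>\<close>, and the shift adds the factor
  \<open>exp (- \<i> * z)\<close>, which is bounded there.\<close>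

definition shifted_erlang :: "complex \<Rightarrow> complex" where
  "shifted_erlang z = exp (- \<i> * z) / (1 + \<i> * z) ^ 3"

lemma cmod_shifted_erlang_le:
  assumes "Im z \<le> 0"
  shows "cmod (shifted_erlang z) \<le> 1" "cmod z \<ge> 1 \<Longrightarrow> cmod (shifted_erlang z) \<le> cmod z powr (- 3)"
proof -
  have e: "cmod (exp (- \<i> * z)) \<le> 1" using assms by simp
  have sq: "(cmod (1 + \<i> * z))\<^sup>2 = (1 - Im z)\<^sup>2 + (Re z)\<^sup>2" by (simp add: cmod_power2)
  have "1\<^sup>2 \<le> (cmod (1 + \<i> * z))\<^sup>2" unfolding sq using assms by (intro order_trans[OF power_mono[of 1 "1 - Im z" 2]]) auto
  then have d1: "1 \<le> cmod (1 + \<i> * z)" by (rule power2_le_imp_le) simp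
  have "(Im z)\<^sup>2 \<le> (1 - Im z)\<^sup>2" using assms by (intro abs_le_square_iff[THEN iffD1]) auto
  then have "(cmod z)\<^sup>2 \<le> (cmod (1 + \<i> * z))\<^sup>2" unfolding sq by (simp add: cmod_power2)
  then have d2: "cmod z \<le> cmod (1 + \<i> * z)" by (rule power2_le_imp_le) simp
  have "cmod (shifted_erlang z) \<le> 1 / cmod (1 + \<i> * z) ^ 3"
    unfolding shifted_erlang_def norm_divide norm_power using e by (intro divide_right_mono) auto
  also have "\<dots> \<le> 1 / 1" using one_le_power[OF d1, of 3] by (intro divide_left_mono) auto
  finally show "cmod (shifted_erlang z) \<le> 1" by simp
  assume z: "cmod z \<ge> 1"
  have "cmod (shifted_erlang z) \<le> 1 / cmod (1 + \<i> * z) ^ 3"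
    unfolding shifted_erlang_def norm_divide norm_power using e by (intro divide_right_mono) auto
  also have "\<dots> \<le> 1 / cmod z ^ 3" using z d2 by (intro divide_left_mono power_mono mult_pos_pos zero_less_power) auto
  also have "\<dots> = cmod z powr (- 3)"
    using z powr_realpow[of "cmod z" 3] by (simp add: powr_minus inverse_eq_divide)
  finally show "cmod (shifted_erlang z) \<le> cmod z powr (- 3)" .
qed

lemma one_plus_iz_nonzero: "Im z \<le> 0 \<Longrightarrow> 1 + \<i> * z \<noteq> 0"
  by (auto simp: complex_eq_iff)

text \<open>The negative half-line contributes the conjugate of the positive one. The latter is
  rotated to the negative imaginary axis, where \<open>shifted_erlang\<close> is real and positive
  and \<open>- \<i>\<close> times the exponent has strictly negative real part.\<close>

lemma stable_line_integral_neg: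
  assumes \<alpha>: "0 < \<alpha>" "\<alpha> < 2" and \<beta>: "-1 < \<beta>" "\<beta> < 1"
  shows "integrable lborel (\<lambda>t. shifted_erlang (of_real t) * stable_log_char \<alpha> \<beta> t)"
    and "Re (\<integral>t. shifted_erlang (of_real t) * stable_log_char \<alpha> \<beta> t \<partial>lborel) < 0"
proof -
  from stable_exponent_bounds[OF \<alpha>, of \<beta>] obtain K q r where K: "K \<ge> 0" and q: "0 < q" "q < 2" and r: "r > 0"
    and big: "\<And>z. 1 \<le> cmod z \<Longrightarrow> cmod (stable_exponent \<alpha> \<beta> z) \<le> K * cmod z powr q"
    and small: "\<And>z. cmod z \<le> 1 \<Longrightarrow> cmod (stable_exponent \<alpha> \<beta> z) \<le> K * cmod z powr r" by blast
  define p where "p = 3 - q"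
  have p: "p > 1" using q by (simp add: p_def)
  define F where "F z = shifted_erlang z * stable_exponent \<alpha> \<beta> z" for z
  have F1: "cmod (F z) \<le> K" if "Im z \<le> 0" "cmod z \<le> 1" for z
  proof -
    have "cmod (F z) \<le> 1 * (K * cmod z powr r)"
      unfolding F_def norm_mult using that cmod_shifted_erlang_le(1) small by (intro mult_mono) auto
    also have "\<dots> \<le> K" using that r K by (simp add: mult_left_le powr_le1)
    finally show ?thesis .
  qed
  have F2: "cmod (F z) \<le> K * cmod z powr (- p)" if "Im z \<le> 0" "cmod z \<ge> 1" for z
  proof -
    have "cmod (F z) \<le> cmod z powr (- 3) * (K * cmod z powr q)"
      unfolding F_def norm_mult using that cmod_shifted_erlang_le(2) big by (intro mult_mono) auto
    also have "\<dots> = K * (cmod z powr (- 3) * cmod z powr q)" by simp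
    also have "cmod z powr (- 3) * cmod z powr q = cmod z powr (- p)" by (simp add: powr_add[symmetric] p_def)
    finally show ?thesis .
  qed
  let ?dom = "\<lambda>t::real. indicator {-1..1} t + indicator {t. \<bar>t\<bar> \<ge> 1} t * \<bar>t\<bar> powr (- p)"
  have dom: "cmod (F z) \<le> K * ?dom t" if "Im z \<le> 0" "cmod z = \<bar>t\<bar>" for z t
  proof (cases "\<bar>t\<bar> \<le> 1")
    case True
    then have "1 \<le> ?dom t" by (auto simp: indicator_def)
    then have "K * 1 \<le> K * ?dom t" using K by (intro mult_left_mono)
    then show ?thesis using F1[of z] that True by simp
  next
    case False
    then have "t \<notin> {-1..1}" "\<bar>t\<bar> \<ge> 1" by auto
    then show ?thesis using F2[of z] that by simp
  qed
  have idom: "integrable lborel (\<lambda>t. K * ?dom t)" by (intro integrable_mult_right integrable_powr_tail p)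
  have notneg: "z \<notin> \<real>\<^sub>\<le>\<^sub>0 \<or> z = 0" if "0 \<le> Re z" for z
    using that by (auto simp: complex_nonpos_Reals_iff complex_eq_iff)
  have cont: "continuous_on {z. 0 \<le> Re z \<and> Im z \<le> 0} F"
  proof (rule continuous_at_imp_continuous_on, rule ballI)
    fix z assume z: "z \<in> {z. 0 \<le> Re z \<and> Im z \<le> 0}"
    then have "isCont (stable_exponent \<alpha> \<beta>) z" using notneg by (intro continuous_stable_exponent \<alpha>) auto
    moreover have "isCont shifted_erlang z" unfolding shifted_erlang_def[abs_def]
      using one_plus_iz_nonzero[of z] z by (intro continuous_intros) auto
    ultimately show "isCont F z" unfolding F_def[abs_def] by (intro continuous_intros)
  qed
  have holo: "F field_differentiable at z" if "0 < Re z" "Im z < 0" for z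
  proof -
    have "stable_exponent \<alpha> \<beta> field_differentiable at z"
      using that by (intro stable_exponent_differentiable) (auto simp: complex_nonpos_Reals_iff)
    moreover have "shifted_erlang field_differentiable at z"
    proof -
      have "(\<lambda>z. exp (- \<i> * z) / (1 + \<i> * z) ^ 3) holomorphic_on {z. Im z < 0}"
        by (intro holomorphic_intros) (use one_plus_iz_nonzero in auto)
      moreover have "open {z. Im z < 0}" by (rule open_halfspace_Im_lt)
      ultimately show ?thesis unfolding shifted_erlang_def[abs_def] using that holomorphic_on_imp_differentiable_at by blast
    qed
    ultimately show ?thesis unfolding F_def[abs_def] by (intro field_differentiable_mult)
  qed
  have c1: "continuous_on {0..} (\<lambda>t. F (of_real t))"
    by (rule continuous_on_compose2[OF cont]) (auto intro!: continuous_intros)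
  have c3: "continuous_on {0..} (\<lambda>t. F (Complex 0 (- t)))"
    by (rule continuous_on_compose2[OF cont]) (auto intro!: continuous_intros simp: Complex_eq)
  have int1: "set_integrable lborel {0..} (\<lambda>t. F (of_real t))"
    unfolding set_integrable_def
  proof (rule Bochner_Integration.integrable_bound[OF idom])
    show "(\<lambda>t. indicator {0..} t *\<^sub>R F (of_real t)) \<in> borel_measurable lborel"
      using borel_measurable_continuous_on_indicator[OF _ c1] by simp
    show "AE t in lborel. norm (indicator {0..} t *\<^sub>R F (of_real t)) \<le> norm (K * ?dom t)"
    proof (rule AE_I2)
      fix t :: real
      have "0 \<le> K * ?dom t" using K by simp
      then show "norm (indicator {0..} t *\<^sub>R F (of_real t)) \<le> norm (K * ?dom t)"
        using dom[of "of_real t" t] by (cases "t \<in> {0..}") auto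
    qed
  qed
  have int3: "set_integrable lborel {0..} (\<lambda>t. F (Complex 0 (- t)))"
    unfolding set_integrable_def
  proof (rule Bochner_Integration.integrable_bound[OF idom])
    show "(\<lambda>t. indicator {0..} t *\<^sub>R F (Complex 0 (- t))) \<in> borel_measurable lborel"
      using borel_measurable_continuous_on_indicator[OF _ c3] by simp
    show "AE t in lborel. norm (indicator {0..} t *\<^sub>R F (Complex 0 (- t))) \<le> norm (K * ?dom t)"
    proof (rule AE_I2)
      fix t :: real
      have "0 \<le> K * ?dom t" using K by simp
      then show "norm (indicator {0..} t *\<^sub>R F (Complex 0 (- t))) \<le> norm (K * ?dom t)"
        using dom[of "Complex 0 (- t)" t] by (cases "t \<in> {0..}") (auto simp: complex_norm)
    qed
  qed
  have rot: "(CLINT t:{0..}|lborel. F (of_real t)) = - \<i> * (CLINT t:{0..}|lborel. F (Complex 0 (- t)))"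
    by (rule quadrant_rotation[OF cont _ p K _ int1 int3]) (auto intro: holo F2)
  have neg: "Re (CLINT t:{0..}|lborel. F (of_real t)) < 0"
  proof -
    let ?w = "\<lambda>u::real. indicator {0..} u * (exp (- u) / (1 + u) ^ 3 * Re (- \<i> * stable_exponent \<alpha> \<beta> (Complex 0 (- u))))"
    have val: "Re (indicator {0..} u *\<^sub>R (- \<i> * F (Complex 0 (- u)))) = ?w u" for u :: real
    proof -
      have "\<i> * Complex 0 (- u) = of_real u" by (simp add: complex_eq_iff)
      then have "shifted_erlang (Complex 0 (- u)) = of_real (exp (- u) / (1 + u) ^ 3)"
        unfolding shifted_erlang_def by (simp add: exp_of_real[symmetric])
      then show ?thesis unfolding F_def by simp
    qed
    have iF: "integrable lborel (\<lambda>u. indicator {0..} u *\<^sub>R (- \<i> * F (Complex 0 (- u))))"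
      using integrable_mult_right[OF int3[unfolded set_integrable_def], of "- \<i>"] by simp
    have iw: "integrable lborel ?w" using integrable_Re[OF iF] unfolding val .
    have w0: "?w u \<le> 0" for u
    proof (cases "u > 0")
      case True
      then show ?thesis using stable_exponent_rotated_neg[OF \<alpha> \<beta> True] by (auto intro!: divide_nonpos_nonneg mult_nonneg_nonpos)
    next
      case False
      have "Complex 0 0 = 0" by (simp add: complex_eq_iff)
      then show ?thesis using False by (cases "u = 0") auto
    qed
    have "Re (CLINT t:{0..}|lborel. F (of_real t)) = Re (\<integral>u. indicator {0..} u *\<^sub>R (- \<i> * F (Complex 0 (- u))) \<partial>lborel)"
    proof -
      have m: "(\<integral>u. indicator {0..} u *\<^sub>R (- \<i> * F (Complex 0 (- u))) \<partial>lborel)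
          = - \<i> * (\<integral>u. indicator {0..} u *\<^sub>R F (Complex 0 (- u)) \<partial>lborel)"
        by (subst integral_mult_right_zero[symmetric]) (intro Bochner_Integration.integral_cong, auto)
      show ?thesis unfolding rot m unfolding set_lebesgue_integral_def ..
    qed
    also have "\<dots> = (\<integral>u. ?w u \<partial>lborel)" unfolding val[symmetric] by (rule integral_Re[OF iF, symmetric])
    finally have e: "Re (CLINT t:{0..}|lborel. F (of_real t)) = (\<integral>u. ?w u \<partial>lborel)" .
    \<comment> \<open>A nonnegative integrand of integral zero would vanish almost everywhere,
      against its strict sign on (0, 1).\<close>
    have "(\<integral>u. - ?w u \<partial>lborel) > 0"
    proof (rule ccontr)
      assume "\<not> ?thesis"
      moreover have "(\<integral>u. - ?w u \<partial>lborel) \<ge> 0" using w0 by (intro integral_nonneg_AE AE_I2) simp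
      ultimately have "(\<integral>u. - ?w u \<partial>lborel) = 0" by linarith
      moreover have "integrable lborel (\<lambda>u. - ?w u)" using iw by (rule integrable_minus)
      ultimately have "AE u in lborel. - ?w u = 0"
        using w0 by (subst (asm) integral_nonneg_eq_0_iff_AE) auto
      then have "AE u in lborel. u \<notin> {0<..<1::real}"
      proof eventually_elim
        case (elim u)
        show ?case
        proof
          assume "u \<in> {0<..<1::real}"
          then have u: "u > 0" by simp
          have pos: "exp (- u) / (1 + u) ^ 3 > 0" using u by simp
          have "indicator {0..} u = (1::real)" using u by simp
          then have "?w u < 0" using mult_pos_neg[OF pos stable_exponent_rotated_neg[OF \<alpha> \<beta> u]]
            by (simp only: mult_1_left)
          with elim show False by linarith
        qed
      qed
      then have "{0<..<1::real} \<in> null_sets lborel" by (subst AE_iff_null_sets) auto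
      then show False by (auto simp: null_sets_def)
    qed
    then show ?thesis unfolding e by simp
  qed
  have even: "shifted_erlang (of_real (- t)) * stable_log_char \<alpha> \<beta> (- t) = cnj (shifted_erlang (of_real t) * stable_log_char \<alpha> \<beta> t)" for t
    unfolding stable_log_char_uminus by (simp add: shifted_erlang_def exp_cnj)
  let ?k = "\<lambda>t. shifted_erlang (of_real t) * stable_log_char \<alpha> \<beta> t"
  have kF: "?k t = F (of_real t)" if "t \<ge> 0" for t using that by (simp add: F_def stable_log_char_pos)
  define R where "R t = Re (indicator {0..} t *\<^sub>R F (of_real t))" for t :: real
  have iR: "integrable lborel R" unfolding R_def using int1 unfolding set_integrable_def by (rule integrable_Re)
  \<comment> \<open>Both half-line indicators contain the origin; the last term removes the double
    count.\<close>
  have split: "?k t = indicator {0..} t *\<^sub>R F (of_real t) + (indicator {0..} (- t) *\<^sub>R cnj (F (of_real (- t)))) - (if t = 0 then cnj (F 0) else 0)" for t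
  proof (cases "t > 0")
    case True then show ?thesis using kF[of t] by simp
  next
    case False
    show ?thesis
    proof (cases "t = 0")
      case True then show ?thesis using kF[of 0] by simp
    next
      case f: False
      then show ?thesis using False kF[of "-t"] even[of "-t"] by simp
    qed
  qed
  have i2: "integrable lborel (\<lambda>t::real. indicator {0..} (- t) *\<^sub>R cnj (F (of_real (- t))))"
  proof -
    have "integrable lborel (\<lambda>t. cnj (indicator {0..} t *\<^sub>R F (of_real t)))"
      by (rule integrable_bounded_linear[OF bounded_linear_cnj int1[unfolded set_integrable_def]])
    from lborel_integrable_real_affine[OF this, of "-1" 0] show ?thesis by simp
  qed
  have i3: "integrable lborel (\<lambda>t::real. if t = 0 then cnj (F 0) else 0)"
  proof (rule integrable_cong_AE_imp[OF integrable_zero])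
    show "AE t in (lborel :: real measure). 0 = (if t = 0 then cnj (F 0) else 0)"
      using AE_lborel_singleton[of "0::real"] by eventually_elim simp
  qed simp
  show ik: "integrable lborel ?k" unfolding split
    using int1 i2 i3 unfolding set_integrable_def by (intro Bochner_Integration.integrable_diff Bochner_Integration.integrable_add)
  have "Re (\<integral>t. ?k t \<partial>lborel) = (\<integral>t. Re (?k t) \<partial>lborel)" by (rule integral_Re[OF ik, symmetric])
  also have "\<dots> = (\<integral>t. R t + R (- t) \<partial>lborel)"
  proof (rule integral_cong_AE)
    show "AE t in lborel. Re (?k t) = R t + R (- t)"
      using AE_lborel_singleton[of "0::real"] by eventually_elim (subst split, simp add: R_def)
    show "(\<lambda>t. Re (?k t)) \<in> borel_measurable lborel" by (rule borel_measurable_integrable[OF integrable_Re[OF ik]])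
    show "(\<lambda>t. R t + R (- t)) \<in> borel_measurable lborel"
      using iR lborel_integrable_real_affine[OF iR, of "-1" 0] by auto
  qed
  also have "\<dots> = (\<integral>t. R t \<partial>lborel) + (\<integral>t. R (- t) \<partial>lborel)"
    using iR lborel_integrable_real_affine[OF iR, of "-1" 0] by (intro Bochner_Integration.integral_add) auto
  also have "(\<integral>t. R (- t) \<partial>lborel) = (\<integral>t. R t \<partial>lborel)"
    by (subst lborel_integral_real_affine[where c="-1" and t=0 and f=R]) auto
  also have "(\<integral>t. R t \<partial>lborel) = Re (CLINT t:{0..}|lborel. F (of_real t))"
    unfolding R_def set_lebesgue_integral_def using int1 unfolding set_integrable_def by (rule integral_Re)
  finally show "Re (\<integral>t. ?k t \<partial>lborel) < 0" using neg by linarith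
qed

section \<open>The local limit theorem in mean\<close>

lemma density_enn2real:
  assumes [measurable]: "d \<in> borel_measurable borel" and fin: "(\<integral>\<^sup>+x. d x \<partial>lborel) < \<infinity>"
  shows "AE x in lborel. d x = ennreal (enn2real (d x))" "integrable lborel (\<lambda>x. enn2real (d x))"
    "density lborel d = density lborel (\<lambda>x. ennreal (enn2real (d x)))"
    "finite_borel_measure (density lborel d)"
proof -
  have "AE x in lborel. d x \<noteq> \<infinity>" using fin by (intro nn_integral_PInf_AE) auto
  then show ae: "AE x in lborel. d x = ennreal (enn2real (d x))" by eventually_elim (simp add: less_top)
  then have "(\<integral>\<^sup>+x. ennreal (enn2real (d x)) \<partial>lborel) = (\<integral>\<^sup>+x. d x \<partial>lborel)"
    by (intro nn_integral_cong_AE) auto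
  then show "integrable lborel (\<lambda>x. enn2real (d x))" using fin by (intro integrableI_nonneg) auto
  show "density lborel d = density lborel (\<lambda>x. ennreal (enn2real (d x)))"
    using ae by (intro density_cong) auto
  show "finite_borel_measure (density lborel d)"
  proof (intro finite_borel_measure.intro finite_measureI finite_borel_measure_axioms.intro)
    show "emeasure (density lborel d) (space (density lborel d)) \<noteq> \<infinity>"
      using fin by (simp add: emeasure_density)
  qed simp
qed

lemma char_density_enn:
  assumes [measurable]: "d \<in> borel_measurable borel" and fin: "(\<integral>\<^sup>+x. d x \<partial>lborel) < \<infinity>"
  shows "char (density lborel d) t = (\<integral>x. enn2real (d x) *\<^sub>R iexp (t * x) \<partial>lborel)"
  unfolding density_enn2real(3)[OF assms] char_def by (subst integral_density) auto

lemma char_density_add: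
  assumes [measurable]: "d \<in> borel_measurable borel" "g \<in> borel_measurable borel"
    and fin: "(\<integral>\<^sup>+x. d x \<partial>lborel) < \<infinity>" "(\<integral>\<^sup>+x. g x \<partial>lborel) < \<infinity>"
  shows "char (density lborel (\<lambda>x. d x + g x)) t = char (density lborel d) t + char (density lborel g) t"
proof -
  have i: "integrable lborel (\<lambda>x. enn2real (d x) *\<^sub>R iexp (t * x))" "integrable lborel (\<lambda>x. enn2real (g x) *\<^sub>R iexp (t * x))"
    by (rule Bochner_Integration.integrable_bound[OF density_enn2real(2)[OF _ fin(1)]]; simp)
       (rule Bochner_Integration.integrable_bound[OF density_enn2real(2)[OF _ fin(2)]]; simp)
  have s: "(\<integral>\<^sup>+x. d x + g x \<partial>lborel) < \<infinity>" using fin by (subst nn_integral_add) auto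
  have "char (density lborel (\<lambda>x. d x + g x)) t = (\<integral>x. enn2real (d x + g x) *\<^sub>R iexp (t * x) \<partial>lborel)"
    by (rule char_density_enn[OF _ s]) simp
  also have "\<dots> = (\<integral>x. enn2real (d x) *\<^sub>R iexp (t * x) + enn2real (g x) *\<^sub>R iexp (t * x) \<partial>lborel)"
  proof (rule integral_cong_AE)
    have "AE x in lborel. d x \<noteq> \<infinity>" "AE x in lborel. g x \<noteq> \<infinity>"
      by (intro nn_integral_PInf_AE; use fin in simp)+
    then show "AE x in lborel. enn2real (d x + g x) *\<^sub>R iexp (t * x) = enn2real (d x) *\<^sub>R iexp (t * x) + enn2real (g x) *\<^sub>R iexp (t * x)"
      by eventually_elim (simp add: enn2real_plus less_top scaleR_add_left)
  qed auto
  also have "\<dots> = (\<integral>x. enn2real (d x) *\<^sub>R iexp (t * x) \<partial>lborel) + (\<integral>x. enn2real (g x) *\<^sub>R iexp (t * x) \<partial>lborel)"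
    by (rule Bochner_Integration.integral_add[OF i])
  finally show ?thesis
    unfolding char_density_enn[OF assms(1) fin(1)] char_density_enn[OF assms(2) fin(2)] .
qed

text \<open>Truncating \<open>p0\<close> at a height \<open>K\<close> gives a bounded, hence square integrable, density; the square of its
  characteristic function is therefore integrable, and this bounds \<open>G\<close>.\<close>
lemma block_split:
  assumes W0: "real_distribution W0" and [measurable]: "p0 \<in> borel_measurable borel"
    and Wp: "W0 = density lborel p0" and ent: "(\<integral>\<^sup>+x. p0 x * lnp (p0 x) \<partial>lborel) < \<infinity>"
  obtains d2 g2 :: "real \<Rightarrow> ennreal" and G :: "real \<Rightarrow> real" and \<epsilon> :: real
  where "d2 \<in> borel_measurable borel" "g2 \<in> borel_measurable borel" "(W0 \<star> W0) = density lborel d2"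
    "\<And>x. g2 x \<le> d2 x" "(\<integral>\<^sup>+x. g2 x \<partial>lborel) = ennreal \<epsilon>" "0 \<le> \<epsilon>" "\<epsilon> < 1"
    "(\<integral>\<^sup>+x. g2 x * lnp (g2 x) \<partial>lborel) < \<infinity>" "integrable lborel G"
    "\<And>t. cmod (char (W0 \<star> W0) t - char (density lborel g2) t) \<le> G t"
    "\<And>e. e > 0 \<Longrightarrow> \<exists>T. \<forall>t. \<bar>t\<bar> \<ge> T \<longrightarrow> cmod (char (W0 \<star> W0) t) \<le> \<epsilon> + e"
proof -
  interpret W0: real_distribution W0 by fact
  have p1: "(\<integral>\<^sup>+x. p0 x \<partial>lborel) = 1"
    using W0.emeasure_space_1 unfolding Wp by (simp add: emeasure_density)
  \<comment> \<open>If every truncation had zero mass, \<open>p0\<close> would vanish wherever it is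
    finite, that is almost everywhere.\<close>
  obtain K :: nat where K: "(\<integral>\<^sup>+x. p0 x * indicator {x. p0 x \<le> of_nat K} x \<partial>lborel) > 0"
  proof (rule ccontr)
    assume no: "\<not> thesis"
    have z: "AE x in lborel. p0 x * indicator {x. p0 x \<le> of_nat K} x = 0" for K :: nat
    proof -
      have "\<not> (\<integral>\<^sup>+x. p0 x * indicator {x. p0 x \<le> of_nat K} x \<partial>lborel) > 0" using no that by blast
      then have "(\<integral>\<^sup>+x. p0 x * indicator {x. p0 x \<le> of_nat K} x \<partial>lborel) = 0" by simp
      then show ?thesis by (subst (asm) nn_integral_0_iff_AE) auto
    qed
    have "AE x in lborel. p0 x \<noteq> \<infinity>" using p1 by (intro nn_integral_PInf_AE) auto
    moreover have "AE x in lborel. \<forall>K::nat. p0 x * indicator {x. p0 x \<le> of_nat K} x = 0"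
      by (subst AE_all_countable) (use z in blast)
    ultimately have "AE x in lborel. p0 x = 0"
    proof eventually_elim
      case (elim x)
      then obtain r where r: "p0 x = ennreal r" "0 \<le> r" by (cases "p0 x") auto
      obtain k :: nat where k: "r \<le> real k" using real_arch_simple by blast
      have "p0 x \<le> of_nat k" unfolding r(1) using k by (metis ennreal_leI ennreal_of_nat_eq_real_of_nat)
      then show ?case using spec[OF elim(2), of k] by simp
    qed
    then have "(\<integral>\<^sup>+x. p0 x \<partial>lborel) = 0" by (subst nn_integral_0_iff_AE) auto
    then show False using p1 by simp
  qed
  define h where "h x = enn2real (p0 x * indicator {x. p0 x \<le> of_nat K} x)" for x
  have [measurable]: "h \<in> borel_measurable borel" unfolding h_def[abs_def] by measurable
  have he: "ennreal (h x) = p0 x * indicator {x. p0 x \<le> of_nat K} x" for x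
  proof (cases "p0 x \<le> of_nat K")
    case True
    then have "p0 x < \<top>" by (rule le_less_trans) (metis ennreal_less_top ennreal_of_nat_eq_real_of_nat)
    then show ?thesis using True by (simp add: h_def)
  qed (simp add: h_def)
  have h0: "0 \<le> h x" for x by (simp add: h_def)
  have hK: "h x \<le> real K" for x
  proof -
    have "ennreal (h x) \<le> of_nat K" unfolding he by (auto simp: indicator_def)
    then have "ennreal (h x) \<le> ennreal (real K)" by (simp add: ennreal_of_nat_eq_real_of_nat)
    then show ?thesis by simp
  qed
  have hp: "ennreal (h x) \<le> p0 x" for x unfolding he by (auto simp: indicator_def)
  define q where "q = (\<integral>\<^sup>+x. ennreal (h x) \<partial>lborel)"
  have q0: "q > 0" using K unfolding q_def he by simp
  have q1: "q \<le> 1" unfolding q_def p1[symmetric] by (intro nn_integral_mono hp)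
  have ih: "integrable lborel h" using q1 h0 unfolding q_def by (intro integrableI_nonneg) (auto intro: le_less_trans)
  define H where "H = density lborel (\<lambda>x. ennreal (h x))"
  have fH: "finite_borel_measure H" unfolding H_def by (rule finite_borel_density[OF ih h0])
  interpret H: finite_borel_measure H by fact
  have fW: "finite_borel_measure W0" by (rule W0.finite_borel_measure_axioms)
  have HU: "emeasure H UNIV = q" unfolding H_def q_def by (simp add: emeasure_density)
  have HW: "H \<le> W0"
    unfolding H_def Wp
  proof (subst measure_le_iff, simp, rule allI)
    fix A :: "real set"
    show "emeasure (density lborel (\<lambda>x. ennreal (h x))) A \<le> emeasure (density lborel p0) A"
    proof (cases "A \<in> sets borel")
      case True
      then show ?thesis by (simp add: emeasure_density) (intro nn_integral_mono mult_right_mono hp, simp)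
    qed (simp add: emeasure_notin_sets)
  qed
  define d2 where "d2 = conv_density p0 W0"
  define d1 where "d1 = conv_density (\<lambda>x. ennreal (h x)) H"
  \<comment> \<open>Only the square of the bounded part is taken out; the cross terms remain in
    \<open>g2\<close>. With \<open>q\<close> the mass of the bounded part, the mass left is
    \<open>1 - q * q\<close>, hence below one.\<close>
  define g2 where "g2 x = d2 x - d1 x" for x
  have [measurable]: "d2 \<in> borel_measurable borel" "d1 \<in> borel_measurable borel"
    unfolding d2_def d1_def by (auto intro!: conv_density_measurable fH fW)
  have [measurable]: "g2 \<in> borel_measurable borel" unfolding g2_def[abs_def] by measurable
  have WW: "(W0 \<star> W0) = density lborel d2"
    unfolding d2_def using convolution_density_measure[OF fW, of p0] W0.finite_measure_axioms unfolding Wp[symmetric] by simp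
  have HH: "(H \<star> H) = density lborel d1"
    unfolding d1_def using convolution_density_measure[OF fH, of "\<lambda>x. ennreal (h x)"] H.finite_measure_axioms unfolding H_def[symmetric] by simp
  have d12: "d1 x \<le> d2 x" for x
  proof -
    have "d1 x \<le> (\<integral>\<^sup>+y. p0 (x - y) \<partial>H)" unfolding d1_def conv_density_def by (intro nn_integral_mono hp)
    also have "\<dots> \<le> d2 x" unfolding d2_def conv_density_def by (rule nn_integral_mono_measure) (auto simp: HW)
    finally show ?thesis .
  qed
  have sum: "d2 x = d1 x + g2 x" for x unfolding g2_def using d12[of x] by (simp add: add_diff_inverse_ennreal)
  have id2: "(\<integral>\<^sup>+x. d2 x \<partial>lborel) = 1"
    unfolding d2_def using nn_integral_conv_density[OF fW, of p0] p1 W0.emeasure_space_1 by simp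
  have id1: "(\<integral>\<^sup>+x. d1 x \<partial>lborel) = q * q"
    unfolding d1_def using nn_integral_conv_density[OF fH, of "\<lambda>x. ennreal (h x)"] HU by (simp add: q_def)
  have ig2: "1 = q * q + (\<integral>\<^sup>+x. g2 x \<partial>lborel)"
    unfolding id2[symmetric] id1[symmetric] sum by (rule nn_integral_add) auto
  obtain qr where qr: "q = ennreal qr" "0 < qr" "qr \<le> 1"
    using q0 q1 by (cases q) (auto simp: top_unique)
  define \<epsilon> where "\<epsilon> = 1 - qr * qr"
  have \<epsilon>: "0 \<le> \<epsilon>" "\<epsilon> < 1" using qr by (auto simp: \<epsilon>_def mult_le_one)
  have ig: "(\<integral>\<^sup>+x. g2 x \<partial>lborel) = ennreal \<epsilon>"
  proof -
    have "ennreal (qr * qr) + ennreal \<epsilon> = ennreal (qr * qr + \<epsilon>)" using \<epsilon> qr by (intro ennreal_plus[symmetric]) auto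
    also have "\<dots> = 1" by (simp add: \<epsilon>_def)
    also have "1 = ennreal (qr * qr) + (\<integral>\<^sup>+x. g2 x \<partial>lborel)"
      using ig2 unfolding qr(1) using qr by (simp add: ennreal_mult[symmetric])
    finally show ?thesis by (simp add: ennreal_add_left_cancel)
  qed
  have g2d2: "g2 x \<le> d2 x" for x unfolding sum by simp
  have eg: "(\<integral>\<^sup>+x. g2 x * lnp (g2 x) \<partial>lborel) < \<infinity>"
  proof -
    have "(\<integral>\<^sup>+x. g2 x * lnp (g2 x) \<partial>lborel) \<le> (\<integral>\<^sup>+x. d2 x * lnp (d2 x) \<partial>lborel)"
      by (intro nn_integral_mono mult_mono g2d2 lnp_mono) auto
    also have "\<dots> \<le> emeasure W0 UNIV * ((\<integral>\<^sup>+x. p0 x * lnp (p0 x) \<partial>lborel) + (\<integral>\<^sup>+x. d2 x \<partial>lborel))"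
      unfolding d2_def by (rule conv_density_entropy[OF fW]) simp
    also have "\<dots> < \<infinity>" using ent W0.emeasure_space_1 by (simp add: id2)
    finally show ?thesis .
  qed
  define G where "G t = (cmod (char H t))\<^sup>2" for t
  have iG: "integrable lborel G" unfolding G_def[abs_def] H_def by (rule char_density_sq_integrable[OF ih h0 hK])
  have fd1: "(\<integral>\<^sup>+x. d1 x \<partial>lborel) < \<infinity>" unfolding id1 qr(1) by (simp add: ennreal_mult_less_top)
  have fg2: "(\<integral>\<^sup>+x. g2 x \<partial>lborel) < \<infinity>" unfolding ig by simp
  have ch: "char (W0 \<star> W0) t = (char H t)\<^sup>2 + char (density lborel g2) t" for t
  proof -
    have "char (W0 \<star> W0) t = char (density lborel (\<lambda>x. d1 x + g2 x)) t" unfolding WW by (simp add: sum[symmetric])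
    also have "\<dots> = char (density lborel d1) t + char (density lborel g2) t" by (rule char_density_add[OF _ _ fd1 fg2]) auto
    also have "char (density lborel d1) t = (char H t)\<^sup>2"
      unfolding HH[symmetric] by (simp add: char_convolution'[OF fH fH] power2_eq_square)
    finally show ?thesis .
  qed
  have chG: "cmod (char (W0 \<star> W0) t - char (density lborel g2) t) \<le> G t" for t
    unfolding ch G_def by (simp add: norm_power)
  have cg2: "cmod (char (density lborel g2) t) \<le> \<epsilon>" for t
  proof -
    interpret g: finite_borel_measure "density lborel g2" by (rule density_enn2real(4)[OF _ fg2]) simp
    have "emeasure (density lborel g2) (space (density lborel g2)) = ennreal \<epsilon>" by (simp add: emeasure_density ig)
    then have "measure (density lborel g2) (space (density lborel g2)) = \<epsilon>" using \<epsilon> by (simp add: measure_def)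
    then show ?thesis using g.cmod_char_le[of t] by simp
  qed
  \<comment> \<open>The square of the characteristic function of the bounded part vanishes at
    infinity by square integrability; that of \<open>g2\<close> never exceeds its mass
    \<epsilon>.\<close>
  have far: "\<exists>T. \<forall>t. \<bar>t\<bar> \<ge> T \<longrightarrow> cmod (char (W0 \<star> W0) t) \<le> \<epsilon> + e" if e: "e > 0" for e
  proof -
    obtain T where T: "\<And>t. \<bar>t\<bar> \<ge> T \<Longrightarrow> cmod (char H t) \<le> sqrt e"
      using H.char_vanishes_at_infinity[OF iG, of "sqrt e"] e unfolding G_def by auto
    have "cmod (char (W0 \<star> W0) t) \<le> \<epsilon> + e" if "\<bar>t\<bar> \<ge> T" for t
    proof -
      have "(cmod (char H t))\<^sup>2 \<le> (sqrt e)\<^sup>2" using T[OF that] by (intro power_mono) auto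
      then have "cmod ((char H t)\<^sup>2) \<le> e" using e by (simp add: norm_power)
      then show ?thesis unfolding ch using norm_triangle_ineq[of "(char H t)\<^sup>2" "char (density lborel g2) t"] cg2[of t] by linarith
    qed
    then show ?thesis by blast
  qed
  show ?thesis
    by (rule that[OF _ _ WW g2d2 ig \<epsilon> eg iG chG far]) auto
qed

text \<open>For \<open>\<bar>t\<bar> \<le> \<delta> b n\<close> the integrand is dominated by \<open>stable_scaling.small_scale_lower\<close>; beyond that range
  one of the \<open>j n\<close> factors contributes the integrable \<open>G\<close> and the others decay geometrically.\<close>
lemma local_limit_L1:
  fixes f \<Gamma> \<phi> :: "real \<Rightarrow> complex" and a b :: "nat \<Rightarrow> real"
  assumes S: "stable_scaling (\<lambda>s. cmod (f s)) b c \<alpha>"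
    and [measurable]: "f \<in> borel_measurable borel" "\<Gamma> \<in> borel_measurable borel"
    and feven: "\<And>s. cmod (f (- s)) = cmod (f s)"
    and \<Gamma>: "\<And>s. cmod (\<Gamma> s) \<le> \<epsilon>" "0 \<le> \<epsilon>" "\<epsilon> < 1"
    and B: "B > 0" and G: "integrable lborel G" "\<And>s. cmod (f s ^ B - \<Gamma> s) \<le> G s"
    and far: "\<And>d. d > 0 \<Longrightarrow> \<exists>\<eta><1. 0 \<le> \<eta> \<and> (\<forall>s. \<bar>s\<bar> \<ge> d \<longrightarrow> cmod (f s) \<le> \<eta>)"
    and lim: "\<And>t. (\<lambda>n. iexp (- (t * a n)) * f (t / b n) ^ n) \<longlonglongrightarrow> \<phi> t"
    and \<phi>: "integrable lborel \<phi>"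
  defines "j \<equiv> \<lambda>n. n div (2 * B)"
  defines "\<xi> \<equiv> \<lambda>n t. iexp (- (t * a n)) * (f (t / b n) ^ (n - B * j n) * ((f (t / b n) ^ B) ^ j n - \<Gamma> (t / b n) ^ j n))"
  shows "\<And>n. n \<ge> 1 \<Longrightarrow> integrable lborel (\<xi> n)"
    and "(\<lambda>n. \<integral>t. cmod (\<xi> n t - \<phi> t) \<partial>lborel) \<longlonglongrightarrow> 0"
proof -
  interpret S: stable_scaling "\<lambda>s. cmod (f s)" b c \<alpha> by fact
  have f1: "cmod (f s) \<le> 1" for s by (rule S.g_le_1)
  have G0: "0 \<le> G s" for s using G(2)[of s] norm_ge_zero order_trans by blast
  have [measurable]: "G \<in> borel_measurable borel" "\<phi> \<in> borel_measurable borel" using G \<phi> by auto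
  have [measurable]: "\<xi> n \<in> borel_measurable borel" for n unfolding \<xi>_def by measurable
  \<comment> \<open>At least half of the factors \<open>f\<close> lie outside the blocks. They alone
    provide decay, since the difference of block powers is only bounded by 2.\<close>
  have Bj: "2 * (B * j n) \<le> n" for n unfolding j_def
    by (metis div_times_less_eq_dividend mult.assoc mult.commute)
  have fB1: "cmod (f s ^ B) \<le> 1" for s unfolding norm_power using f1 by (intro power_le_one) auto
  have \<Gamma>1: "cmod (\<Gamma> s) \<le> 1" for s using \<Gamma>(1)[of s] \<Gamma>(3) by linarith
  have nchi: "cmod (\<xi> n t) = cmod (f (t / b n)) ^ (n - B * j n) * cmod ((f (t / b n) ^ B) ^ j n - \<Gamma> (t / b n) ^ j n)" for n t
    unfolding \<xi>_def norm_mult norm_power[symmetric] norm_exp_i_times by simp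
  have pd: "cmod ((f s ^ B) ^ k - \<Gamma> s ^ k) \<le> real k * G s" for k s
  proof -
    have "cmod ((f s ^ B) ^ k - \<Gamma> s ^ k) \<le> real k * cmod (f s ^ B - \<Gamma> s)" by (rule norm_power_diff[OF fB1 \<Gamma>1])
    also have "\<dots> \<le> real k * G s" by (intro mult_left_mono G) auto
    finally show ?thesis .
  qed
  have iGb: "integrable lborel (\<lambda>t. G (t / b n))" if "n \<ge> 1" for n
    using lborel_integrable_real_affine[OF G(1), of "1 / b n" 0] S.b_pos[OF that] by simp
  show ichi: "integrable lborel (\<xi> n)" if n: "n \<ge> 1" for n
  proof (rule Bochner_Integration.integrable_bound[OF integrable_mult_right[OF iGb[OF n], of "real (j n)"]])
    show "AE t in lborel. norm (\<xi> n t) \<le> norm (real (j n) * G (t / b n))"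
    proof (rule AE_I2)
      fix t
      have "cmod (\<xi> n t) \<le> 1 * (real (j n) * G (t / b n))"
        unfolding nchi using f1 by (intro mult_mono pd power_le_one) auto
      then show "norm (\<xi> n t) \<le> norm (real (j n) * G (t / b n))" using G0 by simp
    qed
  qed simp
  obtain d k where d: "d > 0" and k: "k > 0"
    and low: "\<forall>\<^sub>F n in sequentially. \<forall>t. 1 \<le> t \<and> t \<le> d * b n \<longrightarrow> cmod (f (t / b n)) ^ n \<le> exp (- k * t powr (\<alpha> / 2))"
    using S.small_scale_lower by blast
  obtain N where N: "\<And>n. n \<ge> N \<Longrightarrow> n \<ge> 1 \<and> (\<forall>t. 1 \<le> t \<and> t \<le> d * b n \<longrightarrow> cmod (f (t / b n)) ^ n \<le> exp (- k * t powr (\<alpha> / 2)))"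
    using eventually_conj[OF eventually_ge_at_top[of 1] low] unfolding eventually_sequentially by auto
  obtain \<eta> where \<eta>: "\<eta> < 1" "0 \<le> \<eta>" "\<And>s. \<bar>s\<bar> \<ge> d \<Longrightarrow> cmod (f s) \<le> \<eta>" using far[OF d] by blast
  \<comment> \<open>The factor 2 bounds the difference of the block powers. The at least
    \<open>n / 2\<close> free factors give the square root of the bound
    \<open>exp (- k * t powr (\<alpha> / 2))\<close>, hence \<open>k / 2\<close>; on [-1, 1] they
    are bounded by one.\<close>
  define w where "w t = 2 * (indicator {-1..1} t * 1 + exp (- (k/2) * \<bar>t\<bar> powr (\<alpha> / 2)))" for t :: real
  have iw: "integrable lborel w" unfolding w_def[abs_def] using k S.\<alpha>
    by (intro integrable_mult_right Bochner_Integration.integrable_add integrable_indicator_Icc integrable_exp_powr) auto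
  \<comment> \<open>The cut at \<open>d * b n\<close> recedes to infinity, so \<open>A\<close> keeps
    the pointwise limit while being dominated by \<open>w\<close>.\<close>
  define A where "A n t = (if \<bar>t\<bar> \<le> d * b n then \<xi> n t else 0)" for n t
  have [measurable]: "A n \<in> borel_measurable borel" for n unfolding A_def[abs_def] by measurable
  have two: "cmod ((f s ^ B) ^ k - \<Gamma> s ^ k) \<le> 2" for s k
  proof -
    have "cmod ((f s ^ B) ^ k - \<Gamma> s ^ k) \<le> cmod ((f s ^ B) ^ k) + cmod (\<Gamma> s ^ k)" by (rule norm_triangle_ineq4)
    also have "\<dots> \<le> 1 + 1" unfolding norm_power[of _ k] using fB1 \<Gamma>1 by (intro add_mono power_le_one) auto
    finally show ?thesis by simp
  qed
  have Adom: "cmod (A n t) \<le> w t" if n: "n \<ge> N" for n t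
  proof (cases "\<bar>t\<bar> \<le> d * b n")
    case False then show ?thesis by (simp add: A_def w_def)
  next
    case True
    let ?m = "n - B * j n" and ?g = "cmod (f (t / b n))"
    have c2: "cmod (A n t) \<le> ?g ^ ?m * 2" using True unfolding A_def by (simp add: nchi mult_left_mono two)
    show ?thesis
    proof (cases "\<bar>t\<bar> \<le> 1")
      case t1: True
      have "?g ^ ?m * 2 \<le> 1 * 2" using f1 by (intro mult_right_mono power_le_one) auto
      also have "\<dots> \<le> w t" using t1 by (auto simp: w_def indicator_def abs_le_iff)
      finally show ?thesis using c2 by simp
    next
      case t1: False
      have g: "?g = cmod (f (\<bar>t\<bar> / b n))" using feven[of "t / b n"] by (cases "t \<ge> 0") auto
      have "(?g ^ ?m)\<^sup>2 = ?g ^ (2 * ?m)" by (simp add: power_mult[symmetric] mult.commute)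
      also have "\<dots> \<le> ?g ^ n" using Bj[of n] f1 by (intro power_decreasing) auto
      also have "\<dots> \<le> exp (- k * \<bar>t\<bar> powr (\<alpha> / 2))" unfolding g using N[OF n] t1 True by auto
      also have "\<dots> = (exp (- (k/2) * \<bar>t\<bar> powr (\<alpha> / 2)))\<^sup>2" by (simp add: power2_eq_square exp_add[symmetric])
      finally have "?g ^ ?m \<le> exp (- (k/2) * \<bar>t\<bar> powr (\<alpha> / 2))" by (rule power2_le_imp_le) simp
      moreover have "w t = 2 * indicator {-1..1} t + 2 * exp (- (k/2) * \<bar>t\<bar> powr (\<alpha> / 2))"
        by (simp only: w_def mult_1_right distrib_left)
      moreover have "0 \<le> (indicator {-1..1} t :: real)" by simp
      ultimately show ?thesis using c2 by linarith
    qed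
  qed
  have Alim: "(\<lambda>n. A n t) \<longlonglongrightarrow> \<phi> t" for t
  proof -
    have jtop: "filterlim j at_top sequentially"
      unfolding filterlim_at_top
    proof
      fix Z
      show "\<forall>\<^sub>F n in sequentially. Z \<le> j n"
        using eventually_ge_at_top[of "Z * (2 * B)"]
      proof eventually_elim
        case (elim n)
        then show ?case unfolding j_def using B by (metis div_le_mono div_mult_self_is_m nat_0_less_mult_iff zero_less_numeral)
      qed
    qed
    have "(\<lambda>n. \<epsilon> ^ j n) \<longlonglongrightarrow> 0"
      using filterlim_compose[OF LIMSEQ_power_zero[of \<epsilon>] jtop] \<Gamma> by simp
    then have z: "(\<lambda>n. iexp (- (t * a n)) * (f (t / b n) ^ (n - B * j n) * \<Gamma> (t / b n) ^ j n)) \<longlonglongrightarrow> 0"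
    proof (rule Lim_null_comparison[rotated], intro always_eventually allI)
      fix n
      have "cmod (f (t / b n) ^ (n - B * j n) * \<Gamma> (t / b n) ^ j n) \<le> 1 * \<epsilon> ^ j n"
        unfolding norm_mult norm_power using f1 \<Gamma> by (intro mult_mono power_mono power_le_one) auto
      then show "norm (iexp (- (t * a n)) * (f (t / b n) ^ (n - B * j n) * \<Gamma> (t / b n) ^ j n)) \<le> \<epsilon> ^ j n"
        unfolding norm_mult[of "iexp _"] norm_exp_i_times by simp
    qed
    have chi: "\<xi> n t = iexp (- (t * a n)) * f (t / b n) ^ n - iexp (- (t * a n)) * (f (t / b n) ^ (n - B * j n) * \<Gamma> (t / b n) ^ j n)" for n
    proof -
      have "f (t / b n) ^ (n - B * j n) * (f (t / b n) ^ B) ^ j n = f (t / b n) ^ n"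
        using Bj[of n] by (simp add: power_mult[symmetric] power_add[symmetric])
      then show ?thesis unfolding \<xi>_def right_diff_distrib by simp
    qed
    have "(\<lambda>n. \<xi> n t) \<longlonglongrightarrow> \<phi> t - 0" unfolding chi by (rule tendsto_diff[OF lim z])
    moreover have "\<forall>\<^sub>F n in sequentially. \<xi> n t = A n t"
    proof -
      have "\<forall>\<^sub>F n in sequentially. b n \<ge> \<bar>t\<bar> / d" using S.b_at_top by (auto simp: filterlim_at_top)
      then show ?thesis by eventually_elim (use d in \<open>auto simp: A_def divide_le_eq mult.commute\<close>)
    qed
    ultimately show ?thesis using Lim_transform_eventually by fastforce
  qed
  have "(\<lambda>n. \<integral>t. cmod (A (n + N) t - \<phi> t) \<partial>lborel) \<longlonglongrightarrow> (\<integral>t. 0 \<partial>(lborel :: real measure))"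
  proof (rule integral_dominated_convergence[where w="\<lambda>t. w t + cmod (\<phi> t)"])
    show "AE t in lborel. (\<lambda>n. cmod (A (n + N) t - \<phi> t)) \<longlonglongrightarrow> 0"
    proof (rule AE_I2)
      fix t
      have "(\<lambda>n. cmod (A (n + N) t - \<phi> t)) \<longlonglongrightarrow> cmod (\<phi> t - \<phi> t)"
        by (intro tendsto_intros LIMSEQ_ignore_initial_segment Alim)
      then show "(\<lambda>n. cmod (A (n + N) t - \<phi> t)) \<longlonglongrightarrow> 0" by simp
    qed
    show "AE t in lborel. norm (cmod (A (n + N) t - \<phi> t)) \<le> w t + cmod (\<phi> t)" for n
    proof (rule AE_I2)
      fix t
      show "norm (cmod (A (n + N) t - \<phi> t)) \<le> w t + cmod (\<phi> t)"
        using Adom[of "n + N" t] norm_triangle_ineq4[of "A (n + N) t" "\<phi> t"] by simp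
    qed
  qed (use iw \<phi> in auto)
  then have Aconv: "(\<lambda>n. \<integral>t. cmod (A n t - \<phi> t) \<partial>lborel) \<longlonglongrightarrow> 0" by (simp add: LIMSEQ_offset[of _ N])
  have sq: "0 \<le> sqrt \<eta>" "sqrt \<eta> < 1" using \<eta> by (auto simp: real_sqrt_lt_1_iff)
  \<comment> \<open>Beyond the cut each free factor is at most \<eta>, and
    \<open>\<eta> ^ (n - B * j n) \<le> sqrt \<eta> ^ n\<close> by \<open>Bj\<close>. Integrating
    \<open>G (t / b n)\<close> produces the factor \<open>b n\<close>.\<close>
  have Bb: "(\<integral>t. cmod (\<xi> n t - \<phi> t) \<partial>lborel) \<le> (\<integral>t. cmod (A n t - \<phi> t) \<partial>lborel) + real n * b n * sqrt \<eta> ^ n * (\<integral>t. G t \<partial>lborel)"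
    if n: "n \<ge> N" for n
  proof -
    have n1: "n \<ge> 1" using N[OF n] by simp
    have bn: "b n > 0" by (rule S.b_pos[OF n1])
    have iA: "integrable lborel (A n)"
    proof (rule Bochner_Integration.integrable_bound[OF iw])
      show "AE t in lborel. norm (A n t) \<le> norm (w t)"
      proof (rule AE_I2)
        fix t
        show "norm (A n t) \<le> norm (w t)" unfolding real_norm_def by (rule order_trans[OF Adom[OF n] abs_ge_self])
      qed
      show "A n \<in> borel_measurable lborel" by measurable
    qed
    have "(\<integral>t. cmod (\<xi> n t - \<phi> t) \<partial>lborel) \<le> (\<integral>t. cmod (A n t - \<phi> t) + real n * sqrt \<eta> ^ n * G (t / b n) \<partial>lborel)"
    proof (rule integral_mono)
      show "integrable lborel (\<lambda>t. cmod (\<xi> n t - \<phi> t))" by (intro integrable_norm Bochner_Integration.integrable_diff ichi n1 \<phi>)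
      show "integrable lborel (\<lambda>t. cmod (A n t - \<phi> t) + real n * sqrt \<eta> ^ n * G (t / b n))"
        by (intro Bochner_Integration.integrable_add integrable_norm Bochner_Integration.integrable_diff iA \<phi> integrable_mult_right iGb n1)
      fix t
      show "cmod (\<xi> n t - \<phi> t) \<le> cmod (A n t - \<phi> t) + real n * sqrt \<eta> ^ n * G (t / b n)"
      proof (cases "\<bar>t\<bar> \<le> d * b n")
        case True then show ?thesis using sq G0 by (simp add: A_def)
      next
        case False
        have "d \<le> \<bar>t / b n\<bar>" using False bn by (simp add: le_divide_eq)
        then have "cmod (f (t / b n)) \<le> \<eta>" by (rule \<eta>)
        then have "cmod (f (t / b n)) ^ (n - B * j n) \<le> \<eta> ^ (n - B * j n)" by (intro power_mono) auto
        also have "\<dots> = sqrt \<eta> ^ (2 * (n - B * j n))" using \<eta> by (simp add: power_mult)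
        also have "\<dots> \<le> sqrt \<eta> ^ n" using Bj[of n] sq by (intro power_decreasing) auto
        finally have fm: "cmod (f (t / b n)) ^ (n - B * j n) \<le> sqrt \<eta> ^ n" .
        have jn: "real (j n) \<le> real n" unfolding j_def by simp
        have "cmod (\<xi> n t) \<le> sqrt \<eta> ^ n * (real n * G (t / b n))"
          unfolding nchi using fm sq jn G0 by (intro mult_mono order_trans[OF pd] mult_right_mono) auto
        then show ?thesis using norm_triangle_ineq4[of "\<xi> n t" "\<phi> t"] False by (simp add: A_def mult.commute mult.left_commute)
      qed
    qed
    also have "\<dots> = (\<integral>t. cmod (A n t - \<phi> t) \<partial>lborel) + real n * sqrt \<eta> ^ n * (\<integral>t. G (t / b n) \<partial>lborel)"
      by (subst Bochner_Integration.integral_add)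
        (auto intro!: integrable_norm Bochner_Integration.integrable_diff iA \<phi> integrable_mult_right iGb n1)
    also have "(\<integral>t. G (t / b n) \<partial>lborel) = b n * (\<integral>t. G t \<partial>lborel)"
      using bn by (subst lborel_integral_real_affine[where c="b n" and t=0]) auto
    finally show ?thesis by (simp add: mult.commute mult.left_commute)
  qed
  have "(\<lambda>n. (\<integral>t. cmod (A n t - \<phi> t) \<partial>lborel) + real n * b n * sqrt \<eta> ^ n * (\<integral>t. G t \<partial>lborel)) \<longlonglongrightarrow> 0 + 0 * (\<integral>t. G t \<partial>lborel)"
    by (intro tendsto_intros Aconv S.subexponential sq)
  then have "(\<lambda>n. (\<integral>t. cmod (A n t - \<phi> t) \<partial>lborel) + real n * b n * sqrt \<eta> ^ n * (\<integral>t. G t \<partial>lborel)) \<longlonglongrightarrow> 0" by simp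
  then show "(\<lambda>n. \<integral>t. cmod (\<xi> n t - \<phi> t) \<partial>lborel) \<longlonglongrightarrow> 0"
  proof (rule Lim_null_comparison[rotated])
    show "\<forall>\<^sub>F n in sequentially. norm (\<integral>t. cmod (\<xi> n t - \<phi> t) \<partial>lborel) \<le> (\<integral>t. cmod (A n t - \<phi> t) \<partial>lborel) + real n * b n * sqrt \<eta> ^ n * (\<integral>t. G t \<partial>lborel)"
      using eventually_ge_at_top[of N] by eventually_elim (use Bb in simp)
  qed
qed

section \<open>Lower bound for non-extremal stable densities\<close>

lemma cmod_exp_minus_one_le:
  assumes "Re z \<le> 0"
  shows "cmod (exp z - 1) \<le> cmod z"
proof -
  have "cmod (exp z - exp 0) \<le> 1 * cmod (z - 0)"
    by (rule field_differentiable_bound[where S="{z. Re z \<le> 0}" and f'=exp])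
      (use assms in \<open>auto intro!: derivative_eq_intros convex_halfspace_Re_le\<close>)
  then show ?thesis by simp
qed

lemma shifted_erlang_eq: "shifted_erlang (of_real t) = cnj (iexp t * erlang_char t)"
  by (simp add: shifted_erlang_def erlang_char_def exp_cnj)

lemma integrable_shifted_erlang: "integrable lborel (\<lambda>t. shifted_erlang (of_real t))"
proof -
  have [measurable]: "erlang_char \<in> borel_measurable borel" using integrable_erlang_char by simp
  have "integrable lborel (\<lambda>t. iexp t * erlang_char t)"
    by (rule Bochner_Integration.integrable_bound[OF integrable_erlang_char]) (auto simp: norm_mult)
  then show ?thesis unfolding shifted_erlang_eq by (rule integrable_bounded_linear[OF bounded_linear_cnj])
qed

lemma char_inverse_erlang_shift:
  "char_inverse erlang_char (y - 1) = Re (\<integral>t. shifted_erlang (of_real t) * iexp (t * y) \<partial>lborel) / (2 * pi)"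
proof -
  have "(\<integral>t. shifted_erlang (of_real t) * iexp (t * y) \<partial>lborel) = (\<integral>t. cnj (iexp (- (t * (y - 1))) * erlang_char t) \<partial>lborel)"
  proof (rule Bochner_Integration.integral_cong[OF refl])
    fix t :: real
    have "iexp (t * y) = cnj (iexp (- (t * y)))" by (simp add: exp_cnj)
    moreover have "iexp (- (t * (y - 1))) = iexp t * iexp (- (t * y))"
      by (simp add: exp_add[symmetric] algebra_simps)
    ultimately show "shifted_erlang (of_real t) * iexp (t * y) = cnj (iexp (- (t * (y - 1))) * erlang_char t)"
      unfolding shifted_erlang_eq by simp
  qed
  also have "\<dots> = cnj (\<integral>t. iexp (- (t * (y - 1))) * erlang_char t \<partial>lborel)"
    by (rule integral_bounded_linear'[OF bounded_linear_cnj bounded_linear_cnj]) simp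
  finally show ?thesis by (simp add: char_inverse_def)
qed

lemma (in real_distribution) integral_char_inverse_erlang:
  "(\<integral>y. char_inverse erlang_char (y - 1) \<partial>M) = Re (\<integral>t. shifted_erlang (of_real t) * char M t \<partial>lborel) / (2 * pi)"
proof -
  interpret pair_sigma_finite "lborel :: real measure" M ..
  have [measurable]: "(\<lambda>t. shifted_erlang (of_real t)) \<in> borel_measurable borel" using integrable_shifted_erlang by simp
  have int: "integrable (lborel \<Otimes>\<^sub>M M) (\<lambda>(t, y). shifted_erlang (of_real t) * iexp (t * y))"
  proof (rule Fubini_integrable)
    have "(\<integral>y. norm (case (t, y) of (t, y) \<Rightarrow> shifted_erlang (of_real t) * iexp (t * y)) \<partial>M) = cmod (shifted_erlang (of_real t))" for t
      using prob_space by (simp add: norm_mult del: of_real_mult)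
    then show "integrable lborel (\<lambda>t. \<integral>y. norm (case (t, y) of (t, y) \<Rightarrow> shifted_erlang (of_real t) * iexp (t * y)) \<partial>M)"
      using integrable_norm[OF integrable_shifted_erlang] by simp
    show "AE t in lborel. integrable M (\<lambda>y. case (t, y) of (t, y) \<Rightarrow> shifted_erlang (of_real t) * iexp (t * y))"
      by (intro AE_I2) (auto intro!: integrable_mult_right integrable_iexp_mult[simplified])
  qed measurable
  have i1: "integrable M (\<lambda>y. \<integral>t. shifted_erlang (of_real t) * iexp (t * y) \<partial>lborel)"
    using integrable_snd[OF int] by simp
  have "(\<integral>y. char_inverse erlang_char (y - 1) \<partial>M) = Re (\<integral>y. (\<integral>t. shifted_erlang (of_real t) * iexp (t * y) \<partial>lborel) \<partial>M) / (2 * pi)"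
    unfolding char_inverse_erlang_shift using integral_Re[OF i1] by simp
  also have "(\<integral>y. (\<integral>t. shifted_erlang (of_real t) * iexp (t * y) \<partial>lborel) \<partial>M) = (\<integral>t. (\<integral>y. shifted_erlang (of_real t) * iexp (t * y) \<partial>M) \<partial>lborel)"
    using Fubini_integral[OF int] by simp
  also have "\<dots> = (\<integral>t. shifted_erlang (of_real t) * char M t \<partial>lborel)"
    unfolding char_def by (intro Bochner_Integration.integral_cong refl integral_mult_right_zero)
  finally show ?thesis .
qed

text \<open>Up to a constant this is the test function at 0, a point outside its support. It removes
  the term of order zero in the expansion for small \<open>l\<close>.\<close>

lemma Re_integral_shifted_erlang: "Re (\<integral>t. shifted_erlang (of_real t) \<partial>lborel) = 0"
proof -
  have "char_inverse erlang_char (0 - 1) = 0" by (simp add: char_inverse_erlang)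
  then show ?thesis unfolding char_inverse_erlang_shift by simp
qed

text \<open>The test function \<open>x\<^sup>2 exp (- x)\<close> on the half-line has an explicit transform, so Parseval reduces the
  right tail of the stable law to the line integral that was rotated onto the imaginary axis.\<close>
lemma stable_functional_lower:
  assumes \<alpha>: "0 < \<alpha>" "\<alpha> < 2" and \<beta>: "-1 < \<beta>" "\<beta> < 1"
  shows "\<exists>c>0. \<exists>l0>0. \<forall>l P. 0 < l \<and> l < l0 \<and> real_distribution P \<and> (\<forall>t. char P t = exp (- of_real l * stable_log_char \<alpha> \<beta> t))
    \<longrightarrow> c * l \<le> (\<integral>y. char_inverse erlang_char (y - 1) \<partial>P)"
proof -
  let ?s = "stable_log_char \<alpha> \<beta>" and ?k = "\<lambda>t::real. shifted_erlang (of_real t)"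
  define L where "L = - Re (\<integral>t. ?k t * ?s t \<partial>lborel) / (2 * pi)"
  have L: "L > 0" using stable_line_integral_neg(2)[OF \<alpha> \<beta>] by (simp add: L_def divide_less_0_iff)
  have ik: "integrable lborel ?k" by (rule integrable_shifted_erlang)
  have iks: "integrable lborel (\<lambda>t. ?k t * ?s t)" by (rule stable_line_integral_neg(1)[OF \<alpha> \<beta>])
  have [measurable]: "?k \<in> borel_measurable borel" using ik by simp
  have [measurable]: "?s \<in> borel_measurable borel" unfolding stable_log_char_def[abs_def] stable_omega_def by measurable
  define m where "m l = Re (\<integral>t. ?k t * exp (- of_real l * ?s t) \<partial>lborel) / (2 * pi)" for l :: real
  \<comment> \<open>\<open>L\<close> is the right derivative of \<open>m\<close> at 0:
    differentiation of the exponential under the integral brings down minus the stable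
    exponent.\<close>
  have "((\<lambda>l. m l / l) \<longlongrightarrow> L) (at_right 0)"
    unfolding tendsto_at_iff_sequentially
  proof (intro allI impI)
    fix X :: "nat \<Rightarrow> real" assume X: "\<forall>i. X i \<in> {0<..} - {0}" and X0: "X \<longlonglongrightarrow> 0"
    have Xp: "X i > 0" for i using X by auto
    have Re0: "Re (- of_real (X n) * ?s t) \<le> 0" for n t using Xp[of n] by (simp add: Re_stable_log_char)
    have ie: "integrable lborel (\<lambda>t. ?k t * exp (- of_real (X n) * ?s t))" for n
    proof (rule Bochner_Integration.integrable_bound[OF ik])
      show "AE t in lborel. norm (?k t * exp (- of_real (X n) * ?s t)) \<le> norm (?k t)"
        using Re0[of n] by (auto simp: norm_mult mult_left_le)
    qed measurable
    have "(\<lambda>n. \<integral>t. ?k t * ((exp (- of_real (X n) * ?s t) - 1) / of_real (X n)) \<partial>lborel) \<longlonglongrightarrow> (\<integral>t. ?k t * (- ?s t) \<partial>lborel)"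
    proof (rule integral_dominated_convergence[where w="\<lambda>t. cmod (?k t * ?s t)"])
      show "AE t in lborel. (\<lambda>n. ?k t * ((exp (- of_real (X n) * ?s t) - 1) / of_real (X n))) \<longlonglongrightarrow> ?k t * (- ?s t)"
      proof (rule AE_I2)
        fix t
        have "((\<lambda>z. exp (z * (- ?s t))) has_field_derivative (- ?s t)) (at 0)" by (auto intro!: derivative_eq_intros)
        then have "((\<lambda>z. (exp (z * (- ?s t)) - 1) / z) \<longlongrightarrow> - ?s t) (at 0)" by (simp add: has_field_derivative_iff)
        moreover have "filterlim (\<lambda>n. complex_of_real (X n)) (at 0) sequentially"
          unfolding filterlim_at using tendsto_of_real[OF X0, where 'a=complex] Xp by (auto simp: less_imp_neq[symmetric] intro!: always_eventually)
        ultimately have "(\<lambda>n. (exp (of_real (X n) * (- ?s t)) - 1) / of_real (X n)) \<longlonglongrightarrow> - ?s t" by (rule filterlim_compose)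
        then show "(\<lambda>n. ?k t * ((exp (- of_real (X n) * ?s t) - 1) / of_real (X n))) \<longlonglongrightarrow> ?k t * (- ?s t)"
          by (intro tendsto_mult tendsto_const) simp
      qed
      show "AE t in lborel. norm (?k t * ((exp (- of_real (X n) * ?s t) - 1) / of_real (X n))) \<le> cmod (?k t * ?s t)" for n
      proof (rule AE_I2)
        fix t
        \<comment> \<open>The nonpositive real part makes the difference quotient at most the
          modulus of the exponent, uniformly in \<open>n\<close>.\<close>
        have "cmod (exp (- of_real (X n) * ?s t) - 1) \<le> X n * cmod (?s t)"
          using cmod_exp_minus_one_le[OF Re0[of n t]] Xp[of n] by (simp add: norm_mult)
        then have "cmod ((exp (- of_real (X n) * ?s t) - 1) / of_real (X n)) \<le> cmod (?s t)"
          using Xp[of n] by (simp add: norm_divide divide_le_eq mult.commute)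
        then show "norm (?k t * ((exp (- of_real (X n) * ?s t) - 1) / of_real (X n))) \<le> cmod (?k t * ?s t)"
          unfolding norm_mult by (intro mult_left_mono) auto
      qed
      show "integrable lborel (\<lambda>t. cmod (?k t * ?s t))" using iks by (rule integrable_norm)
    qed measurable
    from tendsto_Re[OF this]
    have "(\<lambda>n. Re (\<integral>t. ?k t * ((exp (- of_real (X n) * ?s t) - 1) / of_real (X n)) \<partial>lborel) / (2 * pi)) \<longlonglongrightarrow> Re (\<integral>t. ?k t * (- ?s t) \<partial>lborel) / (2 * pi)"
      by (intro tendsto_divide tendsto_const) auto
    also have "Re (\<integral>t. ?k t * (- ?s t) \<partial>lborel) / (2 * pi) = L" by (simp add: L_def)
    also have "(\<lambda>n. Re (\<integral>t. ?k t * ((exp (- of_real (X n) * ?s t) - 1) / of_real (X n)) \<partial>lborel) / (2 * pi)) = (\<lambda>n. m (X n) / X n)"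
    proof (rule ext)
      fix n
      have "(\<integral>t. ?k t * ((exp (- of_real (X n) * ?s t) - 1) / of_real (X n)) \<partial>lborel)
        = (\<integral>t. (?k t * exp (- of_real (X n) * ?s t) - ?k t) / of_real (X n) \<partial>lborel)"
        by (intro Bochner_Integration.integral_cong refl) (simp add: algebra_simps)
      also have "\<dots> = ((\<integral>t. ?k t * exp (- of_real (X n) * ?s t) \<partial>lborel) - (\<integral>t. ?k t \<partial>lborel)) / of_real (X n)"
        by (subst integral_divide_zero, subst Bochner_Integration.integral_diff[OF ie ik]) simp
      finally have eq: "(\<integral>t. ?k t * ((exp (- of_real (X n) * ?s t) - 1) / of_real (X n)) \<partial>lborel)
         = ((\<integral>t. ?k t * exp (- of_real (X n) * ?s t) \<partial>lborel) - (\<integral>t. ?k t \<partial>lborel)) / of_real (X n)" .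
      have "Re (\<integral>t. ?k t * ((exp (- of_real (X n) * ?s t) - 1) / of_real (X n)) \<partial>lborel)
         = Re (\<integral>t. ?k t * exp (- of_real (X n) * ?s t) \<partial>lborel) / X n"
        unfolding eq Re_divide_of_real minus_complex.sel Re_integral_shifted_erlang by simp
      note re = this
      show "Re (\<integral>t. ?k t * ((exp (- of_real (X n) * ?s t) - 1) / of_real (X n)) \<partial>lborel) / (2 * pi) = m (X n) / X n"
        unfolding m_def re by (simp only: divide_divide_eq_left mult.commute)
    qed
    finally show "((\<lambda>l. m l / l) \<circ> X) \<longlonglongrightarrow> L" by (simp add: comp_def)
  qed
  then have "\<forall>\<^sub>F l in at_right 0. m l / l > L / 2" using L by (intro order_tendstoD) auto
  then obtain l0 where l0: "l0 > 0" "\<And>l. 0 < l \<Longrightarrow> l < l0 \<Longrightarrow> m l / l > L / 2"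
    unfolding eventually_at_right_field by auto
  have main: "L / 2 * l \<le> (\<integral>y. char_inverse erlang_char (y - 1) \<partial>P)"
    if "0 < l" "l < l0" "real_distribution P" "\<And>t. char P t = exp (- of_real l * ?s t)" for l P
  proof -
    interpret P: real_distribution P by fact
    have "(\<integral>y. char_inverse erlang_char (y - 1) \<partial>P) = m l"
      unfolding P.integral_char_inverse_erlang m_def using that(4) by simp
    then show ?thesis using l0(2)[of l] that(1,2) by (simp add: less_divide_eq)
  qed
  show ?thesis
    by (rule exI[of _ "L / 2"], rule conjI[OF half_gt_zero[OF L]], rule exI[of _ l0], rule conjI[OF l0(1)])
      (blast intro: main)
qed

text \<open>Homogeneous of degree \<alpha>, except that at \<open>\<alpha> = 1\<close> the logarithm
  turns scaling into an additional drift linear in \<open>t\<close>.\<close>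

lemma stable_log_char_scale:
  assumes "\<sigma> > 0"
  shows "stable_log_char \<alpha> \<beta> (\<sigma> * t) = of_real (\<sigma> powr \<alpha>) * stable_log_char \<alpha> \<beta> t
    + (if \<alpha> = 1 then \<i> * of_real (\<beta> * 2 / pi * t * \<sigma> * ln \<sigma>) else 0)"
proof (cases "t = 0")
  case True
  then show ?thesis by (simp add: stable_log_char_def)
next
  case False
  have s: "sgn (\<sigma> * t) = sgn t" using assms by (simp add: sgn_mult)
  have p: "\<bar>\<sigma> * t\<bar> powr \<alpha> = \<sigma> powr \<alpha> * \<bar>t\<bar> powr \<alpha>" using assms by (simp add: abs_mult powr_mult)
  show ?thesis
  proof (cases "\<alpha> = 1")
    case True
    have l: "ln \<bar>\<sigma> * t\<bar> = ln \<sigma> + ln \<bar>t\<bar>" using assms False by (simp add: abs_mult ln_mult)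
    have ts: "t = \<bar>t\<bar> * sgn t" by (cases "t = 0") (auto simp: sgn_if)
    have "stable_log_char \<alpha> \<beta> (\<sigma> * t) = of_real (\<sigma> * \<bar>t\<bar>) * (1 + \<i> * of_real (\<beta> * sgn t * (2 / pi * (ln \<sigma> + ln \<bar>t\<bar>))))"
      unfolding stable_log_char_def stable_omega_def s p l using True assms False by simp
    also have "\<dots> = of_real \<sigma> * (of_real \<bar>t\<bar> * (1 + \<i> * of_real (\<beta> * sgn t * (2 / pi * ln \<bar>t\<bar>))))
       + \<i> * of_real (\<beta> * 2 / pi * (\<bar>t\<bar> * sgn t) * \<sigma> * ln \<sigma>)"
      by (simp add: complex_eq_iff algebra_simps add_divide_distrib)
    also have "\<dots> = of_real (\<sigma> powr \<alpha>) * stable_log_char \<alpha> \<beta> t + \<i> * of_real (\<beta> * 2 / pi * t * \<sigma> * ln \<sigma>)"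
      unfolding stable_log_char_def stable_omega_def ts[symmetric] using True assms False by simp
    finally show ?thesis using True by simp
  next
    case f: False
    then show ?thesis unfolding stable_log_char_def stable_omega_def s p by simp
  qed
qed

section \<open>The right tail of the stable law\<close>

lemma stable_char_eq: "stable_char \<alpha> \<beta> a c t = exp (\<i> * of_real (a * t) - of_real c * stable_log_char \<alpha> \<beta> t)"
  unfolding stable_char_def stable_log_char_def by (simp add: mult.assoc)

lemma cmod_stable_char: "cmod (stable_char \<alpha> \<beta> a c t) = exp (- c * \<bar>t\<bar> powr \<alpha>)"
  unfolding stable_char_eq by (simp add: Re_stable_log_char)

text \<open>The test function vanishes below 1, is at most 1 everywhere and decays exponentially,
  which turns a lower bound for its mean into one for the probability of \<open>[1, R]\<close>. Both
  estimates use the quadratic Taylor bound for \<open>exp\<close>.\<close>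

lemma erlang_shift_le:
  assumes R: "R \<ge> 1"
  shows "char_inverse erlang_char (y - 1) \<le> indicator {1..R} y + 4 * exp (- (R - 1) / 2)"
proof (cases "y < 1")
  case True
  then show ?thesis by (simp add: char_inverse_erlang)
next
  case False
  define x where "x = y - 1"
  have x: "x \<ge> 0" using False by (simp add: x_def)
  have v: "char_inverse erlang_char (y - 1) = x\<^sup>2 / 2 * exp (- x)"
    using x by (simp add: char_inverse_erlang x_def)
  have e: "1 + z + z\<^sup>2 / 2 \<le> exp z" if "z \<ge> 0" for z :: real using exp_lower_Taylor_quadratic[OF that] .
  show ?thesis
  proof (cases "y \<le> R")
    case True
    have "x\<^sup>2 / 2 * exp (- x) \<le> exp x * exp (- x)" using e[OF x] x by (intro mult_right_mono) auto
    also have "\<dots> = 1" by (simp add: exp_add[symmetric])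
    finally have "char_inverse erlang_char (y - 1) \<le> 1" unfolding v .
    moreover have "indicator {1..R} y = (1 :: real)" using True False by simp
    moreover have "0 \<le> 4 * exp (- (R - 1) / 2)" by simp
    ultimately show ?thesis by linarith
  next
    case f: False
    have "x\<^sup>2 / 2 \<le> 4 * exp (x / 2)" using e[of "x / 2"] x by (simp add: power_divide)
    then have "x\<^sup>2 / 2 * exp (- x) \<le> 4 * exp (x / 2) * exp (- x)" by (intro mult_right_mono) auto
    also have "\<dots> = 4 * exp (- x / 2)" by (simp add: exp_add[symmetric] mult.assoc)
    also have "\<dots> \<le> 4 * exp (- (R - 1) / 2)" using f by (simp add: x_def)
    finally show ?thesis using v f by simp
  qed
qed

text \<open>After recentring and division by \<open>R\<close> the law has scale constant
  \<open>c * R powr (- \<alpha>)\<close>, so the functional bound for small \<open>l\<close>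
  applies. The test function is cut at \<open>R\<close>, where the error is exponentially small
  against this constant; hence the finite right end of order \<open>R^2\<close>, which later allows
  finitely many tiles.\<close>

lemma stable_tail_lower:
  assumes Q: "real_distribution Q" and ch: "\<And>t. char Q t = stable_char \<alpha> \<beta> a c t"
    and \<alpha>: "0 < \<alpha>" "\<alpha> < 2" and \<beta>: "-1 < \<beta>" "\<beta> < 1" and c: "c > 0"
  shows "\<exists>k>0. \<exists>R0\<ge>1. \<forall>R\<ge>R0. k * R powr (- \<alpha>) \<le> measure Q {R / 2<..2 * R\<^sup>2}"
proof -
  interpret Q: real_distribution Q by fact
  obtain k l0 where k: "k > 0" and l0: "l0 > 0" and low: "\<And>l P. 0 < l \<Longrightarrow> l < l0 \<Longrightarrow> real_distribution P \<Longrightarrow>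
      (\<And>t. char P t = exp (- of_real l * stable_log_char \<alpha> \<beta> t)) \<Longrightarrow> k * l \<le> (\<integral>y. char_inverse erlang_char (y - 1) \<partial>P)"
    using stable_functional_lower[OF \<alpha> \<beta>] by metis
  \<comment> \<open>The centre that cancels the location \<open>a\<close> and, for
    \<open>\<alpha> = 1\<close>, the logarithmic drift caused by the rescaling.\<close>
  define m where "m R = (if \<alpha> = 1 then a + c * \<beta> * 2 / pi * ln R else a)" for R
  have E: "k * (c * R powr (- \<alpha>)) - 4 * exp (- (R - 1) / 2) \<le> measure Q {m R + R..m R + R\<^sup>2}"
    if R: "R \<ge> 1" and l: "c * R powr (- \<alpha>) < l0" for R
  proof -
    define P where "P = distr Q borel (\<lambda>x. x / R - m R / R)"
    interpret P: real_distribution P unfolding P_def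
      by (intro real_distribution.intro Q.prob_space_distr real_distribution_axioms.intro) auto
    have lp: "c * R powr (- \<alpha>) > 0" using c R by simp
    have chP: "char P t = exp (- of_real (c * R powr (- \<alpha>)) * stable_log_char \<alpha> \<beta> t)" for t
    proof -
      have "char P t = iexp (- (t * (m R / R))) * char Q (t / R)" unfolding P_def by (rule Q.char_affine)
      also have "\<dots> = exp (\<i> * of_real (- (t * (m R / R))) + (\<i> * of_real (a * (t / R)) - of_real c * stable_log_char \<alpha> \<beta> ((1 / R) * t)))"
        unfolding ch stable_char_eq by (simp only: exp_add[symmetric] mult_1_left times_divide_eq_left)
      also have "stable_log_char \<alpha> \<beta> ((1 / R) * t) = of_real (R powr (- \<alpha>)) * stable_log_char \<alpha> \<beta> t
          + (if \<alpha> = 1 then \<i> * of_real (\<beta> * 2 / pi * t * (1 / R) * (- ln R)) else 0)"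
      proof -
        have "(1 / R) powr \<alpha> = R powr (- \<alpha>)" using R by (simp add: powr_divide powr_minus_divide)
        moreover have "ln (1 / R) = - ln R" using R by (simp add: ln_div)
        ultimately show ?thesis using R by (subst stable_log_char_scale) auto
      qed
      also have "\<i> * of_real (- (t * (m R / R))) + (\<i> * of_real (a * (t / R)) - of_real c * (of_real (R powr (- \<alpha>)) * stable_log_char \<alpha> \<beta> t
          + (if \<alpha> = 1 then \<i> * of_real (\<beta> * 2 / pi * t * (1 / R) * (- ln R)) else 0)))
        = - of_real (c * R powr (- \<alpha>)) * stable_log_char \<alpha> \<beta> t"
        using R by (cases "\<alpha> = 1") (simp_all add: m_def complex_eq_iff field_simps)
      finally show ?thesis .
    qed
    have "k * (c * R powr (- \<alpha>)) \<le> (\<integral>y. char_inverse erlang_char (y - 1) \<partial>P)"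
      by (rule low[OF lp l P.real_distribution_axioms chP])
    also have "\<dots> \<le> (\<integral>y. indicator {1..R} y + 4 * exp (- (R - 1) / 2) \<partial>P)"
    proof (rule integral_mono)
      have [measurable]: "char_inverse erlang_char \<in> borel_measurable borel"
        by (rule char_inverse_borel_measurable[OF integrable_erlang_char])
      show "integrable P (\<lambda>y. char_inverse erlang_char (y - 1))"
        by (rule P.integrable_const_bound[of _ "\<integral>t. cmod (erlang_char t) \<partial>lborel"]) (auto intro!: char_inverse_le integrable_erlang_char)
      show "integrable P (\<lambda>y. indicator {1..R} y + 4 * exp (- (R - 1) / 2))"
        by (rule P.integrable_const_bound[of _ "1 + 4 * exp (- (R - 1) / 2)"]) (auto simp: indicator_def)
    qed (rule erlang_shift_le[OF R])
    also have "\<dots> = measure P {1..R} + 4 * exp (- (R - 1) / 2)"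
      using P.prob_space by (subst Bochner_Integration.integral_add) (auto simp: P.emeasure_eq_measure)
    also have "measure P {1..R} = measure Q {m R + R..m R + R\<^sup>2}"
    proof -
      have "(\<lambda>x. x / R - m R / R) -` {1..R} \<inter> space Q = {m R + R..m R + R\<^sup>2}"
        using R by (auto simp: field_simps power2_eq_square)
      then show ?thesis unfolding P_def by (subst measure_distr) auto
    qed
    finally show ?thesis by simp
  qed
  have e1: "\<forall>\<^sub>F R in at_top. c * R powr (- \<alpha>) < l0"
  proof -
    have "((\<lambda>R. c * R powr (- \<alpha>)) \<longlongrightarrow> c * 0) at_top"
      using \<alpha> by (intro tendsto_intros tendsto_neg_powr filterlim_ident) auto
    then show ?thesis using l0 by (intro order_tendstoD) auto
  qed
  have e2: "\<forall>\<^sub>F R in at_top. 4 * exp (- (R - 1) / 2) \<le> k * c / 2 * R powr (- \<alpha>)"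
  proof -
    have "((\<lambda>R::real. 4 * exp (- (R - 1) / 2) * R powr \<alpha>) \<longlongrightarrow> 0) at_top" by real_asymp
    then have "\<forall>\<^sub>F R in at_top. 4 * exp (- (R - 1) / 2) * R powr \<alpha> < k * c / 2" using k c by (intro order_tendstoD) auto
    then show ?thesis using eventually_gt_at_top[of 0]
      by eventually_elim (simp add: powr_minus field_simps)
  qed
  \<comment> \<open>This places \<open>{m R + R..m R + R^2}\<close> inside the interval of the
    claim.\<close>
  have e3: "\<forall>\<^sub>F R in at_top. \<bar>m R\<bar> < R / 2"
  proof -
    have "((\<lambda>R::real. (a + c * \<beta> * 2 / pi * ln R) / R) \<longlongrightarrow> 0) at_top" "((\<lambda>R::real. a / R) \<longlongrightarrow> 0) at_top"
    proof -
      have l: "((\<lambda>R::real. ln R / R) \<longlongrightarrow> 0) at_top" and i: "((\<lambda>R::real. 1 / R) \<longlongrightarrow> 0) at_top" by real_asymp+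
      have "((\<lambda>R::real. a * (1 / R) + c * \<beta> * 2 / pi * (ln R / R)) \<longlongrightarrow> a * 0 + c * \<beta> * 2 / pi * 0) at_top"
        by (intro tendsto_intros l i)
      then show "((\<lambda>R::real. (a + c * \<beta> * 2 / pi * ln R) / R) \<longlongrightarrow> 0) at_top" by (simp add: add_divide_distrib)
      have "((\<lambda>R::real. a * (1 / R)) \<longlongrightarrow> a * 0) at_top" by (intro tendsto_intros i)
      then show "((\<lambda>R::real. a / R) \<longlongrightarrow> 0) at_top" by simp
    qed
    then have "((\<lambda>R. m R / R) \<longlongrightarrow> 0) at_top" unfolding m_def by (cases "\<alpha> = 1") auto
    then have "((\<lambda>R. \<bar>m R / R\<bar>) \<longlongrightarrow> 0) at_top" by (rule tendsto_rabs_zero)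
    then have "\<forall>\<^sub>F R in at_top. \<bar>m R / R\<bar> < 1/2" by (intro order_tendstoD) auto
    then show ?thesis using eventually_gt_at_top[of 0]
      by eventually_elim (simp add: divide_less_eq)
  qed
  have "\<forall>\<^sub>F R in at_top. R \<ge> 1 \<and> k * c / 2 * R powr (- \<alpha>) \<le> measure Q {R / 2<..2 * R\<^sup>2}"
    using e1 e2 e3 eventually_ge_at_top[of 1]
  proof eventually_elim
    case (elim R)
    have "R \<le> R\<^sup>2" using elim(4) by (simp add: power2_eq_square)
    then have "{m R + R..m R + R\<^sup>2} \<subseteq> {R / 2<..2 * R\<^sup>2}" using elim(3,4) by (auto simp: abs_less_iff)
    then have "measure Q {m R + R..m R + R\<^sup>2} \<le> measure Q {R / 2<..2 * R\<^sup>2}" by (intro Q.finite_measure_mono) auto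
    then show ?case using E[OF elim(4,1)] elim(2,4) by (simp add: algebra_simps)
  qed
  then obtain R0 where R0: "\<And>R. R \<ge> R0 \<Longrightarrow> R \<ge> 1 \<and> k * c / 2 * R powr (- \<alpha>) \<le> measure Q {R / 2<..2 * R\<^sup>2}"
    unfolding eventually_at_top_linorder by auto
  show ?thesis
    by (intro exI[of _ "k * c / 2"] exI[of _ "max R0 1"]) (use k c R0 in auto)
qed

text \<open>For independent copies, \<open>X\<close> has the law of
  \<open>\<sigma> * X' + \<tau> * X'' + d\<close>, as
  \<open>\<sigma> powr \<alpha> + \<tau> powr \<alpha> = 1\<close>. Conditioning on
  \<open>X'\<close> writes the density as an average of rescaled copies of itself. The shift
  \<open>d\<close> restores the location, with the drift of \<open>stable_log_char_scale\<close>
  when \<open>\<alpha> = 1\<close>.\<close>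

lemma stable_self_similar:
  assumes Q: "real_distribution Q" and ch: "\<And>t. char Q t = stable_char \<alpha> \<beta> a c t"
    and \<alpha>: "0 < \<alpha>" and c: "c > 0" and \<sigma>: "0 < \<sigma>" "\<sigma> < 1"
  defines "\<tau> \<equiv> (1 - \<sigma> powr \<alpha>) powr (1 / \<alpha>)"
  defines "d \<equiv> a - a * (\<sigma> + \<tau>) + (if \<alpha> = 1 then c * \<beta> * 2 / pi * (\<sigma> * ln \<sigma> + \<tau> * ln \<tau>) else 0)"
  shows "char_inverse (char Q) x = (\<integral>z. char_inverse (char Q) ((x - d - \<sigma> * z) / \<tau>) \<partial>Q) / \<tau>"
proof -
  interpret Q: real_distribution Q by fact
  interpret pair_sigma_finite "lborel :: real measure" Q ..
  have s1: "\<sigma> powr \<alpha> < 1" using powr_less_mono2[of \<alpha> \<sigma> 1] \<alpha> \<sigma> by simp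
  have \<tau>: "\<tau> > 0" using s1 by (simp add: \<tau>_def)
  have \<tau>\<alpha>: "\<tau> powr \<alpha> = 1 - \<sigma> powr \<alpha>" using \<alpha> s1 by (simp add: \<tau>_def powr_powr)
  have \<phi>: "integrable lborel (char Q)"
  proof (rule Bochner_Integration.integrable_bound[OF integrable_exp_powr[OF \<alpha> c]])
    show "char Q \<in> borel_measurable lborel" using Q.char_measurable by simp
  qed (simp add: ch cmod_stable_char)
  have [measurable]: "char Q \<in> borel_measurable borel" by (rule Q.char_measurable)
  have mult: "iexp (t * d) * (char Q (\<sigma> * t) * char Q (\<tau> * t)) = char Q t" for t
  proof -
    have "iexp (t * d) * (char Q (\<sigma> * t) * char Q (\<tau> * t)) = exp (\<i> * of_real (t * d)
        + ((\<i> * of_real (a * (\<sigma> * t)) - of_real c * stable_log_char \<alpha> \<beta> (\<sigma> * t)) + (\<i> * of_real (a * (\<tau> * t)) - of_real c * stable_log_char \<alpha> \<beta> (\<tau> * t))))"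
      unfolding ch stable_char_eq by (simp only: exp_add)
    also have "\<i> * of_real (t * d)
        + ((\<i> * of_real (a * (\<sigma> * t)) - of_real c * stable_log_char \<alpha> \<beta> (\<sigma> * t)) + (\<i> * of_real (a * (\<tau> * t)) - of_real c * stable_log_char \<alpha> \<beta> (\<tau> * t)))
      = \<i> * of_real (a * t) - of_real c * stable_log_char \<alpha> \<beta> t"
      unfolding stable_log_char_scale[OF \<sigma>(1)] stable_log_char_scale[OF \<tau>] \<tau>\<alpha> d_def
      by (cases "\<alpha> = 1") (simp_all add: complex_eq_iff field_simps)
    finally show ?thesis unfolding ch stable_char_eq .
  qed
  let ?g = "\<lambda>s z. iexp (- (s * ((x - d - \<sigma> * z) / \<tau>))) * char Q s"
  have int: "integrable (lborel \<Otimes>\<^sub>M Q) (\<lambda>(s, z). ?g s z)"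
  proof (rule Fubini_integrable)
    have "(\<integral>z. norm (case (s, z) of (s, z) \<Rightarrow> ?g s z) \<partial>Q) = cmod (char Q s)" for s
      using Q.prob_space by (simp add: norm_mult del: of_real_mult of_real_minus of_real_divide of_real_diff)
    then show "integrable lborel (\<lambda>s. \<integral>z. norm (case (s, z) of (s, z) \<Rightarrow> ?g s z) \<partial>Q)"
      using integrable_norm[OF \<phi>] by simp
    show "AE s in lborel. integrable Q (\<lambda>z. case (s, z) of (s, z) \<Rightarrow> ?g s z)"
    proof (rule AE_I2)
      fix s
      show "integrable Q (\<lambda>z. case (s, z) of (s, z) \<Rightarrow> ?g s z)"
        by (rule Q.integrable_const_bound[of _ "cmod (char Q s)"])
          (auto simp: norm_mult simp del: of_real_mult of_real_minus of_real_divide of_real_diff)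
    qed
  qed measurable
  have i1: "integrable Q (\<lambda>z. \<integral>s. ?g s z \<partial>lborel)" using integrable_snd[OF int] by simp
  have "(\<integral>z. char_inverse (char Q) ((x - d - \<sigma> * z) / \<tau>) \<partial>Q) = Re (\<integral>z. (\<integral>s. ?g s z \<partial>lborel) \<partial>Q) / (2 * pi)"
    unfolding char_inverse_def using integral_Re[OF i1] by simp
  also have "(\<integral>z. (\<integral>s. ?g s z \<partial>lborel) \<partial>Q) = (\<integral>s. (\<integral>z. ?g s z \<partial>Q) \<partial>lborel)"
    using Fubini_integral[OF int] by simp
  also have "\<dots> = (\<integral>s. iexp (- (s * ((x - d) / \<tau>))) * (char Q (\<sigma> * s / \<tau>) * char Q s) \<partial>lborel)"
  proof (rule Bochner_Integration.integral_cong[OF refl])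
    fix s
    have "(\<integral>z. ?g s z \<partial>Q) = (\<integral>z. iexp (- (s * ((x - d) / \<tau>))) * char Q s * iexp ((\<sigma> * s / \<tau>) * z) \<partial>Q)"
    proof (rule Bochner_Integration.integral_cong[OF refl])
      fix z
      have "- (s * ((x - d - \<sigma> * z) / \<tau>)) = - (s * ((x - d) / \<tau>)) + (\<sigma> * s / \<tau>) * z"
        using \<tau> by (simp add: field_simps)
      then have "iexp (- (s * ((x - d - \<sigma> * z) / \<tau>))) = iexp (- (s * ((x - d) / \<tau>))) * iexp ((\<sigma> * s / \<tau>) * z)"
        by (simp only: of_real_add distrib_left exp_add)
      then show "?g s z = iexp (- (s * ((x - d) / \<tau>))) * char Q s * iexp ((\<sigma> * s / \<tau>) * z)" by (simp only: mult_ac)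
    qed
    also have "\<dots> = iexp (- (s * ((x - d) / \<tau>))) * char Q s * char Q (\<sigma> * s / \<tau>)"
      unfolding char_def[of Q "\<sigma> * s / \<tau>"] by (rule integral_mult_right_zero)
    finally show "(\<integral>z. ?g s z \<partial>Q) = iexp (- (s * ((x - d) / \<tau>))) * (char Q (\<sigma> * s / \<tau>) * char Q s)" by (simp only: mult_ac)
  qed
  also have "\<dots> = \<tau> *\<^sub>R (\<integral>t. iexp (- (t * x)) * char Q t \<partial>lborel)"
  proof (subst lborel_integral_real_affine[where c=\<tau> and t=0])
    have "iexp (- ((0 + \<tau> * t) * ((x - d) / \<tau>))) * (char Q (\<sigma> * (0 + \<tau> * t) / \<tau>) * char Q (0 + \<tau> * t)) = iexp (- (t * x)) * char Q t" for t
    proof -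
      have "- ((0 + \<tau> * t) * ((x - d) / \<tau>)) = - (t * x) + t * d" "\<sigma> * (0 + \<tau> * t) / \<tau> = \<sigma> * t"
        using \<tau> by (simp_all add: field_simps)
      then have "iexp (- ((0 + \<tau> * t) * ((x - d) / \<tau>))) * (char Q (\<sigma> * (0 + \<tau> * t) / \<tau>) * char Q (0 + \<tau> * t))
        = iexp (- (t * x)) * (iexp (t * d) * (char Q (\<sigma> * t) * char Q (\<tau> * t)))"
        by (simp only: of_real_add distrib_left exp_add add_0_left mult.assoc)
      then show ?thesis by (simp only: mult)
    qed
    then show "\<bar>\<tau>\<bar> *\<^sub>R (\<integral>t. iexp (- ((0 + \<tau> * t) * ((x - d) / \<tau>))) * (char Q (\<sigma> * (0 + \<tau> * t) / \<tau>) * char Q (0 + \<tau> * t)) \<partial>lborel)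
      = \<tau> *\<^sub>R (\<integral>t. iexp (- (t * x)) * char Q t \<partial>lborel)"
      using \<tau> by (simp only: abs_of_pos)
  qed (use \<tau> in simp)
  finally have "(\<integral>z. char_inverse (char Q) ((x - d - \<sigma> * z) / \<tau>) \<partial>Q) = \<tau> * char_inverse (char Q) x"
    by (simp add: char_inverse_def)
  then show ?thesis using \<tau> by simp
qed

section \<open>From the tail to a pointwise bound\<close>

lemma measure_tiles:
  fixes A q :: real
  assumes Q: "real_distribution Q" and A: "A > 0" and q: "q \<ge> 1"
  shows "measure Q {A<..A * q ^ N} \<le> (\<Sum>i<N. measure Q {A * q ^ i<..A * q ^ Suc i})"
proof (induction N)
  case (Suc N)
  interpret Q: real_distribution Q by fact
  have "measure Q {A<..A * q ^ Suc N} \<le> measure Q ({A<..A * q ^ N} \<union> {A * q ^ N<..A * q ^ Suc N})"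
    by (intro Q.finite_measure_mono) auto
  also have "\<dots> \<le> measure Q {A<..A * q ^ N} + measure Q {A * q ^ N<..A * q ^ Suc N}"
    by (rule measure_Un_le) auto
  finally show ?case using Suc by simp
qed simp

text \<open>By self-similarity \<open>\<psi> x \<ge> \<kappa> * Q {z. \<bar>x - p - \<sigma> * z\<bar> \<le> \<rho>}\<close> for all small \<open>\<sigma>\<close>.  The tail mass of
  \<open>{R / 2<..2 * R\<^sup>2}\<close> is divided among geometric tiles, and \<open>\<sigma>\<close> is chosen to move the heaviest tile next to \<open>x\<close>.\<close>
lemma stable_density_lower_right:
  assumes Q: "real_distribution Q" and ch: "\<And>t. char Q t = stable_char \<alpha> \<beta> a c t"
    and \<alpha>: "0 < \<alpha>" "\<alpha> < 2" and \<beta>: "-1 < \<beta>" "\<beta> < 1" and c: "c > 0"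
    and p: "char_inverse (char Q) p > 0"
  shows "\<exists>C>0. \<forall>x\<ge>p. C * (1 + \<bar>x\<bar>) powr (- (\<alpha> + 2)) \<le> char_inverse (char Q) x"
proof -
  interpret Q: real_distribution Q by fact
  define \<psi> where "\<psi> = char_inverse (char Q)"
  have \<phi>: "integrable lborel (char Q)"
  proof (rule Bochner_Integration.integrable_bound[OF integrable_exp_powr[OF \<alpha>(1) c]])
    show "char Q \<in> borel_measurable lborel" using Q.char_measurable by simp
  qed (simp add: ch cmod_stable_char)
  have \<psi>0: "\<psi> x \<ge> 0" for x unfolding \<psi>_def by (rule Q.char_inverse_nonneg[OF \<phi>])
  have \<psi>c: "isCont \<psi> x" for x unfolding \<psi>_def by (rule continuous_char_inverse[OF \<phi>])
  have [measurable]: "\<psi> \<in> borel_measurable borel" unfolding \<psi>_def by (rule char_inverse_borel_measurable[OF \<phi>])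
  define \<kappa> where "\<kappa> = \<psi> p / 2"
  have \<kappa>: "\<kappa> > 0" using p by (simp add: \<kappa>_def \<psi>_def)
  obtain r where r: "r > 0" and rd: "\<And>y. dist y p < r \<Longrightarrow> dist (\<psi> y) (\<psi> p) < \<kappa>"
    using \<psi>c[of p] \<kappa> unfolding continuous_at_eps_delta by blast
  have r2: "\<psi> y > \<kappa>" if "\<bar>y - p\<bar> < r" for y
    using rd[of y] that unfolding dist_real_def \<kappa>_def by linarith
  \<comment> \<open>Three errors of at most \<rho> each (position in the tile, the shift
    \<open>d \<sigma>\<close>, and \<open>p * (1 - \<tau> \<sigma>)\<close>), divided by
    \<open>\<tau> \<sigma> > 3/4\<close>, amount to at most \<open>4 * \<rho>\<close>, below the
    radius \<open>r\<close> on which the density exceeds \<kappa>.\<close>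
  define \<rho> where "\<rho> = r / 5"
  have \<rho>: "\<rho> > 0" using r by (simp add: \<rho>_def)
  have near: "\<psi> y \<ge> \<kappa>" if "\<bar>y - p\<bar> \<le> 4 * \<rho>" for y using r2[of y] that r by (simp add: \<rho>_def)
  define \<tau> where "\<tau> \<sigma> = (1 - \<sigma> powr \<alpha>) powr (1 / \<alpha>)" for \<sigma>
  define d where "d \<sigma> = a - a * (\<sigma> + \<tau> \<sigma>) + (if \<alpha> = 1 then c * \<beta> * 2 / pi * (\<sigma> * ln \<sigma> + \<tau> \<sigma> * ln (\<tau> \<sigma>)) else 0)" for \<sigma>
  have id0: "((\<lambda>\<sigma>::real. \<sigma>) \<longlongrightarrow> 0) (at_right 0)" by (rule tendsto_ident_at)
  have ps: "((\<lambda>\<sigma>. \<sigma> powr \<alpha>) \<longlongrightarrow> 0) (at_right 0)"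
  proof -
    have "((\<lambda>\<sigma>. \<sigma> powr \<alpha>) \<longlongrightarrow> 0 powr \<alpha>) (at_right 0)"
    proof (rule tendsto_powr2[OF id0 tendsto_const])
      show "\<forall>\<^sub>F \<sigma> in at_right 0. (0::real) \<le> \<sigma>" using eventually_at_right_less[of "0::real"] by eventually_elim simp
    qed (use \<alpha> in simp)
    then show ?thesis by simp
  qed
  have \<tau>1: "(\<tau> \<longlongrightarrow> 1) (at_right 0)"
  proof -
    have "((\<lambda>\<sigma>. (1 - \<sigma> powr \<alpha>) powr (1 / \<alpha>)) \<longlongrightarrow> (1 - 0) powr (1 / \<alpha>)) (at_right 0)"
      by (intro tendsto_intros ps) auto
    then show ?thesis unfolding \<tau>_def[abs_def] by simp
  qed
  have xl: "((\<lambda>\<sigma>::real. \<sigma> * ln \<sigma>) \<longlongrightarrow> 0) (at_right 0)" by real_asymp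
  have d0: "(d \<longlongrightarrow> 0) (at_right 0)"
  proof -
    have 1: "((\<lambda>\<sigma>. a - a * (\<sigma> + \<tau> \<sigma>)) \<longlongrightarrow> a - a * (0 + 1)) (at_right 0)" by (intro tendsto_intros id0 \<tau>1)
    have "((\<lambda>\<sigma>. c * \<beta> * 2 / pi * (\<sigma> * ln \<sigma> + \<tau> \<sigma> * ln (\<tau> \<sigma>))) \<longlongrightarrow> c * \<beta> * 2 / pi * (0 + 1 * ln 1)) (at_right 0)"
      by (intro tendsto_intros xl \<tau>1) auto
    then have 2: "((\<lambda>\<sigma>. c * \<beta> * 2 / pi * (\<sigma> * ln \<sigma> + \<tau> \<sigma> * ln (\<tau> \<sigma>))) \<longlongrightarrow> 0) (at_right 0)" by simp
    show ?thesis
    proof (cases "\<alpha> = 1")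
      case True
      then show ?thesis using tendsto_add[OF 1 2] unfolding d_def[abs_def] by simp
    next
      case False
      then show ?thesis using 1 unfolding d_def[abs_def] by simp
    qed
  qed
  have ptau: "((\<lambda>\<sigma>. \<bar>p\<bar> * \<bar>1 - \<tau> \<sigma>\<bar>) \<longlongrightarrow> 0) (at_right 0)"
  proof -
    have "((\<lambda>\<sigma>. \<bar>p\<bar> * \<bar>1 - \<tau> \<sigma>\<bar>) \<longlongrightarrow> \<bar>p\<bar> * \<bar>1 - 1\<bar>) (at_right 0)" by (intro tendsto_intros \<tau>1)
    then show ?thesis by simp
  qed
  have "\<forall>\<^sub>F \<sigma> in at_right 0. \<tau> \<sigma> > 3/4 \<and> \<bar>d \<sigma>\<bar> < \<rho> \<and> \<bar>p\<bar> * \<bar>1 - \<tau> \<sigma>\<bar> < \<rho> \<and> \<sigma> < 1"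
    using order_tendstoD(1)[OF \<tau>1, of "3/4"] order_tendstoD(2)[OF tendsto_rabs_zero[OF d0] \<rho>] order_tendstoD(2)[OF ptau \<rho>]
      order_tendstoD(2)[OF id0, of 1]
    by (auto intro!: eventually_conj)
  then obtain \<sigma>1 where \<sigma>1: "\<sigma>1 > 0" "\<And>\<sigma>. 0 < \<sigma> \<Longrightarrow> \<sigma> < \<sigma>1 \<Longrightarrow> \<tau> \<sigma> > 3/4 \<and> \<bar>d \<sigma>\<bar> < \<rho> \<and> \<bar>p\<bar> * \<bar>1 - \<tau> \<sigma>\<bar> < \<rho> \<and> \<sigma> < 1"
    unfolding eventually_at_right_field by auto
  define \<sigma>0 where "\<sigma>0 = \<sigma>1 / 2"
  have \<sigma>0: "\<sigma>0 > 0" using \<sigma>1 by (simp add: \<sigma>0_def)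
  \<comment> \<open>In the self-similar average only \<open>z\<close> in \<open>S\<close> is kept;
    there the inner density is evaluated within \<open>4 * \<rho>\<close> of \<open>p\<close>. The
    outer factor \<open>1 / \<tau> \<sigma>\<close> is at least one.\<close>
  have key: "\<kappa> * measure Q S \<le> \<psi> x"
    if \<sigma>: "0 < \<sigma>" "\<sigma> \<le> \<sigma>0" and S: "S \<in> sets borel" "\<And>z. z \<in> S \<Longrightarrow> \<bar>x - p - \<sigma> * z\<bar> \<le> \<rho>" for \<sigma> S x
  proof -
    have s: "\<tau> \<sigma> > 3/4" "\<bar>d \<sigma>\<bar> < \<rho>" "\<bar>p\<bar> * \<bar>1 - \<tau> \<sigma>\<bar> < \<rho>" "\<sigma> < 1" using \<sigma>1(2)[of \<sigma>] \<sigma> \<sigma>1(1) by (auto simp: \<sigma>0_def)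
    have \<tau>le: "\<tau> \<sigma> \<le> 1"
    proof -
      have "\<sigma> powr \<alpha> \<le> 1" using s(4) \<sigma> \<alpha> by (intro powr_le1) auto
      then have "0 \<le> 1 - \<sigma> powr \<alpha>" "1 - \<sigma> powr \<alpha> \<le> 1" by simp_all
      then show ?thesis unfolding \<tau>_def using \<alpha> by (intro powr_le1) auto
    qed
    have "\<psi> x = (\<integral>z. \<psi> ((x - d \<sigma> - \<sigma> * z) / \<tau> \<sigma>) \<partial>Q) / \<tau> \<sigma>"
      unfolding \<psi>_def \<tau>_def d_def by (rule stable_self_similar[OF Q ch \<alpha>(1) c \<sigma>(1) s(4)])
    moreover have "\<kappa> * measure Q S \<le> (\<integral>z. \<psi> ((x - d \<sigma> - \<sigma> * z) / \<tau> \<sigma>) \<partial>Q)"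
    proof -
      have "\<kappa> * measure Q S = (\<integral>z. \<kappa> * indicator S z \<partial>Q)" using S by simp
      also have "\<dots> \<le> (\<integral>z. \<psi> ((x - d \<sigma> - \<sigma> * z) / \<tau> \<sigma>) \<partial>Q)"
      proof (rule integral_mono)
        show "integrable Q (\<lambda>z. \<kappa> * indicator S z)" using S(1) by (intro Q.integrable_const_bound[of _ \<kappa>]) (use \<kappa> in \<open>auto simp: indicator_def\<close>)
        show "integrable Q (\<lambda>z. \<psi> ((x - d \<sigma> - \<sigma> * z) / \<tau> \<sigma>))"
        proof (rule Q.integrable_const_bound)
          show "AE z in Q. norm (\<psi> ((x - d \<sigma> - \<sigma> * z) / \<tau> \<sigma>)) \<le> (\<integral>t. cmod (char Q t) \<partial>lborel)"
            unfolding \<psi>_def real_norm_def by (intro AE_I2 char_inverse_le \<phi>)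
        qed measurable
        fix z
        show "\<kappa> * indicator S z \<le> \<psi> ((x - d \<sigma> - \<sigma> * z) / \<tau> \<sigma>)"
        proof (cases "z \<in> S")
          case True
          have "(x - d \<sigma> - \<sigma> * z) / \<tau> \<sigma> - p = ((x - p - \<sigma> * z) - d \<sigma> + p * (1 - \<tau> \<sigma>)) / \<tau> \<sigma>"
            using s(1) by (simp add: field_simps)
          also have "\<bar>\<dots>\<bar> \<le> (3 * \<rho>) / (3/4)"
          proof -
            have "\<bar>(x - p - \<sigma> * z) - d \<sigma> + p * (1 - \<tau> \<sigma>)\<bar> \<le> 3 * \<rho>"
              using S(2)[OF True] s(2,3) by (simp add: abs_mult[symmetric])
            then show ?thesis unfolding abs_divide using s(1) by (intro frac_le) auto
          qed
          finally have "\<bar>(x - d \<sigma> - \<sigma> * z) / \<tau> \<sigma> - p\<bar> \<le> 4 * \<rho>" by simp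
          then show ?thesis using near True by simp
        qed (simp add: \<psi>0)
      qed
      finally show ?thesis .
    qed
    moreover have "(\<integral>z. \<psi> ((x - d \<sigma> - \<sigma> * z) / \<tau> \<sigma>) \<partial>Q) * 1 \<le> (\<integral>z. \<psi> ((x - d \<sigma> - \<sigma> * z) / \<tau> \<sigma>) \<partial>Q) * (1 / \<tau> \<sigma>)"
      by (rule mult_left_mono) (use s(1) \<tau>le \<psi>0 in \<open>auto intro!: Bochner_Integration.integral_nonneg\<close>)
    ultimately show ?thesis by simp
  qed
  obtain k R0 where k: "k > 0" and R0: "R0 \<ge> 1" and tail: "\<And>R. R \<ge> R0 \<Longrightarrow> k * R powr (- \<alpha>) \<le> measure Q {R / 2<..2 * R\<^sup>2}"
    using stable_tail_lower[OF Q ch \<alpha> \<beta> c] by blast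
  define K1 where "K1 = R0 + 2 / \<sigma>0"
  define K2 where "K2 = 4 / \<rho> + 1"
  have K1: "K1 \<ge> 1" using R0 \<sigma>0 by (simp add: K1_def add_increasing2)
  have K2: "K2 \<ge> 1" using \<rho> by (simp add: K2_def)
  define C0 where "C0 = \<kappa> * k * K1 powr (- (\<alpha> + 1)) / K2"
  have C0: "C0 > 0" unfolding C0_def using \<kappa> k K1 K2 by simp
  have big: "C0 * (1 + w) powr (- (\<alpha> + 2)) \<le> \<psi> x" if w: "w = x - p" "w > 4 * \<rho>" for x w
  proof -
    have w0: "w > 0" using w \<rho> by linarith
    \<comment> \<open>The first entry makes the tail bound available; the second forces
      \<open>\<sigma> = w / (A * q ^ i)\<close> below \<open>\<sigma>0\<close> for every tile, as
      \<open>A = R / 2\<close>.\<close>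
    define R where "R = max R0 (2 * w / \<sigma>0)"
    have R: "R \<ge> R0" "R \<ge> 1" "2 * w / \<sigma>0 \<le> R" using R0 by (auto simp: R_def)
    have RK: "R \<le> K1 * (1 + w)"
    proof -
      have "R0 * 1 \<le> R0 * (1 + w)" using R0 w0 by (intro mult_left_mono) auto
      moreover have "0 \<le> 2 / \<sigma>0 * (1 + w)" "2 * w / \<sigma>0 \<le> 2 / \<sigma>0 * (1 + w)" "0 \<le> R0 * (1 + w)" using \<sigma>0 w0 R0 by (auto simp: divide_right_mono)
      ultimately show ?thesis unfolding K1_def R_def distrib_right by linarith
    qed
    \<comment> \<open>With this ratio, scaling a tile so that its left end lands on \<open>w\<close>
      puts its right end exactly on \<open>w + \<rho>\<close>.\<close>
    define q where "q = 1 + \<rho> / w"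
    have q: "q \<ge> 1" using \<rho> w0 by (simp add: q_def)
    \<comment> \<open>Enough tiles for \<open>q ^ N \<ge> 4 * R\<close> by Bernoulli's inequality,
      so that they reach \<open>2 * R^2\<close> starting from \<open>R / 2\<close>.\<close>
    define N where "N = nat \<lceil>4 * R * w / \<rho>\<rceil>"
    have Np: "4 * R * w / \<rho> > 0" using R w0 \<rho> by simp
    have N: "4 * R * w / \<rho> \<le> real N" "real N \<le> 4 * R * w / \<rho> + 1" "N > 0" unfolding N_def using Np by linarith+
    define A where "A = R / 2"
    have A: "A > 0" using R by (simp add: A_def)
    have AN: "2 * R\<^sup>2 \<le> A * q ^ N"
    proof -
      have "4 * R = (4 * R * w / \<rho>) * (\<rho> / w)" using w0 \<rho> by simp
      also have "\<dots> \<le> real N * (\<rho> / w)" using N(1) w0 \<rho> by (intro mult_right_mono) auto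
      also have "\<dots> \<le> q ^ N" 
      proof -
        have "0 < \<rho> / w" using \<rho> w0 by simp
        then show ?thesis unfolding q_def using Bernoulli_inequality[of "\<rho> / w" N] by linarith
      qed
      finally have "A * (4 * R) \<le> A * q ^ N" using A by (intro mult_left_mono) auto
      then show ?thesis by (simp add: A_def power2_eq_square)
    qed
    have "k * R powr (- \<alpha>) \<le> measure Q {A<..2 * R\<^sup>2}" using tail[OF R(1)] by (simp add: A_def)
    also have "\<dots> \<le> measure Q {A<..A * q ^ N}" using AN by (intro Q.finite_measure_mono) auto
    also have "\<dots> \<le> (\<Sum>i<N. measure Q {A * q ^ i<..A * q ^ Suc i})" by (rule measure_tiles[OF Q A q])
    finally have total: "k * R powr (- \<alpha>) \<le> (\<Sum>i<N. measure Q {A * q ^ i<..A * q ^ Suc i})" .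
    \<comment> \<open>Pigeonhole: some tile carries at least the average mass.\<close>
    have "\<exists>i<N. k * R powr (- \<alpha>) / real N \<le> measure Q {A * q ^ i<..A * q ^ Suc i}"
    proof (rule ccontr)
      assume "\<not> ?thesis"
      then have "(\<Sum>i<N. measure Q {A * q ^ i<..A * q ^ Suc i}) < (\<Sum>i<N. k * R powr (- \<alpha>) / real N)"
        using N(3) by (intro sum_strict_mono) (auto simp: not_le)
      then show False using total N(3) by simp
    qed
    then obtain i where i: "k * R powr (- \<alpha>) / real N \<le> measure Q {A * q ^ i<..A * q ^ Suc i}" by blast
    define \<sigma> where "\<sigma> = w / (A * q ^ i)"
    have qi: "q ^ i \<ge> 1" using q by simp
    have Aq: "A * q ^ i > 0" using A qi by simp
    have \<sigma>: "0 < \<sigma>" using w0 Aq by (simp add: \<sigma>_def)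
    have \<sigma>le: "\<sigma> \<le> \<sigma>0"
    proof -
      have "w \<le> \<sigma>0 * A" using R(3) \<sigma>0 by (simp add: A_def divide_le_eq mult.commute)
      also have "\<dots> \<le> \<sigma>0 * (A * q ^ i)" using \<sigma>0 A qi by (intro mult_left_mono) (auto simp: mult_le_cancel_left1)
      finally show ?thesis using Aq by (simp add: \<sigma>_def divide_le_eq)
    qed
    have tile: "\<bar>x - p - \<sigma> * z\<bar> \<le> \<rho>" if z: "z \<in> {A * q ^ i<..A * q ^ Suc i}" for z
    proof -
      have weq: "w = \<sigma> * (A * q ^ i)" using A q by (simp add: \<sigma>_def)
      then have "w \<le> \<sigma> * z" using z \<sigma> by simp
      moreover have "\<sigma> * z \<le> \<sigma> * (A * q ^ Suc i)" using z \<sigma> by simp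
      moreover have "\<sigma> * (A * q ^ Suc i) = w + \<rho>"
      proof -
        have "\<sigma> * (A * q ^ Suc i) = (\<sigma> * (A * q ^ i)) * q" by simp
        also have "\<dots> = w * q" by (simp only: weq[symmetric])
        also have "\<dots> = w + \<rho>" using w0 by (simp add: q_def distrib_left)
        finally show ?thesis .
      qed
      ultimately show ?thesis unfolding w(1)[symmetric] using \<rho> by linarith
    qed
    have "\<kappa> * (k * R powr (- \<alpha>) / real N) \<le> \<kappa> * measure Q {A * q ^ i<..A * q ^ Suc i}" using i \<kappa> by (intro mult_left_mono) auto
    also have "\<dots> \<le> \<psi> x" by (rule key[OF \<sigma> \<sigma>le _ tile]) auto
    finally have lowx: "\<kappa> * (k * R powr (- \<alpha>) / real N) \<le> \<psi> x" .
    have NK: "real N \<le> R * (K2 * (1 + w))"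
    proof -
      have "real N \<le> R * (4 / \<rho> * w) + 1" using N(2) by (simp add: field_simps)
      also have "\<dots> \<le> R * (4 / \<rho> * (1 + w)) + R * (1 + w)"
      proof (intro add_mono mult_left_mono)
        have "1 * 1 \<le> R * (1 + w)" using R w0 by (intro mult_mono) auto
        then show "1 \<le> R * (1 + w)" by simp
      qed (use R \<rho> in auto)
      also have "\<dots> = R * (K2 * (1 + w))" by (simp add: K2_def algebra_simps)
      finally show ?thesis .
    qed
    \<comment> \<open>The count of powers: tail mass of order \<open>R powr (- \<alpha>)\<close>,
      shared among order \<open>R * w\<close> tiles, with \<open>R\<close> at most of order
      \<open>1 + w\<close>.\<close>
    have "C0 * (1 + w) powr (- (\<alpha> + 2)) = \<kappa> * (k * (K1 * (1 + w)) powr (- (\<alpha> + 1)) / (K2 * (1 + w)))"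
    proof -
      have "(1 + w) powr (- (\<alpha> + 2)) = (1 + w) powr (- (\<alpha> + 1)) * (1 + w) powr (- 1)"
        unfolding powr_add[symmetric] by (rule arg_cong[of _ _ "(powr) (1 + w)"]) simp
      also have "(1 + w) powr (- 1) = 1 / (1 + w)" using w0 by (simp add: powr_minus_divide)
      finally show ?thesis using K1 w0 unfolding C0_def by (simp add: powr_mult)
    qed
    also have "\<dots> \<le> \<kappa> * (k * R powr (- (\<alpha> + 1)) / (K2 * (1 + w)))"
      using \<kappa> k K2 w0 RK R \<alpha> by (intro mult_left_mono divide_right_mono powr_mono2') auto
    also have "\<dots> = \<kappa> * (k * R powr (- \<alpha>) / (R * (K2 * (1 + w))))"
    proof -
      have "R powr (- (\<alpha> + 1)) = R powr (- \<alpha>) * R powr (- 1)"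
        unfolding powr_add[symmetric] by (rule arg_cong[of _ _ "(powr) R"]) simp
      also have "R powr (- 1) = 1 / R" using R by (simp add: powr_minus_divide)
      finally show ?thesis by simp
    qed
    also have "\<dots> \<le> \<kappa> * (k * R powr (- \<alpha>) / real N)"
      using \<kappa> k NK N(3) by (intro mult_left_mono divide_left_mono mult_pos_pos) (use K2 R w0 in auto)
    finally show ?thesis using lowx by linarith
  qed
  \<comment> \<open>Near \<open>p\<close> the density exceeds \<kappa>; farther right
    \<open>1 + w \<le> (1 + \<bar>p\<bar>) * (1 + \<bar>x\<bar>)\<close> trades the distance from
    \<open>p\<close> for the modulus of \<open>x\<close>.\<close>
  define C where "C = min \<kappa> (C0 * (1 + \<bar>p\<bar>) powr (- (\<alpha> + 2)))"
  have C: "C > 0" using \<kappa> C0 by (simp add: C_def)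
  have "C * (1 + \<bar>x\<bar>) powr (- (\<alpha> + 2)) \<le> \<psi> x" if x: "x \<ge> p" for x
  proof (cases "x - p \<le> 4 * \<rho>")
    case True
    then have "\<kappa> \<le> \<psi> x" using x by (intro near) auto
    moreover have "C * (1 + \<bar>x\<bar>) powr (- (\<alpha> + 2)) \<le> \<kappa> * 1"
    proof (rule mult_mono)
      have "1 + \<bar>x\<bar> \<noteq> 0" by linarith
      then show "(1 + \<bar>x\<bar>) powr (- (\<alpha> + 2)) \<le> 1" using \<alpha> powr_mono[of "- (\<alpha> + 2)" 0 "1 + \<bar>x\<bar>"] by simp
    qed (use \<kappa> in \<open>auto simp: C_def\<close>)
    ultimately show ?thesis by simp
  next
    case False
    define w where "w = x - p"
    have w: "w > 4 * \<rho>" "w > 0" using False \<rho> by (auto simp: w_def)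
    have "1 + w \<le> (1 + \<bar>p\<bar>) * (1 + \<bar>x\<bar>)"
    proof -
      have "w \<le> \<bar>x\<bar> + \<bar>p\<bar>" unfolding w_def by linarith
      moreover have "0 \<le> \<bar>p\<bar> * \<bar>x\<bar>" by simp
      moreover have "(1 + \<bar>p\<bar>) * (1 + \<bar>x\<bar>) = 1 + \<bar>p\<bar> + \<bar>x\<bar> + \<bar>p\<bar> * \<bar>x\<bar>" by (simp add: algebra_simps)
      ultimately show ?thesis by linarith
    qed
    then have "((1 + \<bar>p\<bar>) * (1 + \<bar>x\<bar>)) powr (- (\<alpha> + 2)) \<le> (1 + w) powr (- (\<alpha> + 2))"
      using w \<alpha> by (intro powr_mono2') auto
    then have "C0 * ((1 + \<bar>p\<bar>) * (1 + \<bar>x\<bar>)) powr (- (\<alpha> + 2)) \<le> \<psi> x"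
      using big[OF w_def w(1)] C0 by (meson mult_left_mono less_imp_le order_trans)
    moreover have "C * (1 + \<bar>x\<bar>) powr (- (\<alpha> + 2)) \<le> C0 * (1 + \<bar>p\<bar>) powr (- (\<alpha> + 2)) * (1 + \<bar>x\<bar>) powr (- (\<alpha> + 2))"
      by (intro mult_right_mono) (auto simp: C_def)
    ultimately show ?thesis by (simp add: powr_mult mult.assoc)
  qed
  then show ?thesis using C unfolding \<psi>_def by blast
qed

text \<open>The left side follows by reflection: the law of the negative has skewness
  \<open>- \<beta>\<close>, so it is non-extremal as well, and \<open>- p\<close> is a point of
  positive density for it. Integrability of the density to one supplies \<open>p\<close>.\<close>

theorem stable_density_lower:
  assumes Q: "real_distribution Q" and ch: "\<And>t. char Q t = stable_char \<alpha> \<beta> a c t"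
    and \<alpha>: "0 < \<alpha>" "\<alpha> < 2" and \<beta>: "-1 < \<beta>" "\<beta> < 1" and c: "c > 0"
  shows "\<exists>C>0. \<forall>x. C * (1 + \<bar>x\<bar>) powr (- (\<alpha> + 2)) \<le> char_inverse (char Q) x"
proof -
  interpret Q: real_distribution Q by fact
  have \<phi>: "integrable lborel (char Q)"
  proof (rule Bochner_Integration.integrable_bound[OF integrable_exp_powr[OF \<alpha>(1) c]])
    show "char Q \<in> borel_measurable lborel" using Q.char_measurable by simp
  qed (simp add: ch cmod_stable_char)
  obtain p where p: "char_inverse (char Q) p > 0"
  proof (rule ccontr)
    assume no: "\<not> thesis"
    have "char_inverse (char Q) x = 0" for x
      using no that[of x] Q.char_inverse_nonneg[OF \<phi>, of x] by fastforce
    then have Qz: "Q = density lborel (\<lambda>_. 0)" using Q.density_char_inverse[OF \<phi>] by simp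
    have "emeasure Q UNIV = 0" by (rule ssubst[OF Qz, of "\<lambda>M. emeasure M UNIV = 0"]) (simp add: emeasure_density)
    then show False using Q.emeasure_space_1 by simp
  qed
  obtain C1 where C1: "C1 > 0" "\<And>x. x \<ge> p \<Longrightarrow> C1 * (1 + \<bar>x\<bar>) powr (- (\<alpha> + 2)) \<le> char_inverse (char Q) x"
    using stable_density_lower_right[OF Q ch \<alpha> \<beta> c p] by blast
  define Q' where "Q' = distr Q borel uminus"
  have Q': "real_distribution Q'" unfolding Q'_def by (rule Q.real_distribution_uminus)
  have ch': "char Q' t = stable_char \<alpha> (- \<beta>) (- a) c t" for t
    unfolding Q'_def Q.char_distr_uminus ch
    by (simp add: stable_char_def exp_cnj)
  have refl: "char_inverse (char Q') x = char_inverse (char Q) (- x)" for x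
  proof -
    have "(\<integral>t. iexp (- (t * x)) * char Q' t \<partial>lborel) = (\<integral>t. cnj (iexp (- (t * - x)) * char Q t) \<partial>lborel)"
      unfolding Q'_def Q.char_distr_uminus by (intro Bochner_Integration.integral_cong refl) (simp add: exp_cnj)
    also have "\<dots> = cnj (\<integral>t. iexp (- (t * - x)) * char Q t \<partial>lborel)"
      by (rule integral_bounded_linear'[OF bounded_linear_cnj bounded_linear_cnj]) simp
    finally show ?thesis unfolding char_inverse_def by simp
  qed
  have "char_inverse (char Q') (- p) > 0" unfolding refl using p by simp
  then obtain C2 where C2: "C2 > 0" "\<And>x. x \<ge> - p \<Longrightarrow> C2 * (1 + \<bar>x\<bar>) powr (- (\<alpha> + 2)) \<le> char_inverse (char Q') x"
    using stable_density_lower_right[OF Q' ch' \<alpha> _ _ c] \<beta> by auto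
  have "min C1 C2 * (1 + \<bar>x\<bar>) powr (- (\<alpha> + 2)) \<le> char_inverse (char Q) x" for x
  proof (cases "x \<ge> p")
    case True
    have "min C1 C2 * (1 + \<bar>x\<bar>) powr (- (\<alpha> + 2)) \<le> C1 * (1 + \<bar>x\<bar>) powr (- (\<alpha> + 2))" by (intro mult_right_mono) auto
    then show ?thesis using C1(2)[OF True] by linarith
  next
    case False
    have "min C1 C2 * (1 + \<bar>x\<bar>) powr (- (\<alpha> + 2)) \<le> C2 * (1 + \<bar>x\<bar>) powr (- (\<alpha> + 2))" by (intro mult_right_mono) auto
    then show ?thesis using C2(2)[of "- x"] False unfolding refl by simp
  qed
  then show ?thesis using C1 C2 by (intro exI[of _ "min C1 C2"]) auto
qed

section \<open>Decomposition of the densities\<close>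

lemma stable_scaling_char:
  fixes \<mu> Q :: "real measure" and P :: "nat \<Rightarrow> real measure" and a b :: "nat \<Rightarrow> real"
  assumes \<mu>: "real_distribution \<mu>" and P: "\<And>n. real_distribution (P n)" and Q: "real_distribution Q"
    and chP: "\<And>n t. n \<ge> 1 \<Longrightarrow> char (P n) t = iexp (- (t * a n)) * char \<mu> (t / b n) ^ n"
    and b: "\<And>n. n \<ge> 1 \<Longrightarrow> b n > 0" and wc: "weak_conv_m P Q"
    and chQ: "\<And>t. cmod (char Q t) = exp (- c * \<bar>t\<bar> powr \<alpha>)" and c: "c > 0" and \<alpha>: "\<alpha> > 0"
  shows "stable_scaling (\<lambda>s. cmod (char \<mu> s)) b c \<alpha>"
proof
  interpret \<mu>: real_distribution \<mu> by fact
  show "0 < c" "0 < \<alpha>" by fact+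
  show "0 \<le> cmod (char \<mu> s)" "cmod (char \<mu> s) \<le> 1" for s by (simp_all add: \<mu>.cmod_char_le_1)
  show "0 < b n" if "1 \<le> n" for n using b that .
  fix T e :: real assume "e > 0"
  from weak_conv_char_uniform[OF P Q wc this, of T] eventually_ge_at_top[of 1]
  show "\<forall>\<^sub>F n in sequentially. \<forall>t. \<bar>t\<bar> \<le> T \<longrightarrow> \<bar>cmod (char \<mu> (t / b n)) ^ n - exp (- c * \<bar>t\<bar> powr \<alpha>)\<bar> < e"
  proof eventually_elim
    case (elim n)
    show ?case
    proof (intro allI impI)
      fix t assume t: "\<bar>t\<bar> \<le> T"
      have "cmod (char (P n) t) = cmod (char \<mu> (t / b n)) ^ n"
        unfolding chP[OF elim(2)] norm_mult norm_exp_i_times by (simp add: norm_power)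
      then have "\<bar>cmod (char \<mu> (t / b n)) ^ n - exp (- c * \<bar>t\<bar> powr \<alpha>)\<bar> = \<bar>cmod (char (P n) t) - cmod (char Q t)\<bar>"
        by (simp only: chQ)
      also have "\<dots> \<le> cmod (char (P n) t - char Q t)" by (rule norm_triangle_ineq3)
      also have "\<dots> < e" using elim t by blast
      finally show "\<bar>cmod (char \<mu> (t / b n)) ^ n - exp (- c * \<bar>t\<bar> powr \<alpha>)\<bar> < e" .
    qed
  qed
qed

lemma enn2real_lnp:
  assumes "x < \<infinity>"
  shows "x * lnp x = ennreal (enn2real x * max 0 (ln (enn2real x)))"
proof -
  obtain r where r: "x = ennreal r" "0 \<le> r" using assms by (cases x) auto
  show ?thesis unfolding r(1) lnp_ennreal[OF r(2)] using r(2) by (simp add: ennreal_mult del: ennreal_max_0 ennreal_max_0')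
qed

text \<open>\<open>v n\<close> is the normalised density of the event that all blocks follow the
  remainder, so its transform is a product and its mass a power of \<epsilon>. \<open>u n\<close> is
  recovered by inversion from the difference of transforms, which is integrable although neither
  term need be.\<close>

theorem entropic_decomposition:
  fixes \<mu> Q :: "real measure" and P :: "nat \<Rightarrow> real measure" and a b :: "nat \<Rightarrow> real"
  assumes \<mu>: "real_distribution \<mu>" and P: "\<And>n. real_distribution (P n)" and Q: "real_distribution Q"
    and chP: "\<And>n t. n \<ge> 1 \<Longrightarrow> char (P n) t = iexp (- (t * a n)) * char \<mu> (t / b n) ^ n"
    and b: "\<And>n. n \<ge> 1 \<Longrightarrow> b n > 0" and wc: "weak_conv_m P Q"
    and chQ: "\<And>t. cmod (char Q t) = exp (- c * \<bar>t\<bar> powr \<alpha>)" and c: "c > 0" and \<alpha>: "\<alpha> > 0"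
    and n0: "n0 \<ge> 1" and p0m [measurable]: "p0 \<in> borel_measurable borel"
    and dens: "conv_pow \<mu> n0 (return borel 0) = density lborel p0"
    and ent: "(\<integral>\<^sup>+x. p0 x * lnp (p0 x) \<partial>lborel) < \<infinity>"
  obtains u v :: "nat \<Rightarrow> real \<Rightarrow> real" and N C
  where "\<And>n. u n \<in> borel_measurable borel" "\<And>n. v n \<in> borel_measurable borel" "\<And>n x. 0 \<le> u n x" "\<And>n x. 0 \<le> v n x"
    "\<And>n. n \<ge> N \<Longrightarrow> P n = density lborel (\<lambda>x. ennreal (u n x + v n x))"
    "\<And>n x. n \<ge> N \<Longrightarrow> u n x \<le> C" "\<And>x. (\<lambda>n. u n x) \<longlonglongrightarrow> char_inverse (char Q) x"
    "(\<lambda>n. \<integral>\<^sup>+x. ennreal (v n x) \<partial>lborel) \<longlonglongrightarrow> 0"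
    "(\<lambda>n. \<integral>\<^sup>+x. ennreal (v n x * max 0 (ln (v n x))) \<partial>lborel) \<longlonglongrightarrow> 0"
proof -
  interpret \<mu>: real_distribution \<mu> by fact
  interpret P: real_distribution "P n" for n by (rule P)
  interpret Q: real_distribution Q by fact
  define W0 where "W0 = conv_pow \<mu> n0 (return borel 0)"
  have W0: "real_distribution W0" unfolding W0_def by (rule real_distribution_conv_pow[OF \<mu> real_distribution_return])
  have fin_ret: "finite_borel_measure (return borel (0::real))"
    using real_distribution_return by (simp add: real_distribution.axioms(1) finite_borel_measure_axioms_def finite_borel_measure_def prob_space.axioms(1))
  have fin_\<mu>: "finite_borel_measure \<mu>" by (rule \<mu>.finite_borel_measure_axioms)
  define W where "W = (W0 \<star> W0)"
  have W: "real_distribution W" unfolding W_def by (rule real_distribution_convolution[OF W0 W0])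
  interpret W: real_distribution W by fact
  interpret W0: real_distribution W0 by fact
  have Wp: "W0 = density lborel p0" unfolding W0_def by (rule dens)
  obtain d2 g2 G \<epsilon> where [measurable]: "d2 \<in> borel_measurable borel" "g2 \<in> borel_measurable borel"
    and WW: "(W0 \<star> W0) = density lborel d2" and g2d2: "\<And>x. g2 x \<le> d2 x" and ig: "(\<integral>\<^sup>+x. g2 x \<partial>lborel) = ennreal \<epsilon>"
    and \<epsilon>: "0 \<le> \<epsilon>" "\<epsilon> < 1" and eg: "(\<integral>\<^sup>+x. g2 x * lnp (g2 x) \<partial>lborel) < \<infinity>" and iG: "integrable lborel G"
    and chG: "\<And>t. cmod (char (W0 \<star> W0) t - char (density lborel g2) t) \<le> G t"
    and far0: "\<And>e. e > 0 \<Longrightarrow> \<exists>T. \<forall>t. \<bar>t\<bar> \<ge> T \<longrightarrow> cmod (char (W0 \<star> W0) t) \<le> \<epsilon> + e"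
    by (rule block_split[OF W0 p0m Wp ent]) (rule that; assumption)
  define f where "f = char \<mu>"
  have [measurable]: "f \<in> borel_measurable borel" unfolding f_def by (rule \<mu>.char_measurable)
  \<comment> \<open>A block joins two sums of \<open>n0\<close> summands, one for each bounded
    factor of its good component.\<close>
  define B where "B = 2 * n0"
  have B: "B > 0" using n0 by (simp add: B_def)
  have chW: "char W t = f t ^ B" for t
  proof -
    have "char W0 t = f t ^ n0" unfolding W0_def f_def by (simp add: char_conv_pow[OF fin_\<mu> fin_ret] char_return_0)
    then show ?thesis unfolding W_def B_def
      by (simp add: char_convolution'[OF W0.finite_borel_measure_axioms W0.finite_borel_measure_axioms] power_add[symmetric] mult_2)
  qed
  define G2 where "G2 = density lborel g2"
  have fg2: "(\<integral>\<^sup>+x. g2 x \<partial>lborel) < \<infinity>" unfolding ig by simp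
  have fG2: "finite_borel_measure G2" unfolding G2_def by (rule density_enn2real(4)[OF _ fg2]) simp
  interpret G2: finite_borel_measure G2 by fact
  have G2U: "emeasure G2 UNIV = ennreal \<epsilon>" unfolding G2_def by (simp add: emeasure_density ig)
  have G2W: "G2 \<le> W"
    unfolding G2_def W_def WW
  proof (subst measure_le_iff, simp, rule allI)
    fix A :: "real set"
    show "emeasure (density lborel g2) A \<le> emeasure (density lborel d2) A"
    proof (cases "A \<in> sets borel")
      case True
      then show ?thesis by (simp add: emeasure_density) (intro nn_integral_mono mult_right_mono g2d2, simp)
    qed (simp add: emeasure_notin_sets)
  qed
  define \<Gamma> where "\<Gamma> = char G2"
  have [measurable]: "\<Gamma> \<in> borel_measurable borel" unfolding \<Gamma>_def by (rule G2.char_borel_measurable)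
  have sG2: "space G2 = UNIV" unfolding G2_def by simp
  have \<Gamma>: "cmod (\<Gamma> s) \<le> \<epsilon>" for s
    using G2.cmod_char_le[of s] G2U \<epsilon> unfolding \<Gamma>_def sG2 by (simp add: measure_def)
  interpret S: stable_scaling "\<lambda>s. cmod (f s)" b c \<alpha>
    unfolding f_def by (rule stable_scaling_char[OF \<mu> P Q chP b wc chQ c \<alpha>])
  have far: "\<exists>\<eta><1. 0 \<le> \<eta> \<and> (\<forall>s. \<bar>s\<bar> \<ge> d \<longrightarrow> cmod (f s) \<le> \<eta>)" if d: "d > 0" for d
  proof -
    \<comment> \<open>Halfway between \<epsilon> and 1: block characteristic functions fall below it
      far out, and a \<open>B\<close>-th root transfers this to a single summand.\<close>
    define y where "y = (1 + \<epsilon>) / 2"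
    have y: "0 \<le> y" "y < 1" using \<epsilon> by (auto simp: y_def)
    obtain T where T: "\<And>t. \<bar>t\<bar> \<ge> T \<Longrightarrow> cmod (f t ^ B) \<le> y"
      using far0[of "(1 - \<epsilon>) / 2"] \<epsilon> unfolding W_def[symmetric] chW y_def by (auto simp: field_simps)
    have root: "root B y < 1" "0 \<le> root B y" using y B by (auto simp: real_root_lt_1_iff)
    show ?thesis
    proof (rule uniformly_below_one[where T=T and \<eta>="root B y"])
      fix s assume "\<bar>s\<bar> \<ge> T"
      then have "cmod (f s) ^ B \<le> y" using T[of s] by (simp add: norm_power)
      then have "root B (cmod (f s) ^ B) \<le> root B y" using B by simp
      then show "cmod (f s) \<le> root B y" using B by (simp add: real_root_power_cancel)
    next
      show "1 - (cmod (f (2 * s)))\<^sup>2 \<le> 4 * (1 - (cmod (f s))\<^sup>2)" for s unfolding f_def by (rule \<mu>.norm_char_doubling)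
    qed (use root d in auto)
  qed
  have feven: "cmod (f (- s)) = cmod (f s)" for s
  proof -
    have "f (- s) = cnj (f s)" unfolding f_def char_def
      by (subst integral_bounded_linear'[OF bounded_linear_cnj bounded_linear_cnj, symmetric]) (auto simp: exp_cnj)
    then show ?thesis by simp
  qed
  have lim: "(\<lambda>n. iexp (- (t * a n)) * f (t / b n) ^ n) \<longlonglongrightarrow> char Q t" for t
  proof (rule Lim_transform_eventually[OF levy_continuity1[OF P Q wc, of t]])
    show "\<forall>\<^sub>F n in sequentially. char (P n) t = iexp (- (t * a n)) * f (t / b n) ^ n"
      using eventually_ge_at_top[of 1] by eventually_elim (simp add: chP f_def)
  qed
  have \<phi>: "integrable lborel (char Q)"
  proof (rule Bochner_Integration.integrable_bound[OF integrable_exp_powr[OF \<alpha> c]])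
    show "char Q \<in> borel_measurable lborel" using Q.char_measurable by simp
  qed (simp add: chQ)
  define j where "j n = n div (2 * B)" for n
  define \<xi> where "\<xi> n t = iexp (- (t * a n)) * (f (t / b n) ^ (n - B * j n) * ((f (t / b n) ^ B) ^ j n - \<Gamma> (t / b n) ^ j n))" for n t
  have fG: "cmod (f s ^ B - \<Gamma> s) \<le> G s" for s using chG[of s] unfolding W_def[symmetric] chW \<Gamma>_def G2_def .
  have i\<xi>: "integrable lborel (\<xi> n)" if "n \<ge> 1" for n
    unfolding \<xi>_def[abs_def] j_def
    by (rule local_limit_L1(1)[OF S.stable_scaling_axioms _ _ feven \<Gamma> \<epsilon> B iG fG far lim \<phi> that]) auto
  have L1: "(\<lambda>n. \<integral>t. cmod (\<xi> n t - char Q t) \<partial>lborel) \<longlonglongrightarrow> 0"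
    unfolding \<xi>_def[abs_def] j_def
    by (rule local_limit_L1(2)[OF S.stable_scaling_axioms _ _ feven \<Gamma> \<epsilon> B iG fG far lim \<phi>]) auto
  define T where "T n = conv_pow \<mu> (n - B * j n) (return borel 0)" for n
  have T: "real_distribution (T n)" for n unfolding T_def by (rule real_distribution_conv_pow[OF \<mu> real_distribution_return])
  have fT: "finite_borel_measure (T n)" for n
    unfolding T_def by (rule finite_borel_conv_pow[OF fin_\<mu> fin_ret])
  have chT: "char (T n) t = f t ^ (n - B * j n)" for n t
    unfolding T_def f_def by (simp add: char_conv_pow[OF fin_\<mu> fin_ret] char_return_0)
  have TU: "emeasure (T n) UNIV = 1" for n
    using T[of n] by (metis prob_space.emeasure_space_1 real_distribution.axioms(1) real_distribution.space_eq_univ)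
  \<comment> \<open>One block is held back as an honest density, \<open>g2\<close> or
    \<open>d2\<close>, to be convolved with the measure of everything else; hence
    \<open>j n - 1\<close> factors here.\<close>
  define \<tau> where "\<tau> n = conv_pow G2 (j n - 1) (T n)" for n
  define \<tau>' where "\<tau>' n = conv_pow W (j n - 1) (T n)" for n
  have f\<tau>: "finite_borel_measure (\<tau> n)" for n unfolding \<tau>_def by (rule finite_borel_conv_pow[OF fG2 fT])
  have f\<tau>': "finite_borel_measure (\<tau>' n)" for n unfolding \<tau>'_def by (rule finite_borel_conv_pow[OF W.finite_borel_measure_axioms fT])
  have \<tau>\<tau>': "\<tau> n \<le> \<tau>' n" for n unfolding \<tau>_def \<tau>'_def by (rule conv_pow_mono[OF fG2 W.finite_borel_measure_axioms fT G2W])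
  have \<tau>U: "emeasure (\<tau> n) UNIV = ennreal (\<epsilon> ^ (j n - 1))" for n
    unfolding \<tau>_def using \<epsilon> by (simp add: emeasure_conv_pow[OF fG2 fT] TU G2U ennreal_power)
  define v0 where "v0 n = conv_density g2 (\<tau> n)" for n
  define q0 where "q0 n = conv_density d2 (\<tau>' n)" for n
  have [measurable]: "v0 n \<in> borel_measurable borel" "q0 n \<in> borel_measurable borel" for n
    unfolding v0_def q0_def by (auto intro!: conv_density_measurable f\<tau> f\<tau>')
  have le0: "v0 n x \<le> q0 n x" for n x
  proof -
    interpret t: finite_borel_measure "\<tau> n" by (rule f\<tau>)
    interpret t': finite_borel_measure "\<tau>' n" by (rule f\<tau>')
    have "v0 n x \<le> (\<integral>\<^sup>+y. d2 (x - y) \<partial>\<tau> n)" unfolding v0_def conv_density_def by (intro nn_integral_mono g2d2)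
    also have "\<dots> \<le> q0 n x" unfolding q0_def conv_density_def by (rule nn_integral_mono_measure) (auto simp: \<tau>\<tau>')
    finally show ?thesis .
  qed
  have iv0: "(\<integral>\<^sup>+x. v0 n x \<partial>lborel) = ennreal (\<epsilon> * \<epsilon> ^ (j n - 1))" for n
    unfolding v0_def using \<epsilon> by (simp add: nn_integral_conv_density[OF f\<tau>] ig \<tau>U ennreal_mult)
  have ev0: "(\<integral>\<^sup>+x. v0 n x * lnp (v0 n x) \<partial>lborel) \<le> ennreal (\<epsilon> ^ (j n - 1)) * ((\<integral>\<^sup>+x. g2 x * lnp (g2 x) \<partial>lborel) + 1)" for n
  proof -
    have "(\<integral>\<^sup>+x. v0 n x * lnp (v0 n x) \<partial>lborel) \<le> emeasure (\<tau> n) UNIV * ((\<integral>\<^sup>+x. g2 x * lnp (g2 x) \<partial>lborel) + (\<integral>\<^sup>+x. v0 n x \<partial>lborel))"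
      unfolding v0_def by (rule conv_density_entropy[OF f\<tau>]) simp
    also have "\<dots> \<le> ennreal (\<epsilon> ^ (j n - 1)) * ((\<integral>\<^sup>+x. g2 x * lnp (g2 x) \<partial>lborel) + 1)"
      unfolding \<tau>U iv0 using \<epsilon> by (intro mult_left_mono add_left_mono) (auto simp: ennreal_le_1 mult_le_one power_le_one)
    finally show ?thesis .
  qed
  define pn where "pn n x = ennreal (b n) * q0 n (b n * (x + a n))" for n x
  define vn where "vn n x = ennreal (b n) * v0 n (b n * (x + a n))" for n x
  have [measurable]: "pn n \<in> borel_measurable borel" "vn n \<in> borel_measurable borel" for n
    unfolding pn_def[abs_def] vn_def[abs_def] by measurable
  have vp: "vn n x \<le> pn n x" for n x unfolding vn_def pn_def by (intro mult_left_mono le0) auto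
  define v where "v n x = enn2real (vn n x)" for n x
  \<comment> \<open>The truncation makes \<open>u\<close> nonnegative at every point and index. For
    \<open>n \<ge> 2 * B\<close> its image in \<open>ennreal\<close> is almost everywhere the
    density \<open>dn\<close> below.\<close>
  define u where "u n x = max 0 (char_inverse (\<xi> n) x)" for n x
  have good: "n \<ge> 1 \<and> j n \<ge> 1" if "n \<ge> 2 * B" for n
    using that B div_le_mono[of "2*B" n "2*B"] by (auto simp: j_def)
  have um: "u n \<in> borel_measurable borel" for n
  proof (cases "n \<ge> 1")
    case True
    then show ?thesis unfolding u_def[abs_def] using char_inverse_borel_measurable[OF i\<xi>[OF True]] by measurable
  next
    case False
    then have n0: "n = 0" by simp
    \<comment> \<open>Index 0 is outside the range where \<open>\<xi> n\<close> is known to be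
      integrable; there are no blocks, so both powers equal 1 and cancel.\<close>
    have "\<xi> n t = 0" for t unfolding \<xi>_def n0 by (simp add: j_def)
    then show ?thesis unfolding u_def[abs_def] char_inverse_def[abs_def] by simp
  qed
  have vm: "v n \<in> borel_measurable borel" for n unfolding v_def[abs_def] by measurable
  have ivn: "(\<integral>\<^sup>+x. vn n x \<partial>lborel) = ennreal (\<epsilon> * \<epsilon> ^ (j n - 1))" if "n \<ge> 1" for n
    unfolding vn_def by (simp add: nn_integral_affine_density b[OF that] iv0)
  have dec: "P n = density lborel (\<lambda>x. ennreal (u n x + v n x))" if n: "n \<ge> 2 * B" for n
  proof -
    have n1: "n \<ge> 1" and j1: "j n \<ge> 1" using good[OF n] by auto
    have bn: "b n > 0" by (rule b[OF n1])
    define F where "F = (\<lambda>x::real. x / b n - a n)"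
    have [measurable]: "F \<in> borel_measurable borel" unfolding F_def by measurable
    have jS: "j n = Suc (j n - 1)" using j1 by simp
    have BjN: "B * j n \<le> n" unfolding j_def
      using div_times_less_eq_dividend[of n "2 * B"] by (metis add_leD1 mult.assoc mult.commute mult_2)
    define P' where "P' = conv_pow W (j n) (T n)"
    define V' where "V' = conv_pow G2 (j n) (T n)"
    have fP': "finite_borel_measure P'" unfolding P'_def by (rule finite_borel_conv_pow[OF W.finite_borel_measure_axioms fT])
    have fV': "finite_borel_measure V'" unfolding V'_def by (rule finite_borel_conv_pow[OF fG2 fT])
    have rP': "real_distribution P'" unfolding P'_def by (rule real_distribution_conv_pow[OF W T])
    interpret P': real_distribution P' by fact
    interpret V': finite_borel_measure V' by fact
    have chP': "char P' t = f t ^ n" for t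
    proof -
      have "char P' t = (f t ^ B) ^ j n * f t ^ (n - B * j n)"
        unfolding P'_def by (simp add: char_conv_pow[OF W.finite_borel_measure_axioms fT] chW chT)
      then show ?thesis using BjN by (simp add: power_mult[symmetric] power_add[symmetric])
    qed
    have chV': "char V' t = \<Gamma> t ^ j n * f t ^ (n - B * j n)" for t
      unfolding V'_def \<Gamma>_def by (simp add: char_conv_pow[OF fG2 fT] chT)
    have P'd: "P' = density lborel (q0 n)"
    proof -
      have "P' = (W \<star> \<tau>' n)" unfolding P'_def \<tau>'_def by (subst jS) simp
      also have "\<dots> = density lborel (q0 n)"
        unfolding q0_def W_def WW by (rule convolution_density_measure[OF f\<tau>'])
          (use W.finite_measure_axioms in \<open>auto simp: W_def WW\<close>)
      finally show ?thesis .
    qed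
    have V'd: "V' = density lborel (v0 n)"
    proof -
      have "V' = (G2 \<star> \<tau> n)" unfolding V'_def \<tau>_def by (subst jS) simp
      also have "\<dots> = density lborel (v0 n)"
        unfolding v0_def G2_def by (rule convolution_density_measure[OF f\<tau>])
          (use G2.finite_measure_axioms in \<open>auto simp: G2_def\<close>)
      finally show ?thesis .
    qed
    have Pd': "P n = distr P' borel F"
    proof (rule Levy_uniqueness[OF P])
      show "real_distribution (distr P' borel F)"
        by (intro real_distribution.intro P'.prob_space_distr real_distribution_axioms.intro) auto
      show "char (P n) = char (distr P' borel F)"
        by (rule ext) (simp add: F_def P'.char_affine chP' chP[OF n1] f_def)
    qed
    have Pd: "P n = density lborel (pn n)"
      unfolding Pd' P'd F_def pn_def[abs_def] by (rule distr_density_affine[OF _ bn]) simp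
    have Vd: "distr V' borel F = density lborel (vn n)"
      unfolding V'd F_def vn_def[abs_def] by (rule distr_density_affine[OF _ bn]) simp
    have chV: "char (density lborel (vn n)) t = iexp (- (t * a n)) * (\<Gamma> (t / b n) ^ j n * f (t / b n) ^ (n - B * j n))" for t
      unfolding Vd[symmetric] F_def V'.char_affine chV' ..
    \<comment> \<open>The density of the event that some block uses its good component. Its
      characteristic function is \<open>\<xi> n\<close>, so it has a continuous bounded
      version.\<close>
    define dn where "dn x = pn n x - vn n x" for x
    have [measurable]: "dn \<in> borel_measurable borel" unfolding dn_def[abs_def] by measurable
    have ipn: "(\<integral>\<^sup>+x. pn n x \<partial>lborel) = 1"
      using P.emeasure_space_1[of n] unfolding Pd by (simp add: emeasure_density)
    have fvn: "(\<integral>\<^sup>+x. vn n x \<partial>lborel) < \<infinity>" unfolding ivn[OF n1] by simp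
    have sum: "pn n x = dn x + vn n x" for x unfolding dn_def using vp[of n x] by (simp add: diff_add_cancel_ennreal)
    have idn: "(\<integral>\<^sup>+x. dn x \<partial>lborel) + ennreal (\<epsilon> * \<epsilon> ^ (j n - 1)) = 1"
      unfolding ivn[OF n1, symmetric] ipn[symmetric] sum by (rule nn_integral_add[symmetric]) auto
    have fdn: "(\<integral>\<^sup>+x. dn x \<partial>lborel) < \<infinity>" using idn by (metis ennreal_add_eq_top ennreal_one_neq_top infinity_ennreal_def top.not_eq_extremum)
    have ndn: "(\<integral>\<^sup>+x. dn x \<partial>lborel) \<noteq> 0"
    proof
      assume "(\<integral>\<^sup>+x. dn x \<partial>lborel) = 0"
      then have "ennreal (\<epsilon> * \<epsilon> ^ (j n - 1)) = 1" using idn by simp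
      then have "\<epsilon> * \<epsilon> ^ (j n - 1) = 1" using \<epsilon> by (simp add: ennreal_eq_1)
      moreover have "\<epsilon> * \<epsilon> ^ (j n - 1) \<le> \<epsilon> * 1" using \<epsilon> by (intro mult_left_mono power_le_one) auto
      ultimately show False using \<epsilon> by simp
    qed
    define U where "U = density lborel dn"
    have fU: "finite_borel_measure U" unfolding U_def by (rule density_enn2real(4)[OF _ fdn]) simp
    interpret U: finite_borel_measure U by fact
    have chU: "char U t = \<xi> n t" for t
    proof -
      have "char (P n) t = char U t + char (density lborel (vn n)) t"
        unfolding Pd sum U_def by (rule char_density_add[OF _ _ fdn fvn]) auto
      then have "char U t = iexp (- (t * a n)) * f (t / b n) ^ n - iexp (- (t * a n)) * (\<Gamma> (t / b n) ^ j n * f (t / b n) ^ (n - B * j n))"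
        unfolding chV chP[OF n1] f_def by simp
      also have "f (t / b n) ^ n = f (t / b n) ^ (n - B * j n) * (f (t / b n) ^ B) ^ j n"
        using BjN by (simp add: power_mult[symmetric] power_add[symmetric])
      finally show ?thesis unfolding \<xi>_def by (simp add: algebra_simps)
    qed
    have chU': "char U = \<xi> n" by (rule ext) (rule chU)
    have "measure U UNIV \<noteq> 0"
    proof -
      have "emeasure U UNIV \<noteq> 0" unfolding U_def using ndn by (simp add: emeasure_density)
      then show ?thesis by (simp add: U.emeasure_eq_measure)
    qed
    then have "U = density lborel (\<lambda>x. ennreal (char_inverse (\<xi> n) x))"
      using U.density_char_inverse_finite i\<xi>[OF n1] unfolding chU' by simp
    moreover have [measurable]: "char_inverse (\<xi> n) \<in> borel_measurable borel" by (rule char_inverse_borel_measurable[OF i\<xi>[OF n1]])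
    ultimately have ae: "AE x in lborel. dn x = ennreal (char_inverse (\<xi> n) x)"
      unfolding U_def by (subst (asm) sigma_finite_measure.density_unique_iff[OF sigma_finite_lborel]) auto
    show ?thesis unfolding Pd
    proof (rule density_cong)
      show "AE x in lborel. pn n x = ennreal (u n x + v n x)"
        using ae density_enn2real(1)[OF _ fvn, simplified]
      proof eventually_elim
        case (elim x)
        have "dn x = ennreal (u n x)" unfolding elim(1) u_def by simp
        moreover have "vn n x = ennreal (v n x)" unfolding v_def by (rule elim(2))
        ultimately show ?case unfolding sum by (simp add: ennreal_plus u_def v_def)
      qed
    qed (use um vm in auto)
  qed
  define D where "D n = (\<integral>t. cmod (\<xi> n t - char Q t) \<partial>lborel)" for n
  define \<psi> where "\<psi> = char_inverse (char Q)"
  have \<psi>0: "\<psi> x \<ge> 0" for x unfolding \<psi>_def by (rule Q.char_inverse_nonneg[OF \<phi>])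
  have ud: "\<bar>u n x - \<psi> x\<bar> \<le> D n" if "n \<ge> 1" for n x
  proof -
    have "\<bar>char_inverse (\<xi> n) x - \<psi> x\<bar> \<le> D n" unfolding \<psi>_def D_def by (rule char_inverse_diff_le[OF i\<xi>[OF that] \<phi>])
    then show ?thesis using \<psi>0[of x] unfolding u_def by (auto simp: max_def abs_if split: if_splits)
  qed
  have D0: "D \<longlonglongrightarrow> 0" unfolding D_def[abs_def] by (rule L1)
  have ulim: "(\<lambda>n. u n x) \<longlonglongrightarrow> \<psi> x" for x
  proof (rule LIM_zero_cancel, rule Lim_null_comparison[OF _ D0])
    show "\<forall>\<^sub>F n in sequentially. norm (u n x - \<psi> x) \<le> D n"
      using eventually_ge_at_top[of 1] by eventually_elim (simp add: ud)
  qed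
  obtain N1 where N1: "\<And>n. n \<ge> N1 \<Longrightarrow> D n < 1"
    using order_tendstoD(2)[OF D0, of 1] by (auto simp: eventually_sequentially)
  define C where "C = (\<integral>t. cmod (char Q t) \<partial>lborel) + 1"
  have uC: "u n x \<le> C" if "n \<ge> max N1 1" for n x
  proof -
    have "\<psi> x \<le> (\<integral>t. cmod (char Q t) \<partial>lborel)" using char_inverse_le[OF \<phi>, of x] by (simp add: \<psi>_def)
    moreover have "D n < 1" using N1 that by simp
    ultimately show ?thesis using ud[of n x] that unfolding C_def by (simp add: abs_le_iff)
  qed
  \<comment> \<open>The lower limit 1/2 keeps \<open>x\<close> positive and the division by
    \<open>e\<close> squared legitimate when \<epsilon> is zero. The square compensates for passing
    from \<open>j n - 1\<close> to \<open>j n + 1\<close>, which is what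
    \<open>n \<le> 2 * B * (j n + 1)\<close> requires.\<close>
  define e where "e = max \<epsilon> (1/2)"
  have e: "1/2 \<le> e" "e < 1" "\<epsilon> \<le> e" using \<epsilon> by (auto simp: e_def)
  define x where "x = root (2 * B) e"
  have x: "0 < x" "x < 1" "x ^ (2 * B) = e" using e B by (auto simp: x_def real_root_lt_1_iff)
  have epsj: "\<epsilon> ^ (j n - 1) \<le> x ^ n / e\<^sup>2" if n: "n \<ge> 2 * B" for n
  proof -
    have j1: "j n \<ge> 1" using good[OF n] by simp
    have "\<epsilon> ^ (j n - 1) \<le> e ^ (j n - 1)" using \<epsilon> e by (intro power_mono) auto
    also have "\<dots> = e ^ (j n + 1) / e\<^sup>2"
    proof -
      have "j n + 1 = (j n - 1) + 2" using j1 by simp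
      then have "e ^ (j n + 1) = e ^ (j n - 1) * e\<^sup>2" by (simp only: power_add)
      then show ?thesis using e by simp
    qed
    also have "e ^ (j n + 1) = x ^ (2 * B * (j n + 1))" unfolding x(3)[symmetric] by (rule power_mult[symmetric])
    also have "\<dots> \<le> x ^ n"
    proof (rule power_decreasing)
      have "n mod (2 * B) < 2 * B" using B by simp
      then show "n \<le> 2 * B * (j n + 1)" using div_mult_mod_eq[of n "2 * B"] unfolding j_def by (simp add: algebra_simps)
    qed (use x in auto)
    finally show ?thesis by (simp add: divide_right_mono)
  qed
  have xlim: "(\<lambda>n. x ^ n / e\<^sup>2) \<longlonglongrightarrow> 0"
    using x by (intro tendsto_divide_zero LIMSEQ_power_zero) auto
  have vv: "(\<integral>\<^sup>+x. ennreal (v n x) \<partial>lborel) = ennreal (\<epsilon> * \<epsilon> ^ (j n - 1))" if n: "n \<ge> 1" for n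
  proof -
    have fvn: "(\<integral>\<^sup>+x. vn n x \<partial>lborel) < \<infinity>" unfolding ivn[OF n] by simp
    have "(\<integral>\<^sup>+x. ennreal (v n x) \<partial>lborel) = (\<integral>\<^sup>+x. vn n x \<partial>lborel)"
      unfolding v_def using density_enn2real(1)[OF _ fvn, simplified] by (intro nn_integral_cong_AE) auto
    then show ?thesis using ivn[OF n] by simp
  qed
  have vlim: "(\<lambda>n. \<integral>\<^sup>+x. ennreal (v n x) \<partial>lborel) \<longlonglongrightarrow> 0"
  proof (rule tendsto_sandwich[of "\<lambda>_. 0"])
    show "\<forall>\<^sub>F n in sequentially. (\<integral>\<^sup>+x. ennreal (v n x) \<partial>lborel) \<le> ennreal (x ^ n / e\<^sup>2)"
      using eventually_ge_at_top[of "2 * B"]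
    proof eventually_elim
      case (elim n)
      have "\<epsilon> * \<epsilon> ^ (j n - 1) \<le> 1 * \<epsilon> ^ (j n - 1)" using \<epsilon> by (intro mult_right_mono) auto
      then have "\<epsilon> * \<epsilon> ^ (j n - 1) \<le> x ^ n / e\<^sup>2" using epsj[OF elim] by linarith
      then show ?case using good[OF elim] by (simp add: vv ennreal_leI)
    qed
    show "(\<lambda>n. ennreal (x ^ n / e\<^sup>2)) \<longlonglongrightarrow> 0" using tendsto_ennrealI[OF xlim] by simp
  qed auto
  obtain Eg where Eg: "(\<integral>\<^sup>+x. g2 x * lnp (g2 x) \<partial>lborel) = ennreal Eg" "0 \<le> Eg"
    using eg by (cases "\<integral>\<^sup>+x. g2 x * lnp (g2 x) \<partial>lborel") auto
  have vent: "(\<lambda>n. \<integral>\<^sup>+x. ennreal (v n x * max 0 (ln (v n x))) \<partial>lborel) \<longlonglongrightarrow> 0"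
  proof (rule tendsto_sandwich[of "\<lambda>_. 0"])
    \<comment> \<open>The rescaling costs \<open>ln (b n) \<le> b n\<close>; the extra factor
      \<open>real n\<close> only enlarges the bound and brings it into the form of
      \<open>subexponential\<close>.\<close>
    show "\<forall>\<^sub>F n in sequentially. (\<integral>\<^sup>+x. ennreal (v n x * max 0 (ln (v n x))) \<partial>lborel) \<le> ennreal (real n * b n * x ^ n / e\<^sup>2 + x ^ n / e\<^sup>2 * (Eg + 1))"
      using eventually_ge_at_top[of "2 * B"]
    proof eventually_elim
      case (elim n)
      have n1: "n \<ge> 1" using good[OF elim] by simp
      have bn: "b n > 0" by (rule b[OF n1])
      have fvn: "(\<integral>\<^sup>+x. vn n x \<partial>lborel) < \<infinity>" unfolding ivn[OF n1] by simp
      have nx: "0 \<le> x ^ n / e\<^sup>2" using x by simp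
      have "(\<integral>\<^sup>+x. ennreal (v n x * max 0 (ln (v n x))) \<partial>lborel) = (\<integral>\<^sup>+x. vn n x * lnp (vn n x) \<partial>lborel)"
      proof (rule nn_integral_cong_AE)
        show "AE x in lborel. ennreal (v n x * max 0 (ln (v n x))) = vn n x * lnp (vn n x)"
          using density_enn2real(1)[OF _ fvn, simplified]
        proof eventually_elim
          case (elim x)
          have "vn n x < \<infinity>" by (subst elim) simp
          then show ?case unfolding v_def by (rule enn2real_lnp[symmetric])
        qed
      qed
      also have "\<dots> \<le> ennreal (max 0 (ln (b n))) * (\<integral>\<^sup>+x. v0 n x \<partial>lborel) + (\<integral>\<^sup>+x. v0 n x * lnp (v0 n x) \<partial>lborel)"
        unfolding vn_def by (rule affine_density_entropy[OF _ bn]) simp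
      also have "\<dots> \<le> ennreal (b n) * ennreal (x ^ n / e\<^sup>2) + ennreal (x ^ n / e\<^sup>2) * ennreal (Eg + 1)"
      proof (rule add_mono)
        have "max 0 (ln (b n)) \<le> b n" using bn ln_le_minus_one[OF bn] by auto
        moreover have "\<epsilon> * \<epsilon> ^ (j n - 1) \<le> x ^ n / e\<^sup>2"
        proof -
          have "\<epsilon> * \<epsilon> ^ (j n - 1) \<le> 1 * \<epsilon> ^ (j n - 1)" using \<epsilon> by (intro mult_right_mono) auto
          then show ?thesis using epsj[OF elim] by linarith
        qed
        ultimately show "ennreal (max 0 (ln (b n))) * (\<integral>\<^sup>+x. v0 n x \<partial>lborel) \<le> ennreal (b n) * ennreal (x ^ n / e\<^sup>2)"
          unfolding iv0 by (intro mult_mono ennreal_leI) auto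
        have "(\<integral>\<^sup>+x. v0 n x * lnp (v0 n x) \<partial>lborel) \<le> ennreal (\<epsilon> ^ (j n - 1)) * (ennreal Eg + 1)" using ev0[of n] unfolding Eg(1) .
        also have "ennreal Eg + 1 = ennreal (Eg + 1)" using Eg(2) by simp
        also have "ennreal (\<epsilon> ^ (j n - 1)) * ennreal (Eg + 1) \<le> ennreal (x ^ n / e\<^sup>2) * ennreal (Eg + 1)"
          by (intro mult_right_mono ennreal_leI epsj[OF elim]) auto
        finally show "(\<integral>\<^sup>+x. v0 n x * lnp (v0 n x) \<partial>lborel) \<le> ennreal (x ^ n / e\<^sup>2) * ennreal (Eg + 1)" .
      qed
      also have "\<dots> = ennreal (b n * (x ^ n / e\<^sup>2) + x ^ n / e\<^sup>2 * (Eg + 1))"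
      proof -
        have "0 \<le> b n * (x ^ n / e\<^sup>2)" "0 \<le> x ^ n / e\<^sup>2 * (Eg + 1)"
          using nx bn Eg(2) mult_nonneg_nonneg[of "b n" "x ^ n / e\<^sup>2"] mult_nonneg_nonneg[of "x ^ n / e\<^sup>2" "Eg + 1"] by linarith+
        moreover have "ennreal (b n) * ennreal (x ^ n / e\<^sup>2) = ennreal (b n * (x ^ n / e\<^sup>2))"
          using nx bn by (intro ennreal_mult[symmetric]) auto
        moreover have "ennreal (x ^ n / e\<^sup>2) * ennreal (Eg + 1) = ennreal (x ^ n / e\<^sup>2 * (Eg + 1))"
          using nx Eg(2) by (intro ennreal_mult[symmetric]) auto
        ultimately show ?thesis by (simp only: ennreal_plus)
      qed
      also have "\<dots> \<le> ennreal (real n * b n * x ^ n / e\<^sup>2 + x ^ n / e\<^sup>2 * (Eg + 1))"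
      proof (rule ennreal_leI)
        have "0 \<le> b n * (x ^ n / e\<^sup>2)" by (rule mult_nonneg_nonneg[OF less_imp_le[OF bn] nx])
        then have "1 * (b n * (x ^ n / e\<^sup>2)) \<le> real n * (b n * (x ^ n / e\<^sup>2))" using n1 by (intro mult_right_mono) auto
        then show "b n * (x ^ n / e\<^sup>2) + x ^ n / e\<^sup>2 * (Eg + 1) \<le> real n * b n * x ^ n / e\<^sup>2 + x ^ n / e\<^sup>2 * (Eg + 1)" by (simp add: mult.assoc)
      qed
      finally show ?case .
    qed
    have "(\<lambda>n. real n * b n * x ^ n / e\<^sup>2 + x ^ n / e\<^sup>2 * (Eg + 1)) \<longlonglongrightarrow> 0 / e\<^sup>2 + 0 * (Eg + 1)"
      using x e by (intro tendsto_intros S.subexponential xlim) auto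
    then show "(\<lambda>n. ennreal (real n * b n * x ^ n / e\<^sup>2 + x ^ n / e\<^sup>2 * (Eg + 1))) \<longlonglongrightarrow> 0" using tendsto_ennrealI by fastforce
  qed auto
  show ?thesis
    by (rule that[of u v "max (2 * B) (max N1 1)" C])
      (use um vm dec uC ulim vlim vent in \<open>auto simp: u_def v_def \<psi>_def\<close>)
qed

section \<open>Uniform integrability\<close>

text \<open>Of the exponent \<alpha>, one half is lost in the doubling argument and another half in
  passing from the characteristic function to a moment, which leaves \<alpha>/4. Tightness carries
  the bound from the symmetrized laws back to \<open>P n\<close>.\<close>

lemma weak_conv_fractional_moment:
  fixes \<mu> Q :: "real measure" and P :: "nat \<Rightarrow> real measure" and a b :: "nat \<Rightarrow> real"
  assumes \<mu>: "real_distribution \<mu>" and P: "\<And>n. real_distribution (P n)" and Q: "real_distribution Q"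
    and chP: "\<And>n t. n \<ge> 1 \<Longrightarrow> char (P n) t = iexp (- (t * a n)) * char \<mu> (t / b n) ^ n"
    and b: "\<And>n. n \<ge> 1 \<Longrightarrow> b n > 0" and wc: "weak_conv_m P Q"
    and chQ: "\<And>t. cmod (char Q t) = exp (- c * \<bar>t\<bar> powr \<alpha>)" and c: "c > 0" and \<alpha>: "\<alpha> > 0"
  obtains K R where "K \<ge> 0"
    "\<forall>\<^sub>F n in sequentially. (\<integral>\<^sup>+x. ennreal (\<bar>x\<bar> powr (\<alpha> / 4)) * indicator {x. \<bar>x\<bar> \<ge> R} x \<partial>P n) \<le> ennreal K"
proof -
  interpret S: stable_scaling "\<lambda>s. cmod (char \<mu> s)" b c \<alpha>
    by (rule stable_scaling_char[OF \<mu> P Q chP b wc chQ c \<alpha>])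
  obtain C where C: "C \<ge> 0" and ev: "\<forall>\<^sub>F n in sequentially. \<forall>t. 0 < t \<and> t \<le> 1 \<longrightarrow> 1 - (cmod (char \<mu> (t / b n)) ^ n)\<^sup>2 \<le> C * t powr (\<alpha> / 2)"
    using S.small_scale_upper by blast
  obtain K where K: "K \<ge> 0" and tight: "\<forall>\<^sub>F n in sequentially. measure (P n) {-K..K} \<ge> 1/2"
    by (rule weak_conv_tight[OF P Q wc])
  define D where "D = 4 * C / (\<alpha> / 2 * (1 - cos (1/2)))"
  have cos12: "cos (1/2 :: real) < 1" using cos_monotone_0_pi[of 0 "1/2"] pi_gt3 by simp
  have D: "D \<ge> 0" using C \<alpha> cos12 by (simp add: D_def)
  have "\<forall>\<^sub>F n in sequentially. (\<integral>\<^sup>+x. ennreal (\<bar>x\<bar> powr (\<alpha> / 4)) * indicator {x. \<bar>x\<bar> \<ge> 2 * K + 2 * 1} x \<partial>P n) \<le> ennreal (2 * 2 powr (\<alpha> / 4) * D)"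
    using ev tight eventually_ge_at_top[of 1]
  proof eventually_elim
    case (elim n)
    interpret Pn: real_distribution "P n" by (rule P)
    have cm: "cmod (char (P n) t) = cmod (char \<mu> (t / b n)) ^ n" for t
      unfolding chP[OF elim(3)] norm_mult norm_exp_i_times by (simp add: norm_power)
    have "(\<integral>\<^sup>+x. ennreal (\<bar>x\<bar> powr (\<alpha> / 4)) * indicator {x. \<bar>x\<bar> \<ge> 2 * K + 2 * 1} x \<partial>P n)
      \<le> ennreal (2 * 2 powr (\<alpha> / 4)) * (\<integral>\<^sup>+x. ennreal (\<bar>x\<bar> powr (\<alpha> / 4)) * indicator {x. \<bar>x\<bar> \<ge> 1} x \<partial>Pn.symm)"
      by (rule Pn.desymmetrize[OF K elim(2)]) (use \<alpha> in auto)
    also have "(\<integral>\<^sup>+x. ennreal (\<bar>x\<bar> powr (\<alpha> / 4)) * indicator {x. \<bar>x\<bar> \<ge> 1} x \<partial>Pn.symm) \<le> ennreal D"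
      using Pn.fractional_moment_bound[of "\<alpha> / 2" C] \<alpha> C elim(1) unfolding cm D_def by simp
    finally show ?case using D by (simp add: ennreal_mult mult_left_mono)
  qed
  then show ?thesis using D by (intro that[of "2 * 2 powr (\<alpha> / 4) * D"]) auto
qed

text \<open>A logarithm is negligible against any positive power, so a bounded moment of small order
  suffices.\<close>

lemma fractional_moment_log_UI:
  fixes P :: "nat \<Rightarrow> real measure"
  assumes P: "\<And>n. sets (P n) = sets borel" and \<gamma>: "\<gamma> > 0" and K: "K \<ge> 0"
    and ev: "\<forall>\<^sub>F n in sequentially. (\<integral>\<^sup>+x. ennreal (\<bar>x\<bar> powr \<gamma>) * indicator {x. \<bar>x\<bar> \<ge> R} x \<partial>P n) \<le> ennreal K"
    and e: "e > 0"
  shows "\<exists>T. \<forall>\<^sub>F n in sequentially. (\<integral>\<^sup>+x. ennreal (1 + (A + B * ln (1 + \<bar>x\<bar>))) * indicator {x. \<bar>x\<bar> > T} x \<partial>P n) \<le> ennreal e"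
proof -
  have "((\<lambda>x. (1 + (A + B * ln (1 + x))) / x powr \<gamma>) \<longlongrightarrow> 0) at_top" using \<gamma> by real_asymp
  then have "\<forall>\<^sub>F x in at_top. (1 + (A + B * ln (1 + x))) / x powr \<gamma> < e / (K + 1)"
    by (rule order_tendstoD) (use e K in auto)
  then obtain T0 where T0: "\<And>x. x \<ge> T0 \<Longrightarrow> (1 + (A + B * ln (1 + x))) / x powr \<gamma> < e / (K + 1)"
    unfolding eventually_at_top_linorder by blast
  define T where "T = max (max T0 R) 1"
  have le: "ennreal (1 + (A + B * ln (1 + \<bar>x\<bar>))) * indicator {x. \<bar>x\<bar> > T} x
     \<le> ennreal (e / (K + 1)) * (ennreal (\<bar>x\<bar> powr \<gamma>) * indicator {x. \<bar>x\<bar> \<ge> R} x)" for x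
  proof (cases "\<bar>x\<bar> > T")
    case True
    then have x: "\<bar>x\<bar> \<ge> T0" "\<bar>x\<bar> \<ge> R" "\<bar>x\<bar> > 1" by (auto simp: T_def)
    have "1 + (A + B * ln (1 + \<bar>x\<bar>)) \<le> e / (K + 1) * \<bar>x\<bar> powr \<gamma>"
      using T0[OF x(1)] x(3) by (simp add: pos_divide_less_eq)
    then have "ennreal (1 + (A + B * ln (1 + \<bar>x\<bar>))) \<le> ennreal (e / (K + 1) * \<bar>x\<bar> powr \<gamma>)" by (rule ennreal_leI)
    also have "\<dots> = ennreal (e / (K + 1)) * ennreal (\<bar>x\<bar> powr \<gamma>)" using e K by (intro ennreal_mult) auto
    finally show ?thesis using True x by simp
  qed simp
  have "\<forall>\<^sub>F n in sequentially. (\<integral>\<^sup>+x. ennreal (1 + (A + B * ln (1 + \<bar>x\<bar>))) * indicator {x. \<bar>x\<bar> > T} x \<partial>P n) \<le> ennreal e"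
    using ev
  proof eventually_elim
    case (elim n)
    have [measurable_cong]: "sets (P n) = sets borel" by (rule P)
    have "(\<integral>\<^sup>+x. ennreal (1 + (A + B * ln (1 + \<bar>x\<bar>))) * indicator {x. \<bar>x\<bar> > T} x \<partial>P n)
      \<le> (\<integral>\<^sup>+x. ennreal (e / (K + 1)) * (ennreal (\<bar>x\<bar> powr \<gamma>) * indicator {x. \<bar>x\<bar> \<ge> R} x) \<partial>P n)"
      by (intro nn_integral_mono le)
    also have "\<dots> = ennreal (e / (K + 1)) * (\<integral>\<^sup>+x. ennreal (\<bar>x\<bar> powr \<gamma>) * indicator {x. \<bar>x\<bar> \<ge> R} x \<partial>P n)"
      by (rule nn_integral_cmult) measurable
    also have "\<dots> \<le> ennreal (e / (K + 1)) * ennreal K" by (intro mult_left_mono elim) simp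
    also have "\<dots> = ennreal (e / (K + 1) * K)" using e K by (intro ennreal_mult[symmetric]) auto
    also have "\<dots> \<le> ennreal e" using e K by (intro ennreal_leI) (simp add: divide_le_eq)
    finally show ?case .
  qed
  then show ?thesis by blast
qed

section \<open>Second moments of symmetrized laws\<close>

context real_distribution begin

lemma one_minus_char_sq_le:
  assumes v: "v \<ge> 0" and m: "(\<integral>\<^sup>+x. ennreal (x\<^sup>2) \<partial>symm) \<le> ennreal v"
  shows "1 - (cmod (char M t))\<^sup>2 \<le> v / 2 * t\<^sup>2"
proof -
  interpret W: real_distribution symm by (rule real_distribution_symm)
  have "1 - (cmod (char M t))\<^sup>2 = (\<integral>x. 1 - cos (t * x) \<partial>symm)" by (rule one_minus_norm_char_sq)
  then have "ennreal (1 - (cmod (char M t))\<^sup>2) = (\<integral>\<^sup>+x. ennreal (1 - cos (t * x)) \<partial>symm)"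
    by (subst nn_integral_eq_integral) (auto intro!: integrable_cos_symm)
  also have "\<dots> \<le> (\<integral>\<^sup>+x. ennreal (t\<^sup>2 / 2) * ennreal (x\<^sup>2) \<partial>symm)"
  proof (rule nn_integral_mono)
    fix x :: real
    have "1 - cos (t * x) = 2 * (sin (t * x / 2))\<^sup>2" using cos_double_sin[of "t * x / 2"] by simp
    also have "\<dots> \<le> 2 * (t * x / 2)\<^sup>2"
      using abs_sin_x_le_abs_x[of "t * x / 2"] unfolding abs_le_square_iff by simp
    also have "\<dots> = t\<^sup>2 / 2 * x\<^sup>2" by (simp add: power2_eq_square)
    finally have "ennreal (1 - cos (t * x)) \<le> ennreal (t\<^sup>2 / 2 * x\<^sup>2)" by (rule ennreal_leI)
    also have "ennreal (t\<^sup>2 / 2 * x\<^sup>2) = ennreal (t\<^sup>2 / 2) * ennreal (x\<^sup>2)" by (rule ennreal_mult) auto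
    finally show "ennreal (1 - cos (t * x)) \<le> ennreal (t\<^sup>2 / 2) * ennreal (x\<^sup>2)" .
  qed
  also have "\<dots> = ennreal (t\<^sup>2 / 2) * (\<integral>\<^sup>+x. ennreal (x\<^sup>2) \<partial>symm)" by (rule nn_integral_cmult) measurable
  also have "\<dots> \<le> ennreal (t\<^sup>2 / 2) * ennreal v" by (intro mult_left_mono m) simp
  also have "\<dots> = ennreal (v / 2 * t\<^sup>2)" using v by (simp add: ennreal_mult'[symmetric] mult.commute)
  finally show ?thesis using v by (subst (asm) ennreal_le_iff) auto
qed

text \<open>Fatou, since \<open>2 * (1 - cos (t * x)) / t^2\<close> tends to \<open>x^2\<close>.
  Finiteness of the second moment is not presupposed.\<close>

lemma second_moment_symm_le_liminf:
  assumes t: "t \<longlonglongrightarrow> 0" "\<And>n. t n \<noteq> 0"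
  shows "(\<integral>\<^sup>+x. ennreal (x\<^sup>2) \<partial>symm) \<le> liminf (\<lambda>n. ennreal (2 * (1 - (cmod (char M (t n)))\<^sup>2) / (t n)\<^sup>2))"
proof -
  interpret W: real_distribution symm by (rule real_distribution_symm)
  have lim: "(\<lambda>n. ennreal (2 * (1 - cos (t n * x)) / (t n)\<^sup>2)) \<longlonglongrightarrow> ennreal (x\<^sup>2)" for x :: real
  proof (rule tendsto_ennrealI)
    have "(\<lambda>s::real. 2 * (1 - cos (s * x)) / s\<^sup>2) \<midarrow>0\<rightarrow> x\<^sup>2"
    proof (cases "x = 0")
      case False
      then show ?thesis by (real_asymp simp: power2_eq_square)
    qed simp
    then show "(\<lambda>n. 2 * (1 - cos (t n * x)) / (t n)\<^sup>2) \<longlonglongrightarrow> x\<^sup>2"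
      by (rule filterlim_compose) (use t in \<open>auto simp: filterlim_at\<close>)
  qed
  have "(\<integral>\<^sup>+x. ennreal (x\<^sup>2) \<partial>symm) = (\<integral>\<^sup>+x. liminf (\<lambda>n. ennreal (2 * (1 - cos (t n * x)) / (t n)\<^sup>2)) \<partial>symm)"
    by (intro nn_integral_cong lim_imp_Liminf[symmetric] lim) simp
  also have "\<dots> \<le> liminf (\<lambda>n. \<integral>\<^sup>+x. ennreal (2 * (1 - cos (t n * x)) / (t n)\<^sup>2) \<partial>symm)"
    by (rule nn_integral_liminf) measurable
  also have "(\<lambda>n. \<integral>\<^sup>+x. ennreal (2 * (1 - cos (t n * x)) / (t n)\<^sup>2) \<partial>symm) = (\<lambda>n. ennreal (2 * (1 - (cmod (char M (t n)))\<^sup>2) / (t n)\<^sup>2))"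
  proof
    fix n
    have i: "integrable symm (\<lambda>x. 2 * (1 - cos (t n * x)) / (t n)\<^sup>2)"
      by (intro integrable_mult_right integrable_divide_zero Bochner_Integration.integrable_diff integrable_cos_symm) auto
    show "(\<integral>\<^sup>+x. ennreal (2 * (1 - cos (t n * x)) / (t n)\<^sup>2) \<partial>symm) = ennreal (2 * (1 - (cmod (char M (t n)))\<^sup>2) / (t n)\<^sup>2)"
      unfolding one_minus_norm_char_sq by (subst nn_integral_eq_integral[OF i]) (simp_all only: integral_divide_zero integral_mult_right_zero, simp)
  qed
  finally show ?thesis .
qed

lemma second_moment_symm_le:
  assumes C: "\<And>t. t \<noteq> 0 \<Longrightarrow> 1 - (cmod (char M t))\<^sup>2 \<le> C * t\<^sup>2"
  shows "(\<integral>\<^sup>+x. ennreal (x\<^sup>2) \<partial>symm) \<le> ennreal (2 * C)"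
proof -
  have "(\<integral>\<^sup>+x. ennreal (x\<^sup>2) \<partial>symm) \<le> liminf (\<lambda>n. ennreal (2 * (1 - (cmod (char M (inverse (real (Suc n)))))\<^sup>2) / (inverse (real (Suc n)))\<^sup>2))"
    by (rule second_moment_symm_le_liminf[OF LIMSEQ_inverse_real_of_nat]) simp
  also have "\<dots> \<le> liminf (\<lambda>n::nat. ennreal (2 * C))"
  proof (intro Liminf_mono always_eventually allI ennreal_leI)
    fix n :: nat
    define t where "t = inverse (real (Suc n))"
    have "t \<noteq> 0" by (simp add: t_def)
    then show "2 * (1 - (cmod (char M (inverse (real (Suc n)))))\<^sup>2) / (inverse (real (Suc n)))\<^sup>2 \<le> 2 * C"
      using C[of t] unfolding t_def[symmetric] by (simp add: divide_le_eq)
  qed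
  also have "\<dots> = ennreal (2 * C)" by (rule Liminf_const) simp
  finally show ?thesis .
qed

lemma second_moment_symm_le_second_moment:
  "(\<integral>\<^sup>+x. ennreal (x\<^sup>2) \<partial>symm) \<le> 4 * (\<integral>\<^sup>+x. ennreal (x\<^sup>2) \<partial>M)"
proof -
  have "(\<integral>\<^sup>+x. ennreal (x\<^sup>2) \<partial>symm) = (\<integral>\<^sup>+x. \<integral>\<^sup>+y. ennreal ((x - y)\<^sup>2) \<partial>M \<partial>M)" by (rule nn_integral_symm) measurable
  also have "\<dots> \<le> (\<integral>\<^sup>+x. \<integral>\<^sup>+y. 2 * ennreal (x\<^sup>2) + 2 * ennreal (y\<^sup>2) \<partial>M \<partial>M)"
  proof (intro nn_integral_mono)
    fix x y :: real
    have "0 \<le> (x + y)\<^sup>2" by simp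
    then have "(x - y)\<^sup>2 \<le> 2 * x\<^sup>2 + 2 * y\<^sup>2" by (simp add: power2_eq_square algebra_simps)
    then have "ennreal ((x - y)\<^sup>2) \<le> ennreal (2 * x\<^sup>2 + 2 * y\<^sup>2)" by (rule ennreal_leI)
    then show "ennreal ((x - y)\<^sup>2) \<le> 2 * ennreal (x\<^sup>2) + 2 * ennreal (y\<^sup>2)" by (simp add: ennreal_mult)
  qed
  also have "\<dots> = 4 * (\<integral>\<^sup>+x. ennreal (x\<^sup>2) \<partial>M)"
    by (simp add: nn_integral_add nn_integral_cmult emeasure_space_1 del: space_eq_univ) (simp add: mult_2[symmetric] distrib_right[symmetric] mult.assoc[symmetric])
  finally show ?thesis .
qed

end

text \<open>With \<open>v\<close> the symmetrized second moment of one summand, Bernoulli bounds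
  that of \<open>P n\<close> by \<open>v * n / (b n)^2\<close>. Fatou bounds \<open>v\<close> by
  nearly \<open>2 * q n * (b n)^2\<close>, and convergence at \<open>t = 1\<close> bounds
  \<open>n * q n\<close> by nearly \<open>2 * c\<close>. The resulting \<open>4 * c\<close> is the
  variance of the symmetrized limit.\<close>

lemma second_moment_symm_limsup:
  fixes \<mu> Q :: "real measure" and P :: "nat \<Rightarrow> real measure" and a b :: "nat \<Rightarrow> real"
  assumes \<mu>: "real_distribution \<mu>" and P: "\<And>n. real_distribution (P n)" and Q: "real_distribution Q"
    and chP: "\<And>n t. n \<ge> 1 \<Longrightarrow> char (P n) t = iexp (- (t * a n)) * char \<mu> (t / b n) ^ n"
    and b: "\<And>n. n \<ge> 1 \<Longrightarrow> b n > 0" and wc: "weak_conv_m P Q"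
    and chQ: "\<And>t. cmod (char Q t) = exp (- c * \<bar>t\<bar> powr 2)" and c: "c > 0"
    and fin: "(\<integral>\<^sup>+x. ennreal (x\<^sup>2) \<partial>real_distribution.symm \<mu>) < \<infinity>" and e: "e > 0"
  shows "\<forall>\<^sub>F n in sequentially. (\<integral>\<^sup>+x. ennreal (x\<^sup>2) \<partial>real_distribution.symm (P n)) \<le> ennreal (4 * c + e)"
proof -
  interpret \<mu>: real_distribution \<mu> by fact
  interpret S: stable_scaling "\<lambda>s. cmod (char \<mu> s)" b c 2
    by (rule stable_scaling_char[OF \<mu> P Q chP b wc chQ c]) auto
  obtain v where v: "(\<integral>\<^sup>+x. ennreal (x\<^sup>2) \<partial>\<mu>.symm) = ennreal v" "v \<ge> 0"
    using fin by (cases "\<integral>\<^sup>+x. ennreal (x\<^sup>2) \<partial>\<mu>.symm") auto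
  have F1: "(\<integral>\<^sup>+x. ennreal (x\<^sup>2) \<partial>real_distribution.symm (P n)) \<le> ennreal (v * real n / (b n)\<^sup>2)" if n: "n \<ge> 1" for n
  proof -
    interpret Pn: real_distribution "P n" by (rule P)
    have "1 - (cmod (char (P n) t))\<^sup>2 \<le> (v * real n / (b n)\<^sup>2 / 2) * t\<^sup>2" for t
    proof -
      define q where "q = 1 - (cmod (char \<mu> (t / b n)))\<^sup>2"
      have q: "q \<le> v / 2 * (t / b n)\<^sup>2" unfolding q_def by (rule \<mu>.one_minus_char_sq_le) (use v in auto)
      have q1: "q \<le> 1" by (simp add: q_def)
      have "1 + real n * (- q) \<le> (1 + (- q)) ^ n" by (rule Bernoulli_inequality) (use q1 in simp)
      also have "(1 + (- q)) ^ n = (cmod (char (P n) t))\<^sup>2"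
        unfolding chP[OF n] norm_mult norm_exp_i_times q_def by (simp add: norm_power power_mult[symmetric] mult.commute)
      finally have "1 - (cmod (char (P n) t))\<^sup>2 \<le> real n * q" by simp
      also have "\<dots> \<le> real n * (v / 2 * (t / b n)\<^sup>2)" using q by (intro mult_left_mono) auto
      also have "\<dots> = (v * real n / (b n)\<^sup>2 / 2) * t\<^sup>2" by (simp add: power_divide mult_ac)
      finally show ?thesis .
    qed
    from Pn.second_moment_symm_le[OF this] show ?thesis by simp
  qed
  define q where "q n = 1 - (cmod (char \<mu> (1 / b n)))\<^sup>2" for n
  \<comment> \<open>Chosen for the final product \<open>2 * (2 * c + \<eta>) * (1 + \<eta>)\<close>,
    whose excess over \<open>4 * c\<close> is at most \<open>\<eta> * (4 * c + 4)\<close>.\<close>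
  define \<eta> where "\<eta> = min 1 (e / (4 * c + 4))"
  have "\<eta> * (4 * c + 4) \<le> e / (4 * c + 4) * (4 * c + 4)" using c by (intro mult_right_mono) (auto simp: \<eta>_def)
  then have \<eta>: "\<eta> > 0" "\<eta> \<le> 1" "\<eta> * (4 * c + 4) \<le> e" using e c by (auto simp: \<eta>_def)
  have F2: "\<forall>\<^sub>F n in sequentially. real n * q n \<le> 2 * c + \<eta>"
  proof -
    have "exp (- c) - exp (- c - \<eta> / 2) > 0" using \<eta> by simp
    from S.unif[OF this, of 1] show ?thesis
    proof eventually_elim
      case (elim n)
      have "\<bar>cmod (char \<mu> (1 / b n)) ^ n - exp (- c)\<bar> < exp (- c) - exp (- c - \<eta> / 2)" using elim[rule_format, of 1] by simp
      then have "exp (- c - \<eta> / 2) \<le> cmod (char \<mu> (1 / b n)) ^ n" by linarith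
      then have "(exp (- c - \<eta> / 2))\<^sup>2 \<le> (cmod (char \<mu> (1 / b n)) ^ n)\<^sup>2" by (intro power_mono) auto
      also have "(exp (- c - \<eta> / 2))\<^sup>2 = exp (- (2 * c + \<eta>))" by (simp add: power2_eq_square exp_add[symmetric])
      also have "(cmod (char \<mu> (1 / b n)) ^ n)\<^sup>2 = (1 - q n) ^ n" by (simp add: q_def power_mult[symmetric] mult.commute)
      also have "\<dots> \<le> exp (- q n) ^ n" using exp_ge_add_one_self[of "- q n"] by (intro power_mono) (auto simp: q_def)
      also have "\<dots> = exp (- (real n * q n))" by (simp add: exp_of_nat_mult[symmetric])
      finally show ?case by simp
    qed
  qed
  have "\<forall>\<^sub>F n in sequentially. v * real n / (b n)\<^sup>2 \<le> 4 * c + e"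
  proof (cases "v = 0")
    case True
    then show ?thesis using c e by simp
  next
    case False
    then have v0: "v > 0" using v by simp
    have bS: "filterlim (\<lambda>n. b (Suc n)) at_top sequentially"
      by (rule filterlim_compose[OF S.b_at_top filterlim_Suc])
    have t0: "(\<lambda>n. 1 / b (Suc n)) \<longlonglongrightarrow> 0"
      using tendsto_inverse_0_at_top[OF bS] by (simp add: inverse_eq_divide)
    have "ennreal (v / (1 + \<eta>)) < ennreal v" using v0 \<eta> by (subst ennreal_less_iff) (auto simp: field_simps)
    also have "ennreal v \<le> liminf (\<lambda>n. ennreal (2 * (1 - (cmod (char \<mu> (1 / b (Suc n))))\<^sup>2) / (1 / b (Suc n))\<^sup>2))"
      unfolding v(1)[symmetric]
    proof (rule \<mu>.second_moment_symm_le_liminf[OF t0])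
      show "1 / b (Suc n) \<noteq> 0" for n using b[of "Suc n"] by simp
    qed
    finally have "\<forall>\<^sub>F n in sequentially. ennreal (v / (1 + \<eta>)) < ennreal (2 * (1 - (cmod (char \<mu> (1 / b (Suc n))))\<^sup>2) / (1 / b (Suc n))\<^sup>2)"
      by (rule less_LiminfD)
    then have F3: "\<forall>\<^sub>F n in sequentially. ennreal (v / (1 + \<eta>)) < ennreal (2 * (1 - (cmod (char \<mu> (1 / b n)))\<^sup>2) / (1 / b n)\<^sup>2)"
      using eventually_sequentially_Suc[of "\<lambda>n. ennreal (v / (1 + \<eta>)) < ennreal (2 * (1 - (cmod (char \<mu> (1 / b n)))\<^sup>2) / (1 / b n)\<^sup>2)"] by simp
    from F2 F3 eventually_ge_at_top[of 1] show ?thesis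
    proof eventually_elim
      case (elim n)
      have bn: "b n > 0" using b elim by blast
      have "v / (1 + \<eta>) < 2 * q n / (1 / b n)\<^sup>2"
        using elim(2) v0 \<eta> unfolding q_def[symmetric] by (subst (asm) ennreal_less_iff) auto
      then have "v < 2 * q n * (b n)\<^sup>2 * (1 + \<eta>)"
        using \<eta> by (simp add: power_divide pos_divide_less_eq)
      then have "v / (b n)\<^sup>2 \<le> 2 * q n * (1 + \<eta>)" using bn by (simp add: pos_divide_le_eq algebra_simps)
      then have "real n * (v / (b n)\<^sup>2) \<le> real n * (2 * q n * (1 + \<eta>))" by (intro mult_left_mono) auto
      also have "\<dots> = 2 * (real n * q n) * (1 + \<eta>)" by simp
      also have "\<dots> \<le> 2 * (2 * c + \<eta>) * (1 + \<eta>)" using elim(1) \<eta> by (intro mult_right_mono mult_left_mono) auto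
      also have "\<dots> = 4 * c + \<eta> * (4 * c + 2 + 2 * \<eta>)" by (simp add: algebra_simps)
      also have "\<dots> \<le> 4 * c + \<eta> * (4 * c + 4)" using \<eta> by (intro add_left_mono mult_left_mono) auto
      also have "\<dots> \<le> 4 * c + e" using \<eta> by simp
      finally show ?case by (simp add: mult.commute)
    qed
  qed
  then show ?thesis using eventually_ge_at_top[of 1]
  proof eventually_elim
    case (elim n)
    show ?case by (rule order_trans[OF F1[OF elim(2)] ennreal_leI[OF elim(1)]])
  qed
qed

text \<open>If the second moment is a finite \<open>w\<close>, the quadratic bound on the
  characteristic function gives \<open>(1 - exp (- 2 * c * s)) / s \<le> w / 2\<close>, and the left
  side tends to \<open>2 * c\<close>.\<close>

lemma gaussian_second_moment_symm:
  assumes Q: "real_distribution Q" and chQ: "\<And>t. cmod (char Q t) = exp (- c * \<bar>t\<bar> powr 2)"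
  shows "ennreal (4 * c) \<le> (\<integral>\<^sup>+x. ennreal (x\<^sup>2) \<partial>real_distribution.symm Q)"
proof (cases "\<integral>\<^sup>+x. ennreal (x\<^sup>2) \<partial>real_distribution.symm Q")
  case (real w)
  interpret Q: real_distribution Q by fact
  have le: "(1 - exp (- 2 * c * s)) / s \<le> w / 2" if s: "s > 0" for s
  proof -
    have "1 - (cmod (char Q (sqrt s)))\<^sup>2 \<le> w / 2 * (sqrt s)\<^sup>2" by (rule Q.one_minus_char_sq_le) (use real in auto)
    moreover have "(cmod (char Q (sqrt s)))\<^sup>2 = exp (- 2 * c * s)"
      using s unfolding chQ by (simp add: power2_eq_square exp_add[symmetric])
    ultimately show ?thesis using s by (simp add: pos_divide_le_eq)
  qed
  have "((\<lambda>s. (1 - exp (- 2 * c * s)) / s) \<longlongrightarrow> 2 * c) (at_right 0)" by real_asymp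
  then have "2 * c \<le> w / 2"
    by (rule tendsto_upperbound) (use le in \<open>auto simp only: eventually_at_right_field trivial_limit_at_right_real intro!: exI[of _ 1]\<close>)
  then show ?thesis using real by (simp add: ennreal_leI)
qed simp

lemma weak_conv_symm:
  assumes P: "\<And>n. real_distribution (P n)" and Q: "real_distribution Q" and wc: "weak_conv_m P Q"
  shows "weak_conv_m (\<lambda>n. real_distribution.symm (P n)) (real_distribution.symm Q)"
proof (rule levy_continuity)
  fix t
  have "(\<lambda>n. complex_of_real ((cmod (char (P n) t))\<^sup>2)) \<longlonglongrightarrow> of_real ((cmod (char Q t))\<^sup>2)"
    by (intro tendsto_intros levy_continuity1 P Q wc)
  then show "(\<lambda>n. char (real_distribution.symm (P n)) t) \<longlonglongrightarrow> char (real_distribution.symm Q) t"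
    by (simp add: real_distribution.char_symm[OF P] real_distribution.char_symm[OF Q])
qed (auto intro: real_distribution.real_distribution_symm P Q)

text \<open>Weak convergence together with no excess of second moments in the limit. A continuous
  cutoff of \<open>x^2\<close> captures all but \<open>e\<close> of \<open>k\<close> under
  \<open>L\<close>, hence more than \<open>k - 2 * e\<close> under \<open>W n\<close>; of at most
  \<open>k + e\<close> only \<open>3 * e\<close> is left for the tails.\<close>

lemma uniformly_integrable_of_second_moments:
  fixes W :: "nat \<Rightarrow> real measure" and L :: "real measure"
  assumes W: "\<And>n. real_distribution (W n)" and L: "real_distribution L" and wc: "weak_conv_m W L"
    and k: "k \<ge> 0" and low: "ennreal k \<le> (\<integral>\<^sup>+x. ennreal (x\<^sup>2) \<partial>L)"
    and up: "\<And>e. e > 0 \<Longrightarrow> \<forall>\<^sub>F n in sequentially. (\<integral>\<^sup>+x. ennreal (x\<^sup>2) \<partial>W n) \<le> ennreal (k + e)"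
    and e: "e > 0"
  obtains R where "R > 0" "\<forall>\<^sub>F n in sequentially. (\<integral>\<^sup>+x. ennreal (x\<^sup>2) * indicator {x. \<bar>x\<bar> \<ge> R} x \<partial>W n) \<le> ennreal (3 * e)"
proof -
  interpret W: real_distribution "W n" for n by (rule W)
  interpret L: real_distribution L by fact
  have "(\<integral>\<^sup>+x. ennreal (x\<^sup>2) \<partial>L) = (\<integral>\<^sup>+x. (SUP j::nat. ennreal (x\<^sup>2) * indicator {- real j..real j} x) \<partial>L)"
  proof (rule nn_integral_cong)
    fix x :: real
    obtain j where j: "\<bar>x\<bar> \<le> real j" using real_arch_simple by blast
    show "ennreal (x\<^sup>2) = (SUP j::nat. ennreal (x\<^sup>2) * indicator {- real j..real j} x)"
    proof (rule antisym)
      have "ennreal (x\<^sup>2) = ennreal (x\<^sup>2) * indicator {- real j..real j} x" using j by (simp add: abs_le_iff)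
      also have "\<dots> \<le> (SUP j::nat. ennreal (x\<^sup>2) * indicator {- real j..real j} x)" by (rule SUP_upper) simp
      finally show "ennreal (x\<^sup>2) \<le> (SUP j::nat. ennreal (x\<^sup>2) * indicator {- real j..real j} x)" .
    qed (auto intro!: SUP_least simp: indicator_def)
  qed
  also have "\<dots> = (SUP j::nat. \<integral>\<^sup>+x. ennreal (x\<^sup>2) * indicator {- real j..real j} x \<partial>L)"
    by (rule nn_integral_monotone_convergence_SUP) (auto simp: incseq_def le_fun_def indicator_def)
  finally have S: "(\<integral>\<^sup>+x. ennreal (x\<^sup>2) \<partial>L) = (SUP j::nat. \<integral>\<^sup>+x. ennreal (x\<^sup>2) * indicator {- real j..real j} x \<partial>L)" .
  have "\<exists>j::nat. ennreal (k - e) \<le> (\<integral>\<^sup>+x. ennreal (x\<^sup>2) * indicator {- real j..real j} x \<partial>L)"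
  \<comment> \<open>For \<open>k = 0\<close> the strict inequality between
    \<open>ennreal (k - e)\<close> and \<open>ennreal k\<close> fails, both being zero.\<close>
  proof (cases "k = 0")
    case True
    then show ?thesis using e by (simp add: ennreal_neg)
  next
    case False
    then have "ennreal (k - e) < ennreal k" using e k by (cases "k - e \<ge> 0") (auto simp: ennreal_less_iff ennreal_neg)
    then have "ennreal (k - e) < (SUP j::nat. \<integral>\<^sup>+x. ennreal (x\<^sup>2) * indicator {- real j..real j} x \<partial>L)"
      using low unfolding S by simp
    then show ?thesis by (auto simp: less_SUP_iff intro: less_imp_le)
  qed
  then obtain j :: nat where j: "ennreal (k - e) \<le> (\<integral>\<^sup>+x. ennreal (x\<^sup>2) * indicator {- real j..real j} x \<partial>L)" by blast
  define g where "g x = x\<^sup>2 * max 0 (min 1 (real j + 1 - \<bar>x\<bar>))" for x :: real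
  have g0: "0 \<le> g x" for x by (simp add: g_def)
  have gc: "isCont g x" for x unfolding g_def by (intro continuous_intros)
  have [measurable]: "g \<in> borel_measurable borel" unfolding g_def by measurable
  have gle: "g x \<le> x\<^sup>2" for x
    unfolding g_def using mult_left_mono[of "max 0 (min 1 (real j + 1 - \<bar>x\<bar>))" 1 "x\<^sup>2"] by simp
  have gb: "norm (g x) \<le> (real j + 1)\<^sup>2" for x
  proof (cases "\<bar>x\<bar> \<le> real j + 1")
    case True
    then have "x\<^sup>2 \<le> (real j + 1)\<^sup>2" using abs_le_square_iff[of x "real j + 1"] by simp
    then show ?thesis using gle[of x] g0[of x] by simp
  qed (simp add: g_def)
  have gW: "integrable (W n) g" for n by (rule W.integrable_const_bound[of _ "(real j + 1)\<^sup>2"]) (use gb in auto)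
  have gL: "integrable L g" by (rule L.integrable_const_bound[of _ "(real j + 1)\<^sup>2"]) (use gb in auto)
  have "(\<integral>\<^sup>+x. ennreal (x\<^sup>2) * indicator {- real j..real j} x \<partial>L) \<le> (\<integral>\<^sup>+x. ennreal (g x) \<partial>L)"
    by (intro nn_integral_mono) (auto simp: indicator_def g_def)
  also have "\<dots> = ennreal (\<integral>x. g x \<partial>L)" by (rule nn_integral_eq_integral[OF gL]) (simp add: g0)
  finally have "ennreal (k - e) \<le> ennreal (\<integral>x. g x \<partial>L)" using j by (rule order_trans[rotated])
  then have Lg: "k - e \<le> (\<integral>x. g x \<partial>L)" by (subst (asm) ennreal_le_iff) (auto intro: Bochner_Integration.integral_nonneg g0)
  have "(\<lambda>n. \<integral>x. g x \<partial>W n) \<longlonglongrightarrow> (\<integral>x. g x \<partial>L)"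
    by (rule weak_conv_imp_integral_bdd_continuous_conv[OF W L wc gc gb])
  then have ev: "\<forall>\<^sub>F n in sequentially. (\<integral>x. g x \<partial>W n) > k - 2 * e" by (rule order_tendstoD) (use Lg e in simp)
  have "\<forall>\<^sub>F n in sequentially. (\<integral>\<^sup>+x. ennreal (x\<^sup>2) * indicator {x. \<bar>x\<bar> \<ge> real j + 1} x \<partial>W n) \<le> ennreal (3 * e)"
    using ev up[OF e]
  proof eventually_elim
    case (elim n)
    let ?A = "\<integral>\<^sup>+x. ennreal (x\<^sup>2) * indicator {x. \<bar>x\<bar> \<ge> real j + 1} x \<partial>W n"
    have "?A + ennreal (\<integral>x. g x \<partial>W n) = ?A + (\<integral>\<^sup>+x. ennreal (g x) \<partial>W n)"
      by (simp add: nn_integral_eq_integral[OF gW] g0)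
    also have "\<dots> = (\<integral>\<^sup>+x. ennreal (x\<^sup>2) * indicator {x. \<bar>x\<bar> \<ge> real j + 1} x + ennreal (g x) \<partial>W n)"
      by (rule nn_integral_add[symmetric]) measurable
    also have "\<dots> \<le> (\<integral>\<^sup>+x. ennreal (x\<^sup>2) \<partial>W n)"
      by (intro nn_integral_mono) (auto simp: indicator_def gle ennreal_leI, simp add: g_def)
    also have "\<dots> \<le> ennreal (k + e)" by (rule elim)
    finally have le: "?A + ennreal (\<integral>x. g x \<partial>W n) \<le> ennreal (k + e)" .
    then have "?A \<le> ennreal (k + e)" by (rule order_trans[rotated]) simp
    then obtain w where w: "?A = ennreal w" "w \<ge> 0" by (cases ?A) (auto simp: top_unique)
    have "0 \<le> (\<integral>x. g x \<partial>W n)" by (intro Bochner_Integration.integral_nonneg g0)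
    then have "w + (\<integral>x. g x \<partial>W n) \<le> k + e"
      using le w k e unfolding w(1) by (simp add: ennreal_plus[symmetric] del: ennreal_plus)
    then show ?case unfolding w(1) using elim by (intro ennreal_leI) linarith
  qed
  then show ?thesis by (intro that[of "real j + 1"]) auto
qed

text \<open>The means of \<open>P n\<close> are not under control because of the constants
  \<open>a n\<close>, so uniform integrability is proved for the symmetrized laws and brought back
  by tightness.\<close>

lemma weak_conv_second_moment_UI:
  fixes \<mu> Q :: "real measure" and P :: "nat \<Rightarrow> real measure" and a b :: "nat \<Rightarrow> real"
  assumes \<mu>: "real_distribution \<mu>" and P: "\<And>n. real_distribution (P n)" and Q: "real_distribution Q"
    and chP: "\<And>n t. n \<ge> 1 \<Longrightarrow> char (P n) t = iexp (- (t * a n)) * char \<mu> (t / b n) ^ n"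
    and b: "\<And>n. n \<ge> 1 \<Longrightarrow> b n > 0" and wc: "weak_conv_m P Q"
    and chQ: "\<And>t. cmod (char Q t) = exp (- c * \<bar>t\<bar> powr 2)" and c: "c > 0"
    and fin: "(\<integral>\<^sup>+x. ennreal (x\<^sup>2) \<partial>real_distribution.symm \<mu>) < \<infinity>" and e: "e > 0" and B: "B \<ge> 0"
  shows "\<exists>T. \<forall>\<^sub>F n in sequentially. (\<integral>\<^sup>+x. ennreal (1 + (A + B * x\<^sup>2)) * indicator {x. \<bar>x\<bar> > T} x \<partial>P n) \<le> ennreal e"
proof -
  define D where "D = 1 + \<bar>A\<bar> + B"
  have D: "D > 0" using B by (simp add: D_def)
  \<comment> \<open>24 is 8 times 3: the factor \<open>2 * 2 powr 2\<close> of
    \<open>desymmetrize\<close> and the \<open>3 * d\<close> of the uniform integrability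
    bound.\<close>
  define d where "d = e / (24 * D)"
  have d: "d > 0" using e D by (simp add: d_def)
  obtain R where R: "R > 0" and ev: "\<forall>\<^sub>F n in sequentially. (\<integral>\<^sup>+x. ennreal (x\<^sup>2) * indicator {x. \<bar>x\<bar> \<ge> R} x \<partial>real_distribution.symm (P n)) \<le> ennreal (3 * d)"
  proof (rule uniformly_integrable_of_second_moments[OF _ _ weak_conv_symm[OF P Q wc] _ gaussian_second_moment_symm[OF Q chQ] second_moment_symm_limsup[OF \<mu> P Q chP b wc chQ c fin] d])
    show "real_distribution (real_distribution.symm (P n))" "real_distribution (real_distribution.symm Q)" for n
      by (intro real_distribution.real_distribution_symm P Q)+
  qed (use c in auto)
  obtain K where K: "K \<ge> 0" and tight: "\<forall>\<^sub>F n in sequentially. measure (P n) {-K..K} \<ge> 1/2"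
    by (rule weak_conv_tight[OF P Q wc])
  define T where "T = max (2 * K + 2 * R) 1"
  have le: "ennreal (1 + (A + B * x\<^sup>2)) * indicator {x. \<bar>x\<bar> > T} x
     \<le> ennreal D * (ennreal (\<bar>x\<bar> powr 2) * indicator {x. \<bar>x\<bar> \<ge> 2 * K + 2 * R} x)" for x
  proof (cases "\<bar>x\<bar> > T")
    case True
    then have x: "\<bar>x\<bar> \<ge> 2 * K + 2 * R" "\<bar>x\<bar> > 1" by (auto simp: T_def)
    have "1 \<le> x\<^sup>2" using x(2) abs_le_square_iff[of 1 x] by simp
    then have "(1 + \<bar>A\<bar>) * 1 \<le> (1 + \<bar>A\<bar>) * x\<^sup>2" by (intro mult_left_mono) auto
    then have "1 + (A + B * x\<^sup>2) \<le> D * x\<^sup>2" unfolding D_def distrib_right by linarith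
    then have "ennreal (1 + (A + B * x\<^sup>2)) \<le> ennreal (D * x\<^sup>2)" by (rule ennreal_leI)
    then show ?thesis using True x D by (simp add: ennreal_mult)
  qed simp
  have "\<forall>\<^sub>F n in sequentially. (\<integral>\<^sup>+x. ennreal (1 + (A + B * x\<^sup>2)) * indicator {x. \<bar>x\<bar> > T} x \<partial>P n) \<le> ennreal e"
    using ev tight
  proof eventually_elim
    case (elim n)
    interpret Pn: real_distribution "P n" by (rule P)
    have "(\<integral>\<^sup>+x. ennreal (1 + (A + B * x\<^sup>2)) * indicator {x. \<bar>x\<bar> > T} x \<partial>P n)
      \<le> (\<integral>\<^sup>+x. ennreal D * (ennreal (\<bar>x\<bar> powr 2) * indicator {x. \<bar>x\<bar> \<ge> 2 * K + 2 * R} x) \<partial>P n)"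
      by (intro nn_integral_mono le)
    also have "\<dots> = ennreal D * (\<integral>\<^sup>+x. ennreal (\<bar>x\<bar> powr 2) * indicator {x. \<bar>x\<bar> \<ge> 2 * K + 2 * R} x \<partial>P n)"
      by (rule nn_integral_cmult) measurable
    also have "\<dots> \<le> ennreal D * (ennreal (2 * 2 powr 2) * (\<integral>\<^sup>+x. ennreal (\<bar>x\<bar> powr 2) * indicator {x. \<bar>x\<bar> \<ge> R} x \<partial>Pn.symm))"
      by (intro mult_left_mono Pn.desymmetrize K elim R) auto
    also have "\<dots> \<le> ennreal D * (ennreal 8 * ennreal (3 * d))"
      using elim(1) by (intro mult_left_mono mult_mono) auto
    also have "\<dots> = ennreal (D * (8 * (3 * d)))"
      by (subst ennreal_mult', use D in simp, subst ennreal_mult', simp, rule refl)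
    also have "D * (8 * (3 * d)) = e" using D by (simp add: d_def)
    finally show ?case .
  qed
  then show ?thesis by blast
qed

text \<open>Raising a modulus at most 1 to the power \<open>n\<close> only decreases it, so
  \<open>1 - (cmod (char \<mu> t))^2\<close> inherits the quadratic bound valid for \<open>P\<close>
  at \<open>b * t\<close>.\<close>

lemma second_moment_symm_root:
  assumes \<mu>: "real_distribution \<mu>" and P: "real_distribution P" and n: "n \<ge> 1" and b: "b > 0"
    and ch: "\<And>t. cmod (char P t) = cmod (char \<mu> (t / b)) ^ n" and fin: "(\<integral>\<^sup>+x. ennreal (x\<^sup>2) \<partial>P) < \<infinity>"
  shows "(\<integral>\<^sup>+x. ennreal (x\<^sup>2) \<partial>real_distribution.symm \<mu>) < \<infinity>"
proof -
  interpret \<mu>: real_distribution \<mu> by fact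
  interpret P: real_distribution P by fact
  have "(\<integral>\<^sup>+x. ennreal (x\<^sup>2) \<partial>P.symm) < \<infinity>"
    by (rule le_less_trans[OF P.second_moment_symm_le_second_moment]) (use fin in \<open>simp add: ennreal_mult_less_top\<close>)
  then obtain v where v: "(\<integral>\<^sup>+x. ennreal (x\<^sup>2) \<partial>P.symm) = ennreal v" "v \<ge> 0"
    by (cases "\<integral>\<^sup>+x. ennreal (x\<^sup>2) \<partial>P.symm") auto
  have "1 - (cmod (char \<mu> t))\<^sup>2 \<le> (v / 2 * b\<^sup>2) * t\<^sup>2" for t
  proof -
    have "(cmod (char P (b * t)))\<^sup>2 = ((cmod (char \<mu> t))\<^sup>2) ^ n" using b by (simp add: ch power_mult[symmetric] mult.commute)
    also have "\<dots> \<le> ((cmod (char \<mu> t))\<^sup>2) ^ 1"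
      using n \<mu>.cmod_char_le_1[of t] by (intro power_decreasing) (auto simp: power_le_one)
    finally have "1 - (cmod (char \<mu> t))\<^sup>2 \<le> 1 - (cmod (char P (b * t)))\<^sup>2" by simp
    also have "\<dots> \<le> v / 2 * (b * t)\<^sup>2" by (rule P.one_minus_char_sq_le) (use v in auto)
    finally show ?thesis by (simp add: power_mult_distrib mult_ac)
  qed
  from \<mu>.second_moment_symm_le[OF this] show ?thesis by (rule le_less_trans) simp
qed

section \<open>Finite variance from finite relative entropy to a normal law\<close>

lemma normal_exp_moment:
  assumes s: "s > 0"
  shows "(\<integral>\<^sup>+x. ennreal (exp (x\<^sup>2 / (8 * s\<^sup>2))) * ennreal (normal_density m s x) \<partial>lborel) < \<infinity>"
proof -
  \<comment> \<open>Half of the Gaussian exponent pays for \<open>exp (x^2 / (8 * s^2))\<close>,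
    leaving a normal density of twice the variance; \<open>sqrt 2\<close> is the ratio of the
    normalisations and the exponential comes from the mean \<open>m\<close>.\<close>
  define k where "k = exp (m\<^sup>2 / (4 * s\<^sup>2)) * sqrt 2"
  have le: "exp (x\<^sup>2 / (8 * s\<^sup>2)) * normal_density m s x \<le> k * normal_density m (sqrt 2 * s) x" for x
  proof -
    have "0 \<le> (x - 2 * m)\<^sup>2" by simp
    then have "x\<^sup>2 \<le> 2 * (x - m)\<^sup>2 + 2 * m\<^sup>2" by (simp add: power2_eq_square algebra_simps)
    then have "x\<^sup>2 / (8 * s\<^sup>2) \<le> (2 * (x - m)\<^sup>2 + 2 * m\<^sup>2) / (8 * s\<^sup>2)" by (rule divide_right_mono) simp
    also have "\<dots> = m\<^sup>2 / (4 * s\<^sup>2) + (x - m)\<^sup>2 / (2 * s\<^sup>2) - (x - m)\<^sup>2 / (4 * s\<^sup>2)" using s by (simp add: field_simps)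
    finally have "x\<^sup>2 / (8 * s\<^sup>2) - (x - m)\<^sup>2 / (2 * s\<^sup>2) \<le> m\<^sup>2 / (4 * s\<^sup>2) - (x - m)\<^sup>2 / (4 * s\<^sup>2)" by simp
    then have "exp (x\<^sup>2 / (8 * s\<^sup>2)) * exp (- ((x - m)\<^sup>2 / (2 * s\<^sup>2))) \<le> exp (m\<^sup>2 / (4 * s\<^sup>2)) * exp (- ((x - m)\<^sup>2 / (4 * s\<^sup>2)))"
      unfolding exp_add[symmetric] by simp
    then have "1 / sqrt (2 * pi * s\<^sup>2) * (exp (x\<^sup>2 / (8 * s\<^sup>2)) * exp (- ((x - m)\<^sup>2 / (2 * s\<^sup>2))))
       \<le> 1 / sqrt (2 * pi * s\<^sup>2) * (exp (m\<^sup>2 / (4 * s\<^sup>2)) * exp (- ((x - m)\<^sup>2 / (4 * s\<^sup>2))))"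
      by (intro mult_left_mono) auto
    also have "\<dots> = k * normal_density m (sqrt 2 * s) x"
    proof -
      have 1: "(sqrt 2 * s)\<^sup>2 = 2 * s\<^sup>2" by (simp add: power_mult_distrib)
      have 2: "sqrt (2 * pi * (2 * s\<^sup>2)) = sqrt 2 * sqrt (2 * pi * s\<^sup>2)" unfolding real_sqrt_mult[symmetric] by simp
      show ?thesis unfolding k_def normal_density_def 1 2 using s by simp
    qed
    finally show ?thesis by (simp add: normal_density_def mult_ac)
  qed
  have "(\<integral>\<^sup>+x. ennreal (exp (x\<^sup>2 / (8 * s\<^sup>2))) * ennreal (normal_density m s x) \<partial>lborel) \<le> (\<integral>\<^sup>+x. ennreal (k * normal_density m (sqrt 2 * s) x) \<partial>lborel)"
    using le by (intro nn_integral_mono) (simp add: ennreal_mult'[symmetric] ennreal_leI)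
  also have "\<dots> = ennreal (\<integral>x. k * normal_density m (sqrt 2 * s) x \<partial>lborel)"
    using s by (intro nn_integral_eq_integral integrable_mult_right integrable_normal_density) (auto simp: k_def)
  finally show ?thesis by (rule le_less_trans) simp
qed

text \<open>Young's inequality between \<open>r x\<close> and \<open>exp (x^2 / (8 * s^2))\<close>,
  whose logarithm is the square to be integrated and which has a finite mean under the normal
  law.\<close>

lemma second_moment_of_normal_entropy:
  assumes s: "s > 0" and Q: "Q = density lborel (\<lambda>x. ennreal (normal_density m s x))"
    and [measurable]: "r \<in> borel_measurable borel" and r: "\<And>x. 0 \<le> r x"
    and ent: "(\<integral>\<^sup>+x. ennreal (r x * max 0 (ln (r x))) \<partial>Q) < \<infinity>"
  shows "(\<integral>\<^sup>+x. ennreal (x\<^sup>2) \<partial>density Q (\<lambda>x. ennreal (r x))) < \<infinity>"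
proof -
  have [measurable_cong]: "sets Q = sets borel" by (simp add: Q)
  have pt: "ennreal (r x) * ennreal (x\<^sup>2) \<le> ennreal (8 * s\<^sup>2) * (ennreal (r x * max 0 (ln (r x))) + ennreal (exp (x\<^sup>2 / (8 * s\<^sup>2))))" for x
  proof -
    have "ennreal (r x) * lnp (ennreal (exp (x\<^sup>2 / (8 * s\<^sup>2)))) \<le> ennreal (r x) * lnp (ennreal (r x)) + ennreal (exp (x\<^sup>2 / (8 * s\<^sup>2)))"
      by (rule young_lnp)
    then have "ennreal (8 * s\<^sup>2) * (ennreal (r x) * ennreal (x\<^sup>2 / (8 * s\<^sup>2))) \<le>
      ennreal (8 * s\<^sup>2) * (ennreal (r x) * ennreal (max 0 (ln (r x))) + ennreal (exp (x\<^sup>2 / (8 * s\<^sup>2))))"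
      by (intro mult_left_mono) (auto simp: lnp_ennreal r del: ennreal_max_0 ennreal_max_0')
    also have "ennreal (8 * s\<^sup>2) * (ennreal (r x) * ennreal (x\<^sup>2 / (8 * s\<^sup>2))) = ennreal (r x) * ennreal (x\<^sup>2)"
      using s r[of x] by (simp add: ennreal_mult'[symmetric])
    also have "ennreal (r x) * ennreal (max 0 (ln (r x))) = ennreal (r x * max 0 (ln (r x)))"
      using r[of x] by (intro ennreal_mult[symmetric]) auto
    finally show ?thesis .
  qed
  have "(\<integral>\<^sup>+x. ennreal (x\<^sup>2) \<partial>density Q (\<lambda>x. ennreal (r x))) = (\<integral>\<^sup>+x. ennreal (r x) * ennreal (x\<^sup>2) \<partial>Q)"
    by (rule nn_integral_density) measurable
  also have "\<dots> \<le> (\<integral>\<^sup>+x. ennreal (8 * s\<^sup>2) * (ennreal (r x * max 0 (ln (r x))) + ennreal (exp (x\<^sup>2 / (8 * s\<^sup>2)))) \<partial>Q)"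
    by (intro nn_integral_mono pt)
  also have "\<dots> = ennreal (8 * s\<^sup>2) * ((\<integral>\<^sup>+x. ennreal (r x * max 0 (ln (r x))) \<partial>Q) + (\<integral>\<^sup>+x. ennreal (exp (x\<^sup>2 / (8 * s\<^sup>2))) \<partial>Q))"
    by (subst nn_integral_cmult, measurable, subst nn_integral_add) simp_all
  also have "(\<integral>\<^sup>+x. ennreal (exp (x\<^sup>2 / (8 * s\<^sup>2))) \<partial>Q) = (\<integral>\<^sup>+x. ennreal (exp (x\<^sup>2 / (8 * s\<^sup>2))) * ennreal (normal_density m s x) \<partial>lborel)"
    unfolding Q by (subst nn_integral_density) (auto simp: mult.commute)
  also have "ennreal (8 * s\<^sup>2) * ((\<integral>\<^sup>+x. ennreal (r x * max 0 (ln (r x))) \<partial>Q) + \<dots>) < \<infinity>"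
    using ent normal_exp_moment[OF s, of m] by (simp add: ennreal_mult_less_top ennreal_add_less_top)
  finally show ?thesis .
qed

section \<open>The entropic limit theorem\<close>

text \<open>The hypothesis concerns the entropy relative to \<open>Q\<close>, whereas the splitting
  needs the integral of \<open>p0 * lnp p0\<close> for the unnormalised sum of \<open>n0\<close>
  terms. Boundedness of the density of \<open>Q\<close> converts one into the other, and an affine
  change of variable undoes the norming.\<close>

lemma entropic_limit_core:
  fixes \<mu> Q :: "real measure" and P :: "nat \<Rightarrow> real measure" and a b :: "nat \<Rightarrow> real" and V :: "real \<Rightarrow> real"
  assumes \<mu>: "real_distribution \<mu>" and P: "\<And>n. real_distribution (P n)" and Q: "real_distribution Q"
    and chP: "\<And>n t. n \<ge> 1 \<Longrightarrow> char (P n) t = iexp (- (t * a n)) * char \<mu> (t / b n) ^ n"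
    and b: "\<And>n. n \<ge> 1 \<Longrightarrow> b n > 0" and wc: "weak_conv_m P Q"
    and chQ: "\<And>t. cmod (char Q t) = exp (- c * \<bar>t\<bar> powr \<alpha>)" and c: "c > 0" and \<alpha>: "\<alpha> > 0"
    and n0: "n0 \<ge> 1" and fin: "relative_entropy (P n0) Q < \<infinity>"
    and V [measurable]: "V \<in> borel_measurable borel" and V0: "\<And>x. 0 \<le> V x"
    and \<psi>V: "AE x in lborel. char_inverse (char Q) x \<ge> exp (- V x)"
    and Vloc: "\<And>T. \<exists>K. \<forall>x. \<bar>x\<bar> \<le> T \<longrightarrow> V x \<le> K"
    and UI: "\<And>e. e > 0 \<Longrightarrow> \<exists>T. \<forall>\<^sub>F n in sequentially. (\<integral>\<^sup>+x. ennreal (1 + V x) * indicator {x. \<bar>x\<bar> > T} x \<partial>P n) \<le> ennreal e"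
  shows "(\<lambda>n. relative_entropy (P n) Q) \<longlonglongrightarrow> 0"
proof -
  interpret \<mu>: real_distribution \<mu> by fact
  interpret Q: real_distribution Q by fact
  interpret Pn0: real_distribution "P n0" by (rule P)
  define \<psi> where "\<psi> = char_inverse (char Q)"
  have \<phi>: "integrable lborel (char Q)"
  proof (rule Bochner_Integration.integrable_bound[OF integrable_exp_powr[OF \<alpha> c]])
    show "char Q \<in> borel_measurable lborel" using Q.char_measurable by simp
  qed (simp add: chQ)
  have [measurable]: "\<psi> \<in> borel_measurable borel" unfolding \<psi>_def by (rule char_inverse_borel_measurable[OF \<phi>])
  have \<psi>0: "0 \<le> \<psi> x" for x unfolding \<psi>_def by (rule Q.char_inverse_nonneg[OF \<phi>])
  have Q\<psi>: "Q = density lborel (\<lambda>x. ennreal (\<psi> x))" unfolding \<psi>_def by (rule Q.density_char_inverse[OF \<phi>])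
  \<comment> \<open>The entry 1 keeps \<open>ln B\<close> nonnegative, as its passage through
    \<open>ennreal\<close> requires.\<close>
  define B where "B = max 1 (\<integral>t. cmod (char Q t) \<partial>lborel)"
  have B: "\<psi> x \<le> B" for x using char_inverse_le[OF \<phi>, of x] by (simp add: \<psi>_def B_def)
  have B1: "B \<ge> 1" by (simp add: B_def)
  obtain r where [measurable]: "r \<in> borel_measurable borel" and r0: "\<And>x. 0 \<le> r x"
    and Pr: "P n0 = density Q (\<lambda>x. ennreal (r x))" and er: "(\<integral>\<^sup>+x. ennreal (r x * max 0 (ln (r x))) \<partial>Q) < \<infinity>"
    by (rule relative_entropy_finiteE[OF P Q fin]) (rule that; assumption)
  define g where "g x = ennreal (\<psi> x) * ennreal (r x)" for x
  have [measurable]: "g \<in> borel_measurable borel" unfolding g_def by measurable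
  have Pg: "P n0 = density lborel g"
    unfolding Pr by (subst Q\<psi>, subst density_density_eq) (auto simp: g_def[abs_def])
  have g1: "(\<integral>\<^sup>+x. g x \<partial>lborel) = 1"
  proof -
    have "(\<integral>\<^sup>+x. g x \<partial>lborel) = emeasure (density lborel g) UNIV" by (simp add: emeasure_density)
    also have "\<dots> = 1" unfolding Pg[symmetric] using Pn0.emeasure_space_1 by simp
    finally show ?thesis .
  qed
  have pt: "g x * lnp (g x) \<le> ennreal (ln B) * g x + ennreal (\<psi> x) * ennreal (r x * max 0 (ln (r x)))" for x
  proof (cases "\<psi> x = 0")
    case False
    then have p: "\<psi> x > 0" using \<psi>0[of x] by simp
    have "lnp (g x) \<le> ennreal (max 0 (ln (\<psi> x))) + lnp (ennreal (r x))" unfolding g_def by (rule lnp_mult_le[OF p])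
    also have "\<dots> \<le> ennreal (ln B) + ennreal (max 0 (ln (r x)))"
      using p B[of x] B1 r0[of x] by (intro add_mono ennreal_leI) (auto simp: lnp_ennreal simp del: ennreal_max_0 ennreal_max_0')
    finally have "g x * lnp (g x) \<le> g x * (ennreal (ln B) + ennreal (max 0 (ln (r x))))" by (rule mult_left_mono) simp
    also have "\<dots> = ennreal (ln B) * g x + ennreal (\<psi> x) * (ennreal (r x) * ennreal (max 0 (ln (r x))))"
      unfolding g_def by (simp add: distrib_left mult_ac)
    also have "ennreal (r x) * ennreal (max 0 (ln (r x))) = ennreal (r x * max 0 (ln (r x)))"
      using r0[of x] by (intro ennreal_mult[symmetric]) auto
    finally show ?thesis .
  qed (simp add: g_def)
  have "(\<integral>\<^sup>+x. g x * lnp (g x) \<partial>lborel) \<le> (\<integral>\<^sup>+x. ennreal (ln B) * g x + ennreal (\<psi> x) * ennreal (r x * max 0 (ln (r x))) \<partial>lborel)"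
    by (intro nn_integral_mono pt)
  also have "\<dots> = ennreal (ln B) * (\<integral>\<^sup>+x. g x \<partial>lborel) + (\<integral>\<^sup>+x. ennreal (\<psi> x) * ennreal (r x * max 0 (ln (r x))) \<partial>lborel)"
    by (subst nn_integral_add) (simp_all add: nn_integral_cmult)
  also have "(\<integral>\<^sup>+x. ennreal (\<psi> x) * ennreal (r x * max 0 (ln (r x))) \<partial>lborel) = (\<integral>\<^sup>+x. ennreal (r x * max 0 (ln (r x))) \<partial>Q)"
    by (subst Q\<psi>, subst nn_integral_density) auto
  also have "ennreal (ln B) * (\<integral>\<^sup>+x. g x \<partial>lborel) + \<dots> < \<infinity>" unfolding g1 using er by (simp add: ennreal_add_less_top)
  finally have eg: "(\<integral>\<^sup>+x. g x * lnp (g x) \<partial>lborel) < \<infinity>" .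
  \<comment> \<open>Scale \<open>d\<close> and shift \<open>- (b n0 * a n0)\<close> express
    \<open>x * b n0 + b n0 * a n0\<close>, the inverse of the normalisation, in the form
    \<open>x / d - a\<close> of the affine lemmas.\<close>
  define d where "d = 1 / b n0"
  have d: "d > 0" using b[OF n0] by (simp add: d_def)
  define p0 where "p0 x = ennreal d * g (d * (x + - (b n0 * a n0)))" for x
  have p0m [measurable]: "p0 \<in> borel_measurable borel" unfolding p0_def by measurable
  have ent: "(\<integral>\<^sup>+x. p0 x * lnp (p0 x) \<partial>lborel) < \<infinity>"
    unfolding p0_def
    by (rule le_less_trans[OF affine_density_entropy[OF _ d]]) (use eg in \<open>simp_all add: g1 ennreal_add_less_top\<close>)
  define S where "S = distr (P n0) borel (\<lambda>x. x / d - - (b n0 * a n0))"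
  have Sp: "S = density lborel p0" unfolding S_def Pg p0_def by (rule distr_density_affine[OF _ d]) measurable
  have fin_ret: "finite_borel_measure (return borel (0::real))"
    using real_distribution_return by (simp add: real_distribution.axioms(1) finite_borel_measure_axioms_def finite_borel_measure_def prob_space.axioms(1))
  have dens: "conv_pow \<mu> n0 (return borel 0) = density lborel p0"
    unfolding Sp[symmetric]
  proof (rule Levy_uniqueness)
    show "real_distribution (conv_pow \<mu> n0 (return borel 0))" by (rule real_distribution_conv_pow[OF \<mu> real_distribution_return])
    show "real_distribution S" unfolding S_def by (rule Pn0.real_distribution_distr) simp
    show "char (conv_pow \<mu> n0 (return borel 0)) = char S"
    proof
      fix t
      have "char S t = iexp (- (t * - (b n0 * a n0))) * char (P n0) (t / d)"
        unfolding S_def by (rule Pn0.char_affine)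
      also have "char (P n0) (t / d) = iexp (- (t * b n0 * a n0)) * char \<mu> t ^ n0"
        unfolding chP[OF n0] using b[OF n0] by (simp add: d_def)
      also have "iexp (- (t * - (b n0 * a n0))) * (iexp (- (t * b n0 * a n0)) * char \<mu> t ^ n0) = char \<mu> t ^ n0"
        unfolding mult.assoc[symmetric] exp_add[symmetric] by (simp add: mult.assoc)
      also have "\<dots> = char (conv_pow \<mu> n0 (return borel 0)) t"
        by (simp add: char_conv_pow[OF \<mu>.finite_borel_measure_axioms fin_ret] char_return_0)
      finally show "char (conv_pow \<mu> n0 (return borel 0)) t = char S t" by simp
    qed
  qed
  obtain u v :: "nat \<Rightarrow> real \<Rightarrow> real" and N C
    where uv: "\<And>n. u n \<in> borel_measurable borel" "\<And>n. v n \<in> borel_measurable borel" "\<And>n x. 0 \<le> u n x" "\<And>n x. 0 \<le> v n x"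
    "\<And>n. n \<ge> N \<Longrightarrow> P n = density lborel (\<lambda>x. ennreal (u n x + v n x))"
    "\<And>n x. n \<ge> N \<Longrightarrow> u n x \<le> C" "\<And>x. (\<lambda>n. u n x) \<longlonglongrightarrow> char_inverse (char Q) x"
    "(\<lambda>n. \<integral>\<^sup>+x. ennreal (v n x) \<partial>lborel) \<longlonglongrightarrow> 0"
    "(\<lambda>n. \<integral>\<^sup>+x. ennreal (v n x * max 0 (ln (v n x))) \<partial>lborel) \<longlonglongrightarrow> 0"
    by (rule entropic_decomposition[OF \<mu> P Q chP b wc chQ c \<alpha> n0 p0m dens ent]) (assumption | (rule that; assumption))+
  show ?thesis
    by (rule relative_entropy_tendsto_0[where u=u and v=v and \<psi>=\<psi> and V=V and N=N and C=C, OF P Q _ V uv(1,2) Q\<psi> uv(5,3,4) V0 \<psi>0 _ Vloc _ _ uv(8,9) UI])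
      (use \<psi>V uv(6,7) in \<open>auto simp: \<psi>_def[symmetric]\<close>)
qed

theorem entropic_limit:
  fixes \<mu> Q :: "real measure" and P :: "nat \<Rightarrow> real measure" and a b :: "nat \<Rightarrow> real"
  assumes \<mu>: "real_distribution \<mu>" and P: "\<And>n. real_distribution (P n)"
    and chP: "\<And>n t. n \<ge> 1 \<Longrightarrow> char (P n) t = iexp (- (t * a n)) * char \<mu> (t / b n) ^ n"
    and b: "\<And>n. n \<ge> 1 \<Longrightarrow> b n > 0" and wc: "weak_conv_m P Q" and ne: "non_extremal_stable_law Q"
    and n0: "n0 \<ge> 1" and fin: "relative_entropy (P n0) Q < \<infinity>"
  shows "(\<lambda>n. relative_entropy (P n) Q) \<longlonglongrightarrow> 0"
  using ne unfolding non_extremal_stable_law_def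
proof (elim disjE exE conjE)
  assume "normal_law Q"
  then obtain m s where s: "s > 0" and Qn: "Q = density lborel (\<lambda>x. ennreal (normal_density m s x))"
    unfolding normal_law_def by blast
  have Q: "real_distribution Q" unfolding Qn
    by (intro real_distribution.intro prob_space_normal_density s real_distribution_axioms.intro) auto
  interpret Q: real_distribution Q by fact
  have chQ: "cmod (char Q t) = exp (- (s\<^sup>2 / 2) * \<bar>t\<bar> powr 2)" for t
    unfolding Qn char_normal[OF s] norm_mult norm_exp_i_times by simp
  have c: "s\<^sup>2 / 2 > 0" using s by simp
  obtain r where r: "r \<in> borel_measurable borel" "\<And>x. 0 \<le> r x" "P n0 = density Q (\<lambda>x. ennreal (r x))"
    "(\<integral>\<^sup>+x. ennreal (r x * max 0 (ln (r x))) \<partial>Q) < \<infinity>"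
    by (rule relative_entropy_finiteE[OF P Q fin]) (rule that; assumption)
  \<comment> \<open>The entropy hypothesis is used here a second time: it gives the variance of
    \<open>P n0\<close>, and through it that of the symmetrized summand.\<close>
  have "(\<integral>\<^sup>+x. ennreal (x\<^sup>2) \<partial>P n0) < \<infinity>" unfolding r(3) by (rule second_moment_of_normal_entropy[OF s Qn r(1,2,4)])
  then have mom: "(\<integral>\<^sup>+x. ennreal (x\<^sup>2) \<partial>real_distribution.symm \<mu>) < \<infinity>"
    by (rule second_moment_symm_root[OF \<mu> P n0 b[OF n0], rotated]) (simp add: chP[OF n0] norm_mult norm_power)
  have \<phi>: "integrable lborel (char Q)"
  proof (rule Bochner_Integration.integrable_bound[OF integrable_exp_powr[OF _ c, of 2]])
    show "char Q \<in> borel_measurable lborel" using Q.char_measurable by simp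
  qed (simp_all add: chQ)
  have "AE x in lborel. ennreal (char_inverse (char Q) x) = ennreal (normal_density m s x)"
  proof (rule sigma_finite_measure.density_unique[OF sigma_finite_lborel])
    show "(\<lambda>x. ennreal (char_inverse (char Q) x)) \<in> borel_measurable lborel" using char_inverse_borel_measurable[OF \<phi>] by simp
    show "density lborel (\<lambda>x. ennreal (char_inverse (char Q) x)) = density lborel (\<lambda>x. ennreal (normal_density m s x))"
      unfolding Q.density_char_inverse[OF \<phi>, symmetric] by (rule Qn)
  qed simp
  then have dn: "AE x in lborel. char_inverse (char Q) x = normal_density m s x"
    by eventually_elim (use Q.char_inverse_nonneg[OF \<phi>] in simp)
  \<comment> \<open>From \<open>(x - m)^2 \<le> 2 * x^2 + 2 * m^2\<close>; the absolute value makes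
    \<open>A\<close> nonnegative whatever the size of \<open>s\<close>.\<close>
  define A where "A = \<bar>ln (sqrt (2 * pi * s\<^sup>2))\<bar> + m\<^sup>2 / s\<^sup>2"
  define B where "B = 1 / s\<^sup>2"
  have A: "A \<ge> 0" and B: "B \<ge> 0" by (auto simp: A_def B_def)
  have low: "exp (- (A + B * x\<^sup>2)) \<le> normal_density m s x" for x
  proof -
    have "0 \<le> (x + m)\<^sup>2" by simp
    then have "(x - m)\<^sup>2 \<le> 2 * x\<^sup>2 + 2 * m\<^sup>2" by (simp add: power2_eq_square algebra_simps)
    then have "(x - m)\<^sup>2 / (2 * s\<^sup>2) \<le> (2 * x\<^sup>2 + 2 * m\<^sup>2) / (2 * s\<^sup>2)" by (rule divide_right_mono) simp
    also have "\<dots> = x\<^sup>2 / s\<^sup>2 + m\<^sup>2 / s\<^sup>2" using s by (simp add: field_simps)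
    finally have "- (A + B * x\<^sup>2) \<le> - ln (sqrt (2 * pi * s\<^sup>2)) + - (x - m)\<^sup>2 / (2 * s\<^sup>2)" by (simp add: A_def B_def)
    then have "exp (- (A + B * x\<^sup>2)) \<le> exp (- ln (sqrt (2 * pi * s\<^sup>2))) * exp (- (x - m)\<^sup>2 / (2 * s\<^sup>2))"
      unfolding exp_add[symmetric] by simp
    also have "exp (- ln (sqrt (2 * pi * s\<^sup>2))) = 1 / sqrt (2 * pi * s\<^sup>2)" using s by (simp only: exp_minus) (simp add: inverse_eq_divide)
    finally show ?thesis by (simp only: normal_density_def)
  qed
  show ?thesis
  proof (rule entropic_limit_core[OF \<mu> P Q chP b wc chQ c _ n0 fin, where V="\<lambda>x. A + B * x\<^sup>2"])
    show "0 \<le> A + B * x\<^sup>2" for x using A B by simp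
    show "AE x in lborel. exp (- (A + B * x\<^sup>2)) \<le> char_inverse (char Q) x" using dn by eventually_elim (metis low)
    show "\<exists>K. \<forall>x. \<bar>x\<bar> \<le> T \<longrightarrow> A + B * x\<^sup>2 \<le> K" for T
    proof (intro exI allI impI)
      fix x :: real assume "\<bar>x\<bar> \<le> T"
      then have "\<bar>x\<bar>\<^sup>2 \<le> T\<^sup>2" by (intro power_mono) auto
      then show "A + B * x\<^sup>2 \<le> A + B * T\<^sup>2" using B by (simp add: mult_left_mono)
    qed
    show "\<exists>T. \<forall>\<^sub>F n in sequentially. (\<integral>\<^sup>+x. ennreal (1 + (A + B * x\<^sup>2)) * indicator {x. \<bar>x\<bar> > T} x \<partial>P n) \<le> ennreal e" if "e > 0" for e
      by (rule weak_conv_second_moment_UI[OF \<mu> P Q chP b wc chQ c mom that B])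
  qed auto
next
  fix \<alpha> \<beta> a' c
  assume st: "nonnormal_stable_law \<alpha> \<beta> a' c Q" and \<beta>: "-1 < \<beta>" "\<beta> < 1"
  have \<alpha>: "0 < \<alpha>" "\<alpha> < 2" and c: "c > 0" and Q: "real_distribution Q" and ch: "\<And>t. char Q t = stable_char \<alpha> \<beta> a' c t"
    using st by (auto simp: nonnormal_stable_law_def)
  have chQ: "cmod (char Q t) = exp (- c * \<bar>t\<bar> powr \<alpha>)" for t unfolding ch by (rule cmod_stable_char)
  obtain C where C: "C > 0" and low: "\<And>x. C * (1 + \<bar>x\<bar>) powr (- (\<alpha> + 2)) \<le> char_inverse (char Q) x"
    using stable_density_lower[OF Q ch \<alpha> \<beta> c] by blast
  obtain K R where K: "K \<ge> 0" and mom: "\<forall>\<^sub>F n in sequentially. (\<integral>\<^sup>+x. ennreal (\<bar>x\<bar> powr (\<alpha> / 4)) * indicator {x. \<bar>x\<bar> \<ge> R} x \<partial>P n) \<le> ennreal K"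
    by (rule weak_conv_fractional_moment[OF \<mu> P Q chP b wc chQ c \<alpha>(1)])
  have ln0: "0 \<le> ln (1 + \<bar>x\<bar>)" for x :: real by simp
  show ?thesis
  proof (rule entropic_limit_core[OF \<mu> P Q chP b wc chQ c \<alpha>(1) n0 fin, where V="\<lambda>x. \<bar>ln C\<bar> + (\<alpha> + 2) * ln (1 + \<bar>x\<bar>)"])
    show "0 \<le> \<bar>ln C\<bar> + (\<alpha> + 2) * ln (1 + \<bar>x\<bar>)" for x using ln0[of x] \<alpha> by simp
    show "AE x in lborel. exp (- (\<bar>ln C\<bar> + (\<alpha> + 2) * ln (1 + \<bar>x\<bar>))) \<le> char_inverse (char Q) x"
    proof (rule AE_I2)
      fix x :: real
      have px: "1 + \<bar>x\<bar> \<noteq> 0" by linarith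
      have "exp (- (\<bar>ln C\<bar> + (\<alpha> + 2) * ln (1 + \<bar>x\<bar>))) \<le> exp (ln C + - (\<alpha> + 2) * ln (1 + \<bar>x\<bar>))"
        unfolding exp_le_cancel_iff mult_minus_left by linarith
      also have "\<dots> = exp (ln C) * exp (- (\<alpha> + 2) * ln (1 + \<bar>x\<bar>))" by (rule exp_add)
      also have "\<dots> = C * (1 + \<bar>x\<bar>) powr (- (\<alpha> + 2))" unfolding powr_def using px C by simp
      also have "\<dots> \<le> char_inverse (char Q) x" by (rule low)
      finally show "exp (- (\<bar>ln C\<bar> + (\<alpha> + 2) * ln (1 + \<bar>x\<bar>))) \<le> char_inverse (char Q) x" .
    qed
    show "\<exists>K. \<forall>x. \<bar>x\<bar> \<le> T \<longrightarrow> \<bar>ln C\<bar> + (\<alpha> + 2) * ln (1 + \<bar>x\<bar>) \<le> K" for T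
    proof (intro exI[of _ "\<bar>ln C\<bar> + (\<alpha> + 2) * ln (1 + T)"] allI impI)
      fix x :: real assume "\<bar>x\<bar> \<le> T"
      then have "ln (1 + \<bar>x\<bar>) \<le> ln (1 + T)" by (intro ln_mono) linarith+
      then show "\<bar>ln C\<bar> + (\<alpha> + 2) * ln (1 + \<bar>x\<bar>) \<le> \<bar>ln C\<bar> + (\<alpha> + 2) * ln (1 + T)"
        using \<alpha> by (intro add_left_mono mult_left_mono) auto
    qed
    show "\<exists>T. \<forall>\<^sub>F n in sequentially. (\<integral>\<^sup>+x. ennreal (1 + (\<bar>ln C\<bar> + (\<alpha> + 2) * ln (1 + \<bar>x\<bar>))) * indicator {x. \<bar>x\<bar> > T} x \<partial>P n) \<le> ennreal e" if "e > 0" for e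
      by (rule fractional_moment_log_UI[OF _ _ K mom that]) (use real_distribution.events_eq_borel[OF P] \<alpha> in simp_all)
  qed auto
qed

theorem theorem1p1:
  fixes M :: "'a measure" and N :: "'b measure"
    and X :: "nat \<Rightarrow> 'a \<Rightarrow> real" and Z :: "'b \<Rightarrow> real"
    and a b :: "nat \<Rightarrow> real" and Zn :: "nat \<Rightarrow> 'a \<Rightarrow> real"
  assumes "prob_space M"
    and "prob_space.indep_vars M (\<lambda>_. borel) X {1..}"
    and "\<And>i. i \<ge> 1 \<Longrightarrow> distr M borel (X i) = distr M borel (X 1)"
    and "\<And>n. n \<ge> 1 \<Longrightarrow> b n > 0"
    and "\<And>n \<omega>. n \<ge> 1 \<Longrightarrow> Zn n \<omega> = (\<Sum>k=1..n. X k \<omega>) / b n - a n"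
    and "prob_space N" and "Z \<in> borel_measurable N"
    and "non_extremal_stable_law (distr N borel Z)"
    and "weak_conv_m (\<lambda>n. distr M borel (Zn n)) (distr N borel Z)"
  shows "((\<lambda>n. relative_entropy (distr M borel (Zn n)) (distr N borel Z)) \<longlonglongrightarrow> 0)
         \<longleftrightarrow> (\<exists>n\<ge>1. relative_entropy (distr M borel (Zn n)) (distr N borel Z) < \<infinity>)"
proof
  assume "(\<lambda>n. relative_entropy (distr M borel (Zn n)) (distr N borel Z)) \<longlonglongrightarrow> 0"
  then have "\<forall>\<^sub>F n in sequentially. relative_entropy (distr M borel (Zn n)) (distr N borel Z) < \<infinity>"
    by (rule order_tendstoD) simp
  then obtain n where "\<And>k. k \<ge> n \<Longrightarrow> relative_entropy (distr M borel (Zn k)) (distr N borel Z) < \<infinity>"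
    unfolding eventually_sequentially by blast
  then show "\<exists>n\<ge>1. relative_entropy (distr M borel (Zn n)) (distr N borel Z) < \<infinity>"
    by (intro exI[of _ "max n 1"]) simp
next
  assume "\<exists>n\<ge>1. relative_entropy (distr M borel (Zn n)) (distr N borel Z) < \<infinity>"
  then obtain n0 where n0: "n0 \<ge> 1" "relative_entropy (distr M borel (Zn n0)) (distr N borel Z) < \<infinity>" by blast
  interpret M: prob_space M by fact
  interpret N: prob_space N by fact
  have [measurable]: "X i \<in> borel_measurable M" if "i \<ge> 1" for i
    using assms(2) that unfolding M.indep_vars_def by simp
  define \<mu> where "\<mu> = distr M borel (X 1)"
  define Q where "Q = distr N borel Z"
  have \<mu>: "real_distribution \<mu>" unfolding \<mu>_def by simp
  have Q: "real_distribution Q" unfolding Q_def using assms(7) by simp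
  \<comment> \<open>\<open>Zn\<close> is constrained only from index 1 on and \<open>Zn 0\<close>
    need not be measurable; index 0 is filled with \<open>Q\<close> so that every \<open>P n\<close>
    is a distribution.\<close>
  define P where "P n = (if n \<ge> 1 then distr M borel (Zn n) else Q)" for n
  have Znm: "Zn n \<in> borel_measurable M" if "n \<ge> 1" for n
    unfolding assms(5)[OF that, abs_def] by measurable
  have P: "real_distribution (P n)" for n unfolding P_def using Q Znm by simp
  have chP: "char (P n) t = iexp (- (t * a n)) * char \<mu> (t / b n) ^ n" if n: "n \<ge> 1" for n t
  proof -
    define S where "S = distr M borel (\<lambda>\<omega>. \<Sum>k=1..n. X k \<omega>)"
    interpret S: real_distribution S unfolding S_def by simp
    have "P n = distr S borel (\<lambda>x. x / b n - a n)"
      unfolding S_def P_def using n by (subst distr_distr) (auto simp: o_def assms(5) intro!: distr_cong)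
    moreover have "char S s = char \<mu> s ^ n" for s
    proof -
      have "char S s = (\<Prod>k=1..n. char (distr M borel (X k)) s)"
        unfolding S_def by (rule M.char_distr_sum) (rule M.indep_vars_subset[OF assms(2)], simp)
      also have "\<dots> = (\<Prod>k=1..n. char \<mu> s)" unfolding \<mu>_def by (intro prod.cong refl) (subst assms(3), auto)
      finally show ?thesis by simp
    qed
    ultimately show ?thesis using S.char_affine by simp
  qed
  have ev: "\<forall>\<^sub>F n in sequentially. distr M borel (Zn n) = P n"
    using eventually_ge_at_top[of 1] by eventually_elim (simp add: P_def)
  have wc: "weak_conv_m P Q"
    unfolding weak_conv_m_def weak_conv_def
  proof (intro allI impI)
    fix x assume "isCont (cdf Q) x"
    then have "(\<lambda>n. cdf (distr M borel (Zn n)) x) \<longlonglongrightarrow> cdf Q x"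
      using assms(9) unfolding Q_def weak_conv_m_def weak_conv_def by blast
    then show "(\<lambda>n. cdf (P n) x) \<longlonglongrightarrow> cdf Q x"
      by (rule Lim_transform_eventually) (use ev in eventually_elim, simp)
  qed
  have "(\<lambda>n. relative_entropy (P n) Q) \<longlonglongrightarrow> 0"
    by (rule entropic_limit[OF \<mu> P chP assms(4) wc _ n0(1)]) (use assms(8) n0 in \<open>simp_all add: P_def Q_def\<close>)
  then show "(\<lambda>n. relative_entropy (distr M borel (Zn n)) (distr N borel Z)) \<longlonglongrightarrow> 0"
    unfolding Q_def[symmetric] by (rule Lim_transform_eventually) (use ev in eventually_elim, simp)
qed

end
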